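(* Let $d\geq 4$, $k\in\{2,3,\ldots,d-2\}$, and $m:=\min\{d-k,k\}$. If $1\leq p\leq \frac{2(d+m)}{d+m+2}$, then there exists a constant $C(k,d,p)<\infty$ such that the estimate $$\left(\int_{\mathbb{S}^{d-1}} |\widehat{f}(\omega)|^2\, d\sigma(\omega)\right)^{\frac12}\leq C(k,d,p)\, \|f\|_{L^p(\mathbb{R}^d)}$$ holds for every $G_k$-symmetric function $f:\mathbb{R}^d\to\mathbb{C}$ in $L^p(\mathbb{R}^d)$.
   Context: $\sigma$ is the usual (unnormalized) surface measure on the unit sphere $\mathbb{S}^{d-1}=\{\omega\in\mathbb{R}^d:|\omega|=1\}$. The Fourier transform is $\widehat f(\xi)=\int_{\mathbb{R}^d} f(x)e^{-i\xi\cdot x}\,dx$. Write $\mathbb{R}^d=\mathbb{R}^{d-k}\times\mathbb{R}^k$ and let $G_k:=O(d-k)\times O(k)\subset O(d)$ act blockwise. A function $f:\mathbb{R}^d\to\mathbb{C}$ is $G_k$-symmetric if $f\circ A=f$ for every $A\in G_k$. As usual in restriction theory, the estimate is understood a priori for $G_k$-symmetric Schwartz functions, and for general $f$ the restriction $\widehat f|_{\mathbb{S}^{d-1}}$ is defined by density (continuous extension). *)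

theory Defs
  imports "HOL-Analysis.Analysis"
begin

text \<open>Surface measure by polar coordinates: the mass of a Borel set \<open>E\<close> of unit vectors is
  \<open>d\<close> times the volume of the cone \<open>{r \<omega> | 0 < r \<le> 1, \<omega> \<in> E}\<close>, where \<open>d\<close> is the dimension.
  It is unnormalized.\<close>

definition surface_measure :: "'v::euclidean_space measure" where
  "surface_measure =
     distr (scale_measure (of_nat DIM('v)) (restrict_space lborel (cball 0 1 - {0})))
           (restrict_space borel (sphere 0 1)) sgn"

lemma sgn_measurable_sphere:
  "sgn \<in> restrict_space (lborel :: 'v::euclidean_space measure) (cball 0 1 - {0})
           \<rightarrow>\<^sub>M restrict_space borel (sphere 0 1)"
proof (rule measurable_restrict_space2)
  show "sgn \<in> space (restrict_space (lborel :: 'v measure) (cball 0 1 - {0})) \<rightarrow> sphere 0 1"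
    by (auto simp: space_restrict_space norm_sgn)
  have "sgn \<in> borel_measurable (borel :: 'v measure)"
    unfolding sgn_div_norm by measurable
  then show "sgn \<in> borel_measurable (restrict_space (lborel :: 'v measure) (cball 0 1 - {0}))"
    by (simp add: measurable_restrict_space1)
qed

lemma emeasure_surface_measure:
  fixes E :: "'v::euclidean_space set"
  assumes "E \<in> sets borel" "E \<subseteq> sphere 0 1"
  shows "emeasure surface_measure E =
           of_nat DIM('v) * emeasure lborel {x \<in> cball 0 1 - {0}. sgn x \<in> E}"
proof -
  let ?B = "cball 0 1 - {0 :: 'v}"
  let ?R = "restrict_space lborel ?B"
  have E: "E \<in> sets (restrict_space borel (sphere 0 1))"
    using assms by (auto simp: sets_restrict_space_iff)
  have "emeasure surface_measure E
      = emeasure (scale_measure (of_nat DIM('v)) ?R) (sgn -` E \<inter> space ?R)"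
    unfolding surface_measure_def
    by (subst emeasure_distr) (use E sgn_measurable_sphere[where 'v='v] in
         \<open>auto simp: space_scale_measure measurable_def\<close>)
  also have "sgn -` E \<inter> space ?R = {x \<in> ?B. sgn x \<in> E}"
    by (auto simp: space_restrict_space)
  finally show ?thesis
    using emeasure_restrict_space[of ?B "lborel :: 'v measure" "{x \<in> ?B. sgn x \<in> E}"]
    by (simp add: subset_eq)
qed

definition Lp_norm :: "'x measure \<Rightarrow> real \<Rightarrow> ('x \<Rightarrow> complex) \<Rightarrow> real" where
  "Lp_norm M p f = (\<integral>x. norm (f x) powr p \<partial>M) powr (1 / p)"

definition in_Lp :: "'x measure \<Rightarrow> real \<Rightarrow> ('x \<Rightarrow> complex) \<Rightarrow> bool" where
  "in_Lp M p f \<longleftrightarrow> f \<in> borel_measurable M \<and> integrable M (\<lambda>x. norm (f x) powr p)"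

definition fourier :: "('v::euclidean_space \<Rightarrow> complex) \<Rightarrow> 'v \<Rightarrow> complex" where
  "fourier f \<xi> = (\<integral>x. f x * exp (- \<i> * of_real (\<xi> \<bullet> x)) \<partial>lebesgue)"

fun iter_deriv :: "'v::euclidean_space list \<Rightarrow> ('v \<Rightarrow> complex) \<Rightarrow> 'v \<Rightarrow> complex" where
  "iter_deriv [] f = f"
| "iter_deriv (v # vs) f = (\<lambda>x. frechet_derivative (iter_deriv vs f) (at x) v)"

text \<open>Lists of basis vectors play the role of multi-indices. Total differentiability of every
  iterated partial derivative is smoothness.\<close>

definition schwartz :: "('v::euclidean_space \<Rightarrow> complex) \<Rightarrow> bool" where
  "schwartz f \<longleftrightarrow>
     (\<forall>vs. set vs \<subseteq> Basis \<longrightarrow>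
        (\<forall>x. iter_deriv vs f differentiable (at x)) \<and>
        (\<forall>N::nat. bounded (range (\<lambda>x. norm x ^ N *\<^sub>R iter_deriv vs f x))))"

definition block_group ::
    "(('a::euclidean_space \<times> 'b::euclidean_space) \<Rightarrow> ('a \<times> 'b)) set" where
  "block_group =
     {map_prod A B | A B. orthogonal_transformation A \<and> orthogonal_transformation B}"

definition block_symmetric ::
    "(('a::euclidean_space \<times> 'b::euclidean_space) \<Rightarrow> complex) \<Rightarrow> bool" where
  "block_symmetric f \<longleftrightarrow> (\<forall>A \<in> block_group. f \<circ> A = f)"

text \<open>\<open>g\<close> is the restriction to the sphere of the Fourier transform of \<open>f\<close>, defined by density:
  \<open>g\<close> is the \<open>L\<^sup>2\<close>-limit of the restricted transforms of symmetric Schwartz functions that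
  approximate \<open>f\<close> in \<open>L\<^sup>p\<close>.  Only the values of \<open>g\<close> on the sphere matter, and only up to
  null sets. Existence and uniqueness of \<open>g\<close> are not built into the definition.\<close>

definition fourier_restriction ::
    "real \<Rightarrow> (('a::euclidean_space \<times> 'b::euclidean_space) \<Rightarrow> complex)
       \<Rightarrow> ('a \<times> 'b \<Rightarrow> complex) \<Rightarrow> bool" where
  "fourier_restriction p f g \<longleftrightarrow>
     in_Lp surface_measure 2 g \<and>
     (\<exists>F :: nat \<Rightarrow> 'a \<times> 'b \<Rightarrow> complex.
        (\<forall>n. schwartz (F n) \<and> block_symmetric (F n)) \<and>
        (\<lambda>n. Lp_norm lebesgue p (\<lambda>x. F n x - f x)) \<longlonglongrightarrow> 0 \<and>
        (\<lambda>n. Lp_norm surface_measure 2 (\<lambda>\<omega>. fourier (F n) \<omega> - g \<omega>)) \<longlonglongrightarrow> 0)"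

end

theory Submission
  imports Defs "HOL-Probability.Characteristic_Functions"
begin

text \<open>
The idea. Write \<open>a\<close> and \<open>b\<close> for the dimensions of the two blocks. A block-symmetric function depends only on
\<open>\<rho> = |y|\<close> and \<open>s = |z|\<close>, and its Fourier transform at a point of the sphere with \<open>|\<omega>\<^sub>1| = cos t\<close> and
\<open>|\<omega>\<^sub>2| = sin t\<close> is the integral of the profile against \<open>u\<^sub>a(\<rho> cos t) u\<^sub>b(s sin t)\<close>, where \<open>u\<^sub>n\<close> is the Fourier
transform of the surface measure of the unit sphere of dimension \<open>n - 1\<close>. The estimate thus becomes an
estimate for a family of oscillatory integrals on a quadrant. It suffices to treat \<open>0 < t \<le> \<pi> / 4\<close>; the other
half of the range follows by exchanging the blocks.

About \<open>u\<^sub>n\<close> only three facts are used: it is bounded, \<open>r\<close> to the power \<open>(n - 1) / 2\<close> times \<open>u\<^sub>n(r)\<close> equals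
\<open>A cos r + B sin r + O(1 / r)\<close> (a consequence of Bessel's equation), and the Hankel transform with kernel \<open>u\<^sub>n\<close>
is bounded on \<open>L\<^sup>2\<close> (Plancherel for radial functions). The locale \<open>kernel_pair\<close> collects them.

The angles are cut into dyadic shells \<open>\<delta> \<le> t \<le> 2 \<delta>\<close>. On one shell there are four bounds for the energy, the
integral of the squared transform: from absolute values alone (\<open>energy_L1\<close>); from the Hankel transform in one of the
two radial variables and Cauchy-Schwarz in the other one (\<open>energy_L2_rho\<close>, \<open>energy_L2_s\<close>); and from van der Corput's
estimate for the kernel of the squared operator (\<open>energy_mid\<close>). The last one exploits the oscillation of the
product kernel, and it is what makes the endpoint exponent accessible. Since the exponent is critical, all four
bounds are functions of scale-invariant quantities: with \<open>h = |f|\<close> to the power \<open>1 / N\<close>, \<open>N = a + 1 + b / 2\<close>, these are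
\<open>y = h / \<delta>\<close>, \<open>P = h\<^sup>2 \<rho>\<close> and \<open>Q = h s\<close>. At each point of the quadrant the best of the four bounds is chosen
according to \<open>(y, P, Q)\<close>; it then decays geometrically away from two critical values of \<open>y\<close>, so that the sum over the
dyadic shells costs only a constant (\<open>shells_sum\<close>). The value and the position of \<open>f\<close> select the bound together, which is why
no logarithm is lost at the endpoint. Smaller exponents follow by splitting \<open>f\<close> according to
whether \<open>|f| \<le> 1\<close>, because integrable functions have bounded transforms.

Finally, functions \<open>exp (- |x|\<^sup>2) p(exp (- |y|\<^sup>2), exp (- |z|\<^sup>2))\<close> with polynomials \<open>p\<close> are symmetric Schwartz
functions, and by the Stone-Weierstrass theorem they are dense among the symmetric functions of \<open>L\<^sup>p\<close>. The extension of
the estimate to all of these is the completeness of \<open>L\<^sup>2\<close> of the sphere.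
\<close>

abbreviation (input) "nni \<equiv> nn_integral"
abbreviation (input) "enn \<equiv> ennreal"
abbreviation (input) "cpx \<equiv> complex_of_real"
abbreviation (input) surf :: "'v::euclidean_space measure" where "surf \<equiv> surface_measure"

section \<open>Polar coordinates\<close>

lemma nn_integral_lborel_translate:
 fixes g :: "'v::euclidean_space => ennreal"
 assumes [measurable]: "g: borel_measurable borel"
 shows "(nni lborel (%x. g (t + x))) = (nni lborel (%x. g x))"
proof -
 have "(nni lborel (%x. g x)) = (nni (density (distr lborel borel (%x. t + 1 *\<^sub>R x)) (%_. enn (\<bar>1\<bar>^DIM('v)))) (%x. g x))"
  by (subst lborel_affine[of 1 t]) auto
 then show ?thesis by (simp add: nn_integral_density nn_integral_distr)
qed

lemma nn_integral_lborel_uminus: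
 fixes g :: "'v::euclidean_space => ennreal"
 assumes [measurable]: "g: borel_measurable borel"
 shows "(nni lborel (%x. g (- x))) = (nni lborel (%x. g x))"
proof -
 have "(nni lborel (%x. g x)) = (nni (density (distr lborel borel (%x. 0 + (-1) *\<^sub>R x)) (%_. enn (\<bar>-1\<bar>^DIM('v)))) (%x. g x))"
  by (subst lborel_affine[of "-1" 0]) auto
 then show ?thesis by (simp add: nn_integral_density nn_integral_distr)
qed

text \<open>The push-forward of Lebesgue measure under an orthogonal map is translation invariant, hence a multiple of Lebesgue measure, and the unit ball shows that the factor is 1.\<close>

lemma nn_integral_lborel_orthogonal:
 fixes g :: "'v::euclidean_space => ennreal" and T :: "'v => 'v"
 assumes [measurable]: "g: borel_measurable borel" and T: "orthogonal_transformation T"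
 shows "(nni lborel (%x. g (T x))) = (nni lborel (%x. g x))"
proof -
 let ?A = "indicator (ball (0::'v) 1) :: 'v => ennreal"
 let ?V = "emeasure lborel (ball (0::'v) 1)"
 have [measurable]: "?A: borel_measurable borel"
  by (rule borel_measurable_indicator) simp
 have lin: "linear T" using T by (rule orthogonal_transformation_linear)
 have bij: "bij T" using T by (rule orthogonal_transformation_bij)
 have Tinv: "orthogonal_transformation (inv T)" using T by (rule orthogonal_transformation_inv)
 have [measurable]: "T: borel_measurable borel"
  using lin by (intro borel_measurable_continuous_onI linear_continuous_on linear_conv_bounded_linear[THEN iffD1])
 have TT: "T (inv T x) = x" for x using bij by (simp add: bij_is_surj surj_f_inv_f)
 have add: "T (x + y) = T x + T y" for x y using lin by (simp add: linear_add)
 have V0: "?V ~= 0"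
  using content_ball_pos[of 1 "0::'v"] by (auto simp: measure_def)
 have Vf: "?V ~= \<infinity>" using emeasure_lborel_ball_finite[of "0::'v" 1] by auto
 have "?V * (nni lborel (%y. g (T y))) = (nni lborel (%x. ?A x * (nni lborel (%y. g (T y)))))"
  by (subst nn_integral_multc) auto
 also have "... = (nni lborel (%x. ?A x * (nni lborel (%y. g (T y + x)))))"
 proof (rule nn_integral_cong)
  fix x
  have "(nni lborel (%y. g (T y))) = (nni lborel (%y. g (T (inv T x + y))))"
  by (rule nn_integral_lborel_translate[symmetric]) measurable
  then show "?A x * (nni lborel (%y. g (T y))) = ?A x * (nni lborel (%y. g (T y + x)))"
  by (simp add: add TT add.commute)
 qed
 also have "... = (nni lborel (%x. (nni lborel (%y. ?A x * g (T y + x)))))"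
  by (simp add: nn_integral_cmult)
 also have "... = (nni lborel (%y. (nni lborel (%x. ?A x * g (T y + x)))))"
  by (rule lborel_pair.Fubini'[symmetric]) measurable
 also have "... = (nni lborel (%y. (nni lborel (%x. ?A (- T y + x) * g x))))"
 proof (rule nn_integral_cong)
  fix y
  show "(nni lborel (%x. ?A x * g (T y + x))) = (nni lborel (%x. ?A (- T y + x) * g x))"
  using nn_integral_lborel_translate[of "%x. ?A (- T y + x) * g x" "T y"] by simp
 qed
 also have "... = (nni lborel (%x. (nni lborel (%y. ?A (- T y + x) * g x))))"
  by (rule lborel_pair.Fubini') measurable
 also have "... = (nni lborel (%x. g x * ?V))"
 proof (rule nn_integral_cong)
  fix x
  have eq: "?A (- T y + x) = ?A (- (- inv T x + y))" for y
  proof -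
  have "T (- (- inv T x + y)) = - T y + x"
  using lin by (simp add: linear_diff TT)
  then have "norm (- T y + x) = norm (- (- inv T x + y))"
  using orthogonal_transformation_norm[OF T] by metis
  then show ?thesis by (auto simp: indicator_def)
  qed
  have "(nni lborel (%y. ?A (- T y + x))) = (nni lborel (%y. ?A (- (- inv T x + y))))"
  unfolding eq ..
  also have "... = (nni lborel (%y. ?A (- y)))"
  by (rule nn_integral_lborel_translate[of "%y. ?A (- y)"]) measurable
  also have "... = ?V"
  by (subst nn_integral_lborel_uminus) auto
  finally show "(nni lborel (%y. ?A (- T y + x) * g x)) = g x * ?V"
  by (subst nn_integral_multc) (auto simp: mult.commute)
 qed
 also have "... = ?V * (nni lborel (%x. g x))"
  by (simp add: nn_integral_multc mult.commute)
 finally show ?thesis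
  using V0 Vf by (simp add: ennreal_mult_cancel_left)
qed

definition radial :: "nat => real measure" where
 "radial n = density lborel (%r. enn (indicator {0<..} r * r ^ (n - 1)))"

lemma sets_radial [measurable_cong, simp]: "sets (radial n) = sets borel"
 and space_radial [simp]: "space (radial n) = UNIV"
 by (simp_all add: radial_def)

lemma sigma_finite_radial [simp, intro]: "sigma_finite_measure (radial n)"
 unfolding radial_def
 by (subst sigma_finite_measure.sigma_finite_iff_density_finite[OF sigma_finite_lborel]) auto

lemma nn_integral_radial:
 assumes [measurable]: "f: borel_measurable borel"
 shows "(nni (radial n) (%r. f r)) = (nni lborel (%r. enn (indicator {0<..} r * r ^ (n - 1)) * f r))"
 unfolding radial_def by (rule nn_integral_density) auto

lemma AE_radial_pos: "AE r in radial n. 0 < r"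
 unfolding radial_def by (subst AE_density) (auto simp: indicator_def)

lemma emeasure_radial_atMost:
 assumes "n \<ge> 1"
 shows "emeasure (radial n) {..t} = enn (max 0 t ^ n / n)"
proof (cases "t <= 0")
 case True
 have "emeasure (radial n) {..t} = (nni lborel (%r. enn (indicator {0<..} r * r ^ (n - 1)) * indicator {..t} r))"
  unfolding radial_def by (subst emeasure_density) auto
 also have "... = (nni (lborel::real measure) (%r. 0))"
  using True by (intro nn_integral_cong) (auto simp: indicator_def)
 finally have "emeasure (radial n) {..t} = 0" by simp
 then show ?thesis using True assms by (simp add: max_def)
next
 case False
 have "emeasure (radial n) {..t} = (nni lborel (%r. enn (r ^ (n-1)) * indicator {0..t} r))"
  unfolding radial_def
  by (subst emeasure_density)
  (auto intro!: nn_integral_cong_AE eventually_mono[OF AE_lborel_singleton[of 0]] simp: indicator_def)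
 also have "... = enn (t ^ n / n - 0 ^ n / n)"
 proof (rule nn_integral_FTC_Icc[where F="%x. x ^ n / real n"])
  fix x :: real assume "x \<in> {0..t}"
  show "DERIV (%x. x ^ n / real n) x :> x ^ (n-1)"
  using assms by (auto intro!: derivative_eq_intros)
 qed (use False in auto)
 finally show ?thesis using False assms by (simp add: max_def power_0_left)
qed

lemma space_surface_measure [simp]: "space (surf :: 'v::euclidean_space measure) = sphere 0 1"
 and sets_surface_measure [measurable_cong, simp]:
  "sets (surf :: 'v::euclidean_space measure) = sets (restrict_space borel (sphere 0 1))"
 by (auto simp: surface_measure_def space_restrict_space)

lemma surface_measure_finite [simp, intro]: "finite_measure (surf :: 'v::euclidean_space measure)"
proof
 have "emeasure (surf :: 'v measure) (sphere 0 1)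
  = of_nat DIM('v) * emeasure lborel {x \<in> cball 0 1 - {0::'v}. sgn x \<in> sphere 0 1}"
  by (rule emeasure_surface_measure) simp_all
 also have "... <= of_nat DIM('v) * emeasure lborel (cball 0 (1::real) :: 'v set)"
  by (intro mult_left_mono emeasure_mono) auto
 also have "... < \<infinity>"
  using emeasure_lborel_cball_finite[of "0::'v" 1] by (simp add: ennreal_mult_less_top ennreal_of_nat_eq_real_of_nat)
 finally show "emeasure (surf :: 'v measure) (space surf) ~= \<infinity>"
  unfolding space_surface_measure by (rule less_imp_neq)
qed

lemma borel_measurable_surface_measure:
 "f: borel_measurable borel ==> f: borel_measurable (surf :: 'v::euclidean_space measure)"
 unfolding measurable_cong_sets[OF sets_surface_measure refl] by (rule measurable_restrict_space1) simp

text \<open>Both sides agree on products of a ray \<open>{..t}\<close> and a Borel set of directions: by homogeneity the cone of height \<open>t\<close> has \<open>t\<close> to the power of the dimension times the volume of the cone of height 1, which defines the surface measure.\<close>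

lemma radial_surface_eq_distr:
 "radial DIM('v) \<Otimes>\<^sub>M (surf :: 'v::euclidean_space measure)
  = distr (restrict_space lborel (- {0})) (borel \<Otimes>\<^sub>M restrict_space borel (sphere 0 1)) (%x. (norm x, sgn x))"
proof (rule pair_measure_eqI)
 let ?D = "DIM('v)"
 show "sigma_finite_measure (surf :: 'v measure)"
  using surface_measure_finite by (rule finite_measure.sigma_finite_measure)
 show "sets (radial ?D \<Otimes>\<^sub>M (surf :: 'v measure))
  = sets (distr (restrict_space lborel (- {0})) (borel \<Otimes>\<^sub>M restrict_space borel (sphere 0 1)) (%x::'v. (norm x, sgn x)))"
  by (simp cong: sets_pair_measure_cong)
 have sgn_m [measurable]: "sgn: borel_measurable (borel :: 'v measure)"
  unfolding sgn_div_norm by measurable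
 have m: "(%x::'v. (norm x, sgn x)) \<in> restrict_space lborel (- {0}) \<rightarrow>\<^sub>M borel \<Otimes>\<^sub>M restrict_space borel (sphere 0 1)"
 proof (rule measurable_Pair)
  show "norm \<in> restrict_space lborel (- {0::'v}) \<rightarrow>\<^sub>M borel"
  by (rule measurable_restrict_space1) simp
  show "sgn \<in> restrict_space lborel (- {0::'v}) \<rightarrow>\<^sub>M restrict_space borel (sphere 0 1)"
  by (rule measurable_restrict_space2)
  (auto simp: space_restrict_space norm_sgn intro!: measurable_restrict_space1)
 qed
 fix A :: "real set" and E :: "'v set"
 assume "A \<in> sets (radial ?D)" and "E \<in> sets surf"
 then have A [measurable]: "A \<in> sets borel" and E: "E \<in> sets (restrict_space borel (sphere 0 1))" by auto
 then have Eb [measurable]: "E \<in> sets borel" and Esub: "E \<subseteq> sphere 0 1"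
  by (auto simp: sets_restrict_space_iff)
 define S where "S = {x::'v. x ~= 0 & sgn x \<in> E}"
 have [measurable]: "S \<in> sets borel" unfolding S_def by measurable
 define M1 where "M1 = scale_measure (emeasure surf E) (radial ?D)"
 define M2 where "M2 = distr (restrict_space lborel S) borel norm"
 have norm_m: "norm \<in> restrict_space lborel S \<rightarrow>\<^sub>M borel"
  by (rule measurable_restrict_space1) simp
 have M2: "emeasure M2 B = emeasure lborel {x\<in>S. norm x \<in> B}" if "B \<in> sets borel" for B
 proof -
  have "emeasure M2 B = emeasure (restrict_space lborel S) {x\<in>S. norm x \<in> B}"
  unfolding M2_def using that norm_m
  by (subst emeasure_distr) (auto simp: space_restrict_space intro!: arg_cong2[where f=emeasure])
  also have "... = emeasure lborel {x\<in>S. norm x \<in> B}"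
  by (rule emeasure_restrict_space) auto
  finally show ?thesis .
 qed
 have "M1 = M2"
 proof (rule measure_eqI_generator_eq[where E="range (%a::real. {..a})" and \<Omega>=UNIV and A="%i. {..real i}"])
  show "Int_stable (range (%a::real. {..a}))"
  by (auto simp: Int_stable_def)
  show "sets M1 = sigma_sets UNIV (range (%a::real. {..a}))" "sets M2 = sigma_sets UNIV (range (%a::real. {..a}))"
  by (simp_all add: M1_def M2_def borel_eq_atMost[where 'a=real])
  show "(\<Union>i::nat. {..real i}) = UNIV"
  by (auto intro: real_arch_simple)
  show "emeasure M1 {..real i} ~= \<infinity>" for i
  proof -
  have "emeasure surf E < \<infinity>"
  using finite_measure.emeasure_finite[OF surface_measure_finite, of E] by (simp add: less_top)
  then have "emeasure M1 {..real i} < \<infinity>"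
  by (simp add: M1_def emeasure_radial_atMost ennreal_mult_less_top)
  then show ?thesis by simp
  qed
  fix X :: "real set" assume "X \<in> range (%a::real. {..a})"
  then obtain t where X: "X = {..t}" by auto
  show "emeasure M1 X = emeasure M2 X"
  proof (cases "t <= 0")
  case True
  then have "{x\<in>S. norm x \<in> {..t}} = {}"
  by (auto simp: S_def) (meson norm_le_zero_iff order_trans)
  then have "emeasure M2 X = 0"
  unfolding X by (subst M2) (simp_all only: emeasure_empty atMost_borel)
  moreover have "max 0 t = 0" using True by simp
  ultimately show ?thesis
  unfolding X M1_def by (simp add: emeasure_radial_atMost power_0_left)
  next
  case False
  then have t: "t > 0" by simp
  define C where "C = {x \<in> cball 0 1 - {0::'v}. sgn x \<in> E}"
  have [measurable]: "C \<in> sets borel" unfolding C_def by measurable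
  have "emeasure lborel {x\<in>S. norm x \<in> {..t}} = emeasure (density (distr lborel borel (%x::'v. 0 + t *\<^sub>R x)) (%_. enn (\<bar>t\<bar>^DIM('v)))) {x\<in>S. norm x \<in> {..t}}"
  using t by (subst lborel_affine[of t 0]) auto
  also have "... = enn (t ^ ?D) * emeasure (distr lborel borel (%x::'v. 0 + t *\<^sub>R x)) {x\<in>S. norm x \<in> {..t}}"
  using t by (subst emeasure_density_const) auto
  also have "emeasure (distr lborel borel (%x::'v. 0 + t *\<^sub>R x)) {x\<in>S. norm x \<in> {..t}} = emeasure lborel C"
  using t by (subst emeasure_distr) (auto simp: C_def S_def sgn_scaleR intro!: arg_cong2[where f=emeasure])
  finally have "emeasure M2 X = enn (t ^ ?D) * emeasure lborel C"
  unfolding X by (subst M2) auto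
  also have "... = enn (t ^ ?D / ?D) * (of_nat ?D * emeasure lborel C)"
  using t by (simp add: mult.assoc[symmetric] ennreal_of_nat_eq_real_of_nat ennreal_mult[symmetric])
  also have "of_nat ?D * emeasure lborel C = emeasure surf E"
  unfolding C_def using Eb Esub by (rule emeasure_surface_measure[symmetric])
  finally show ?thesis
  unfolding X M1_def using t by (simp add: emeasure_radial_atMost max_def mult.commute)
  qed
 qed auto
 have "emeasure (radial ?D) A * emeasure surf E = emeasure M1 A"
  by (simp add: M1_def mult.commute)
 also have "... = emeasure lborel {x\<in>S. norm x \<in> A}"
  unfolding \<open>M1 = M2\<close> by (rule M2) simp
 also have "... = emeasure (restrict_space lborel (- {0})) {x\<in>S. norm x \<in> A}"
  by (rule emeasure_restrict_space[symmetric]) (auto simp: S_def)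
 also have "... = emeasure (distr (restrict_space lborel (- {0})) (borel \<Otimes>\<^sub>M restrict_space borel (sphere 0 1)) (%x. (norm x, sgn x))) (A \<times> E)"
  using m E by (subst emeasure_distr) (auto simp: S_def space_restrict_space intro!: arg_cong2[where f=emeasure])
 finally show "emeasure (radial ?D) A * emeasure surf E
  = emeasure (distr (restrict_space lborel (- {0})) (borel \<Otimes>\<^sub>M restrict_space borel (sphere 0 1)) (%x. (norm x, sgn x))) (A \<times> E)" .
qed auto

lemma lborel_polar:
 "(lborel :: 'v::euclidean_space measure)
  = distr (radial DIM('v) \<Otimes>\<^sub>M surf) borel (%(r, om). r *\<^sub>R om)"
proof (rule measure_eqI)
 let ?P = "borel \<Otimes>\<^sub>M restrict_space borel (sphere (0::'v) 1)"
 have m1: "(%(r, om). r *\<^sub>R om) \<in> ?P \<rightarrow>\<^sub>M borel"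
 proof -
  have [measurable]: "(%om::'v. om) \<in> restrict_space borel (sphere (0::'v) 1) \<rightarrow>\<^sub>M borel"
  by (rule measurable_restrict_space1) simp
  show ?thesis by measurable
 qed
 have m: "(%x::'v. (norm x, sgn x)) \<in> restrict_space lborel (- {0}) \<rightarrow>\<^sub>M ?P"
 proof (rule measurable_Pair)
  show "norm \<in> restrict_space lborel (- {0::'v}) \<rightarrow>\<^sub>M borel"
  by (rule measurable_restrict_space1) simp
  have sgn_m [measurable]: "sgn: borel_measurable (borel :: 'v measure)"
  unfolding sgn_div_norm by measurable
  show "sgn \<in> restrict_space lborel (- {0::'v}) \<rightarrow>\<^sub>M restrict_space borel (sphere 0 1)"
  by (rule measurable_restrict_space2)
  (auto simp: space_restrict_space norm_sgn intro!: measurable_restrict_space1)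
 qed
 fix X :: "'v set" assume "X \<in> sets lborel"
 then have [measurable]: "X \<in> sets borel" by simp
 have "emeasure (distr (radial DIM('v) \<Otimes>\<^sub>M surf) borel (%(r, om). r *\<^sub>R om)) X
  = emeasure (distr (distr (restrict_space lborel (- {0})) ?P (%x. (norm x, sgn x))) borel (%(r, om). r *\<^sub>R om)) X"
  unfolding radial_surface_eq_distr ..
 also have "... = emeasure (distr (restrict_space lborel (- {0})) borel ((%(r, om). r *\<^sub>R om) \<circ> (%x. (norm x, sgn x)))) X"
  using m1 m by (subst distr_distr) auto
 also have "... = emeasure (restrict_space lborel (- {0})) (X - {0})"
  using measurable_comp[OF m m1]
  by (subst emeasure_distr) (auto simp: space_restrict_space sgn_div_norm intro!: arg_cong2[where f=emeasure])
 also have "... = emeasure lborel (X - {0})"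
  by (rule emeasure_restrict_space) auto
 also have "... = emeasure lborel X"
  by (rule emeasure_Diff_null_set) auto
 finally show "emeasure lborel X = emeasure (distr (radial DIM('v) \<Otimes>\<^sub>M surf) borel (%(r, om). r *\<^sub>R om)) X" ..
qed auto

section \<open>Integration over spheres\<close>

lemma measurable_scaleR_polar:
 "(%(r, om). r *\<^sub>R om) \<in> radial n \<Otimes>\<^sub>M (surf :: 'v::euclidean_space measure) \<rightarrow>\<^sub>M borel"
proof -
 have [measurable]: "(%om::'v. om) \<in> (surf :: 'v measure) \<rightarrow>\<^sub>M borel"
  by (rule borel_measurable_surface_measure) simp
 show ?thesis by measurable
qed

lemma sigma_finite_surface_measure: "sigma_finite_measure (surf :: 'v::euclidean_space measure)"
 using surface_measure_finite by (rule finite_measure.sigma_finite_measure)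

lemma pair_sigma_finite_polar:
 "pair_sigma_finite (radial n) (surf :: 'v::euclidean_space measure)"
 using sigma_finite_surface_measure by (intro pair_sigma_finite.intro) auto

lemma nn_integral_polar:
 fixes f :: "'v::euclidean_space => ennreal"
 assumes [measurable]: "f: borel_measurable borel"
 shows "(nni lborel (%x. f x)) = (\<integral>\<^sup>+r. \<integral>\<^sup>+om. f (r *\<^sub>R om) \<partial>(surf :: 'v measure) \<partial>radial DIM('v))"
proof -
 interpret pair_sigma_finite "radial DIM('v)" "surf :: 'v measure"
  by (rule pair_sigma_finite_polar)
 have m: "(%p. f (case p of (r, om) => r *\<^sub>R om)): borel_measurable (radial DIM('v) \<Otimes>\<^sub>M surf)"
  using measurable_comp[OF measurable_scaleR_polar assms] by (simp add: o_def)
 show ?thesis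
  by (subst lborel_polar, subst nn_integral_distr[OF measurable_scaleR_polar])
  (use m in \<open>auto simp: M2.nn_integral_fst[symmetric]\<close>)
qed

lemma
 fixes f :: "'v::euclidean_space => complex"
 assumes f: "integrable lborel f"
 shows integral_polar: "(LINT x|lborel. f x) = (\<integral>r. \<integral>om. f (r *\<^sub>R om) \<partial>(surf :: 'v measure) \<partial>radial DIM('v))"
proof -
 interpret pair_sigma_finite "radial DIM('v)" "surf :: 'v measure"
  by (rule pair_sigma_finite_polar)
 have mf [measurable]: "f: borel_measurable borel" using f by auto
 have i: "integrable (radial DIM('v) \<Otimes>\<^sub>M (surf :: 'v measure)) (%p. f (case p of (r, om) => r *\<^sub>R om))"
  using f unfolding lborel_polar[where 'v='v]
  by (subst (asm) integrable_distr_eq[OF measurable_scaleR_polar]) auto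
 have "(LINT x|lborel. f x) = integral\<^sup>L (radial DIM('v) \<Otimes>\<^sub>M (surf :: 'v measure)) (%p. f (case p of (r, om) => r *\<^sub>R om))"
  by (subst lborel_polar, subst integral_distr[OF measurable_scaleR_polar]) auto
 also have "... = (\<integral>r. \<integral>om. f (r *\<^sub>R om) \<partial>(surf :: 'v measure) \<partial>radial DIM('v))"
  using integral_fst'[OF i] by simp
 finally show ?thesis .
qed

lemma measurable_orthogonal:
 fixes T :: "'v::euclidean_space => 'v"
 assumes "orthogonal_transformation T"
 shows "T: borel_measurable borel"
 using orthogonal_transformation_linear[OF assms]
 by (intro borel_measurable_continuous_onI linear_continuous_on linear_conv_bounded_linear[THEN iffD1])

lemma surface_measure_orthogonal:
 fixes T :: "'v::euclidean_space => 'v"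
 assumes T: "orthogonal_transformation T"
 shows "distr surf surf T = surf"
proof (rule measure_eqI)
 have [measurable]: "T: borel_measurable borel" using T by (rule measurable_orthogonal)
 have [measurable]: "sgn: borel_measurable (borel :: 'v measure)"
  unfolding sgn_div_norm by measurable
 have nT: "norm (T x) = norm x" for x using T by (rule orthogonal_transformation_norm)
 have T0: "T x = 0 \<longleftrightarrow> x = 0" for x using nT[of x] by (metis norm_eq_zero)
 have sT: "sgn (T x) = T (sgn x)" for x
  using orthogonal_transformation_linear[OF T] by (simp add: sgn_div_norm nT linear_cmul)
 have "T \<in> restrict_space borel (sphere 0 1) \<rightarrow>\<^sub>M restrict_space borel (sphere 0 1)"
  by (rule measurable_restrict_space2)
  (auto simp: space_restrict_space nT intro!: measurable_restrict_space1)
 then have Tm: "T \<in> surf \<rightarrow>\<^sub>M surf"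
  unfolding measurable_cong_sets[OF sets_surface_measure sets_surface_measure] .
 fix E assume "E \<in> sets (distr surf surf T)"
 then have E: "E \<in> sets surf" by simp
 then have [measurable]: "E \<in> sets borel" and Es: "E \<subseteq> sphere 0 1"
  by (auto simp: sets_restrict_space_iff)
 define C where "C = {x \<in> cball 0 1 - {0::'v}. sgn x \<in> E}"
 have [measurable]: "C \<in> sets borel" unfolding C_def by measurable
 have TE: "T -` E \<subseteq> sphere 0 1" using Es nT by auto
 have "emeasure (distr surf surf T) E = emeasure surf (T -` E)"
  using TE E Tm by (subst emeasure_distr) (auto simp: Int_absorb2)
 also have "... = of_nat DIM('v) * emeasure lborel {x \<in> cball 0 1 - {0::'v}. sgn x \<in> T -` E}"
 proof (rule emeasure_surface_measure)
  show "T -` E \<in> sets borel" using measurable_sets[of T borel borel E] by simp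
 qed (fact TE)
 also have "{x \<in> cball 0 1 - {0::'v}. sgn x \<in> T -` E} = T -` C"
  by (auto simp: C_def nT T0 sT)
 also have "emeasure lborel (T -` C) = (nni lborel (%x. indicator (T -` C) x))"
  using measurable_sets[of T borel borel C] by (intro nn_integral_indicator[symmetric]) simp
 also have "... = (nni lborel (%x. indicator C (T x)))"
  by (simp only: indicator_vimage)
 also have "... = emeasure lborel C"
  by (subst nn_integral_lborel_orthogonal[OF _ T]) auto
 also have "of_nat DIM('v) * emeasure lborel C = emeasure surf E"
  unfolding C_def by (rule emeasure_surface_measure[symmetric]) (use Es in auto)
 finally show "emeasure (distr surf surf T) E = emeasure surf E" .
qed simp

lemma integral_surface_orthogonal:
 fixes T :: "'v::euclidean_space => 'v" and f :: "'v => real"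
 assumes T: "orthogonal_transformation T" and f: "f: borel_measurable borel"
 shows "(LINT om|surf. f (T om)) = (LINT om|surf. f om)"
proof -
 have "T \<in> restrict_space borel (sphere 0 1) \<rightarrow>\<^sub>M restrict_space borel (sphere 0 1)"
  by (rule measurable_restrict_space2)
  (auto simp: space_restrict_space orthogonal_transformation_norm[OF T] intro!: measurable_restrict_space1 measurable_orthogonal[OF T])
 then have Tm: "T \<in> surf \<rightarrow>\<^sub>M surf"
  unfolding measurable_cong_sets[OF sets_surface_measure sets_surface_measure] .
 have "(LINT om|surf. f om) = (LINT om|distr surf surf T. f om)"
  using surface_measure_orthogonal[OF T] by simp
 also have "... = (LINT om|surf. f (T om))"
  by (rule integral_distr[OF Tm borel_measurable_surface_measure[OF f]])
 finally show ?thesis ..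
qed

lemma integrable_surface_bounded:
 fixes f :: "'v::euclidean_space => 'c::{banach, second_countable_topology}"
 assumes "f: borel_measurable borel" "\<And>om. norm om = 1 ==> norm (f om) <= B"
 shows "integrable surf f"
proof (rule finite_measure.integrable_const_bound[OF surface_measure_finite, where B=B])
 show "AE x in surf. norm (f x) <= B"
  using assms(2) by (intro AE_I2) auto
 show "f: borel_measurable surf"
  using assms(1) by (rule borel_measurable_surface_measure)
qed

lemma has_real_derivative_integral_finite:
 fixes f f' :: "real => 'w => real"
 assumes M: "finite_measure M"
  and meas: "\<And>t. f t: borel_measurable M" "f' t: borel_measurable M"
  and int: "\<And>t. integrable M (f t)"
  and der: "\<And>t om. om \<in> space M ==> ((%t. f t om) has_real_derivative f' t om) (at t)"
  and bd: "\<And>t om. om \<in> space M ==> \<bar>f' t om\<bar> <= K"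
 shows "((%t. \<integral>om. f t om \<partial>M) has_real_derivative (LINT om|M. f' t om)) (at t)"
 unfolding DERIV_def
proof (subst tendsto_at_iff_sequentially, intro allI impI)
 fix h :: "nat => real"
 assume h0: "\<forall>i. h i \<in> UNIV - {0}" and h: "h \<longlonglongrightarrow> 0"
 have eq: "((%h. ((LINT om|M. f (t + h) om) - (LINT om|M. f t om)) / h) \<circ> h)
  = (%i. \<integral>om. (f (t + h i) om - f t om) / h i \<partial>M)"
  by (auto simp: fun_eq_iff Bochner_Integration.integral_diff[OF int int, symmetric])
 show "((%h. ((LINT om|M. f (t + h) om) - (LINT om|M. f t om)) / h) \<circ> h) \<longlonglongrightarrow> (LINT om|M. f' t om)"
  unfolding eq
 proof (rule integral_dominated_convergence[where w="%_. K"])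
  show "integrable M (%_. K)" using M by (rule finite_measure.integrable_const)
  show "AE x in M. (%i. (f (t + h i) x - f t x) / h i) \<longlonglongrightarrow> f' t x"
  proof (rule AE_I2)
  fix x assume "x \<in> space M"
  then have "((%h. (f (t + h) x - f t x) / h) \<longlongrightarrow> f' t x) (at 0)"
  using der[of x t] by (simp add: DERIV_def)
  then show "(%i. (f (t + h i) x - f t x) / h i) \<longlonglongrightarrow> f' t x"
  using h h0 unfolding tendsto_at_iff_sequentially by (auto simp: o_def)
  qed
  fix i
  show "AE x in M. norm ((f (t + h i) x - f t x) / h i) <= K"
  proof (rule AE_I2)
  fix x assume x: "x \<in> space M"
  have "\<bar>f (t + h i) x - f t x\<bar> <= K * \<bar>(t + h i) - t\<bar>"
  using field_differentiable_bound[of UNIV "%t. f t x" "%t. f' t x" K t "t + h i"] der[OF x] bd[OF x]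
  by (auto intro: has_field_derivative_at_within)
  then show "norm ((f (t + h i) x - f t x) / h i) <= K"
  using h0 by (simp add: abs_divide divide_le_eq)
  qed
  have [measurable]: "f t: borel_measurable M" for t by (rule meas)
  show "(%om. (f (t + h i) om - f t om) / h i): borel_measurable M" by measurable
 qed (rule meas)
qed

text \<open>\<open>f r + K / r\<close> decreases and \<open>f r - K / r\<close> increases, so both converge to the same limit, and the limit is squeezed between them.\<close>

lemma decaying_derivative_imp_limit:
 fixes f f' :: "real => real"
 assumes der: "\<And>r. r \<ge> 1 ==> (f has_real_derivative f' r) (at r)"
  and bd: "\<And>r. r \<ge> 1 ==> \<bar>f' r\<bar> <= K / r^2"
 shows "\<exists>L. \<forall>r\<ge>1. \<bar>f r - L\<bar> <= K / r"
proof -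
 have up: "f r - K / r <= f s - K / s" if "1 <= r" "r <= s" for r s
 proof (rule DERIV_nonneg_imp_nondecreasing[OF that(2)])
  fix x assume x: "r <= x" "x <= s"
  then have "((%r. f r - K / r) has_real_derivative f' x - (- (K / x^2))) (at x)"
  using that by (auto intro!: derivative_eq_intros der simp: power2_eq_square)
  moreover have "f' x - (- (K / x^2)) \<ge> 0" using bd[of x] x that by (auto simp: abs_le_iff)
  ultimately show "\<exists>y. ((%r. f r - K / r) has_real_derivative y) (at x) & 0 <= y" by blast
 qed
 have down: "f s + K / s <= f r + K / r" if "1 <= r" "r <= s" for r s
 proof (rule DERIV_nonpos_imp_nonincreasing[OF that(2)])
  fix x assume x: "r <= x" "x <= s"
  then have "((%r. f r + K / r) has_real_derivative f' x + (- (K / x^2))) (at x)"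
  using that by (auto intro!: derivative_eq_intros der simp: power2_eq_square)
  moreover have "f' x + (- (K / x^2)) <= 0" using bd[of x] x that by (auto simp: abs_le_iff)
  ultimately show "\<exists>y. ((%r. f r + K / r) has_real_derivative y) (at x) & y <= 0" by blast
 qed
 have K0: "K \<ge> 0" using bd[of 1] by simp
 have le: "f r - K / r <= f s + K / s" if "1 <= r" "1 <= s" for r s
 proof (cases "r <= s")
  case True
  then show ?thesis using up[of r s] K0 that by (smt (verit) divide_nonneg_nonneg)
 next
  case False
  then show ?thesis using down[of s r] K0 that by (smt (verit) divide_nonneg_nonneg)
 qed
 define L where "L = (SUP r\<in>{1..}. f r - K / r)"
 have "f r - K / r <= L" if "1 <= r" for r
  unfolding L_def using that le[of _ 1] by (intro cSUP_upper bdd_aboveI2[where M="f 1 + K"]) auto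
 moreover have "L <= f s + K / s" if "1 <= s" for s
  unfolding L_def using that le by (intro cSUP_least) auto
 ultimately show ?thesis
  by (intro exI[of _ L]) (auto simp: abs_le_iff algebra_simps)
qed

text \<open>Multiplying a solution of \<open>u'' + (n - 1) / r u' + u = 0\<close> by \<open>r\<close> to the power \<open>(n - 1) / 2\<close> removes the first order term and leaves \<open>w'' + (1 + O(1 / r\<^sup>2)) w = 0\<close>. The coefficients of \<open>cos\<close> and \<open>sin\<close> found by variation of constants have derivatives of size \<open>1 / r\<^sup>2\<close> and converge.\<close>

lemma bessel_equation_asymptotics:
 fixes u u1 u2 :: "real => real" and n :: nat
 assumes n: "n \<ge> 2"
  and d1: "\<And>r. r > 0 ==> (u has_real_derivative u1 r) (at r)"
  and d2: "\<And>r. r > 0 ==> (u1 has_real_derivative u2 r) (at r)"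
  and ode: "\<And>r. r > 0 ==> u2 r + (real n - 1) / r * u1 r + u r = 0"
  and bd: "\<And>r. \<bar>u r\<bar> <= K"
 shows "\<exists>C A B. C \<ge> 0 & (\<forall>r>0. \<bar>r powr ((real n - 1) / 2) * u r\<bar> <= C &
  \<bar>r powr ((real n - 1) / 2) * u r - (A * cos r + B * sin r)\<bar> <= C / r)"
proof -
 define al where "al = (real n - 1) / 2"
 define c where "c = al * (al - 1)"
 define w where "w r = r powr al * u r" for r
 define w1 where "w1 r = r powr al * (u1 r + al * u r / r)" for r
 have al2: "2 * al = real n - 1" by (simp add: al_def)
 have al: "al > 0" using n by (simp add: al_def)
 have powr1: "r powr (al - 1) = r powr al / r" if "r > 0" for r
  using that by (simp add: powr_diff)
 have dw: "(w has_real_derivative w1 r) (at r)" if r: "r > 0" for r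
  unfolding w_def[abs_def] w1_def using r
  by (auto intro!: derivative_eq_intros d1 simp: powr1 field_simps)
 have dw1: "(w1 has_real_derivative (c / r^2 - 1) * w r) (at r)" if r: "r > 0" for r
 proof -
  have "(w1 has_real_derivative al * r powr (al - 1) * (u1 r + al * u r / r)
  + r powr al * (u2 r + (al * u1 r * r - al * u r) / r^2)) (at r)"
  unfolding w1_def[abs_def] using r
  by (auto intro!: derivative_eq_intros d1 d2 simp: field_simps power2_eq_square)
  moreover have "al * r powr (al - 1) * (u1 r + al * u r / r)
  + r powr al * (u2 r + (al * u1 r * r - al * u r) / r^2)
  = r powr al * (u2 r + (2 * al) / r * u1 r + c / r^2 * u r)"
  unfolding powr1[OF r] c_def using r by (simp add: field_simps power2_eq_square)
  moreover have "u2 r = - ((2 * al) / r * u1 r) - u r"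
  using ode[OF r] unfolding al2[symmetric] by linarith
  ultimately have "(w1 has_real_derivative r powr al * (- u r + c / r^2 * u r)) (at r)" by simp
  then show ?thesis by (simp add: w_def algebra_simps)
 qed
 define E where "E r = (w r)^2 + (w1 r)^2" for r
 have E_mono: "E r * exp (\<bar>c\<bar> / r) <= E 1 * exp (\<bar>c\<bar> / 1)" if r: "1 <= r" for r
 proof (rule DERIV_nonpos_imp_nonincreasing[OF r])
  fix x assume x: "1 <= x" "x <= r"
  have d: "((%r. E r * exp (\<bar>c\<bar> / r)) has_real_derivative
  (2 * w x * w1 x + 2 * w1 x * ((c / x^2 - 1) * w x)) * exp (\<bar>c\<bar> / x) + E x * (exp (\<bar>c\<bar> / x) * (- (\<bar>c\<bar> / x^2)))) (at x)"
  unfolding E_def[abs_def] using x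
  by (auto intro!: derivative_eq_intros dw dw1 simp: field_simps power2_eq_square)
  have "2 * \<bar>w x\<bar> * \<bar>w1 x\<bar> <= E x"
  unfolding E_def using sum_squares_bound[of "\<bar>w x\<bar>" "\<bar>w1 x\<bar>"] by simp
  then have "\<bar>c\<bar> * (2 * \<bar>w x\<bar> * \<bar>w1 x\<bar>) <= \<bar>c\<bar> * E x" by (rule mult_left_mono) simp
  moreover have "c * (2 * w x * w1 x) <= \<bar>c\<bar> * (2 * \<bar>w x\<bar> * \<bar>w1 x\<bar>)"
  by (metis abs_ge_self abs_mult abs_numeral)
  ultimately have "(c * (2 * w x * w1 x) - \<bar>c\<bar> * E x) / x^2 <= 0"
  by (simp add: divide_nonpos_nonneg)
  then have "exp (\<bar>c\<bar> / x) * ((c * (2 * w x * w1 x) - \<bar>c\<bar> * E x) / x^2) <= 0"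
  by (rule mult_nonneg_nonpos[OF exp_ge_zero])
  also have "exp (\<bar>c\<bar> / x) * ((c * (2 * w x * w1 x) - \<bar>c\<bar> * E x) / x^2) =
  (2 * w x * w1 x + 2 * w1 x * ((c / x^2 - 1) * w x)) * exp (\<bar>c\<bar> / x) + E x * (exp (\<bar>c\<bar> / x) * (- (\<bar>c\<bar> / x^2)))"
  using x by (simp add: field_simps)
  finally show "\<exists>y. ((%r. E r * exp (\<bar>c\<bar> / r)) has_real_derivative y) (at x) & y <= 0"
  using d by blast
 qed
 define W where "W = sqrt (E 1 * exp \<bar>c\<bar>)"
 have E_nonneg: "E r \<ge> 0" for r by (simp add: E_def)
 have W0: "W \<ge> 0" by (simp add: W_def E_nonneg)
 have wW: "\<bar>w r\<bar> <= W" if r: "1 <= r" for r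
 proof -
  have "E r * 1 <= E r * exp (\<bar>c\<bar> / r)"
  using r by (intro mult_left_mono E_nonneg) simp
  also have "... <= E 1 * exp \<bar>c\<bar>" using E_mono[OF r] by simp
  finally have "E r <= E 1 * exp \<bar>c\<bar>" by simp
  moreover have "\<bar>w r\<bar>\<^sup>2 <= E r" by (simp add: E_def)
  ultimately show ?thesis unfolding W_def by (intro real_le_rsqrt) linarith
 qed
 have cw: "\<bar>c * w r * t / r^2\<bar> <= \<bar>c\<bar> * W / r^2" if "1 <= r" "\<bar>t\<bar> <= 1" for r t
 proof -
  have "\<bar>w r\<bar> * \<bar>t\<bar> <= W * 1" using wW[OF that(1)] that by (intro mult_mono W0) auto
  then have "\<bar>c\<bar> * (\<bar>w r\<bar> * \<bar>t\<bar>) <= \<bar>c\<bar> * (W * 1)" by (rule mult_left_mono) simp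
  then show ?thesis by (simp add: abs_mult abs_divide mult.assoc divide_right_mono)
 qed
 have "\<exists>L. \<forall>r\<ge>1. \<bar>(w r * cos r - w1 r * sin r) - L\<bar> <= (\<bar>c\<bar> * W) / r"
 proof (rule decaying_derivative_imp_limit[where f'="%r. - (c * w r * sin r / r^2)"])
  fix r :: real assume r: "1 <= r"
  show "((%r. w r * cos r - w1 r * sin r) has_real_derivative - (c * w r * sin r / r^2)) (at r)"
  using r by (auto intro!: derivative_eq_intros dw dw1 simp: field_simps)
  show "\<bar>- (c * w r * sin r / r^2)\<bar> <= \<bar>c\<bar> * W / r^2"
  using cw[OF r, of "sin r"] by simp
 qed
 then obtain A where A0: "\<forall>r\<ge>1. \<bar>(w r * cos r - w1 r * sin r) - A\<bar> <= (\<bar>c\<bar> * W) / r" ..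
 note A = A0[rule_format]
 have "\<exists>L. \<forall>r\<ge>1. \<bar>(w r * sin r + w1 r * cos r) - L\<bar> <= (\<bar>c\<bar> * W) / r"
 proof (rule decaying_derivative_imp_limit[where f'="%r. (c * w r * cos r / r^2)"])
  fix r :: real assume r: "1 <= r"
  show "((%r. w r * sin r + w1 r * cos r) has_real_derivative (c * w r * cos r / r^2)) (at r)"
  using r by (auto intro!: derivative_eq_intros dw dw1 simp: field_simps)
  show "\<bar>(c * w r * cos r / r^2)\<bar> <= \<bar>c\<bar> * W / r^2"
  using cw[OF r, of "cos r"] by simp
 qed
 then obtain B where B0: "\<forall>r\<ge>1. \<bar>(w r * sin r + w1 r * cos r) - B\<bar> <= (\<bar>c\<bar> * W) / r" ..
 note B = B0[rule_format]
 have asym: "\<bar>w r - (A * cos r + B * sin r)\<bar> <= 2 * (\<bar>c\<bar> * W) / r" if r: "1 <= r" for r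
 proof -
  let ?a = "(w r * cos r - w1 r * sin r) - A" and ?b = "(w r * sin r + w1 r * cos r) - B"
  have "w r - (A * cos r + B * sin r) = w r * ((cos r)^2 + (sin r)^2) - (A * cos r + B * sin r)" by simp
  also have "... = ?a * cos r + ?b * sin r" unfolding power2_eq_square by algebra
  also have "\<bar>...\<bar> <= \<bar>?a\<bar> * \<bar>cos r\<bar> + \<bar>?b\<bar> * \<bar>sin r\<bar>" by (simp only: abs_mult[symmetric] abs_triangle_ineq)
  also have "... <= \<bar>?a\<bar> * 1 + \<bar>?b\<bar> * 1" by (intro add_mono mult_left_mono) auto
  also have "... <= (\<bar>c\<bar> * W) / r + (\<bar>c\<bar> * W) / r" unfolding mult_1_right by (rule add_mono[OF A[OF r] B[OF r]])
  finally show ?thesis by (simp add: mult.commute)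
 qed
 have K0: "K \<ge> 0" using bd[of 0] by simp
 define C where "C = W + K + \<bar>A\<bar> + \<bar>B\<bar> + 2 * (\<bar>c\<bar> * W)"
 have C0: "C \<ge> 0" using W0 K0 by (simp add: C_def)
 have small: "\<bar>w r\<bar> <= K" if "0 < r" "r <= 1" for r
 proof -
  have "r powr al <= 1" using that al by (intro powr_le1) auto
  then have "r powr al * \<bar>u r\<bar> <= 1 * K" using bd[of r] by (intro mult_mono) auto
  then show ?thesis by (simp add: w_def abs_mult)
 qed
 have cW: "\<bar>c\<bar> * W \<ge> 0" using W0 by simp
 have "\<bar>w r\<bar> <= C & \<bar>w r - (A * cos r + B * sin r)\<bar> <= C / r" if r: "r > 0" for r
 proof (cases "r \<ge> 1")
  case True
  have "2 * (\<bar>c\<bar> * W) / r <= C / r"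
  using r W0 K0 cW C_def by (intro divide_right_mono) linarith+
  then show ?thesis using wW[OF True] asym[OF True] W0 K0 cW C_def by (intro conjI) linarith+
 next
  case False
  have "\<bar>A * cos r + B * sin r\<bar> <= \<bar>A\<bar> * 1 + \<bar>B\<bar> * 1"
  by (rule order_trans[OF abs_triangle_ineq]) (unfold abs_mult, intro add_mono mult_left_mono, auto)
  moreover have wK: "\<bar>w r\<bar> <= K" using small[of r] r False by simp
  ultimately have "\<bar>w r - (A * cos r + B * sin r)\<bar> <= C"
  using W0 cW C_def by linarith
  also have "C <= C / r" using r False C0 by (simp add: le_divide_eq mult_left_le)
  finally show ?thesis using wK W0 cW C_def by (intro conjI) linarith+
 qed
 then show ?thesis using C0 unfolding w_def al_def by blast
qed

section \<open>The Fourier transform of the surface measure\<close>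

definition bessel :: "'n::finite itself => real => real" where
 "bessel _ r = (LINT om|(surf :: (real^'n) measure). cos (r * (om $ (SOME i::'n. True))))"

lemma bessel_eq:
 fixes xi :: "real^'n::finite"
 shows "(LINT om|surf. cos (xi \<bullet> om)) = bessel TYPE('n) (norm xi)"
proof -
 define i0 where "i0 = (SOME i::'n. True)"
 have "norm (axis i x :: real^'n) = \<bar>x\<bar>" for i x
  unfolding norm_eq_sqrt_inner inner_axis_axis by simp
 then have "norm (axis i0 (norm xi) :: real^'n) = norm xi" by simp
 from orthogonal_transformation_exists[OF this]
 obtain T :: "real^'n => real^'n" where T: "orthogonal_transformation T" "T (axis i0 (norm xi)) = xi" .
 have "(LINT om|surf. cos (xi \<bullet> om)) = (LINT om|surf. cos (xi \<bullet> T om))"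
  by (rule integral_surface_orthogonal[OF T(1), symmetric]) measurable
 also have "... = (LINT om|surf. cos (norm xi * (om $ i0)))"
 proof (rule Bochner_Integration.integral_cong[OF refl])
  fix om
  have "xi \<bullet> T om = axis i0 (norm xi) \<bullet> om"
  using T unfolding orthogonal_transformation_def by metis
  then show "cos (xi \<bullet> T om) = cos (norm xi * (om $ i0))" by (simp add: inner_axis' mult.commute)
 qed
 finally show ?thesis unfolding bessel_def i0_def .
qed

lemma bessel_bounded:
 "\<bar>bessel TYPE('n::finite) r\<bar> <= measure (surf :: (real^'n) measure) (sphere 0 1)"
proof -
 interpret finite_measure "surf :: (real^'n) measure" by (rule surface_measure_finite)
 have "norm (bessel TYPE('n) r) <= (LINT om|(surf :: (real^'n) measure). 1)"
  unfolding bessel_def by (rule Bochner_Integration.integral_norm_bound_integral) (auto intro!: integrable_surface_bounded[where B=1])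
 then show ?thesis by simp
qed

lemma nth_le_1: "norm (om::real^'n) = 1 ==> \<bar>om $ i\<bar> <= 1"
 by (metis component_le_norm_cart)

lemma bessel_asymptotics:
 assumes n: "CARD('n::finite) \<ge> 2"
 shows "\<exists>C A B. C \<ge> 0 & (\<forall>r>0. \<bar>r powr ((real CARD('n) - 1) / 2) * bessel TYPE('n) r\<bar> <= C &
  \<bar>r powr ((real CARD('n) - 1) / 2) * bessel TYPE('n) r - (A * cos r + B * sin r)\<bar> <= C / r)"
proof -
 define S where "S = (surf :: (real^'n) measure)"
 define i0 where "i0 = (SOME i::'n. True)"
 have fin: "finite_measure S" unfolding S_def by (rule surface_measure_finite)
 define u where "u = bessel TYPE('n)"
 have u_eq: "u r = (LINT om|S. cos (r * om $ i0))" for r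
  unfolding u_def S_def i0_def bessel_def ..
 define v where "v r = (LINT om|S. om $ i0 * sin (r * om $ i0))" for r
 define v1 where "v1 r = (LINT om|S. om $ i0 * om $ i0 * cos (r * om $ i0))" for r
 have sp: "om \<in> space S \<longleftrightarrow> norm om = 1" for om by (auto simp: S_def)
 have m: "f: borel_measurable borel ==> f: borel_measurable S" for f :: "real^'n => real"
  unfolding S_def by (rule borel_measurable_surface_measure)
 have int: "f: borel_measurable borel ==> (\<And>om. norm om = 1 ==> norm (f om) <= 1) ==> integrable S f" for f :: "real^'n => real"
  unfolding S_def by (rule integrable_surface_bounded)
 have b1: "\<bar>om $ i * t\<bar> <= 1" if "norm om = 1" "\<bar>t\<bar> <= 1" for om :: "real^'n" and i t
  using mult_mono[OF nth_le_1[OF that(1), of i] that(2)] by (simp add: abs_mult)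
 have b2: "\<bar>om $ i * om $ j * t\<bar> <= 1" if "norm om = 1" "\<bar>t\<bar> <= 1" for om :: "real^'n" and i j t
  using b1[OF that(1) b1[OF that, of j], of i] by (simp add: mult.assoc)
 have du: "(u has_real_derivative - v r) (at r)" for r
 proof -
  have "((%r. \<integral>om. cos (r * om $ i0) \<partial>S) has_real_derivative (LINT om|S. - (om $ i0 * sin (r * om $ i0)))) (at r)"
  by (rule has_real_derivative_integral_finite[where K=1, OF fin])
  (auto intro!: m int b1 derivative_eq_intros simp: sp)
  then show ?thesis unfolding u_eq[abs_def] v_def by simp
 qed
 have dv: "(v has_real_derivative v1 r) (at r)" for r
  unfolding v_def[abs_def] v1_def
  by (rule has_real_derivative_integral_finite[where K=1, OF fin])
  (auto intro!: m int b1 b2 derivative_eq_intros simp: sp)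
 have other: "(LINT om|S. om $ i * om $ i * cos (r * om $ i0)) = v r / r" if i: "i ~= i0" and r: "r > 0" for i r
 proof -
  define U where "U t = (LINT om|S. cos (r * om $ i0 + t * om $ i))" for t
  define U1 where "U1 t = (LINT om|S. - (om $ i * sin (r * om $ i0 + t * om $ i)))" for t
  have dU: "(U has_real_derivative U1 t) (at t)" for t
  unfolding U_def[abs_def] U1_def
  by (rule has_real_derivative_integral_finite[where K=1, OF fin])
  (auto intro!: m int b1 derivative_eq_intros simp: sp)
  have dU1: "(U1 has_real_derivative (LINT om|S. - (om $ i * om $ i * cos (r * om $ i0 + 0 * om $ i)))) (at 0)"
  unfolding U1_def[abs_def]
  by (rule has_real_derivative_integral_finite[where K=1, OF fin])
  (auto intro!: m int b1 b2 derivative_eq_intros simp: sp)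
  define q where "q t = sqrt (r^2 + t^2)" for t
  have qpos: "r^2 + t^2 > 0" for t using r by (simp add: add_pos_nonneg)
  have Uq: "U t = u (q t)" for t
  proof -
  define xi :: "real^'n" where "xi = axis i0 r + axis i t"
  have "xi \<bullet> om = r * om $ i0 + t * om $ i" for om
  by (simp add: xi_def inner_add_left inner_axis' mult.commute)
  moreover have "norm xi = q t"
  unfolding norm_eq_sqrt_inner q_def xi_def using i
  by (simp add: inner_add_left inner_add_right inner_axis_axis power2_eq_square)
  ultimately show ?thesis using bessel_eq[of xi] unfolding U_def u_def S_def by simp
  qed
  have "(U has_real_derivative - v (q t) * (t / q t)) (at t)" for t
  proof -
  have "(q has_real_derivative t / q t) (at t)"
  unfolding q_def[abs_def] using qpos[of t]
  by (auto intro!: derivative_eq_intros simp: field_simps)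
  from DERIV_chain2[OF du this] show ?thesis unfolding Uq[abs_def] by simp
  qed
  then have U1_eq: "U1 t = - v (q t) * (t / q t)" for t using dU DERIV_unique by blast
  have q0: "q 0 = r" using r by (simp add: q_def)
  have "isCont (%t. - v (q t) / q t) 0"
  proof -
  have "isCont q 0" unfolding q_def[abs_def] by (intro continuous_intros)
  moreover have "isCont v (q 0)" using dv DERIV_isCont by blast
  ultimately show ?thesis using r q0 by (intro continuous_intros isCont_o2[of _ q v]) auto
  qed
  then have "((%t. - v (q t) / q t) \<longlongrightarrow> - v r / r) (at 0)"
  unfolding isCont_def q0 .
  then have "((%t. (U1 (0 + t) - U1 0) / t) \<longlongrightarrow> - v r / r) (at 0)"
  proof (rule Lim_transform_eventually)
  show "\<forall>\<^sub>F t in at 0. - v (q t) / q t = (U1 (0 + t) - U1 0) / t"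
  unfolding U1_eq by (auto simp: eventually_at_filter)
  qed
  then have "(U1 has_real_derivative - v r / r) (at 0)" unfolding DERIV_def .
  from DERIV_unique[OF dU1 this] show ?thesis by simp
 qed
 have sum: "v1 r + (real CARD('n) - 1) * (v r / r) = u r" if r: "r > 0" for r
 proof -
  have "u r = (LINT om|S. (\<Sum>i\<in>UNIV. om $ i * om $ i * cos (r * om $ i0)))"
  unfolding u_eq
  proof (rule Bochner_Integration.integral_cong[OF refl])
  fix om assume "om \<in> space S"
  then have "om \<bullet> om = 1" by (simp add: sp norm_eq_1)
  then have "(\<Sum>i\<in>UNIV. om $ i * om $ i) = 1" by (simp add: inner_vec_def)
  then show "cos (r * om $ i0) = (\<Sum>i\<in>UNIV. om $ i * om $ i * cos (r * om $ i0))"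
  by (simp add: sum_distrib_right[symmetric])
  qed
  also have "... = (\<Sum>i\<in>UNIV. (LINT om|S. om $ i * om $ i * cos (r * om $ i0)))"
  by (rule Bochner_Integration.integral_sum) (auto intro!: int b2)
  also have "... = v1 r + (\<Sum>i\<in>UNIV - {i0}. (LINT om|S. om $ i * om $ i * cos (r * om $ i0)))"
  by (subst sum.remove[of _ i0]) (auto simp: v1_def)
  also have "(\<Sum>i\<in>UNIV - {i0}. (LINT om|S. om $ i * om $ i * cos (r * om $ i0))) = (\<Sum>i\<in>UNIV - {i0}. v r / r)"
  by (rule sum.cong) (auto simp: other r)
  also have "... = (real CARD('n) - 1) * (v r / r)"
  using n by (simp add: card_Diff_singleton of_nat_diff)
  finally show ?thesis ..
 qed
 show ?thesis
  unfolding u_def[symmetric]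
 proof (rule bessel_equation_asymptotics[OF n, where ?u1.0="%r. - v r" and ?u2.0="%r. - v1 r"])
  show "(u has_real_derivative - v r) (at r)" for r by (rule du)
  show "((%r. - v r) has_real_derivative - v1 r) (at r)" for r by (rule DERIV_minus[OF dv])
  show "- v1 r + (real CARD('n) - 1) / r * - v r + u r = 0" if "r > 0" for r
  proof -
  have "- v1 r + (real CARD('n) - 1) / r * - v r + u r = u r - (v1 r + (real CARD('n) - 1) * (v r / r))" by simp
  then show ?thesis using sum[OF that] by simp
  qed
  show "\<bar>u r\<bar> <= measure (surf :: (real^'n) measure) (sphere 0 1)" for r
  unfolding u_def by (rule bessel_bounded)
 qed
qed

lemma continuous_bessel: "continuous_on UNIV (bessel TYPE('n::finite))"
proof -
 have "isCont (bessel TYPE('n)) r" for r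
 proof (rule DERIV_isCont)
  show "((%r. bessel TYPE('n) r) has_real_derivative (LINT om|(surf :: (real^'n) measure). - (om $ (SOME i::'n. True) * sin (r * om $ (SOME i::'n. True))))) (at r)"
  unfolding bessel_def
  proof (rule has_real_derivative_integral_finite[where K=1, OF surface_measure_finite])
  fix t and om :: "real^'n" assume om: "om \<in> space surf"
  show "\<bar>- (om $ (SOME i::'n. True) * sin (t * om $ (SOME i::'n. True)))\<bar> <= 1"
  using mult_mono[OF nth_le_1[of om "SOME i::'n. True"] abs_sin_le_one[of "t * om $ (SOME i::'n. True)"]] om by (simp add: abs_mult)
  qed (auto intro!: borel_measurable_surface_measure integrable_surface_bounded[where B=1] derivative_eq_intros)
 qed
 then show ?thesis by (simp add: continuous_at_imp_continuous_on)
qed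

lemma integral_surface_exp:
 fixes xi :: "real^'n::finite"
 shows "(LINT om|surf. exp (- \<i> * of_real (xi \<bullet> om))) = cpx (bessel TYPE('n) (norm xi))"
proof -
 have ic: "integrable surf (%om. cpx (cos (xi \<bullet> om)))"
  and isn: "integrable surf (%om. cpx (sin (xi \<bullet> om)))"
  by (auto intro!: integrable_surface_bounded[where B=1] simp: norm_of_real)
 have "(LINT om|surf. sin (xi \<bullet> om)) = (LINT om|surf. sin (xi \<bullet> (- om)))"
  by (rule integral_surface_orthogonal[symmetric, of uminus "%om. sin (xi \<bullet> om)"])
  (auto simp: orthogonal_transformation_def linear_uminus intro!: module_hom_uminus)
 then have s0: "(LINT om|surf. sin (xi \<bullet> om)) = 0" by simp
 have "(LINT om|surf. exp (- \<i> * of_real (xi \<bullet> om))) =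
  (LINT om|surf. cpx (cos (xi \<bullet> om)) - \<i> * cpx (sin (xi \<bullet> om)))"
 proof (rule Bochner_Integration.integral_cong[OF refl])
  fix om
  have "exp (- \<i> * of_real (xi \<bullet> om)) = cis (- (xi \<bullet> om))" by (simp add: cis_conv_exp)
  then show "exp (- \<i> * of_real (xi \<bullet> om)) = cpx (cos (xi \<bullet> om)) - \<i> * cpx (sin (xi \<bullet> om))"
  by (simp add: complex_eq_iff)
 qed
 also have "... = cpx (LINT om|surf. cos (xi \<bullet> om)) - \<i> * cpx (LINT om|surf. sin (xi \<bullet> om))"
  using ic isn by (subst Bochner_Integration.integral_diff) (auto)
 finally show ?thesis using s0 bessel_eq[of xi] by simp
qed

section \<open>Plancherel's inequality\<close>

lemma borel_measurable_cnj [measurable]: "cnj: borel_measurable borel"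
 by (intro borel_measurable_continuous_onI continuous_intros)

lemma norm_integral_le_nn_integral:
 fixes f :: "'w => 'c::{banach, second_countable_topology}"
 shows "enn (norm (LINT x|M. f x)) <= (nni M (%x. enn (norm (f x))))"
 by (cases "integrable M f") (simp_all add: integral_norm_bound_ennreal not_integrable_integral_eq)

lemma std_normal_fourier:
 "(LINT x|lborel. cpx (std_normal_density x) * exp (\<i> * of_real (t * x))) = cpx (exp (- t\<^sup>2 / 2))"
proof -
 have "cpx (exp (- t\<^sup>2 / 2)) = char std_normal_distribution t"
  by (simp add: char_std_normal_distribution)
 also have "... = (LINT x|lborel. std_normal_density x *\<^sub>R iexp (t * x))"
  unfolding char_def by (rule integral_density) (auto simp: normal_density_nonneg)
 finally show ?thesis by (simp add: scaleR_conv_of_real)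
qed

definition gauss_window :: "real => 'v::euclidean_space => real" where
 "gauss_window k xi = (\<Prod>b\<in>Basis. std_normal_density ((xi \<bullet> b) / k))"

definition gauss_kernel :: "real => 'v::euclidean_space => real" where
 "gauss_kernel k x = (\<Prod>b\<in>Basis. k * exp (- (k * (x \<bullet> b))\<^sup>2 / 2))"

lemma gauss_window_measurable [measurable]: "gauss_window k: borel_measurable borel"
 unfolding gauss_window_def[abs_def] by measurable

lemma gauss_kernel_measurable [measurable]: "gauss_kernel k: borel_measurable borel"
 unfolding gauss_kernel_def[abs_def] by measurable

lemma gauss_window_nonneg: "gauss_window k xi \<ge> 0"
 unfolding gauss_window_def by (intro prod_nonneg) (auto simp: normal_density_nonneg)

lemma gauss_kernel_nonneg: "k \<ge> 0 ==> gauss_kernel k xi \<ge> 0"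
 unfolding gauss_kernel_def by (intro prod_nonneg) auto

lemma nn_integral_std_normal_scale:
 assumes "k > 0"
 shows "(nni lborel (%x. enn (std_normal_density (x / k)))) = enn k"
proof -
 have "(nni lborel (%x. enn (std_normal_density x))) = 1"
  using prob_space.emeasure_space_1[OF prob_space_normal_density[OF zero_less_one, of 0]]
  by (subst (asm) emeasure_density) auto
 then show ?thesis
  using assms by (subst nn_integral_real_affine[where c=k and t=0]) auto
qed

lemma nn_integral_gauss_window:
 assumes "k > 0"
 shows "(nni (lborel :: 'v::euclidean_space measure) (%x. enn (gauss_window k x))) = enn (k ^ DIM('v))"
proof -
 have "(nni (lborel :: 'v measure) (%x. enn (gauss_window k x)))
  = (nni (lborel :: 'v measure) (%x. (\<Prod>b\<in>Basis. enn (std_normal_density ((x \<bullet> b) / k)))))"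
  unfolding gauss_window_def by (simp add: prod_ennreal normal_density_nonneg)
 also have "... = (\<Prod>b\<in>(Basis::'v set). (nni lborel (%x. enn (std_normal_density (x / k)))))"
  by (rule nn_integral_lborel_prod) auto
 finally show ?thesis
  using assms by (simp add: nn_integral_std_normal_scale ennreal_power)
qed

lemma nn_integral_gauss_kernel:
 assumes "k > 0"
 shows "(nni (lborel :: 'v::euclidean_space measure) (%x. enn (gauss_kernel k x))) = enn (sqrt (2 * pi) ^ DIM('v))"
proof -
 have eq: "k * exp (- (k * x)\<^sup>2 / 2) = k * sqrt (2 * pi) * std_normal_density (x / (1 / k))" for x
  by (simp add: std_normal_density_def mult.commute)
 have 1: "(nni lborel (%x. enn (k * exp (- (k * x)\<^sup>2 / 2)))) = enn (sqrt (2 * pi))"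
 proof -
  have "(nni lborel (%x. enn (k * exp (- (k * x)\<^sup>2 / 2))))
  = (nni lborel (%x. enn (k * sqrt (2 * pi)) * enn (std_normal_density (x / (1 / k)))))"
  unfolding eq using assms by (intro nn_integral_cong ennreal_mult) (auto simp: normal_density_nonneg)
  also have "... = enn (k * sqrt (2 * pi)) * enn (1 / k)"
  unfolding nn_integral_std_normal_scale[of "1 / k", OF divide_pos_pos[OF zero_less_one assms], symmetric]
  by (rule nn_integral_cmult) measurable
  also have "... = enn (sqrt (2 * pi))"
  using assms by (simp add: ennreal_mult[symmetric])
  finally show ?thesis .
 qed
 have "(nni (lborel :: 'v measure) (%x. enn (gauss_kernel k x)))
  = (nni (lborel :: 'v measure) (%x. (\<Prod>b\<in>Basis. enn (k * exp (- (k * (x \<bullet> b))\<^sup>2 / 2)))))"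
  unfolding gauss_kernel_def using assms by (simp add: prod_ennreal)
 also have "... = (\<Prod>b\<in>(Basis::'v set). (nni lborel (%x. enn (k * exp (- (k * x)\<^sup>2 / 2)))))"
  by (rule nn_integral_lborel_prod) auto
 finally show ?thesis unfolding 1 by (simp add: ennreal_power)
qed

lemma integral_lborel_prod_complex:
 fixes f :: "'v::euclidean_space => real => complex"
 assumes "\<And>b. b \<in> Basis ==> integrable lborel (f b)"
 shows "(LINT x|lborel. (\<Prod>b\<in>Basis. f b (x \<bullet> b))) = (\<Prod>b\<in>Basis. (LINT x|lborel. f b x))"
proof -
 have [measurable]: "f b: borel_measurable borel" if "b \<in> Basis" for b
  using assms[OF that] by auto
 interpret product_sigma_finite "%_::'v. lborel :: real measure" ..
 have L: "(lborel :: 'v measure) = distr (\<Pi>\<^sub>M b\<in>(Basis::'v set). lborel) borel (%g. \<Sum>b\<in>Basis. g b *\<^sub>R b)"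
  by (subst lborel_def) (simp add: lborel_eq_real)
 have "(LINT x|lborel. (\<Prod>b\<in>Basis. f b (x \<bullet> b)))
  = (LINT g|(\<Pi>\<^sub>M b\<in>(Basis::'v set). lborel). (\<Prod>b\<in>Basis. f b ((\<Sum>b\<in>Basis. g b *\<^sub>R b) \<bullet> b)))"
  by (subst L, rule integral_distr) measurable
 also have "... = (LINT g|(\<Pi>\<^sub>M b\<in>(Basis::'v set). lborel). (\<Prod>b\<in>Basis. f b (g b)))"
  by (intro Bochner_Integration.integral_cong prod.cong refl) simp
 also have "... = (\<Prod>b\<in>Basis. (LINT x|lborel. f b x))"
  by (rule product_integral_prod) (auto intro: assms)
 finally show ?thesis .
qed

lemma gauss_window_fourier:
 fixes x :: "'v::euclidean_space"
 assumes k: "k > 0"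
 shows "(LINT xi|lborel. cpx (gauss_window k xi) * exp (- \<i> * of_real (xi \<bullet> x))) = cpx (gauss_kernel k x)"
proof -
 define g where "g b t = cpx (std_normal_density (t / k)) * exp (- \<i> * of_real (t * (x \<bullet> b)))" for b :: 'v and t
 have g1: "(LINT t|lborel. g b t) = cpx (k * exp (- (k * (x \<bullet> b))\<^sup>2 / 2))" for b
 proof -
  have "(LINT t|lborel. g b t) = k *\<^sub>R (LINT t|lborel. g b (0 + k * t))"
  using k by (subst lborel_integral_real_affine[where c=k and t=0]) auto
  also have "(%t. g b (0 + k * t)) = (%t. cpx (std_normal_density t) * exp (\<i> * of_real ((- k * (x \<bullet> b)) * t)))"
  using k by (auto simp: g_def fun_eq_iff mult_ac)
  finally show ?thesis unfolding std_normal_fourier by (simp add: scaleR_conv_of_real)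
 qed
 have g2: "integrable lborel (g b)" for b
 proof (rule integrableI_bounded)
  show "g b: borel_measurable lborel" unfolding g_def[abs_def] by measurable
  have "(nni lborel (%x. enn (norm (g b x)))) = (nni lborel (%x. enn (std_normal_density (x / k))))"
  by (intro nn_integral_cong) (simp add: g_def norm_mult normal_density_nonneg)
  then show "(nni lborel (%x. enn (norm (g b x)))) < \<infinity>"
  using k by (simp add: nn_integral_std_normal_scale)
 qed
 have "cpx (gauss_window k xi) * exp (- \<i> * of_real (xi \<bullet> x)) = (\<Prod>b\<in>Basis. g b (xi \<bullet> b))" for xi
 proof -
  have "- \<i> * of_real (xi \<bullet> x) = (\<Sum>b\<in>Basis. - \<i> * cpx ((xi \<bullet> b) * (x \<bullet> b)))"
  by (subst euclidean_inner) (simp add: sum_distrib_left sum_negf)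
  then show ?thesis
  unfolding gauss_window_def g_def by (simp only: exp_sum finite_Basis prod.distrib of_real_prod)
 qed
 then have "(LINT xi|lborel. cpx (gauss_window k xi) * exp (- \<i> * of_real (xi \<bullet> x))) = (\<Prod>b\<in>Basis. (LINT x|lborel. g b x))"
  by (simp only: integral_lborel_prod_complex[OF g2])
 then show ?thesis unfolding g1 gauss_kernel_def by simp
qed

lemma (in pair_sigma_finite) integrable_product_bounded:
 fixes h :: "'a => complex" and c :: "'b => complex"
 assumes h: "integrable M1 h" and c: "integrable M2 c"
  and g[measurable]: "g: borel_measurable (M1 \<Otimes>\<^sub>M M2)" and gB: "\<And>p. norm (g p) <= B"
 shows "integrable (M1 \<Otimes>\<^sub>M M2) (%(x, y). h x * c y * g (x, y))"
proof (rule integrableI_bounded)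
 have [measurable]: "h: borel_measurable M1" "c: borel_measurable M2" using h c by auto
 show "(%(x, y). h x * c y * g (x, y)): borel_measurable (M1 \<Otimes>\<^sub>M M2)" by measurable
 have B: "B \<ge> 0" using gB[of undefined] by (rule order_trans[OF norm_ge_zero])
 have "(nni (M1 \<Otimes>\<^sub>M M2) (%p. enn (norm (case p of (x, y) => h x * c y * g (x, y)))))
  <= (nni (M1 \<Otimes>\<^sub>M M2) (%p. enn (norm (h (fst p))) * (enn B * enn (norm (c (snd p))))))"
 proof (rule nn_integral_mono)
  fix p
  have "norm (h (fst p)) * norm (c (snd p)) * norm (g p) <= norm (h (fst p)) * norm (c (snd p)) * B"
  using gB by (intro mult_left_mono) auto
  then show "enn (norm (case p of (x, y) => h x * c y * g (x, y))) <= enn (norm (h (fst p))) * (enn B * enn (norm (c (snd p))))"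
  using B by (simp add: split_beta norm_mult ennreal_mult[symmetric] mult_ac ennreal_leI)
 qed
 also have "... = (nni M1 (%x. (nni M2 (%y. enn (norm (h x)) * (enn B * enn (norm (c y)))))))"
  by (subst M2.nn_integral_fst[symmetric]) auto
 also have "... = (nni M1 (%x. enn (norm (h x)))) * (enn B * (nni M2 (%y. enn (norm (c y)))))"
  by (simp add: nn_integral_cmult nn_integral_multc)
 also have "... < \<infinity>"
  using h c unfolding integrable_iff_bounded by (simp add: ennreal_mult_less_top)
 finally show "(nni (M1 \<Otimes>\<^sub>M M2) (%p. enn (norm (case p of (x, y) => h x * c y * g (x, y))))) < \<infinity>" .
qed

definition fourierB :: "('v::euclidean_space => complex) => 'v => complex" where
 "fourierB h xi = (LINT x|lborel. h x * exp (- \<i> * of_real (xi \<bullet> x)))"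

lemma norm_exp_i [simp]: "norm (exp (- \<i> * cpx t)) = 1" "norm (exp (- (\<i> * cpx t))) = 1"
 "norm (exp (\<i> * cpx t)) = 1"
 by (simp_all add: norm_exp_eq_Re)

lemma fourierB_measurable [measurable]:
 assumes [measurable]: "h: borel_measurable borel"
 shows "fourierB h: borel_measurable borel"
 unfolding fourierB_def[abs_def] by measurable

lemma integrable_mult_exp:
 assumes "integrable lborel h"
 shows "integrable lborel (%x. h x * exp (- \<i> * of_real (xi \<bullet> x)))"
 by (rule Bochner_Integration.integrable_bound[OF assms]) (use assms in \<open>auto simp: norm_mult\<close>)

lemma plancherel_window:
 fixes h :: "'v::euclidean_space => complex"
 assumes h: "integrable lborel h" and k: "k > 0"
 shows "(nni lborel (%xi. enn ((norm (fourierB h xi))^2 * gauss_window k xi)))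
  <= enn (sqrt (2 * pi) ^ DIM('v)) * (nni lborel (%x. enn ((norm (h x))^2)))"
proof -
 have [measurable]: "h: borel_measurable borel" using h by auto
 define e where "e xi x = exp (- \<i> * cpx (xi \<bullet> x))" for xi x :: 'v
 have e_m [measurable]: "(%p. e (fst p) (snd p)): borel_measurable (borel \<Otimes>\<^sub>M borel)"
  unfolding e_def by measurable
 have ne: "norm (e xi x) = 1" for xi x by (simp add: e_def)
 have ce: "cnj (e xi x) = e xi (- x)" for xi x by (simp add: e_def exp_cnj)
 have ee: "e xi x * e xi y = e xi (x + y)" for xi x y
  by (simp add: e_def exp_add[symmetric] inner_add_right distrib_left)
 define F where "F = fourierB h"
 have [measurable]: "F: borel_measurable borel" unfolding F_def by measurable
 define G where "G = (gauss_window k :: 'v => real)"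
 have [measurable]: "G: borel_measurable borel" unfolding G_def by measurable
 have G0: "G xi \<ge> 0" for xi by (simp add: G_def gauss_window_nonneg)
 have iG: "integrable lborel G"
  using nn_integral_gauss_window[OF k, where 'v='v] G0
  by (intro integrableI_nonneg) (auto simp: G_def)
 define K where "K = (LINT x|lborel. norm (h x))"
 have FK: "norm (F xi) <= K" for xi
 proof -
  have "norm (F xi) <= (LINT x|lborel. norm (h x * exp (- \<i> * of_real (xi \<bullet> x))))"
  unfolding F_def fourierB_def by (rule integral_norm_bound)
  then show ?thesis by (simp add: K_def norm_mult)
 qed
 have F_eq: "F xi = (LINT x|lborel. h x * e xi x)" for xi
  unfolding F_def fourierB_def e_def ..
 have Fc: "cnj (F xi) = (LINT x|lborel. cnj (h x) * e xi (- x))" for xi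
 proof -
  have "(LINT x|lborel. cnj (h x) * e xi (- x)) = (LINT x|lborel. cnj (h x * e xi x))"
  by (simp add: ce)
  also have "... = cnj (LINT x|lborel. h x * e xi x)" by (rule Bochner_Integration.integral_cnj)
  finally show ?thesis unfolding F_eq ..
 qed
 define Gm where "Gm = (gauss_kernel k :: 'v => real)"
 have [measurable]: "Gm: borel_measurable borel" unfolding Gm_def by measurable
 have Gm0: "Gm x \<ge> 0" for x using k by (simp add: Gm_def gauss_kernel_nonneg)
 have GGm: "(LINT xi|lborel. cpx (G xi) * e xi x) = cpx (Gm x)" for x
  unfolding G_def e_def Gm_def using k by (rule gauss_window_fourier)
 have iGc: "integrable lborel (%xi. cpx (G xi))" using iG by simp
 have ihc: "integrable lborel (%x. cnj (h x))" using h by simp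
 have P: "(LINT xi|lborel. cpx (G xi) * (cnj (F xi) * e xi x)) = (LINT x'|lborel. cnj (h x') * cpx (Gm (x - x')))" for x
 proof -
  have int: "integrable (lborel \<Otimes>\<^sub>M lborel) (%(xi, x'). cpx (G xi) * cnj (h x') * e xi (x - x'))"
  using lborel_pair.integrable_product_bounded[OF iGc ihc, where g="%p. e (fst p) (x - snd p)" and B=1]
  by (simp add: ne e_def split_beta')
  have "(LINT xi|lborel. cpx (G xi) * (cnj (F xi) * e xi x))
  = (LINT xi|lborel. (LINT x'|lborel. cpx (G xi) * cnj (h x') * e xi (x - x')))"
  proof (rule Bochner_Integration.integral_cong[OF refl])
  fix xi
  have "cpx (G xi) * (cnj (F xi) * e xi x) = (cpx (G xi) * e xi x) * (LINT x'|lborel. cnj (h x') * e xi (- x'))"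
  unfolding Fc by simp
  also have "... = (LINT x'|lborel. (cpx (G xi) * e xi x) * (cnj (h x') * e xi (- x')))"
  by (rule integral_mult_right_zero[symmetric])
  also have "... = (LINT x'|lborel. cpx (G xi) * cnj (h x') * e xi (x - x'))"
  by (intro Bochner_Integration.integral_cong refl) (simp add: ee[of xi x, symmetric] diff_conv_add_uminus del: add_uminus_conv_diff)
  finally show "cpx (G xi) * (cnj (F xi) * e xi x) = (LINT x'|lborel. cpx (G xi) * cnj (h x') * e xi (x - x'))" .
  qed
  also have "... = (LINT x'|lborel. (LINT xi|lborel. cpx (G xi) * cnj (h x') * e xi (x - x')))"
  using lborel_pair.Fubini_integral[OF int] by simp
  also have "... = (LINT x'|lborel. cnj (h x') * (LINT xi|lborel. cpx (G xi) * e xi (x - x')))"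
  by (intro Bochner_Integration.integral_cong refl) (simp add: mult_ac flip: integral_mult_right_zero)
  finally show ?thesis unfolding GGm .
 qed
 have iFG: "integrable lborel (%xi. cpx (G xi) * cnj (F xi))"
 proof (rule Bochner_Integration.integrable_bound)
  show "integrable lborel (%xi. K * G xi)" using iG by simp
  show "AE xi in lborel. norm (cpx (G xi) * cnj (F xi)) <= norm (K * G xi)"
  proof (rule AE_I2)
  fix xi
  have "norm (F xi) * G xi <= \<bar>K\<bar> * G xi" using FK[of xi] G0[of xi] by (intro mult_right_mono) auto
  then show "norm (cpx (G xi) * cnj (F xi)) <= norm (K * G xi)"
  using G0[of xi] by (simp add: norm_mult abs_mult mult.commute)
  qed
 qed measurable
 have "cpx (LINT xi|lborel. (norm (F xi))^2 * G xi) = (LINT xi|lborel. (LINT x|lborel. cpx (G xi) * cnj (F xi) * h x * e xi x))"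
  unfolding integral_complex_of_real[symmetric]
 proof (rule Bochner_Integration.integral_cong[OF refl])
  fix xi
  have "cpx ((norm (F xi))^2 * G xi) = cpx (G xi) * cnj (F xi) * F xi"
  by (simp only: of_real_mult complex_norm_square) (simp add: mult_ac)
  also have "... = (LINT x|lborel. cpx (G xi) * cnj (F xi) * h x * e xi x)"
  by (subst (2) F_eq) (simp add: mult.assoc flip: integral_mult_right_zero)
  finally show "cpx ((norm (F xi))^2 * G xi) = (LINT x|lborel. cpx (G xi) * cnj (F xi) * h x * e xi x)" .
 qed
 also have "... = (LINT x|lborel. (LINT xi|lborel. cpx (G xi) * cnj (F xi) * h x * e xi x))"
 proof (rule lborel_pair.Fubini_integral[symmetric])
  show "integrable (lborel \<Otimes>\<^sub>M lborel) (%(xi, x). cpx (G xi) * cnj (F xi) * h x * e xi x)"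
  using lborel_pair.integrable_product_bounded[OF iFG h, where g="%p. e (fst p) (snd p)" and B=1]
  by (simp add: ne split_beta' e_def)
 qed
 also have "... = (LINT x|lborel. h x * (LINT x'|lborel. cnj (h x') * cpx (Gm (x - x'))))"
  unfolding P[symmetric] by (intro Bochner_Integration.integral_cong refl) (simp add: mult_ac flip: integral_mult_right_zero)
 finally have I: "cpx (LINT xi|lborel. (norm (F xi))^2 * G xi) = (LINT x|lborel. h x * (LINT x'|lborel. cnj (h x') * cpx (Gm (x - x'))))" .
 have iF2: "integrable lborel (%xi. (norm (F xi))^2 * G xi)"
 proof (rule Bochner_Integration.integrable_bound)
  show "integrable lborel (%xi. K^2 * G xi)" using iG by simp
  show "AE xi in lborel. norm ((norm (F xi))^2 * G xi) <= norm (K^2 * G xi)"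
  proof (rule AE_I2)
  fix xi
  have "(norm (F xi))^2 * G xi <= K^2 * G xi" using FK[of xi] G0[of xi] by (intro mult_right_mono power_mono) auto
  then show "norm ((norm (F xi))^2 * G xi) <= norm (K^2 * G xi)"
  using G0[of xi] by (simp add: abs_mult)
  qed
 qed measurable
 have trans: "(nni lborel (%x'. enn (Gm (x - x')))) = enn (sqrt (2 * pi) ^ DIM('v))" for x
 proof -
  have "(nni lborel (%x'. enn (Gm (x - x')))) = (nni lborel (%x'. enn (Gm (x + x'))))"
  proof -
  have "(%y. enn (Gm (x + y))): borel_measurable borel" by measurable
  from nn_integral_lborel_uminus[OF this] show ?thesis by simp
  qed
  also have "... = (nni lborel (%x'. enn (Gm x')))"
  by (rule nn_integral_lborel_translate[of "%y. enn (Gm y)"]) measurable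
  finally show ?thesis unfolding Gm_def using nn_integral_gauss_kernel[OF k, where 'v='v] by simp
 qed
 have trans': "(nni lborel (%x. enn (Gm (x - x')))) = enn (sqrt (2 * pi) ^ DIM('v))" for x'
 proof -
  have "(%y. enn (Gm y)): borel_measurable borel" by measurable
  from nn_integral_lborel_translate[OF this, of "- x'"] nn_integral_gauss_kernel[OF k, where 'v='v]
  show ?thesis unfolding Gm_def by simp
 qed
 let ?V = "enn (sqrt (2 * pi) ^ DIM('v))"
 let ?H = "\<integral>\<^sup>+x. enn ((norm (h x))^2) \<partial>lborel"
 have "(nni lborel (%xi. enn ((norm (F xi))^2 * G xi))) = enn (LINT xi|lborel. (norm (F xi))^2 * G xi)"
  using iF2 G0 by (intro nn_integral_eq_integral) auto
 also have "... <= enn (norm (cpx (LINT xi|lborel. (norm (F xi))^2 * G xi)))"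
  by (intro ennreal_leI) simp
 also have "... <= (nni lborel (%x. enn (norm (h x * (LINT x'|lborel. cnj (h x') * cpx (Gm (x - x')))))))"
  unfolding I by (rule norm_integral_le_nn_integral)
 also have "... <= (nni lborel (%x. (nni lborel (%x'. enn (norm (h x)) * enn (norm (cnj (h x') * cpx (Gm (x - x'))))))))"
 proof (rule nn_integral_mono)
  fix x
  have "enn (norm (h x * (LINT x'|lborel. cnj (h x') * cpx (Gm (x - x')))))
  <= enn (norm (h x)) * (nni lborel (%x'. enn (norm (cnj (h x') * cpx (Gm (x - x'))))))"
  unfolding norm_mult[of "h x"] ennreal_mult[OF norm_ge_zero norm_ge_zero]
  by (intro mult_left_mono norm_integral_le_nn_integral) simp
  also have "... = (nni lborel (%x'. enn (norm (h x)) * enn (norm (cnj (h x') * cpx (Gm (x - x'))))))"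
  by (rule nn_integral_cmult[symmetric]) measurable
  finally show "enn (norm (h x * (LINT x'|lborel. cnj (h x') * cpx (Gm (x - x')))))
  <= (nni lborel (%x'. enn (norm (h x)) * enn (norm (cnj (h x') * cpx (Gm (x - x'))))))" .
 qed
 also have "... <= (nni lborel (%x. (nni lborel (%x'. enn ((norm (h x))^2 / 2) * enn (Gm (x - x')) + enn ((norm (h x'))^2 / 2) * enn (Gm (x - x'))))))"
 proof (intro nn_integral_mono)
  fix x x'
  have "norm (h x) * norm (h x') <= (norm (h x))^2 / 2 + (norm (h x'))^2 / 2"
  using sum_squares_bound[of "norm (h x)" "norm (h x')"] by simp
  then have "norm (h x) * norm (h x') * Gm (x - x') <= ((norm (h x))^2 / 2 + (norm (h x'))^2 / 2) * Gm (x - x')"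
  using Gm0 by (rule mult_right_mono)
  then show "enn (norm (h x)) * enn (norm (cnj (h x') * cpx (Gm (x - x'))))
  <= enn ((norm (h x))^2 / 2) * enn (Gm (x - x')) + enn ((norm (h x'))^2 / 2) * enn (Gm (x - x'))"
  using Gm0 by (simp add: norm_mult ennreal_mult[symmetric] ennreal_plus[symmetric] algebra_simps del: ennreal_plus)
 qed
 also have "... = (nni lborel (%x. (nni lborel (%x'. enn ((norm (h x))^2 / 2) * enn (Gm (x - x'))))))
  + (nni lborel (%x. (nni lborel (%x'. enn ((norm (h x'))^2 / 2) * enn (Gm (x - x'))))))"
  by (simp add: nn_integral_add)
 also have "(nni lborel (%x. (nni lborel (%x'. enn ((norm (h x'))^2 / 2) * enn (Gm (x - x'))))))
  = (nni lborel (%x'. (nni lborel (%x. enn ((norm (h x'))^2 / 2) * enn (Gm (x - x'))))))"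
  by (rule lborel_pair.Fubini') measurable
 also have "(nni lborel (%x. (nni lborel (%x'. enn ((norm (h x))^2 / 2) * enn (Gm (x - x'))))))
  + (nni lborel (%x'. (nni lborel (%x. enn ((norm (h x'))^2 / 2) * enn (Gm (x - x'))))))
  = (nni lborel (%x. enn ((norm (h x))^2 / 2) * ?V)) + (nni lborel (%x. enn ((norm (h x))^2 / 2) * ?V))"
  by (simp add: nn_integral_cmult trans trans')
 also have "... = (nni lborel (%x. enn ((norm (h x))^2 / 2) * ?V + enn ((norm (h x))^2 / 2) * ?V))"
  by (rule nn_integral_add[symmetric]) measurable
 also have "... = (nni lborel (%x. ?V * enn ((norm (h x))^2)))"
 proof (rule nn_integral_cong)
  fix x
  have "enn ((norm (h x))^2 / 2) + enn ((norm (h x))^2 / 2) = enn ((norm (h x))^2)"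
  by (subst ennreal_plus[symmetric]) auto
  then show "enn ((norm (h x))^2 / 2) * ?V + enn ((norm (h x))^2 / 2) * ?V = ?V * enn ((norm (h x))^2)"
  by (metis distrib_right mult.commute)
 qed
 also have "... = ?V * ?H" by (rule nn_integral_cmult) measurable
 finally show ?thesis unfolding F_def G_def .
qed

lemma gauss_window_tendsto:
 "(%k. gauss_window (real (Suc k)) (xi :: 'v::euclidean_space)) \<longlonglongrightarrow> (1 / sqrt (2 * pi)) ^ DIM('v)"
proof -
 have "(%k. \<Prod>b\<in>Basis. std_normal_density ((xi \<bullet> b) / real (Suc k))) \<longlonglongrightarrow> (\<Prod>b\<in>(Basis::'v set). std_normal_density 0)"
 proof (rule tendsto_prod)
  fix b :: 'v
  have "(%k. (xi \<bullet> b) / real (Suc k)) \<longlonglongrightarrow> 0"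
  using tendsto_mult_right_zero[OF LIMSEQ_inverse_real_of_nat, of "xi \<bullet> b"] by (simp add: divide_inverse mult.commute)
  moreover have "isCont (%x. 1 / sqrt (2 * pi) * exp (- x\<^sup>2 / 2)) 0"
  by (intro continuous_intros) auto
  then have "isCont std_normal_density 0" unfolding std_normal_density_def[abs_def] .
  ultimately show "(%k. std_normal_density ((xi \<bullet> b) / real (Suc k))) \<longlonglongrightarrow> std_normal_density 0"
  by (rule isCont_tendsto_compose[rotated])
 qed
 then show ?thesis unfolding gauss_window_def by (simp add: std_normal_density_def)
qed

text \<open>Integrating the squared transform against a wide Gaussian window produces an approximate identity on the other side; the window is then removed by Fatou's lemma.\<close>

lemma plancherel_le:
 fixes h :: "'v::euclidean_space => complex"
 assumes h: "integrable lborel h"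
 shows "(nni lborel (%xi. enn ((norm (fourierB h xi))^2))) <= enn ((2 * pi) ^ DIM('v)) * (nni lborel (%x. enn ((norm (h x))^2)))"
proof -
 have [measurable]: "h: borel_measurable borel" using h by auto
 define s where "s = sqrt (2 * pi) ^ DIM('v)"
 have s0: "s > 0" by (simp add: s_def)
 have "s * s = (sqrt (2 * pi) * sqrt (2 * pi)) ^ DIM('v)"
  unfolding s_def by (rule power_mult_distrib[symmetric])
 then have ss: "s * s = (2 * pi) ^ DIM('v)" by simp
 have s1: "(1 / sqrt (2 * pi)) ^ DIM('v) = 1 / s" by (simp add: s_def power_one_over)
 let ?H = "\<integral>\<^sup>+x. enn ((norm (h x))^2) \<partial>lborel"
 let ?F = "%k xi. enn ((norm (fourierB h xi))^2 * gauss_window (real (Suc k)) xi)"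
 have lim: "liminf (%k. ?F k xi) = enn ((norm (fourierB h xi))^2 * (1 / s))" for xi
  unfolding s1[symmetric]
  by (intro lim_imp_Liminf tendsto_ennrealI tendsto_mult tendsto_const gauss_window_tendsto) simp
 have "(nni lborel (%xi. enn ((norm (fourierB h xi))^2 * (1 / s)))) <= liminf (%k. \<integral>\<^sup>+xi. ?F k xi \<partial>lborel)"
  unfolding lim[symmetric] by (rule nn_integral_liminf) measurable
 also have "... <= enn s * ?H"
 proof (rule Liminf_le)
  show "\<forall>\<^sub>F k in sequentially. (nni lborel (%xi. ?F k xi)) <= enn s * ?H"
  unfolding s_def using plancherel_window[OF h] by (intro always_eventually allI) simp
 qed simp
 finally have "enn s * (nni lborel (%xi. enn ((norm (fourierB h xi))^2 * (1 / s)))) <= enn s * (enn s * ?H)"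
  by (rule mult_left_mono) simp
 also have "enn s * (nni lborel (%xi. enn ((norm (fourierB h xi))^2 * (1 / s)))) = (nni lborel (%xi. enn ((norm (fourierB h xi))^2)))"
  using s0 by (subst nn_integral_cmult[symmetric]) (auto simp: ennreal_mult[symmetric] intro!: nn_integral_cong)
 finally show ?thesis
  using s0 by (simp add: mult.assoc[symmetric] ennreal_mult[symmetric] ss)
qed

section \<open>Radial and block-radial functions\<close>

lemma emeasure_sphere_pos:
 "0 < measure (surf :: 'v::euclidean_space measure) (sphere 0 1)"
proof -
 interpret finite_measure "surf :: 'v measure" by (rule surface_measure_finite)
 have "emeasure (surf :: 'v measure) (sphere 0 1)
  = of_nat DIM('v) * emeasure lborel {x \<in> cball 0 1 - {0::'v}. sgn x \<in> sphere 0 1}"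
  by (rule emeasure_surface_measure) auto
 also have "{x \<in> cball 0 1 - {0::'v}. sgn x \<in> sphere 0 1} = cball 0 1 - {0}"
  by (auto simp: norm_sgn)
 also have "emeasure lborel (cball 0 1 - {0::'v}) = emeasure lborel (cball (0::'v) 1)"
  by (rule emeasure_Diff_null_set) auto
 finally have e: "emeasure (surf :: 'v measure) (sphere 0 1) = of_nat DIM('v) * emeasure lborel (cball (0::'v) 1)" .
 have "measure lborel (cball (0::'v) 1) > 0" by simp
 then have "emeasure lborel (cball (0::'v) 1) ~= 0" by (auto simp: measure_def)
 with e have "emeasure (surf :: 'v measure) (sphere 0 1) ~= 0" by simp
 then show ?thesis by (simp add: emeasure_eq_measure zero_less_measure_iff)
qed

lemma nn_integral_radial_function:
 fixes f :: "real => ennreal"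
 assumes [measurable]: "f: borel_measurable borel"
 shows "(nni (lborel :: 'v::euclidean_space measure) (%x. f (norm x)))
  = enn (measure (surf :: 'v measure) (sphere 0 1)) * (nni (radial DIM('v)) (%r. f r))"
proof -
 interpret finite_measure "surf :: 'v measure" by (rule surface_measure_finite)
 have "(nni (lborel :: 'v measure) (%x. f (norm x))) = (\<integral>\<^sup>+r. \<integral>\<^sup>+om. f (norm (r *\<^sub>R om)) \<partial>(surf :: 'v measure) \<partial>radial DIM('v))"
  by (rule nn_integral_polar) measurable
 also have "... = (nni (radial DIM('v)) (%r. f r * enn (measure (surf :: 'v measure) (sphere 0 1))))"
 proof (rule nn_integral_cong_AE, rule eventually_mono[OF AE_radial_pos])
  fix r :: real assume r: "0 < r"
  have "(nni (surf :: 'v measure) (%om. f (norm (r *\<^sub>R om)))) = (nni (surf :: 'v measure) (%om. f r))"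
  using r by (intro nn_integral_cong) simp
  also have "... = f r * emeasure (surf :: 'v measure) (space surf)" by (rule nn_integral_const)
  finally show "(nni (surf :: 'v measure) (%om. f (norm (r *\<^sub>R om)))) = f r * enn (measure (surf :: 'v measure) (sphere 0 1))"
  by (simp add: emeasure_eq_measure)
 qed
 also have "... = enn (measure (surf :: 'v measure) (sphere 0 1)) * (nni (radial DIM('v)) (%r. f r))"
  by (subst nn_integral_multc) (auto simp: mult.commute)
 finally show ?thesis .
qed

lemma integrable_radial_function_iff:
 fixes f :: "real => complex"
 assumes [measurable]: "f: borel_measurable borel"
 shows "integrable (lborel :: 'v::euclidean_space measure) (%x. f (norm x)) \<longleftrightarrow> integrable (radial DIM('v)) f"
proof -
 have f': "(%r. enn (norm (f r))): borel_measurable borel" by measurable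
 show ?thesis
  unfolding integrable_iff_bounded using emeasure_sphere_pos[where 'v='v] nn_integral_radial_function[OF f', where 'v='v]
  by (auto simp: ennreal_mult_less_top)
qed

lemma fourier_radial:
 fixes f :: "real => complex" and xi :: "real^'n::finite"
 assumes [measurable]: "f: borel_measurable borel" and f: "integrable (radial CARD('n)) f"
 shows "fourierB (%x. f (norm x)) xi = (LINT r|radial CARD('n). f r * cpx (bessel TYPE('n) (r * norm xi)))"
proof -
 have i: "integrable (lborel :: (real^'n) measure) (%x. f (norm x))"
  using f integrable_radial_function_iff[of f, where 'v="real^'n"] by simp
 have "fourierB (%x. f (norm x)) xi = (\<integral>r. \<integral>om. f (norm (r *\<^sub>R om)) * exp (- \<i> * of_real (xi \<bullet> (r *\<^sub>R om))) \<partial>(surf :: (real^'n) measure) \<partial>radial CARD('n))"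
  unfolding fourierB_def using integral_polar[OF integrable_mult_exp[OF i], of xi] by simp
 also have "... = (LINT r|radial CARD('n). f r * cpx (bessel TYPE('n) (r * norm xi)))"
 proof (rule integral_cong_AE)
  have [measurable]: "bessel TYPE('n): borel_measurable borel"
  using continuous_bessel by (rule borel_measurable_continuous_onI)
  show "(%r. f r * cpx (bessel TYPE('n) (r * norm xi))): borel_measurable (radial CARD('n))" by measurable
  interpret finite_measure "surf :: (real^'n) measure" by (rule surface_measure_finite)
  have [measurable]: "(%om::real^'n. om): borel_measurable surf"
  by (rule borel_measurable_surface_measure) simp
  show "(%r. \<integral>om. f (norm (r *\<^sub>R om)) * exp (- \<i> * of_real (xi \<bullet> (r *\<^sub>R om))) \<partial>(surf :: (real^'n) measure)): borel_measurable (radial CARD('n))"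
  by measurable
  show "AE r in radial CARD('n). (LINT om|(surf :: (real^'n) measure). f (norm (r *\<^sub>R om)) * exp (- \<i> * of_real (xi \<bullet> (r *\<^sub>R om)))) = f r * cpx (bessel TYPE('n) (r * norm xi))"
  proof (rule eventually_mono[OF AE_radial_pos])
  fix r :: real assume r: "0 < r"
  have "(LINT om|(surf :: (real^'n) measure). f (norm (r *\<^sub>R om)) * exp (- \<i> * of_real (xi \<bullet> (r *\<^sub>R om))))
  = (LINT om|(surf :: (real^'n) measure). f r * exp (- \<i> * of_real ((r *\<^sub>R xi) \<bullet> om)))"
  using r by (intro Bochner_Integration.integral_cong refl) simp
  also have "... = f r * (LINT om|(surf :: (real^'n) measure). exp (- \<i> * of_real ((r *\<^sub>R xi) \<bullet> om)))"
  by (rule integral_mult_right_zero)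
  also have "... = f r * cpx (bessel TYPE('n) (r * norm xi))"
  unfolding integral_surface_exp using r by simp
  finally show "(LINT om|(surf :: (real^'n) measure). f (norm (r *\<^sub>R om)) * exp (- \<i> * of_real (xi \<bullet> (r *\<^sub>R om)))) = f r * cpx (bessel TYPE('n) (r * norm xi))" .
  qed
 qed
 finally show ?thesis .
qed

lemma hankel_plancherel_le:
 fixes f :: "real => complex"
 assumes [measurable]: "f: borel_measurable borel" and f: "integrable (radial CARD('n::finite)) f"
 shows "(nni (radial CARD('n)) (%t. enn ((norm (LINT r|radial CARD('n). f r * cpx (bessel TYPE('n) (r * t))))^2)))
  <= enn ((2 * pi) ^ CARD('n)) * (nni (radial CARD('n)) (%r. enn ((norm (f r))^2)))"
proof -
 define H where "H t = (LINT r|radial CARD('n). f r * cpx (bessel TYPE('n) (r * t)))" for t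
 interpret R: sigma_finite_measure "radial CARD('n)" by simp
 have [measurable]: "bessel TYPE('n): borel_measurable borel"
  using continuous_bessel by (rule borel_measurable_continuous_onI)
 have [measurable]: "H: borel_measurable borel" unfolding H_def[abs_def] by measurable
 have i: "integrable (lborel :: (real^'n) measure) (%x. f (norm x))"
  using f integrable_radial_function_iff[of f, where 'v="real^'n"] by simp
 let ?c = "enn (measure (surf :: (real^'n) measure) (sphere 0 1))"
 have c: "?c ~= 0" "?c ~= \<infinity>" using emeasure_sphere_pos[where 'v="real^'n"] by auto
 have 1: "(%t. enn ((norm (H t))^2)): borel_measurable borel" by measurable
 have 2: "(%t. enn ((norm (f t))^2)): borel_measurable borel" by measurable
 have "?c * (nni (radial CARD('n)) (%t. enn ((norm (H t))^2))) = (nni lborel (%xi. enn ((norm (H (norm (xi::real^'n))))^2)))"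
  using nn_integral_radial_function[OF 1, where 'v="real^'n"] by simp
 also have "... = (nni lborel (%xi. enn ((norm (fourierB (%x. f (norm x)) (xi::real^'n)))^2)))"
  by (simp add: fourier_radial[OF assms] H_def)
 also have "... <= enn ((2 * pi) ^ DIM(real^'n)) * (nni lborel (%x. enn ((norm (f (norm (x::real^'n))))^2)))"
  by (rule plancherel_le[OF i])
 also have "... = ?c * (enn ((2 * pi) ^ CARD('n)) * (nni (radial CARD('n)) (%r. enn ((norm (f r))^2))))"
  using nn_integral_radial_function[OF 2, where 'v="real^'n"] by (simp add: mult_ac)
 finally show ?thesis
  unfolding H_def using c by (simp add: ennreal_mult_le_mult_iff)
qed

definition quadrant :: "nat => nat => (real * real) measure" where
 "quadrant a b = radial a \<Otimes>\<^sub>M radial b"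

lemma sets_quadrant [measurable_cong, simp]: "sets (quadrant a b) = sets borel"
 unfolding quadrant_def borel_prod[symmetric] by (rule sets_pair_measure_cong) auto

lemma space_quadrant [simp]: "space (quadrant a b) = UNIV"
 unfolding quadrant_def by (simp add: space_pair_measure)

lemma pair_sigma_finite_radial: "pair_sigma_finite (radial a) (radial b)"
 by (intro pair_sigma_finite.intro) auto

lemma sigma_finite_quadrant: "sigma_finite_measure (quadrant a b)"
proof -
 interpret pair_sigma_finite "radial a" "radial b" by (rule pair_sigma_finite_radial)
 show ?thesis unfolding quadrant_def by unfold_locales
qed

lemma nn_integral_quadrant:
 assumes [measurable]: "f: borel_measurable (borel :: (real * real) measure)"
 shows "(nni (quadrant a b) (%p. f p)) = (nni (radial a) (%r. (nni (radial b) (%s. f (r, s)))))"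
proof -
 interpret pair_sigma_finite "radial a" "radial b" by (rule pair_sigma_finite_radial)
 have "f: borel_measurable (radial a \<Otimes>\<^sub>M radial b)"
  using assms sets_quadrant[of a b] unfolding quadrant_def by (simp cong: measurable_cong_sets)
 then show ?thesis unfolding quadrant_def by (simp add: M2.nn_integral_fst)
qed

lemma measurable_block_norm [measurable]:
 "(%x::'v::euclidean_space \<times> 'w::euclidean_space. (norm (fst x), norm (snd x))) \<in> borel \<rightarrow>\<^sub>M borel"
 by (intro borel_measurable_continuous_onI continuous_intros)

lemma nn_integral_block_radial:
 fixes G :: "real * real => ennreal"
 assumes [measurable]: "G: borel_measurable borel"
 shows "(nni (lborel :: ('v::euclidean_space \<times> 'w::euclidean_space) measure) (%x. G (norm (fst x), norm (snd x))))
  = enn (measure (surf :: 'v measure) (sphere 0 1) * measure (surf :: 'w measure) (sphere 0 1))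
  * (nni (quadrant DIM('v) DIM('w)) (%p. G p))"
proof -
 let ?A = "enn (measure (surf :: 'v measure) (sphere 0 1))"
 let ?B = "enn (measure (surf :: 'w measure) (sphere 0 1))"
 interpret R: sigma_finite_measure "radial DIM('w)" by simp
 have m1: "(%s. G (r, s)): borel_measurable borel" for r by measurable
 have m2: "(%r. \<integral>\<^sup>+s. G (r, s) \<partial>radial DIM('w)): borel_measurable borel" by measurable
 have "(nni (lborel :: ('v \<times> 'w) measure) (%x. G (norm (fst x), norm (snd x))))
  = (nni (lborel :: 'v measure) (%y. (nni (lborel :: 'w measure) (%z. G (norm y, norm z)))))"
  unfolding lborel_prod[symmetric] by (subst lborel.nn_integral_fst[symmetric]) (auto simp: lborel_prod)
 also have "... = (nni (lborel :: 'v measure) (%y. ?B * (nni (radial DIM('w)) (%s. G (norm y, s)))))"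
  by (simp add: nn_integral_radial_function[OF m1])
 also have "... = ?B * (nni (lborel :: 'v measure) (%y. (nni (radial DIM('w)) (%s. G (norm y, s)))))"
  by (rule nn_integral_cmult) measurable
 also have "... = ?B * (?A * (nni (radial DIM('v)) (%r. (nni (radial DIM('w)) (%s. G (r, s))))))"
  using nn_integral_radial_function[OF m2, where 'v='v] by simp
 finally show ?thesis by (simp add: nn_integral_quadrant ennreal_mult mult_ac)
qed

lemma fourier_block_radial:
 fixes f :: "real * real => complex" and et :: "real^'a::finite" and zt :: "real^'b::finite"
 assumes [measurable]: "f: borel_measurable borel" and f: "integrable (quadrant CARD('a) CARD('b)) f"
 shows "fourierB (%x. f (norm (fst x), norm (snd x))) (et, zt)
  = (LINT p|quadrant CARD('a) CARD('b). f p * cpx (bessel TYPE('a) (fst p * norm et) * bessel TYPE('b) (snd p * norm zt)))"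
proof -
 let ?A = "radial CARD('a)" and ?B = "radial CARD('b)"
 let ?ua = "%r. cpx (bessel TYPE('a) (r * norm et))"
 let ?ub = "%r. cpx (bessel TYPE('b) (r * norm zt))"
 interpret pair_sigma_finite ?A ?B by (rule pair_sigma_finite_radial)
 have ua_m [measurable]: "bessel TYPE('a): borel_measurable borel" and ub_m [measurable]: "bessel TYPE('b): borel_measurable borel"
  using continuous_bessel by (auto intro: borel_measurable_continuous_onI)
 have fi: "integrable (?A \<Otimes>\<^sub>M ?B) f" using f by (simp add: quadrant_def)
 have fl: "integrable (lborel :: ((real^'a) * (real^'b)) measure) (%x. f (norm (fst x), norm (snd x)))"
 proof (rule integrableI_bounded)
  have m: "(%p. enn (norm (f p))): borel_measurable borel" by measurable
  show "(nni (lborel :: ((real^'a) * (real^'b)) measure) (%x. enn (norm (f (norm (fst x), norm (snd x)))))) < \<infinity>"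
  using nn_integral_block_radial[OF m, where 'v="real^'a" and 'w="real^'b"] f
  unfolding integrable_iff_bounded by (simp add: ennreal_mult_less_top)
 qed measurable
 then have fp: "integrable ((lborel :: (real^'a) measure) \<Otimes>\<^sub>M (lborel :: (real^'b) measure)) (%(y, z). f (norm y, norm z))"
  by (simp add: lborel_prod split_beta')
 have fe: "integrable ((lborel :: (real^'a) measure) \<Otimes>\<^sub>M (lborel :: (real^'b) measure))
  (%(y, z). f (norm y, norm z) * exp (- \<i> * of_real (zt \<bullet> z)) * exp (- \<i> * of_real (et \<bullet> y)))"
  by (rule Bochner_Integration.integrable_bound[OF fp]) (auto simp: norm_mult split_beta')
 define g where "g r = (LINT s|?B. f (r, s) * ?ub s)" for r
 have [measurable]: "g: borel_measurable borel" unfolding g_def[abs_def] by measurable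
 have fub: "integrable (?A \<Otimes>\<^sub>M ?B) (%(r, s). f (r, s) * ?ub s)"
 proof (rule Bochner_Integration.integrable_bound)
  let ?K = "measure (surf :: (real^'b) measure) (sphere 0 1)"
  show "integrable (?A \<Otimes>\<^sub>M ?B) (%p. ?K *\<^sub>R f p)" using fi by simp
  show "AE p in ?A \<Otimes>\<^sub>M ?B. norm (case p of (r, s) => f (r, s) * ?ub s) <= norm (?K *\<^sub>R f p)"
  using bessel_bounded[where 'n='b]
  by (intro AE_I2) (auto simp: norm_mult split_beta' mult.commute intro!: mult_left_mono)
 qed measurable
 have gi: "integrable ?A g" using integrable_fst'[OF fub] unfolding g_def by simp
 have gl: "integrable (lborel :: (real^'a) measure) (%y. g (norm y))"
  using gi integrable_radial_function_iff[of g, where 'v="real^'a"] by simp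
 have "fourierB (%x. f (norm (fst x), norm (snd x))) (et, zt)
  = (LINT x|(lborel \<Otimes>\<^sub>M lborel). (%(y, z). f (norm y, norm z) * exp (- \<i> * of_real (zt \<bullet> z)) * exp (- \<i> * of_real (et \<bullet> y))) x)"
  unfolding fourierB_def lborel_prod
  by (intro Bochner_Integration.integral_cong refl) (auto simp: split_beta' exp_add[symmetric] algebra_simps)
 also have "... = (LINT y|lborel. (LINT z|lborel. f (norm y, norm z) * exp (- \<i> * of_real (zt \<bullet> z)) * exp (- \<i> * of_real (et \<bullet> y))))"
  using lborel_pair.integral_fst'[OF fe] by simp
 also have "... = (LINT y|lborel. g (norm y) * exp (- \<i> * of_real (et \<bullet> y)))"
 proof (rule integral_cong_AE)
  have "AE y in lborel. integrable (lborel :: (real^'b) measure) (%z. f (norm (y::real^'a), norm z))"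
  using lborel_pair.AE_integrable_fst'[OF fp] by simp
  then show "AE y in lborel. (LINT z|lborel. f (norm (y::real^'a), norm (z::real^'b)) * exp (- \<i> * of_real (zt \<bullet> z)) * exp (- \<i> * of_real (et \<bullet> y)))
  = g (norm y) * exp (- \<i> * of_real (et \<bullet> y))"
  proof (rule eventually_mono)
  fix y :: "real^'a" assume y: "integrable (lborel :: (real^'b) measure) (%z. f (norm y, norm z))"
  have m: "(%s. f (norm y, s)): borel_measurable borel" by measurable
  have "integrable ?B (%s. f (norm y, s))"
  using y integrable_radial_function_iff[OF m, where 'v="real^'b"] by simp
  from fourier_radial[OF m this, of zt]
  have "(LINT z|lborel. f (norm y, norm z) * exp (- \<i> * of_real (zt \<bullet> z))) = g (norm y)"
  by (simp add: fourierB_def g_def)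
  then show "(LINT z|lborel. f (norm y, norm (z::real^'b)) * exp (- \<i> * of_real (zt \<bullet> z)) * exp (- \<i> * of_real (et \<bullet> y)))
  = g (norm y) * exp (- \<i> * of_real (et \<bullet> y))"
  by (subst integral_mult_left_zero) simp
  qed
 qed measurable
 also have "... = (LINT r|?A. g r * ?ua r)"
  using fourier_radial[OF _ gi, of et] by (simp add: fourierB_def)
 also have "... = (LINT r|?A. (LINT s|?B. f (r, s) * ?ub s * ?ua r))"
  unfolding g_def by (simp only: integral_mult_left_zero)
 also have "... = (LINT p|(?A \<Otimes>\<^sub>M ?B). (case p of (r, s) => f (r, s) * ?ub s * ?ua r))"
 proof -
  have "integrable (?A \<Otimes>\<^sub>M ?B) (%(r, s). f (r, s) * ?ub s * ?ua r)"
  proof (rule Bochner_Integration.integrable_bound)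
  let ?K = "measure (surf :: (real^'a) measure) (sphere 0 1)"
  show "integrable (?A \<Otimes>\<^sub>M ?B) (%p. ?K *\<^sub>R (case p of (r, s) => f (r, s) * ?ub s))" using fub by simp
  show "AE p in ?A \<Otimes>\<^sub>M ?B. norm (case p of (r, s) => f (r, s) * ?ub s * ?ua r) <= norm (?K *\<^sub>R (case p of (r, s) => f (r, s) * ?ub s))"
  proof (rule AE_I2)
  fix p :: "real * real"
  have "norm (f p * ?ub (snd p)) * \<bar>bessel TYPE('a) (fst p * norm et)\<bar> <= norm (f p * ?ub (snd p)) * ?K"
  using bessel_bounded[where 'n='a] by (intro mult_left_mono) auto
  then show "norm (case p of (r, s) => f (r, s) * ?ub s * ?ua r) <= norm (?K *\<^sub>R (case p of (r, s) => f (r, s) * ?ub s))"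
  by (simp add: split_beta' norm_mult mult_ac)
  qed
  qed measurable
  from integral_fst'[OF this] show ?thesis by simp
 qed
 also have "... = (LINT p|quadrant CARD('a) CARD('b). f p * cpx (bessel TYPE('a) (fst p * norm et) * bessel TYPE('b) (snd p * norm zt)))"
  unfolding quadrant_def by (intro Bochner_Integration.integral_cong refl) (auto simp: split_beta' mult_ac)
 finally show ?thesis .
qed

text \<open>With \<open>s = r tan t\<close> the integrand depends on \<open>r\<close> only through the condition \<open>r <= cos t\<close>, and the integral in \<open>r\<close> gives the factor \<open>1 / (a + b)\<close>.\<close>

lemma quadrant_cone:
 fixes G :: "real * real => ennreal"
 assumes [measurable]: "G: borel_measurable borel" and a: "a \<ge> 1" and b: "b \<ge> 1"
 shows "(nni (radial a) (%r. (nni (radial b) (%s. indicator {(r, s). s <= r & sqrt (r^2 + s^2) <= 1} (r, s) * G (r / sqrt (r^2 + s^2), s / sqrt (r^2 + s^2))))))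
  = enn (1 / (real a + real b)) * (nni lborel (%th. G (cos th, sin th) * enn (cos th ^ (a - 1) * sin th ^ (b - 1)) * indicator {0..pi/4} th))"
proof -
 define g where "g t = G (1 / sqrt (1 + t^2), t / sqrt (1 + t^2))" for t
 have [measurable]: "g: borel_measurable borel" unfolding g_def by measurable
 let ?W = "%r t. enn (indicator {0<..} t * t ^ (b - 1)) * (indicator {..1} t * (if r <= 1 / sqrt (1 + t^2) then 1 else 0) * g t)"
 have Wm: "?W r: borel_measurable lborel" for r by measurable
 have inner: "(nni (radial b) (%s. indicator {(r, s). s <= r & sqrt (r^2 + s^2) <= 1} (r, s) * G (r / sqrt (r^2 + s^2), s / sqrt (r^2 + s^2))))
  = enn (r ^ b) * (nni lborel (%t. ?W r t))" if r: "r > 0" for r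
 proof -
  have "(nni (radial b) (%s. indicator {(r, s). s <= r & sqrt (r^2 + s^2) <= 1} (r, s) * G (r / sqrt (r^2 + s^2), s / sqrt (r^2 + s^2))))
  = (nni lborel (%s. enn (indicator {0<..} s * s ^ (b - 1)) * (indicator {(r, s). s <= r & sqrt (r^2 + s^2) <= 1} (r, s) * G (r / sqrt (r^2 + s^2), s / sqrt (r^2 + s^2)))))"
  by (rule nn_integral_radial) measurable
  also have "... = enn \<bar>r\<bar> * (nni lborel (%t. enn (indicator {0<..} (0 + r * t) * (0 + r * t) ^ (b - 1)) * (indicator {(r, s). s <= r & sqrt (r^2 + s^2) <= 1} (r, 0 + r * t) * G (r / sqrt (r^2 + (0 + r * t)^2), (0 + r * t) / sqrt (r^2 + (0 + r * t)^2)))))"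
  using r by (intro nn_integral_real_affine) auto
  also have "... = enn r * (nni lborel (%t. enn (r ^ (b - 1)) * ?W r t))"
  proof -
  have "enn (indicator {0<..} (0 + r * t) * (0 + r * t) ^ (b - 1)) * (indicator {(r, s). s <= r & sqrt (r^2 + s^2) <= 1} (r, 0 + r * t) * G (r / sqrt (r^2 + (0 + r * t)^2), (0 + r * t) / sqrt (r^2 + (0 + r * t)^2)))
  = enn (r ^ (b - 1)) * ?W r t" for t
  proof (cases "t > 0")
  case True
  have "r^2 + (r * t)^2 = r^2 * (1 + t^2)" by (simp add: power_mult_distrib distrib_left)
  then have s: "sqrt (r^2 + (r * t)^2) = r * sqrt (1 + t^2)" using r by (simp add: real_sqrt_mult)
  have p: "sqrt (1 + t^2) > 0" by (simp add: add_pos_nonneg)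
  have rt: "r * t <= r \<longleftrightarrow> t <= 1" using r by simp
  have "r * sqrt (1 + t^2) <= 1 \<longleftrightarrow> r <= 1 / sqrt (1 + t^2)" using p by (simp add: le_divide_eq)
  then have "r^2 + (r * t)^2 <= 1 \<longleftrightarrow> r <= 1 / sqrt (1 + t^2)"
  unfolding s[symmetric] by simp
  moreover have pw: "(r * t) ^ (b - 1) = r ^ (b - 1) * t ^ (b - 1)" by (rule power_mult_distrib)
  ultimately show ?thesis
  using True r p unfolding g_def
  by (simp add: s rt indicator_def ennreal_mult mult_ac)
  next
  case False
  then show ?thesis using r by (simp add: indicator_def zero_less_mult_iff)
  qed
  then show ?thesis using r by simp
  qed
  also have "(nni lborel (%t. enn (r ^ (b - 1)) * ?W r t)) = enn (r ^ (b - 1)) * (nni lborel (%t. ?W r t))"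
  by (rule nn_integral_cmult) measurable
  also have "enn r * (enn (r ^ (b - 1)) * (nni lborel (%t. ?W r t))) = (enn r * enn (r ^ (b - 1))) * (nni lborel (%t. ?W r t))"
  by (simp only: mult.assoc)
  also have "enn r * enn (r ^ (b - 1)) = enn (r ^ b)"
  using r b by (simp add: ennreal_mult[symmetric] power_Suc[symmetric] del: power_Suc)
  finally show ?thesis .
 qed
 have "(nni (radial a) (%r. (nni (radial b) (%s. indicator {(r, s). s <= r & sqrt (r^2 + s^2) <= 1} (r, s) * G (r / sqrt (r^2 + s^2), s / sqrt (r^2 + s^2))))))
  = (nni (radial a) (%r. enn (r ^ b) * (nni lborel (%t. ?W r t))))"
  by (rule nn_integral_cong_AE, rule eventually_mono[OF AE_radial_pos]) (rule inner)
 also have "... = (nni lborel (%r. enn (indicator {0<..} r * r ^ (a - 1)) * (enn (r ^ b) * (nni lborel (%t. ?W r t)))))"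
  by (rule nn_integral_radial) measurable
 also have "... = (nni lborel (%r. (nni lborel (%t. enn (indicator {0<..} r * r ^ (a + b - 1)) * ?W r t))))"
 proof (rule nn_integral_cong)
  fix r :: real
  have "a - 1 + b = a + b - 1" using a by simp
  then have "r ^ (a - 1) * r ^ b = r ^ (a + b - 1)" by (simp only: power_add[symmetric])
  then have "enn (indicator {0<..} r * r ^ (a - 1)) * (enn (r ^ b) * X) = enn (indicator {0<..} r * r ^ (a + b - 1)) * X" for X
  by (cases "r > 0") (simp_all add: indicator_def mult.assoc[symmetric] ennreal_mult[symmetric])
  then have "enn (indicator {0<..} r * r ^ (a - 1)) * (enn (r ^ b) * (nni lborel (%t. ?W r t))) = enn (indicator {0<..} r * r ^ (a + b - 1)) * (nni lborel (%t. ?W r t))" .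
  also have "... = (nni lborel (%t. enn (indicator {0<..} r * r ^ (a + b - 1)) * ?W r t))"
  by (rule nn_integral_cmult[symmetric, OF Wm])
  finally show "enn (indicator {0<..} r * r ^ (a - 1)) * (enn (r ^ b) * (nni lborel (%t. ?W r t))) = (nni lborel (%t. enn (indicator {0<..} r * r ^ (a + b - 1)) * ?W r t))"
  .
 qed
 also have "... = (nni lborel (%t. (nni lborel (%r. enn (indicator {0<..} r * r ^ (a + b - 1)) * ?W r t))))"
  by (rule lborel_pair.Fubini') measurable
 also have "... = (nni lborel (%t. enn (indicator {0<..} t * t ^ (b - 1)) * (indicator {..1} t * g t) * enn ((1 / sqrt (1 + t^2)) ^ (a + b) / (a + b))))"
 proof (rule nn_integral_cong)
  fix t :: real
  have "(nni lborel (%r. enn (indicator {0<..} r * r ^ (a + b - 1)) * ?W r t))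
  = (nni lborel (%r. enn (indicator {0<..} t * t ^ (b - 1)) * (indicator {..1} t * g t) * (enn (indicator {0<..} r * r ^ (a + b - 1)) * indicator {..1 / sqrt (1 + t^2)} r)))"
  by (intro nn_integral_cong) (auto simp: mult_ac indicator_def)
  also have "... = enn (indicator {0<..} t * t ^ (b - 1)) * (indicator {..1} t * g t) * (nni lborel (%r. enn (indicator {0<..} r * r ^ (a + b - 1)) * indicator {..1 / sqrt (1 + t^2)} r))"
  by (rule nn_integral_cmult) measurable
  also have "(nni lborel (%r. enn (indicator {0<..} r * r ^ (a + b - 1)) * indicator {..1 / sqrt (1 + t^2)} r)) = emeasure (radial (a + b)) {..1 / sqrt (1 + t^2)}"
  by (subst nn_integral_radial[symmetric]) auto
  also have "... = enn ((1 / sqrt (1 + t^2)) ^ (a + b) / (a + b))"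
  using a by (subst emeasure_radial_atMost) (auto simp: max_def)
  finally show "(nni lborel (%r. enn (indicator {0<..} r * r ^ (a + b - 1)) * ?W r t))
  = enn (indicator {0<..} t * t ^ (b - 1)) * (indicator {..1} t * g t) * enn ((1 / sqrt (1 + t^2)) ^ (a + b) / (a + b))" .
 qed
 also have "... = (nni lborel (%t. (enn (t ^ (b - 1)) * g t * enn ((1 / sqrt (1 + t^2)) ^ (a + b) / (a + b))) * indicator {tan 0..tan (pi/4)} t))"
  by (intro nn_integral_cong_AE eventually_mono[OF AE_lborel_singleton[of 0]]) (auto simp: indicator_def tan_45 mult_ac)
 also have "... = (nni lborel (%th. (enn (tan th ^ (b - 1)) * g (tan th) * enn ((1 / sqrt (1 + (tan th)^2)) ^ (a + b) / (a + b))) * enn (inverse ((cos th)^2)) * indicator {0..pi/4} th))"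
 proof (rule nn_integral_substitution_aux)
  show "(tan has_real_derivative inverse ((cos x)^2)) (at x)" if "x \<in> {0..pi/4}" for x
  proof -
  have "- (pi / 2) < x" "x < pi / 2" using that pi_gt_zero unfolding atLeastAtMost_iff by linarith+
  then show ?thesis using cos_gt_zero_pi[of x] by (intro DERIV_tan) auto
  qed
  show "continuous_on {0..pi/4} (%x. inverse ((cos x)^2))"
  proof (intro continuous_intros ballI)
  fix x :: real assume "x \<in> {0..pi/4}"
  then have "- (pi / 2) < x" "x < pi / 2" using pi_gt_zero unfolding atLeastAtMost_iff by linarith+
  then show "(cos x)^2 ~= 0" using cos_gt_zero_pi[of x] by auto
  qed
 qed auto
 also have "... = (nni lborel (%th. enn (1 / (real a + real b)) * (G (cos th, sin th) * enn (cos th ^ (a - 1) * sin th ^ (b - 1)) * indicator {0..pi/4} th)))"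
 proof (rule nn_integral_cong)
  fix th :: real
  show "(enn (tan th ^ (b - 1)) * g (tan th) * enn ((1 / sqrt (1 + (tan th)^2)) ^ (a + b) / (a + b))) * enn (inverse ((cos th)^2)) * indicator {0..pi/4} th
  = enn (1 / (real a + real b)) * (G (cos th, sin th) * enn (cos th ^ (a - 1) * sin th ^ (b - 1)) * indicator {0..pi/4} th)"
  proof (cases "th \<in> {0..pi/4}")
  case True
  have th: "- (pi / 2) < th" "th < pi / 2" "th <= pi" using True pi_gt_zero unfolding atLeastAtMost_iff by linarith+
  have c: "cos th > 0" using th by (intro cos_gt_zero_pi)
  have s: "sin th \<ge> 0" using True th by (intro sin_ge_zero) auto
  have "1 + (tan th)^2 = (1 / cos th)^2"
  using c by (simp add: tan_def field_simps power2_eq_square[symmetric])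
  then have q: "sqrt (1 + (tan th)^2) = 1 / cos th" using c by (simp add: real_sqrt_divide)
  have g: "g (tan th) = G (cos th, sin th)"
  unfolding g_def q using c by (simp add: tan_def)
  have "tan th ^ (b - 1) * (cos th ^ (a + b) / (a + b)) * inverse ((cos th)^2) = 1 / (real a + real b) * (cos th ^ (a - 1) * sin th ^ (b - 1))"
  proof -
  have "cos th ^ (a + b) = cos th ^ (b - 1) * cos th ^ (a - 1) * (cos th)^2"
  proof -
  have "a + b = (b - 1) + (a - 1) + 2" using a b by simp
  then show ?thesis by (simp only: power_add)
  qed
  then show ?thesis using c by (simp add: tan_def power_divide field_simps)
  qed
  moreover have "tan th \<ge> 0" using c s by (simp add: tan_def)
  ultimately have e: "enn (tan th ^ (b - 1)) * enn (cos th ^ (a + b) / (a + b)) * enn (inverse ((cos th)^2)) = enn (1 / (real a + real b)) * enn (cos th ^ (a - 1) * sin th ^ (b - 1))"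
  using c s by (simp add: ennreal_mult[symmetric])
  show ?thesis unfolding g q using True e by (simp add: mult_ac)
  qed simp
 qed
 also have "... = enn (1 / (real a + real b)) * (nni lborel (%th. G (cos th, sin th) * enn (cos th ^ (a - 1) * sin th ^ (b - 1)) * indicator {0..pi/4} th))"
  by (rule nn_integral_cmult) measurable
 finally show ?thesis .
qed

section \<open>Van der Corput's estimate\<close>

lemma cos_ge_half: assumes "0 <= x" "x <= pi / 3" shows "1 / 2 <= cos x"
 using cos_monotone_0_pi_le[of x "pi/3"] assms pi_gt_zero by (simp add: cos_60)

lemma sin_ge_half: assumes "0 <= x" "x <= pi / 3" shows "x / 2 <= sin x"
proof -
 have "sin 0 - 0 / 2 <= sin x - x / 2"
 proof (rule DERIV_nonneg_imp_nondecreasing[OF assms(1)])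
  fix y assume y: "0 <= y" "y <= x"
  have "((%x. sin x - x / 2) has_real_derivative cos y - 1 / 2) (at y)"
  by (auto intro!: derivative_eq_intros)
  moreover have "cos y - 1 / 2 \<ge> 0" using cos_ge_half[of y] y assms by simp
  ultimately show "\<exists>d. ((%x. sin x - x / 2) has_real_derivative d) (at y) & 0 <= d" by blast
 qed
 then show ?thesis by simp
qed

lemma abs_sin_ge_quarter: assumes "\<bar>x\<bar> <= 2 * pi / 3" shows "\<bar>x\<bar> / 4 <= \<bar>sin x\<bar>"
proof -
 have *: "y / 4 <= sin y" if "0 <= y" "y <= 2 * pi / 3" for y
 proof -
  have h: "0 <= y / 2" "y / 2 <= pi / 3" using that by auto
  have "y / 2 / 2 * (1 / 2) <= sin (y / 2) * cos (y / 2)"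
  using cos_ge_half[OF h] sin_ge_half[OF h] that by (intro mult_mono) auto
  moreover have "sin y = 2 * sin (y / 2) * cos (y / 2)" using sin_double[of "y / 2"] by simp
  ultimately show ?thesis by simp
 qed
 show ?thesis
 proof (cases "x \<ge> 0")
  case True then show ?thesis using *[of x] assms by simp
 next
  case False then show ?thesis using *[of "- x"] assms by simp
 qed
qed

lemma integral_lorentz_le:
 assumes "et > 0" "x <= y"
 shows "(nni lborel (%th. enn (et^2 / (th^2 + et^2)) * indicator {x..y} th)) <= enn (et * pi)"
proof -
 have "(nni lborel (%th. enn (et^2 / (th^2 + et^2)) * indicator {x..y} th)) = enn (et * arctan (y / et) - et * arctan (x / et))"
 proof (rule nn_integral_FTC_Icc)
  fix t
  show "((%t. et * arctan (t / et)) has_real_derivative et^2 / (t^2 + et^2)) (at t)"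
  proof -
  have "t^2 + et^2 > 0" using assms by (simp add: add_nonneg_pos)
  then show ?thesis using assms
  by (auto intro!: derivative_eq_intros simp: field_simps power2_eq_square)
  qed
 qed (use assms in auto)
 also have "... <= enn (et * pi)"
 proof (rule ennreal_leI)
  have "arctan (y / et) - arctan (x / et) <= pi"
  using arctan_ubound[of "y / et"] arctan_lbound[of "x / et"] by linarith
  then have "et * (arctan (y / et) - arctan (x / et)) <= et * pi" using assms by (intro mult_left_mono) auto
  then show "et * arctan (y / et) - et * arctan (x / et) <= et * pi" by (simp add: right_diff_distrib)
 qed
 finally show ?thesis .
qed

lemma integral_sin_lorentz_le:
 assumes et: "et > 0" and xy: "x <= y" "y - x <= pi / 4"
 shows "(nni lborel (%th. enn (et^2 / ((sin th)^2 + et^2)) * indicator {x..y} th)) <= enn (16 * pi * et)"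
proof -
 define k where "k = round ((x + y) / 2 / pi)"
 have "\<bar>of_int k - (x + y) / 2 / pi\<bar> <= 1 / 2" unfolding k_def by (rule of_int_round_abs_le)
 then have "\<bar>of_int k - (x + y) / 2 / pi\<bar> * pi <= 1 / 2 * pi" by (intro mult_right_mono) auto
 moreover have "\<bar>of_int k * pi - (x + y) / 2\<bar> = \<bar>of_int k - (x + y) / 2 / pi\<bar> * pi"
  by (simp add: abs_mult_pos left_diff_distrib)
 ultimately have "\<bar>of_int k * pi - (x + y) / 2\<bar> <= 1 / 2 * pi" by (simp only:)
 then have k: "\<bar>of_int k * pi - (x + y) / 2\<bar> <= pi / 2" by simp
 have sin_eq: "(sin (th + of_int k * pi))^2 = (sin th)^2" for th
 proof -
  have s0: "sin (of_int k * pi) = 0" using sin_npi_int[of k] by (simp only: mult.commute)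
  have "(cos (of_int k * pi))^2 = 1" using sin_cos_squared_add[of "of_int k * pi"] s0 by simp
  then show ?thesis by (simp add: sin_add s0 power_mult_distrib)
 qed
 have "(nni lborel (%th. enn (et^2 / ((sin th)^2 + et^2)) * indicator {x..y} th))
  = enn \<bar>1\<bar> * (nni lborel (%th. enn (et^2 / ((sin (of_int k * pi + 1 * th))^2 + et^2)) * indicator {x..y} (of_int k * pi + 1 * th)))"
  by (rule nn_integral_real_affine) auto
 also have "... = (nni lborel (%th. enn (et^2 / ((sin th)^2 + et^2)) * indicator {x - of_int k * pi..y - of_int k * pi} th))"
  by (auto intro!: nn_integral_cong simp: sin_eq add.commute indicator_def)
 also have "... <= (nni lborel (%th. enn ((4 * et)^2 / (th^2 + (4 * et)^2)) * indicator {x - of_int k * pi..y - of_int k * pi} th))"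
 proof (rule nn_integral_mono)
  fix th
  show "enn (et^2 / ((sin th)^2 + et^2)) * indicator {x - of_int k * pi..y - of_int k * pi} th
  <= enn ((4 * et)^2 / (th^2 + (4 * et)^2)) * indicator {x - of_int k * pi..y - of_int k * pi} th"
  proof (cases "th \<in> {x - of_int k * pi..y - of_int k * pi}")
  case True
  then have "\<bar>th\<bar> <= 2 * pi / 3" using k xy pi_gt_zero unfolding atLeastAtMost_iff abs_le_iff by argo
  then have "\<bar>th\<bar> / 4 <= \<bar>sin th\<bar>" by (rule abs_sin_ge_quarter)
  then have "(\<bar>th\<bar> / 4)^2 <= \<bar>sin th\<bar>\<^sup>2" by (rule power_mono) simp
  then have s: "th^2 / 16 <= (sin th)^2" by (simp add: power_divide)
  have "et^2 / ((sin th)^2 + et^2) <= et^2 / (th^2 / 16 + et^2)"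
  using s et by (intro divide_left_mono mult_pos_pos add_nonneg_pos add_right_mono) auto
  also have "... = (16 * et^2) / (16 * (th^2 / 16 + et^2))" by (subst mult_divide_mult_cancel_left) auto
  also have "... = (4 * et)^2 / (th^2 + (4 * et)^2)"
  by (simp add: power_mult_distrib algebra_simps)
  finally show ?thesis using True by (simp add: ennreal_leI)
  qed simp
 qed
 also have "... <= enn ((4 * et) * pi)"
  using et xy by (intro integral_lorentz_le) auto
 also have "... <= enn (16 * pi * et)" using et by (intro ennreal_leI) simp
 finally show ?thesis .
qed

text \<open>Away from the critical points of the phase one integrates by parts; the division by the derivative of the phase is regularised on a scale that balances the two errors. The exponent 1/3 is weaker than the optimal 1/2, but it suffices.\<close>

lemma van_der_corput_cos:
 assumes A: "A > 0" and xy: "x < y" "y - x <= pi / 4" and large: "(y - x)^2 * A \<ge> 1"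
 shows "norm (LINT th|lborel. cis (A * cos th) * of_real (indicator {x..y} th)) <= 60 * ((y - x) * ((y - x)^2 * A) powr (- (1 / 3)))"
proof -
 define l where "l = y - x"
 define et where "et = l * (l^2 * A) powr (- (1/3))"
 have l: "l > 0" using xy by (simp add: l_def)
 have lA: "l^2 * A \<ge> 1" using large by (simp add: l_def)
 have et: "et > 0" using l A by (simp add: et_def)
 define q where "q = (l^2 * A) powr (1/3)"
 have q1: "q \<ge> 1" unfolding q_def using lA by (simp add: ge_one_powr_ge_zero)
 have q3: "q ^ 3 = l^2 * A"
  unfolding q_def using lA by (subst powr_power) auto
 have etq: "et = l / q" by (simp only: et_def q_def powr_minus_divide times_divide_eq_right mult_1_right)
 have e1: "1 / (A * et) <= et"
 proof -
  have "A * et * et = l^2 * A / q^2" by (simp add: etq power2_eq_square)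
  also have "... = q" unfolding q3[symmetric] using q1 by (simp add: power2_eq_square power3_eq_cube)
  finally show ?thesis using q1 A et by (simp add: divide_le_eq mult.commute mult.left_commute)
 qed
 have e2: "l / (A * et^2) = et"
 proof -
  have "A * et^2 * et = l * (l^2 * A) / q ^ 3" by (simp add: etq power2_eq_square power3_eq_cube)
  also have "... = l" unfolding q3[symmetric] using q1 by simp
  finally show ?thesis using A et by (simp add: divide_eq_eq mult.commute)
 qed
 define g where "g th = sin th / ((sin th)^2 + et^2)" for th
 define g' where "g' th = cos th * (et^2 - (sin th)^2) / ((sin th)^2 + et^2)^2" for th
 have pos: "(sin th)^2 + et^2 > 0" for th using et by (simp add: add_nonneg_pos)
 have dg: "(g has_real_derivative g' th) (at th)" for th
  unfolding g_def[abs_def] g'_def using pos[of th]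
  by (auto intro!: derivative_eq_intros simp: field_simps power2_eq_square)
 have g_bd: "\<bar>g th\<bar> <= 1 / et" for th
 proof -
  have "0 <= \<bar>sin th\<bar> * et" using et by simp
  moreover have "2 * (\<bar>sin th\<bar> * et) <= (sin th)^2 + et^2"
  using sum_squares_bound[of "\<bar>sin th\<bar>" et] by (simp only: mult.assoc power2_abs)
  ultimately have "\<bar>sin th\<bar> * et <= (sin th)^2 + et^2" by linarith
  then show ?thesis unfolding g_def using pos[of th] et by (simp add: abs_divide divide_le_eq le_divide_eq)
 qed
 have g'_bd: "\<bar>g' th\<bar> <= 1 / et^2" for th
 proof -
  let ?s = "(sin th)^2" and ?D = "(sin th)^2 + et^2"
  have "\<bar>cos th\<bar> * \<bar>et^2 - ?s\<bar> <= 1 * ?D" by (intro mult_mono) (auto simp: abs_le_iff)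
  then have "\<bar>g' th\<bar> <= ?D / ?D^2" unfolding g'_def using pos[of th] by (simp add: abs_divide abs_mult divide_right_mono)
  also have "... = 1 / ?D" using pos[of th] by (simp add: power2_eq_square)
  also have "... <= 1 / et^2" using et by (intro divide_left_mono mult_pos_pos pos) auto
  finally show ?thesis .
 qed
 define e where "e th = cis (A * cos th)" for th
 define P where "P th = (\<i> / of_real A) * (e th * of_real (g th))" for th
 define P' where "P' th = (\<i> / of_real A) * (e th * of_real (g' th)) + e th * of_real (sin th * g th)" for th
 have de: "(e has_vector_derivative (- \<i> * of_real (A * sin th)) * e th) (at th)" for th
 proof -
  have "((%th. cos (A * cos th)) has_real_derivative A * sin th * sin (A * cos th)) (at th)"
  by (auto intro!: derivative_eq_intros)
  then have c: "((%th. cpx (cos (A * cos th))) has_vector_derivative cpx (A * sin th * sin (A * cos th))) (at th)"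
  by (intro has_vector_derivative_of_real) (simp add: has_real_derivative_iff_has_vector_derivative)
  have "((%th. sin (A * cos th)) has_real_derivative - (A * sin th * cos (A * cos th))) (at th)"
  by (auto intro!: derivative_eq_intros)
  then have s: "((%th. cpx (sin (A * cos th))) has_vector_derivative cpx (- (A * sin th * cos (A * cos th)))) (at th)"
  by (intro has_vector_derivative_of_real) (simp add: has_real_derivative_iff_has_vector_derivative)
  have "e = (%th. cpx (cos (A * cos th)) + \<i> * cpx (sin (A * cos th)))"
  by (auto simp: e_def fun_eq_iff complex_eq_iff)
  moreover have "(- \<i> * of_real (A * sin th)) * e th = cpx (A * sin th * sin (A * cos th)) + \<i> * cpx (- (A * sin th * cos (A * cos th)))"
  by (simp add: e_def complex_eq_iff)
  ultimately show ?thesis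
  using has_vector_derivative_add[OF c has_vector_derivative_mult_right[OF s, of "\<i>"]] by simp
 qed
 have dP: "(P has_vector_derivative P' th) (at th)" for th
 proof -
  have "((%th. cpx (g th)) has_vector_derivative cpx (g' th)) (at th)"
  using dg[of th] by (intro has_vector_derivative_of_real) (simp add: has_real_derivative_iff_has_vector_derivative)
  from has_vector_derivative_mult_right[OF has_vector_derivative_mult[OF de this], of "\<i> / of_real A"]
  show ?thesis unfolding P_def[abs_def] P'_def using A by (simp add: field_simps)
 qed
 have contg': "continuous_on UNIV g'" "continuous_on UNIV g" "continuous_on UNIV e"
  unfolding g'_def[abs_def] g_def[abs_def] e_def[abs_def] cis_conv_exp
  by (intro continuous_intros; use pos in \<open>auto simp: less_imp_neq[symmetric]\<close>)+
 have contP': "continuous_on {x..y} P'"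
  unfolding P'_def[abs_def]
  by (intro continuous_intros continuous_on_subset[OF contg'(1)] continuous_on_subset[OF contg'(2)] continuous_on_subset[OF contg'(3)]) auto
 have FTC: "(LINT th|lborel. indicator {x..y} th *\<^sub>R P' th) = P y - P x"
  using xy by (intro integral_FTC_Icc contP' has_vector_derivative_at_within[OF dP]) auto
 have int1: "integrable lborel (%th. indicator {x..y} th *\<^sub>R h th)" if "continuous_on UNIV h" for h :: "real => complex"
  using borel_integrable_atLeastAtMost'[OF continuous_on_subset[OF that subset_UNIV]] unfolding set_integrable_def by simp
 define Q where "Q th = (\<i> / of_real A) * (e th * of_real (g' th))" for th
 define R where "R th = e th * of_real (et^2 / ((sin th)^2 + et^2))" for th
 have decomp: "e th = P' th - Q th + R th" for th
 proof -
  have "sin th * g th + et^2 / ((sin th)^2 + et^2) = 1"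
  proof -
  have "sin th * g th + et^2 / ((sin th)^2 + et^2) = ((sin th)^2 + et^2) / ((sin th)^2 + et^2)"
  unfolding g_def by (simp only: add_divide_distrib power2_eq_square times_divide_eq_right)
  also have "... = 1" by (rule divide_self, rule less_imp_neq[OF pos, symmetric])
  finally show ?thesis .
  qed
  then have "e th * of_real (sin th * g th + et^2 / ((sin th)^2 + et^2)) = e th" by simp
  then show ?thesis unfolding P'_def Q_def R_def by (simp add: distrib_left)
 qed
 have contQ: "continuous_on UNIV Q" unfolding Q_def[abs_def] using contg' by (intro continuous_intros)
 have contR: "continuous_on UNIV R" unfolding R_def[abs_def]
  by (intro continuous_intros contg') (use pos in \<open>auto simp: less_imp_neq[symmetric]\<close>)
 have contP'U: "continuous_on UNIV P'" unfolding P'_def[abs_def] using contg' by (intro continuous_intros)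
 have "(LINT th|lborel. e th * of_real (indicator {x..y} th)) = (LINT th|lborel. indicator {x..y} th *\<^sub>R P' th - indicator {x..y} th *\<^sub>R Q th + indicator {x..y} th *\<^sub>R R th)"
 proof (rule Bochner_Integration.integral_cong[OF refl])
  fix th show "e th * of_real (indicator {x..y} th) = indicator {x..y} th *\<^sub>R P' th - indicator {x..y} th *\<^sub>R Q th + indicator {x..y} th *\<^sub>R R th"
  by (subst decomp) (simp add: scaleR_conv_of_real algebra_simps)
 qed
 also have "... = (P y - P x) - (LINT th|lborel. indicator {x..y} th *\<^sub>R Q th) + (LINT th|lborel. indicator {x..y} th *\<^sub>R R th)"
  using int1[OF contP'U] int1[OF contQ] int1[OF contR] by (simp add: FTC)
 finally have I: "(LINT th|lborel. e th * of_real (indicator {x..y} th)) = (P y - P x) - (LINT th|lborel. indicator {x..y} th *\<^sub>R Q th) + (LINT th|lborel. indicator {x..y} th *\<^sub>R R th)" .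
 have P_bd: "norm (P th) <= et" for th
 proof -
  have "norm (P th) = 1 / A * \<bar>g th\<bar>" unfolding P_def e_def using A by (simp add: norm_mult norm_divide)
  also have "... <= 1 / A * (1 / et)" using g_bd A by (intro mult_left_mono) auto
  finally show ?thesis using e1 by simp
 qed
 have Q_bd: "norm (LINT th|lborel. indicator {x..y} th *\<^sub>R Q th) <= et"
 proof -
  have "enn (norm (LINT th|lborel. indicator {x..y} th *\<^sub>R Q th)) <= (nni lborel (%th. enn (norm (indicator {x..y} th *\<^sub>R Q th))))"
  by (rule norm_integral_le_nn_integral)
  also have "... <= (nni lborel (%th. enn (1 / (A * et^2)) * indicator {x..y} th))"
  proof (rule nn_integral_mono)
  fix th
  have "norm (Q th) = 1 / A * \<bar>g' th\<bar>" unfolding Q_def e_def using A by (simp add: norm_mult norm_divide)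
  also have "... <= 1 / A * (1 / et^2)" using g'_bd A by (intro mult_left_mono) auto
  finally show "enn (norm (indicator {x..y} th *\<^sub>R Q th)) <= enn (1 / (A * et^2)) * indicator {x..y} th"
  by (auto simp: indicator_def intro!: ennreal_leI)
  qed
  also have "... = enn (l / (A * et^2))"
  using xy A et by (subst nn_integral_cmult_indicator) (auto simp: l_def ennreal_mult[symmetric])
  finally show ?thesis unfolding e2 using et by simp
 qed
 have R_bd: "norm (LINT th|lborel. indicator {x..y} th *\<^sub>R R th) <= 16 * pi * et"
 proof -
  have "enn (norm (LINT th|lborel. indicator {x..y} th *\<^sub>R R th)) <= (nni lborel (%th. enn (norm (indicator {x..y} th *\<^sub>R R th))))"
  by (rule norm_integral_le_nn_integral)
  also have "... = (nni lborel (%th. enn (et^2 / ((sin th)^2 + et^2)) * indicator {x..y} th))"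
  proof (rule nn_integral_cong)
  fix th
  have "norm (R th) = et^2 / ((sin th)^2 + et^2)"
  unfolding R_def e_def norm_mult norm_of_real using pos[of th] by simp
  then show "enn (norm (indicator {x..y} th *\<^sub>R R th)) = enn (et^2 / ((sin th)^2 + et^2)) * indicator {x..y} th"
  by (auto simp: indicator_def)
  qed
  also have "... <= enn (16 * pi * et)" using et xy by (intro integral_sin_lorentz_le) auto
  finally show ?thesis using et by (simp add: ennreal_le_iff)
 qed
 have "norm (LINT th|lborel. e th * of_real (indicator {x..y} th)) <= ((et + et) + et) + 16 * pi * et"
  unfolding I using P_bd Q_bd R_bd by (intro norm_triangle_le norm_triangle_le_diff add_mono) (auto intro: norm_triangle_le_diff add_mono)
 also have "... <= 60 * et"
 proof -
  have "16 * pi * et <= 16 * 3.2 * et" using et pi_approx by (intro mult_right_mono mult_left_mono) auto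
  then show ?thesis using et by simp
 qed
 finally show ?thesis unfolding e_def et_def l_def .
qed

text \<open>A linear combination \<open>P cos + Q sin\<close> is a shifted cosine of amplitude at least \<open>|P|\<close>, whatever \<open>Q\<close> is. This uniformity in \<open>Q\<close> is what makes the kernel bound independent of the variables \<open>s\<close>.\<close>

lemma van_der_corput_rotated:
 assumes L: "L > 0" and PL: "\<bar>P\<bar> \<ge> L" and xy: "x < y" "y - x <= pi / 4" and large: "(y - x)^2 * L \<ge> 1"
 shows "norm (LINT th|lborel. cis (P * cos th + Q * sin th) * of_real (indicator {x..y} th)) <= 60 * ((y - x) * ((y - x)^2 * L) powr (- (1 / 3)))"
proof -
 define A where "A = sqrt (P^2 + Q^2)"
 have AL: "A \<ge> L"
 proof -
  have "L <= \<bar>P\<bar>" by fact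
  also have "... = sqrt (P^2)" by simp
  also have "... <= A" unfolding A_def by (rule real_sqrt_le_mono) simp
  finally show ?thesis .
 qed
 then have A: "A > 0" using L by simp
 have "(P / A)^2 + (Q / A)^2 = 1"
 proof -
  have A2: "A^2 = P^2 + Q^2" unfolding A_def by simp
  show ?thesis unfolding power_divide add_divide_distrib[symmetric] A2[symmetric] using A by simp
 qed
 from sincos_total_2pi[OF this] obtain t where t: "P / A = cos t" "Q / A = sin t" .
 then have PQ: "P = A * cos t" "Q = A * sin t" using A by (auto simp: field_simps)
 have "(LINT th|lborel. cis (P * cos th + Q * sin th) * of_real (indicator {x..y} th))
  = (LINT th|lborel. cis (A * cos (th - t)) * of_real (indicator {x..y} th))"
  by (intro Bochner_Integration.integral_cong refl) (simp add: PQ cos_diff algebra_simps)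
 also have "... = \<bar>1\<bar> *\<^sub>R (LINT th|lborel. cis (A * cos ((t + 1 * th) - t)) * of_real (indicator {x..y} (t + 1 * th)))"
  by (rule lborel_integral_real_affine) simp
 also have "... = (LINT th|lborel. cis (A * cos th) * of_real (indicator {x - t..y - t} th))"
  by (auto intro!: Bochner_Integration.integral_cong simp: indicator_def)
 finally have eq: "(LINT th|lborel. cis (P * cos th + Q * sin th) * of_real (indicator {x..y} th)) = ..." .
 have mono: "(y - x)^2 * L <= (y - x)^2 * A" using AL by (intro mult_left_mono) auto
 have "norm (LINT th|lborel. cis (A * cos th) * of_real (indicator {x - t..y - t} th)) <= 60 * (((y - t) - (x - t)) * (((y - t) - (x - t))^2 * A) powr (- (1 / 3)))"
  using A xy order_trans[OF large mono] by (intro van_der_corput_cos) auto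
 also have "... = 60 * ((y - x) * ((y - x)^2 * A) powr (- (1 / 3)))" by simp
 also have "... <= 60 * ((y - x) * ((y - x)^2 * L) powr (- (1 / 3)))"
  using xy large mono by (intro mult_left_mono powr_mono2') auto
 finally show ?thesis unfolding eq .
qed

section \<open>Energies on dyadic shells\<close>

lemma AE_quadrant_pos: "AE p in quadrant a b. 0 < fst p & 0 < snd p"
proof -
 interpret pair_sigma_finite "radial a" "radial b" by (rule pair_sigma_finite_radial)
 show ?thesis
  unfolding quadrant_def
 proof (rule AE_pair_measure)
  show "{x \<in> space (radial a \<Otimes>\<^sub>M radial b). 0 < fst x & 0 < snd x} \<in> sets (radial a \<Otimes>\<^sub>M radial b)"
  by measurable
  show "AE x in radial a. AE y in radial b. 0 < fst (x, y) & 0 < snd (x, y)"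
  by (rule eventually_mono[OF AE_radial_pos], rule eventually_mono[OF AE_radial_pos]) simp
 qed
qed

lemma borel_measurable_fst_snd [measurable]:
 "fst: borel_measurable (borel :: (real * real) measure)" "snd: borel_measurable (borel :: (real * real) measure)"
 by (intro borel_measurable_continuous_onI continuous_intros)+

lemma powr_minus_cancel: "0 < x ==> x powr (- c) * \<bar>x powr c * v\<bar> = \<bar>v :: real\<bar>"
proof -
 assume x: "0 < x"
 have "x powr (- c) * x powr c = 1" using x by (simp add: powr_add[symmetric] del: powr_minus)
 then show ?thesis by (simp add: abs_mult mult.assoc[symmetric] del: powr_minus)
qed

text \<open>The kernels enter only through these properties: boundedness, decay, leading oscillation and the Hankel inequality. Interchanging the two blocks gives another instance, which covers the second half of the range of angles.\<close>

locale kernel_pair =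
 fixes a b :: nat and ua ub :: "real => real" and K Aa Ba Ab Bb :: real
 assumes a2: "2 <= a" and b2: "2 <= b" and K1: "1 <= K"
  and ua_m [measurable]: "ua: borel_measurable borel" and ub_m [measurable]: "ub: borel_measurable borel"
  and ua_bd: "\<And>r. \<bar>ua r\<bar> <= K" and ub_bd: "\<And>r. \<bar>ub r\<bar> <= K"
  and wa_bd: "\<And>r. 0 < r ==> \<bar>r powr ((real a - 1) / 2) * ua r\<bar> <= K"
  and wb_bd: "\<And>r. 0 < r ==> \<bar>r powr ((real b - 1) / 2) * ub r\<bar> <= K"
  and wa_as: "\<And>r. 0 < r ==> \<bar>r powr ((real a - 1) / 2) * ua r - (Aa * cos r + Ba * sin r)\<bar> <= K / r"
  and wb_as: "\<And>r. 0 < r ==> \<bar>r powr ((real b - 1) / 2) * ub r - (Ab * cos r + Bb * sin r)\<bar> <= K / r"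
  and AB: "\<bar>Aa\<bar> <= K" "\<bar>Ba\<bar> <= K" "\<bar>Ab\<bar> <= K" "\<bar>Bb\<bar> <= K"
  and hankel_a: "\<And>f. f: borel_measurable borel ==> integrable (radial a) f ==>
  (nni (radial a) (%t. enn ((norm (LINT r|radial a. f r * cpx (ua (r * t))))^2)))
  <= enn K * (nni (radial a) (%r. enn ((norm (f r))^2)))"
  and hankel_b: "\<And>f. f: borel_measurable borel ==> integrable (radial b) f ==>
  (nni (radial b) (%t. enn ((norm (LINT r|radial b. f r * cpx (ub (r * t))))^2)))
  <= enn K * (nni (radial b) (%r. enn ((norm (f r))^2)))"
begin

abbreviation "al \<equiv> (real a - 1) / 2"
abbreviation "be \<equiv> (real b - 1) / 2"
abbreviation "mu \<equiv> quadrant a b"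

definition T :: "(real * real => complex) => real => complex" where
 "T f th = (LINT p|mu. f p * cpx (ua (fst p * cos th) * ub (snd p * sin th)))"

definition shell :: "real => real => real" where
 "shell dt th = cos th ^ (a - 1) * sin th ^ (b - 1) * indicator {dt..2 * dt} th"

definition energy :: "(real * real => complex) => real => ennreal" where
 "energy f dt = (nni lborel (%th. enn ((norm (T f th))^2) * enn (shell dt th)))"

definition m1 :: "real => real * real => real" where
 "m1 dt p = fst p powr (- al) * (1 + dt * snd p) powr (- be)"

definition "C1 = K * 4 ^ (a + b)"

lemma C1_ge_1: "1 <= C1"
proof -
 have "1 * 1 <= K * 4 ^ (a + b)" using K1 by (intro mult_mono one_le_power) auto
 then show ?thesis by (simp add: C1_def)
qed

lemma shell_measurable [measurable]: "shell dt: borel_measurable borel"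
 unfolding shell_def[abs_def] by measurable

lemma m1_measurable [measurable]: "m1 dt: borel_measurable borel"
 unfolding m1_def[abs_def] by measurable

lemma m1_nonneg [simp]: "0 <= m1 dt p" by (simp add: m1_def)

lemma T_measurable [measurable]:
 assumes [measurable]: "f: borel_measurable borel"
 shows "T f: borel_measurable borel"
proof -
 interpret sigma_finite_measure mu by (rule sigma_finite_quadrant)
 have [measurable]: "(%p::real \<times> (real * real). fst (snd p)) \<in> borel \<Otimes>\<^sub>M mu \<rightarrow>\<^sub>M borel" "(%p::real \<times> (real * real). snd (snd p)) \<in> borel \<Otimes>\<^sub>M mu \<rightarrow>\<^sub>M borel"
  by measurable
 show ?thesis unfolding T_def[abs_def] by measurable
qed

context
 fixes dt th :: real
 assumes dt: "0 < dt" "dt <= pi / 8" and th: "th \<in> {dt..2 * dt}"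
begin

lemma shell_trig: "1 / 2 <= cos th" "cos th <= 1" "dt / 2 <= sin th" "sin th <= 2 * dt" "0 <= sin th"
proof -
 have t: "0 <= th" "th <= pi / 3" "dt <= th" "th <= 2 * dt" using dt th pi_gt_zero by auto
 show "1 / 2 <= cos th" using t by (intro cos_ge_half)
 show "cos th <= 1" by simp
 show s: "dt / 2 <= sin th" using sin_ge_half[OF t(1,2)] t by simp
 show "sin th <= 2 * dt" using sin_x_le_x[OF t(1)] t by simp
 show "0 <= sin th" using s dt by simp
qed

lemma shell_nonneg: "0 <= shell dt th"
 using shell_trig by (simp add: shell_def)

lemma shell_le: "shell dt th <= (2 * dt) ^ (b - 1)"
proof -
 have "cos th ^ (a - 1) * sin th ^ (b - 1) <= 1 * (2 * dt) ^ (b - 1)"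
  using shell_trig by (intro mult_mono power_le_one power_mono) auto
 then show ?thesis using th by (simp add: shell_def)
qed

lemma shell_ua: assumes r: "0 < r" shows "\<bar>ua (r * cos th)\<bar> <= C1 * r powr (- al)"
proof -
 have c: "0 < r * cos th" using shell_trig r by (intro mult_pos_pos) auto
 have al0: "0 <= al" using a2 by simp
 have "\<bar>ua (r * cos th)\<bar> = (r * cos th) powr (- al) * \<bar>(r * cos th) powr al * ua (r * cos th)\<bar>"
  using powr_minus_cancel[OF c] by simp
 also have "... <= (r * cos th) powr (- al) * K"
  using wa_bd[OF c] by (intro mult_left_mono) auto
 also have "... <= (r / 2) powr (- al) * K"
 proof (intro mult_right_mono powr_mono2')
  have "r * (1 / 2) <= r * cos th" using shell_trig r by (intro mult_left_mono) auto
  then show "r / 2 <= r * cos th" by simp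
 qed (use r al0 K1 in auto)
 also have "(r / 2) powr (- al) = r powr (- al) * 2 powr al"
  using r by (simp add: powr_divide powr_minus field_simps)
 also have "2 powr al <= 4 ^ (a + b)"
 proof -
  have "2 powr al <= 4 powr real (a + b)"
  proof -
  have "2 powr al <= 2 powr real (a + b)" by (intro powr_mono) auto
  also have "... <= 4 powr real (a + b)" by (intro powr_mono2) auto
  finally show ?thesis .
  qed
  then show ?thesis by (simp add: powr_realpow[symmetric])
 qed
 finally show ?thesis using K1 r unfolding C1_def by (simp add: mult_ac mult_left_mono)
qed

lemma shell_ub: assumes s: "0 < s" shows "\<bar>ub (s * sin th)\<bar> <= C1 * (1 + dt * s) powr (- be)"
proof -
 have p: "0 < dt * s" using dt s by simp
 have be0: "0 <= be" using b2 by simp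
 have four: "4 powr be <= 4 ^ (a + b)"
 proof -
  have "4 powr be <= 4 powr real (a + b)" by (intro powr_mono) auto
  then show ?thesis by (simp add: powr_realpow[symmetric])
 qed
 have main: "\<bar>ub (s * sin th)\<bar> <= K * ((1 + dt * s) / 4) powr (- be)"
 proof (cases "dt * s <= 1")
  case True
  have "1 <= ((1 + dt * s) / 4) powr (- be)"
  using True p be0 powr_mono2'[of "- be" "(1 + dt * s) / 4" 1] by simp
  then have "K * 1 <= K * ((1 + dt * s) / 4) powr (- be)" using K1 by (intro mult_left_mono) auto
  then show ?thesis using ub_bd[of "s * sin th"] by simp
 next
  case False
  have c: "0 < s * sin th" using shell_trig s dt by (intro mult_pos_pos) auto
  have "\<bar>ub (s * sin th)\<bar> = (s * sin th) powr (- be) * \<bar>(s * sin th) powr be * ub (s * sin th)\<bar>"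
  using powr_minus_cancel[OF c] by simp
  also have "... <= (s * sin th) powr (- be) * K"
  using wb_bd[OF c] by (intro mult_left_mono) auto
  also have "... <= ((1 + dt * s) / 4) powr (- be) * K"
  proof (intro mult_right_mono powr_mono2')
  have "s * (dt / 2) <= s * sin th" using shell_trig s by (intro mult_left_mono) auto
  then show "(1 + dt * s) / 4 <= s * sin th" using False by (simp add: mult.commute)
  qed (use p be0 K1 in auto)
  finally show ?thesis by (simp add: mult.commute)
 qed
 also have "((1 + dt * s) / 4) powr (- be) = (1 + dt * s) powr (- be) * 4 powr be"
  using p by (simp add: powr_divide powr_minus field_simps)
 also have "K * ((1 + dt * s) powr (- be) * 4 powr be) <= K * ((1 + dt * s) powr (- be) * 4 ^ (a + b))"
  using K1 four by (intro mult_left_mono) auto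
 finally show ?thesis unfolding C1_def by (simp add: mult_ac)
qed

end

lemma shell_outside: "th \<notin> {dt..2 * dt} ==> shell dt th = 0"
 by (simp add: shell_def)

lemma nn_integral_shell_const:
 assumes "0 < dt" "dt <= pi / 8"
 shows "(nni lborel (%th. enn (shell dt th))) <= enn (2 ^ b * dt ^ b)"
proof -
 have "(nni lborel (%th. enn (shell dt th))) <= (nni lborel (%th. enn ((2 * dt) ^ (b - 1)) * indicator {dt..2*dt} th))"
 proof (rule nn_integral_mono)
  fix th show "enn (shell dt th) <= enn ((2 * dt) ^ (b - 1)) * indicator {dt..2*dt} th"
  using shell_le[OF assms, of th] shell_outside[of th dt] by (cases "th \<in> {dt..2*dt}") (auto intro: ennreal_leI)
 qed
 also have "... = enn ((2 * dt) ^ (b - 1) * dt)"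
  using assms by (subst nn_integral_cmult_indicator) (auto simp: ennreal_mult[symmetric])
 also have "... <= enn (2 ^ b * dt ^ b)"
 proof (rule ennreal_leI)
  have "(2 * dt) ^ (b - 1) * dt <= (2 * dt) ^ (b - 1) * (2 * dt)" using assms by (intro mult_left_mono) auto
  also have "... = (2 * dt) ^ b" using b2 by (intro power_minus_mult) simp
  finally show "(2 * dt) ^ (b - 1) * dt <= 2 ^ b * dt ^ b" by (simp add: power_mult_distrib)
 qed
 finally show ?thesis .
qed

lemma energy_le_pointwise:
 assumes "\<And>th. th \<in> {dt..2*dt} ==> ennreal ((norm (T f th))^2) <= X th"
 shows "energy f dt <= (nni lborel (%th. X th * enn (shell dt th)))"
 unfolding energy_def
proof (rule nn_integral_mono)
 fix th
 show "enn ((norm (T f th))^2) * enn (shell dt th) <= X th * enn (shell dt th)"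
  using assms[of th] shell_outside[of th dt] by (cases "th \<in> {dt..2*dt}") (auto intro: mult_right_mono)
qed

text \<open>Triangle inequality only: on the shell the kernel is at most a constant times \<open>m1\<close>.\<close>

lemma energy_L1:
 assumes dt: "0 < dt" "dt <= pi / 8" and [measurable]: "f: borel_measurable borel"
 shows "energy f dt <= enn (C1 ^ 4 * 2 ^ b * dt ^ b) * (nni mu (%p. enn (norm (f p) * m1 dt p)))^2"
proof -
 let ?X = "\<integral>\<^sup>+p. enn (norm (f p) * m1 dt p) \<partial>mu"
 have C1: "0 <= C1" using C1_ge_1 by simp
 have "energy f dt <= (nni lborel (%th. (enn (C1^2) * ?X)^2 * enn (shell dt th)))"
 proof (rule energy_le_pointwise)
  fix th assume th: "th \<in> {dt..2*dt}"
  have "enn (norm (T f th)) <= (nni mu (%p. enn (norm (f p * cpx (ua (fst p * cos th) * ub (snd p * sin th))))))"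
  unfolding T_def by (rule norm_integral_le_nn_integral)
  also have "... <= (nni mu (%p. enn (C1^2) * enn (norm (f p) * m1 dt p)))"
  proof (rule nn_integral_mono_AE, rule eventually_mono[OF AE_quadrant_pos])
  fix p :: "real * real" assume p: "0 < fst p & 0 < snd p"
  have "\<bar>ua (fst p * cos th)\<bar> * \<bar>ub (snd p * sin th)\<bar> <= (C1 * fst p powr (- al)) * (C1 * (1 + dt * snd p) powr (- be))"
  using shell_ua[OF dt th, of "fst p"] shell_ub[OF dt th, of "snd p"] p C1 by (intro mult_mono) auto
  then have "norm (f p) * (\<bar>ua (fst p * cos th)\<bar> * \<bar>ub (snd p * sin th)\<bar>) <= norm (f p) * ((C1 * fst p powr (- al)) * (C1 * (1 + dt * snd p) powr (- be)))"
  by (rule mult_left_mono) simp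
  then show "enn (norm (f p * cpx (ua (fst p * cos th) * ub (snd p * sin th)))) <= enn (C1^2) * enn (norm (f p) * m1 dt p)"
  by (subst ennreal_mult[symmetric]) (auto simp: norm_mult abs_mult m1_def power2_eq_square mult_ac intro!: ennreal_leI)
  qed
  also have "... = enn (C1^2) * ?X" by (rule nn_integral_cmult) measurable
  finally have "(enn (norm (T f th)))^2 <= (enn (C1^2) * ?X)^2" by (rule power_mono) simp
  then show "enn ((norm (T f th))^2) <= (enn (C1^2) * ?X)^2" by (simp add: ennreal_power)
 qed
 also have "... = (enn (C1^2) * ?X)^2 * (nni lborel (%th. enn (shell dt th)))"
  by (rule nn_integral_cmult) measurable
 also have "... <= (enn (C1^2) * ?X)^2 * enn (2 ^ b * dt ^ b)"
  using nn_integral_shell_const[OF dt] by (rule mult_left_mono) simp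
 also have "... = enn (C1 ^ 4 * 2 ^ b * dt ^ b) * ?X^2"
 proof -
  have "(C1^2)^2 = C1 ^ 4" by simp
  then have "(enn (C1^2))^2 * enn (2 ^ b * dt ^ b) = enn (C1 ^ 4 * 2 ^ b * dt ^ b)"
  using dt C1 by (simp add: ennreal_power ennreal_mult[symmetric] mult.assoc)
  from this[symmetric] show ?thesis unfolding power_mult_distrib by (simp only: mult_ac)
 qed
 finally show ?thesis .
qed

lemma shell_substitution_sin:
 assumes dt: "0 < dt" "dt <= pi / 8" and [measurable]: "g: borel_measurable borel"
 shows "(nni lborel (%th. g (sin th) * enn (shell dt th))) <= 2 * (nni (radial b) (%t. g t))"
proof -
 have "(nni lborel (%th. g (sin th) * enn (shell dt th)))
  <= (nni lborel (%th. 2 * ((g (sin th) * enn (sin th ^ (b - 1))) * enn (cos th) * indicator {dt..2*dt} th)))"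
 proof (rule nn_integral_mono)
  fix th
  show "g (sin th) * enn (shell dt th) <= 2 * ((g (sin th) * enn (sin th ^ (b - 1))) * enn (cos th) * indicator {dt..2*dt} th)"
  proof (cases "th \<in> {dt..2*dt}")
  case True
  note tr = shell_trig[OF dt True]
  have "cos th ^ (a - 1) * sin th ^ (b - 1) <= 1 * sin th ^ (b - 1)"
  using tr by (intro mult_right_mono power_le_one) auto
  also have "... <= (2 * cos th) * sin th ^ (b - 1)" using tr by (intro mult_right_mono) auto
  finally have "g (sin th) * enn (shell dt th) <= g (sin th) * enn ((2 * cos th) * sin th ^ (b - 1))"
  using True by (intro mult_left_mono ennreal_leI) (auto simp: shell_def)
  also have "enn ((2 * cos th) * sin th ^ (b - 1)) = ennreal 2 * (enn (sin th ^ (b - 1)) * enn (cos th))"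
  proof -
  have "enn ((2 * cos th) * sin th ^ (b - 1)) = enn (2 * (sin th ^ (b - 1) * cos th))" by (simp only: mult_ac)
  also have "... = ennreal 2 * enn (sin th ^ (b - 1) * cos th)"
  using tr by (intro ennreal_mult mult_nonneg_nonneg) auto
  also have "enn (sin th ^ (b - 1) * cos th) = enn (sin th ^ (b - 1)) * enn (cos th)"
  using tr by (intro ennreal_mult) auto
  finally show ?thesis .
  qed
  also have "g (sin th) * (ennreal 2 * (enn (sin th ^ (b - 1)) * enn (cos th))) = 2 * ((g (sin th) * enn (sin th ^ (b - 1))) * enn (cos th))"
  unfolding ennreal_numeral by (simp only: mult.assoc mult.left_commute)
  finally show ?thesis using True by simp
  qed (simp add: shell_outside)
 qed
 also have "... = 2 * (nni lborel (%th. (g (sin th) * enn (sin th ^ (b - 1))) * enn (cos th) * indicator {dt..2*dt} th))"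
  by (rule nn_integral_cmult) measurable
 finally have I: "(nni lborel (%th. g (sin th) * enn (shell dt th))) <= 2 * (nni lborel (%th. (g (sin th) * enn (sin th ^ (b - 1))) * enn (cos th) * indicator {dt..2*dt} th))" .
 have "(nni lborel (%th. (g (sin th) * enn (sin th ^ (b - 1))) * enn (cos th) * indicator {dt..2*dt} th))
  = (nni lborel (%t. (g t * enn (t ^ (b - 1))) * indicator {sin dt..sin (2*dt)} t))"
 proof (rule nn_integral_substitution_aux[symmetric])
  fix x assume x: "x \<in> {dt..2*dt}"
  show "(sin has_real_derivative cos x) (at x)" by (rule DERIV_sin)
  show "0 <= cos x" using shell_trig(1)[OF dt x] by simp
 qed (use dt in \<open>auto intro!: continuous_intros\<close>)
 also have "... <= (nni lborel (%t. enn (indicator {0<..} t * t ^ (b - 1)) * g t))"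
 proof (rule nn_integral_mono)
  fix t
  have "0 < sin dt" using dt pi_gt_zero by (intro sin_gt_zero) auto
  then show "(g t * enn (t ^ (b - 1))) * indicator {sin dt..sin (2*dt)} t <= enn (indicator {0<..} t * t ^ (b - 1)) * g t"
  by (auto simp: indicator_def mult.commute)
 qed
 also have "... = (nni (radial b) (%t. g t))" by (rule nn_integral_radial[symmetric]) measurable
 finally have "(nni lborel (%th. (g (sin th) * enn (sin th ^ (b - 1))) * enn (cos th) * indicator {dt..2*dt} th)) <= (nni (radial b) (%t. g t))" .
 with I show ?thesis by (meson mult_left_mono order_trans zero_le)
qed

lemma shell_substitution_cos:
 assumes dt: "0 < dt" "dt <= pi / 8" and [measurable]: "g: borel_measurable borel"
 shows "(nni lborel (%th. g (cos th) * enn (shell dt th))) <= enn ((2 * dt) ^ (b - 1) * (2 / dt)) * (nni (radial a) (%t. g t))"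
proof -
 let ?c = "enn ((2 * dt) ^ (b - 1) * (2 / dt))"
 let ?G = "%t. g (- t) * enn ((- t) ^ (a - 1))"
 have "(nni lborel (%th. g (cos th) * enn (shell dt th)))
  <= (nni lborel (%th. ?c * (?G (- cos th) * enn (sin th) * indicator {dt..2*dt} th)))"
 proof (rule nn_integral_mono)
  fix th
  show "g (cos th) * enn (shell dt th) <= ?c * (?G (- cos th) * enn (sin th) * indicator {dt..2*dt} th)"
  proof (cases "th \<in> {dt..2*dt}")
  case True
  note tr = shell_trig[OF dt True]
  have "cos th ^ (a - 1) * (sin th ^ (b - 1) * 1) <= cos th ^ (a - 1) * ((2 * dt) ^ (b - 1) * (2 / dt * sin th))"
  using tr dt by (intro mult_left_mono mult_mono power_mono) (auto simp: field_simps)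
  then have "g (cos th) * enn (shell dt th) <= g (cos th) * enn (((2 * dt) ^ (b - 1) * (2 / dt)) * (cos th ^ (a - 1) * sin th))"
  using True by (intro mult_left_mono ennreal_leI) (auto simp: shell_def mult_ac)
  also have "enn (((2 * dt) ^ (b - 1) * (2 / dt)) * (cos th ^ (a - 1) * sin th)) = ?c * (enn (cos th ^ (a - 1)) * enn (sin th))"
  proof -
  have "enn (((2 * dt) ^ (b - 1) * (2 / dt)) * (cos th ^ (a - 1) * sin th)) = ?c * enn (cos th ^ (a - 1) * sin th)"
  using tr dt by (intro ennreal_mult mult_nonneg_nonneg) auto
  also have "enn (cos th ^ (a - 1) * sin th) = enn (cos th ^ (a - 1)) * enn (sin th)"
  using tr by (intro ennreal_mult) auto
  finally show ?thesis .
  qed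
  also have "g (cos th) * (?c * (enn (cos th ^ (a - 1)) * enn (sin th))) = ?c * ((g (cos th) * enn (cos th ^ (a - 1))) * enn (sin th))"
  by (simp only: mult.assoc mult.left_commute)
  finally show ?thesis using True by simp
  qed (simp add: shell_outside)
 qed
 also have "... = ?c * (nni lborel (%th. ?G (- cos th) * enn (sin th) * indicator {dt..2*dt} th))"
  by (rule nn_integral_cmult) measurable
 finally have I: "(nni lborel (%th. g (cos th) * enn (shell dt th))) <= ?c * (nni lborel (%th. ?G (- cos th) * enn (sin th) * indicator {dt..2*dt} th))" .
 have "(nni lborel (%th. ?G (- cos th) * enn (sin th) * indicator {dt..2*dt} th))
  = (nni lborel (%t. ?G t * indicator {- cos dt..- cos (2*dt)} t))"
 proof (rule nn_integral_substitution_aux[symmetric])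
  fix x assume x: "x \<in> {dt..2*dt}"
  show "((%x. - cos x) has_real_derivative sin x) (at x)" by (auto intro!: derivative_eq_intros)
  show "0 <= sin x" using shell_trig(5)[OF dt x] by simp
 qed (use dt in \<open>auto intro!: continuous_intros\<close>)
 also have "... = enn \<bar>-1\<bar> * (nni lborel (%t. ?G (0 + (-1) * t) * indicator {- cos dt..- cos (2*dt)} (0 + (-1) * t)))"
  by (rule nn_integral_real_affine) auto
 also have "... <= (nni lborel (%t. enn (indicator {0<..} t * t ^ (a - 1)) * g t))"
 proof -
  have "0 < cos (2 * dt)" using dt shell_trig(1)[OF dt, of "2*dt"] by auto
  then have "?G (0 + (-1) * t) * indicator {- cos dt..- cos (2*dt)} (0 + (-1) * t) <= enn (indicator {0<..} t * t ^ (a - 1)) * g t" for t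
  by (auto simp: indicator_def mult.commute)
  then show ?thesis by (simp add: nn_integral_mono)
 qed
 also have "... = (nni (radial a) (%t. g t))" by (rule nn_integral_radial[symmetric]) measurable
 finally have "(nni lborel (%th. ?G (- cos th) * enn (sin th) * indicator {dt..2*dt} th)) <= (nni (radial a) (%t. g t))" .
 with I show ?thesis by (meson mult_left_mono order_trans zero_le)
qed

end

section \<open>Mean square bounds from the Hankel transform\<close>

lemma powr_half_square: "0 < x ==> (x powr (- (c / 2)))^2 = x powr (- c)" for x c :: real
 by (simp add: power2_eq_square powr_add[symmetric] del: powr_minus)

context kernel_pair begin

definition Fa :: "(real * real => complex) => real => real => complex" where
 "Fa f s t = (LINT r|radial a. f (r, s) * cpx (ua (r * t)))"

definition Fb :: "(real * real => complex) => real => real => complex" where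
 "Fb f r t = (LINT s|radial b. f (r, s) * cpx (ub (s * t)))"

lemma Fa_measurable [measurable (raw)]:
 assumes [measurable]: "f: borel_measurable borel" "g: borel_measurable M" "h: borel_measurable M"
 shows "(%x. Fa f (g x) (h x)): borel_measurable M"
proof -
 interpret sigma_finite_measure "radial a" by simp
 have [measurable]: "(%p. Fa f (fst p) (snd p)): borel_measurable (borel \<Otimes>\<^sub>M borel)"
  unfolding Fa_def by measurable
 have "(%x. (%p. Fa f (fst p) (snd p)) (g x, h x)): borel_measurable M" by measurable
 then show ?thesis by simp
qed

lemma Fb_measurable [measurable (raw)]:
 assumes [measurable]: "f: borel_measurable borel" "g: borel_measurable M" "h: borel_measurable M"
 shows "(%x. Fb f (g x) (h x)): borel_measurable M"
proof -
 interpret sigma_finite_measure "radial b" by simp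
 have [measurable]: "(%p. Fb f (fst p) (snd p)): borel_measurable (borel \<Otimes>\<^sub>M borel)"
  unfolding Fb_def by measurable
 have "(%x. (%p. Fb f (fst p) (snd p)) (g x, h x)): borel_measurable M" by measurable
 then show ?thesis by simp
qed

lemma integrable_mult_bounded:
 fixes f g :: "real * real => complex"
 assumes f: "integrable mu f" and [measurable]: "g: borel_measurable borel" and g: "\<And>p. norm (g p) <= B"
 shows "integrable mu (%p. f p * g p)"
proof (rule Bochner_Integration.integrable_bound)
 have [measurable]: "f: borel_measurable borel" using f by auto
 show "integrable mu (%p. B *\<^sub>R f p)" using f by simp
 show "(%p. f p * g p): borel_measurable mu" by measurable
 show "AE p in mu. norm (f p * g p) <= norm (B *\<^sub>R f p)"
 proof (rule AE_I2)
  fix p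
  have "norm (f p) * norm (g p) <= norm (f p) * \<bar>B\<bar>" using g[of p] by (intro mult_left_mono) auto
  then show "norm (f p * g p) <= norm (B *\<^sub>R f p)" by (simp add: norm_mult mult.commute)
 qed
qed

lemma integral_quadrant_fst:
 fixes h :: "real * real => complex" and q :: "real => complex"
 assumes h: "integrable mu h" and [measurable]: "q: borel_measurable borel" and q: "\<And>r. norm (q r) <= B"
 shows "(LINT p|mu. h p * q (fst p)) = (LINT r|radial a. (LINT s|radial b. h (r, s)) * q r)"
proof -
 interpret pair_sigma_finite "radial a" "radial b" by (rule pair_sigma_finite_radial)
 have "integrable mu (%p. h p * q (fst p))"
  using q by (intro integrable_mult_bounded[OF h]) auto
 from integral_fst'[OF this[unfolded quadrant_def]]
 have "(LINT p|mu. h p * q (fst p)) = (LINT r|radial a. (LINT s|radial b. h (r, s) * q r))"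
  unfolding quadrant_def by simp
 then show ?thesis by (simp only: integral_mult_left_zero)
qed

definition u :: "real => real * real => real" where
 "u th p = ua (fst p * cos th) * ub (snd p * sin th)"

lemma u_measurable [measurable]: "u th: borel_measurable borel"
 unfolding u_def[abs_def] by measurable

lemma u_bd: "\<bar>u th p\<bar> <= K^2"
 unfolding u_def abs_mult power2_eq_square using ua_bd ub_bd K1 by (intro mult_mono) auto

lemma integrable_u:
 assumes f: "integrable mu f"
 shows "integrable mu (%p. f p * cpx (u th p))"
 using u_bd by (intro integrable_mult_bounded[OF f, where B="K^2"]) auto

lemma slice_b: "(LINT s|radial b. f (r, s) * cpx (u th (r, s))) = Fb f r (sin th) * cpx (ua (r * cos th))"
proof -
 have "(LINT s|radial b. f (r, s) * cpx (u th (r, s)))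
  = (LINT s|radial b. (f (r, s) * cpx (ub (s * sin th))) * cpx (ua (r * cos th)))"
  by (intro Bochner_Integration.integral_cong refl) (simp add: u_def mult_ac)
 then show ?thesis unfolding Fb_def by (simp only: integral_mult_left_zero)
qed

lemma T_eq_Fb:
 assumes f: "integrable mu f"
 shows "T f th = (LINT r|radial a. Fb f r (sin th) * cpx (ua (r * cos th)))"
 unfolding T_def u_def[symmetric] using integral_quadrant_fst[OF integrable_u[OF f, of th], of "%_. 1" 1]
 by (simp add: slice_b)

lemma T_eq_Fa:
 assumes f: "integrable mu f"
 shows "T f th = (LINT s|radial b. Fa f s (cos th) * cpx (ub (s * sin th)))"
proof -
 interpret pair_sigma_finite "radial a" "radial b" by (rule pair_sigma_finite_radial)
 have i: "integrable (radial a \<Otimes>\<^sub>M radial b) (%(r, s). f (r, s) * cpx (u th (r, s)))"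
  using integrable_u[OF f, of th] unfolding quadrant_def by (simp add: split_beta')
 have "T f th = (LINT s|radial b. (LINT r|radial a. f (r, s) * cpx (u th (r, s))))"
  unfolding T_def u_def[symmetric] integral_snd[OF i] quadrant_def by (simp add: split_beta')
 also have "... = (LINT s|radial b. (LINT r|radial a. (f (r, s) * cpx (ua (r * cos th))) * cpx (ub (s * sin th))))"
  by (intro Bochner_Integration.integral_cong refl) (simp add: u_def mult_ac)
 finally show ?thesis unfolding Fa_def by (simp only: integral_mult_left_zero)
qed

lemma hankel_slices_b:
 assumes f: "integrable mu f" and [measurable]: "om: borel_measurable borel"
 shows "(nni (radial a) (%r. om r * (nni (radial b) (%t. enn ((norm (Fb f r t))^2)))))
  <= enn K * (nni mu (%p. om (fst p) * enn ((norm (f p))^2)))"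
proof -
 interpret pair_sigma_finite "radial a" "radial b" by (rule pair_sigma_finite_radial)
 have [measurable]: "f: borel_measurable borel" using f by auto
 have "AE r in radial a. integrable (radial b) (%s. f (r, s))"
  using AE_integrable_fst'[of f] f unfolding quadrant_def by simp
 then have "(nni (radial a) (%r. om r * (nni (radial b) (%t. enn ((norm (Fb f r t))^2)))))
  <= (nni (radial a) (%r. om r * (enn K * (nni (radial b) (%s. enn ((norm (f (r, s)))^2))))))"
  unfolding Fb_def by (intro nn_integral_mono_AE, elim eventually_mono) (intro mult_left_mono hankel_b; simp)
 also have "... = (nni (radial a) (%r. enn K * (nni (radial b) (%s. om r * enn ((norm (f (r, s)))^2)))))"
  by (simp add: nn_integral_cmult mult_ac)
 also have "... = enn K * (nni (radial a) (%r. (nni (radial b) (%s. om r * enn ((norm (f (r, s)))^2)))))"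
  by (rule nn_integral_cmult) measurable
 finally show ?thesis by (simp add: nn_integral_quadrant)
qed

lemma hankel_slices_a:
 assumes f: "integrable mu f" and [measurable]: "om: borel_measurable borel"
 shows "(nni (radial b) (%s. om s * (nni (radial a) (%t. enn ((norm (Fa f s t))^2)))))
  <= enn K * (nni mu (%p. om (snd p) * enn ((norm (f p))^2)))"
proof -
 interpret pair_sigma_finite "radial a" "radial b" by (rule pair_sigma_finite_radial)
 have [measurable]: "f: borel_measurable borel" using f by auto
 have "AE s in radial b. integrable (radial a) (%r. f (r, s))"
  using AE_integrable_snd[of "%r s. f (r, s)"] f unfolding quadrant_def by simp
 then have "(nni (radial b) (%s. om s * (nni (radial a) (%t. enn ((norm (Fa f s t))^2)))))
  <= (nni (radial b) (%s. om s * (enn K * (nni (radial a) (%r. enn ((norm (f (r, s)))^2))))))"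
  unfolding Fa_def by (intro nn_integral_mono_AE, elim eventually_mono) (intro mult_left_mono hankel_a; simp)
 also have "... = (nni (radial b) (%s. enn K * (nni (radial a) (%r. om s * enn ((norm (f (r, s)))^2)))))"
  by (simp add: nn_integral_cmult mult_ac)
 also have "... = enn K * (nni (radial b) (%s. (nni (radial a) (%r. om s * enn ((norm (f (r, s)))^2)))))"
  by (rule nn_integral_cmult) measurable
 also have "(nni (radial b) (%s. (nni (radial a) (%r. om s * enn ((norm (f (r, s)))^2)))))
  = (nni (radial a) (%r. (nni (radial b) (%s. om s * enn ((norm (f (r, s)))^2)))))"
  by (rule Fubini'[of "%r s. om s * enn ((norm (f (r, s)))^2)"]) measurable
 finally show ?thesis by (simp add: nn_integral_quadrant)
qed

lemma Fb_shell:
 assumes dt: "0 < dt" "dt <= pi / 8" and f: "integrable mu f" and [measurable]: "om: borel_measurable borel"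
 shows "(nni lborel (%th. (nni (radial a) (%r. om r * enn ((norm (Fb f r (sin th)))^2))) * enn (shell dt th)))
  <= 2 * (enn K * (nni mu (%p. om (fst p) * enn ((norm (f p))^2))))"
proof -
 have [measurable]: "f: borel_measurable borel" using f by auto
 interpret pair_sigma_finite lborel "radial a" by (intro pair_sigma_finite.intro sigma_finite_lborel) auto
 interpret B: sigma_finite_measure "radial b" by simp
 have "(nni lborel (%th. (nni (radial a) (%r. om r * enn ((norm (Fb f r (sin th)))^2))) * enn (shell dt th)))
  = (nni lborel (%th. (nni (radial a) (%r. om r * enn ((norm (Fb f r (sin th)))^2) * enn (shell dt th)))))"
  by (simp add: nn_integral_multc)
 also have "... = (nni (radial a) (%r. (nni lborel (%th. om r * enn ((norm (Fb f r (sin th)))^2) * enn (shell dt th)))))"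
  by (rule Fubini'[symmetric]) measurable
 also have "... = (nni (radial a) (%r. om r * (nni lborel (%th. enn ((norm (Fb f r (sin th)))^2) * enn (shell dt th)))))"
  by (simp add: nn_integral_cmult mult.assoc)
 also have "... <= (nni (radial a) (%r. 2 * (om r * (nni (radial b) (%t. enn ((norm (Fb f r t))^2))))))"
 proof (rule nn_integral_mono)
  fix r
  have m: "(%t. enn ((norm (Fb f r t))^2)): borel_measurable borel" by measurable
  have "om r * (nni lborel (%th. enn ((norm (Fb f r (sin th)))^2) * enn (shell dt th)))
  <= om r * (2 * (nni (radial b) (%t. enn ((norm (Fb f r t))^2))))"
  using shell_substitution_sin[OF dt m] by (rule mult_left_mono) simp
  then show "om r * (nni lborel (%th. enn ((norm (Fb f r (sin th)))^2) * enn (shell dt th)))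
  <= 2 * (om r * (nni (radial b) (%t. enn ((norm (Fb f r t))^2))))"
  by (simp only: mult.left_commute)
 qed
 also have "... = 2 * (nni (radial a) (%r. om r * (nni (radial b) (%t. enn ((norm (Fb f r t))^2)))))"
  by (rule nn_integral_cmult) measurable
 also have "... <= 2 * (enn K * (nni mu (%p. om (fst p) * enn ((norm (f p))^2))))"
  using hankel_slices_b[OF f, of om] by (intro mult_left_mono) auto
 finally show ?thesis .
qed

lemma Fa_shell:
 assumes dt: "0 < dt" "dt <= pi / 8" and f: "integrable mu f" and [measurable]: "om: borel_measurable borel"
 shows "(nni lborel (%th. (nni (radial b) (%s. om s * enn ((norm (Fa f s (cos th)))^2))) * enn (shell dt th)))
  <= enn ((2 * dt) ^ (b - 1) * (2 / dt)) * (enn K * (nni mu (%p. om (snd p) * enn ((norm (f p))^2))))"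
proof -
 let ?c = "enn ((2 * dt) ^ (b - 1) * (2 / dt))"
 have [measurable]: "f: borel_measurable borel" using f by auto
 interpret pair_sigma_finite lborel "radial b" by (intro pair_sigma_finite.intro sigma_finite_lborel) auto
 interpret A: sigma_finite_measure "radial a" by simp
 have "(nni lborel (%th. (nni (radial b) (%s. om s * enn ((norm (Fa f s (cos th)))^2))) * enn (shell dt th)))
  = (nni lborel (%th. (nni (radial b) (%s. om s * enn ((norm (Fa f s (cos th)))^2) * enn (shell dt th)))))"
  by (simp add: nn_integral_multc)
 also have "... = (nni (radial b) (%s. (nni lborel (%th. om s * enn ((norm (Fa f s (cos th)))^2) * enn (shell dt th)))))"
  by (rule Fubini'[symmetric]) measurable
 also have "... = (nni (radial b) (%s. om s * (nni lborel (%th. enn ((norm (Fa f s (cos th)))^2) * enn (shell dt th)))))"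
  by (simp add: nn_integral_cmult mult.assoc)
 also have "... <= (nni (radial b) (%s. ?c * (om s * (nni (radial a) (%t. enn ((norm (Fa f s t))^2))))))"
 proof (rule nn_integral_mono)
  fix s
  have m: "(%t. enn ((norm (Fa f s t))^2)): borel_measurable borel" by measurable
  have "om s * (nni lborel (%th. enn ((norm (Fa f s (cos th)))^2) * enn (shell dt th)))
  <= om s * (?c * (nni (radial a) (%t. enn ((norm (Fa f s t))^2))))"
  using shell_substitution_cos[OF dt m] by (rule mult_left_mono) simp
  then show "om s * (nni lborel (%th. enn ((norm (Fa f s (cos th)))^2) * enn (shell dt th)))
  <= ?c * (om s * (nni (radial a) (%t. enn ((norm (Fa f s t))^2))))"
  by (simp only: mult.left_commute)
 qed
 also have "... = ?c * (nni (radial b) (%s. om s * (nni (radial a) (%t. enn ((norm (Fa f s t))^2)))))"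
  by (rule nn_integral_cmult) measurable
 also have "... <= ?c * (enn K * (nni mu (%p. om (snd p) * enn ((norm (f p))^2))))"
  using hankel_slices_a[OF f, of om] by (intro mult_left_mono) auto
 finally show ?thesis .
qed

text \<open>Cauchy-Schwarz in \<open>\<rho>\<close> against an integrable weight reduces the transform to Hankel transforms in \<open>s\<close> on the slices; substituting \<open>sin t\<close> for the angle makes the Hankel inequality applicable.\<close>

lemma energy_L2_rho:
 assumes dt: "0 < dt" "dt <= pi / 8" and f: "integrable mu f" and [measurable]: "om: borel_measurable borel"
  and om: "\<And>r. 0 < r ==> 0 < om r"
  and W: "(nni lborel (%r. enn (indicator {0<..} r / om r))) <= enn W" "0 <= W"
 shows "energy f dt <= enn (C1^2 * W * (2 * K)) * (nni mu (%p. enn (om (fst p) * (norm (f p))^2)))"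
proof -
 have [measurable]: "f: borel_measurable borel" using f by auto
 let ?Y = "%th. \<integral>\<^sup>+r. enn (om r) * enn ((norm (Fb f r (sin th)))^2) \<partial>radial a"
 have C1: "0 <= C1" using C1_ge_1 by simp
 interpret A: sigma_finite_measure "radial a" by simp
 have "energy f dt <= (nni lborel (%th. (enn (C1^2 * W) * ?Y th) * enn (shell dt th)))"
 proof (rule energy_le_pointwise)
  fix th assume th: "th \<in> {dt..2*dt}"
  let ?f = "%r. enn (norm (Fb f r (sin th)) * sqrt (om r))" and ?g = "%r. enn (\<bar>ua (r * cos th)\<bar> / sqrt (om r))"
  have "enn (norm (T f th)) <= (nni (radial a) (%r. enn (norm (Fb f r (sin th) * cpx (ua (r * cos th))))))"
  unfolding T_eq_Fb[OF f] by (rule norm_integral_le_nn_integral)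
  also have "... = (nni (radial a) (%r. ?f r * ?g r))"
  by (rule nn_integral_cong_AE, rule eventually_mono[OF AE_radial_pos])
  (use om in \<open>auto simp: norm_mult ennreal_mult'[symmetric] less_imp_neq[symmetric] less_imp_le\<close>)
  finally have "(enn (norm (T f th)))^2 <= (nni (radial a) (%r. ?f r * ?g r))^2" by (rule power_mono) simp
  also have "... <= (nni (radial a) (%r. (?f r)^2)) * (nni (radial a) (%r. (?g r)^2))"
  by (rule Cauchy_Schwarz_nn_integral) measurable
  also have "(nni (radial a) (%r. (?f r)^2)) = ?Y th"
  by (rule nn_integral_cong_AE, rule eventually_mono[OF AE_radial_pos])
  (use om in \<open>auto simp: ennreal_power power_mult_distrib ennreal_mult'[symmetric] less_imp_le mult.commute\<close>)
  also have "(nni (radial a) (%r. (?g r)^2)) <= enn (C1^2 * W)"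
  proof -
  have "(nni (radial a) (%r. (?g r)^2)) = (nni lborel (%r. enn (indicator {0<..} r * r ^ (a - 1)) * (?g r)^2))"
  by (rule nn_integral_radial) measurable
  also have "... <= (nni lborel (%r. enn (C1^2) * enn (indicator {0<..} r / om r)))"
  proof (rule nn_integral_mono)
  fix r :: real
  show "enn (indicator {0<..} r * r ^ (a - 1)) * (?g r)^2 <= enn (C1^2) * enn (indicator {0<..} r / om r)"
  proof (cases "0 < r")
  case True
  have "\<bar>ua (r * cos th)\<bar>\<^sup>2 <= (C1 * r powr (- al))^2"
  using shell_ua[OF dt th True] by (rule power_mono) simp
  also have "... = C1^2 * r powr (- (real a - 1))"
  using True by (simp only: power_mult_distrib powr_half_square)
  finally have "r ^ (a - 1) * \<bar>ua (r * cos th)\<bar>\<^sup>2 <= r ^ (a - 1) * (C1^2 * r powr (- (real a - 1)))"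
  using True by (intro mult_left_mono) auto
  also have "r ^ (a - 1) = r powr (real a - 1)"
  using True a2 by (simp add: powr_realpow[symmetric] of_nat_diff)
  also have "r powr (real a - 1) * (C1^2 * r powr (- (real a - 1))) = C1^2"
  using True by (simp add: mult.left_commute powr_add[symmetric] del: powr_minus)
  finally have "r ^ (a - 1) * \<bar>ua (r * cos th)\<bar>\<^sup>2 / om r <= C1^2 / om r"
  using om[OF True] True a2 by (intro divide_right_mono) (auto simp: powr_realpow[symmetric] of_nat_diff)
  then show ?thesis
  using True om[OF True] by (simp add: ennreal_power power_divide ennreal_mult'[symmetric] ennreal_leI)
  qed simp
  qed
  also have "... = enn (C1^2) * (nni lborel (%r. enn (indicator {0<..} r / om r)))"
  by (rule nn_integral_cmult) measurable
  also have "... <= enn (C1^2) * enn W" using W(1) by (rule mult_left_mono) simp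
  finally show ?thesis using W(2) by (simp add: ennreal_mult)
  qed
  finally have "(enn (norm (T f th)))^2 <= ?Y th * enn (C1^2 * W)" by (simp add: mult_left_mono)
  then show "enn ((norm (T f th))^2) <= enn (C1^2 * W) * ?Y th" by (simp add: ennreal_power mult.commute)
 qed
 also have "... = enn (C1^2 * W) * (nni lborel (%th. ?Y th * enn (shell dt th)))"
  unfolding mult.assoc by (rule nn_integral_cmult) measurable
 also have "... <= enn (C1^2 * W) * (2 * (enn K * (nni mu (%p. enn (om (fst p)) * enn ((norm (f p))^2)))))"
  by (intro mult_left_mono Fb_shell[OF dt f]) auto
 also have "(nni mu (%p. enn (om (fst p)) * enn ((norm (f p))^2))) = (nni mu (%p. enn (om (fst p) * (norm (f p))^2)))"
  by (rule nn_integral_cong_AE, rule eventually_mono[OF AE_quadrant_pos]) (use om in \<open>auto simp: ennreal_mult'[symmetric] less_imp_le\<close>)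
 also have "enn (C1^2 * W) * (2 * (enn K * X)) = enn (C1^2 * W * (2 * K)) * X" for X
 proof -
  have "enn (C1^2 * W * (2 * K)) = enn (C1^2 * W) * (ennreal 2 * enn K)"
  using W(2) K1 by (subst ennreal_mult[symmetric], simp, simp, subst ennreal_mult[symmetric]) auto
  then show ?thesis by (simp add: mult.assoc)
 qed
 finally show ?thesis .
qed

text \<open>The same with the roles of the variables exchanged. The substitution is now \<open>cos t\<close>, whose derivative is only of size \<open>\<delta>\<close> on the shell; this causes the loss of \<open>1 / \<delta>\<close>.\<close>

lemma energy_L2_s:
 assumes dt: "0 < dt" "dt <= pi / 8" and f: "integrable mu f" and [measurable]: "om: borel_measurable borel"
  and om: "\<And>r. 0 < r ==> 0 < om r"
  and W: "(nni lborel (%r. enn (indicator {0<..} r / om r))) <= enn W" "0 <= W"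
 shows "energy f dt <= enn (C1^2 * W * (2 ^ b * K / dt)) * (nni mu (%p. enn (om (snd p) * (norm (f p))^2)))"
proof -
 have [measurable]: "f: borel_measurable borel" using f by auto
 let ?Y = "%th. \<integral>\<^sup>+s. enn (om s) * enn ((norm (Fa f s (cos th)))^2) \<partial>radial b"
 let ?D = "C1^2 / dt ^ (b - 1) * W"
 have C1: "0 <= C1" using C1_ge_1 by simp
 have D0: "0 <= ?D" using W dt by simp
 interpret B: sigma_finite_measure "radial b" by simp
 have "energy f dt <= (nni lborel (%th. (enn ?D * ?Y th) * enn (shell dt th)))"
 proof (rule energy_le_pointwise)
  fix th assume th: "th \<in> {dt..2*dt}"
  let ?f = "%r. enn (norm (Fa f r (cos th)) * sqrt (om r))" and ?g = "%r. enn (\<bar>ub (r * sin th)\<bar> / sqrt (om r))"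
  have "enn (norm (T f th)) <= (nni (radial b) (%r. enn (norm (Fa f r (cos th) * cpx (ub (r * sin th))))))"
  unfolding T_eq_Fa[OF f] by (rule norm_integral_le_nn_integral)
  also have "... = (nni (radial b) (%r. ?f r * ?g r))"
  by (rule nn_integral_cong_AE, rule eventually_mono[OF AE_radial_pos])
  (use om in \<open>auto simp: norm_mult ennreal_mult'[symmetric] less_imp_neq[symmetric] less_imp_le\<close>)
  finally have "(enn (norm (T f th)))^2 <= (nni (radial b) (%r. ?f r * ?g r))^2" by (rule power_mono) simp
  also have "... <= (nni (radial b) (%r. (?f r)^2)) * (nni (radial b) (%r. (?g r)^2))"
  by (rule Cauchy_Schwarz_nn_integral) measurable
  also have "(nni (radial b) (%r. (?f r)^2)) = ?Y th"
  by (rule nn_integral_cong_AE, rule eventually_mono[OF AE_radial_pos])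
  (use om in \<open>auto simp: ennreal_power power_mult_distrib ennreal_mult'[symmetric] less_imp_le mult.commute\<close>)
  also have "(nni (radial b) (%r. (?g r)^2)) <= enn ?D"
  proof -
  have "(nni (radial b) (%r. (?g r)^2)) = (nni lborel (%r. enn (indicator {0<..} r * r ^ (b - 1)) * (?g r)^2))"
  by (rule nn_integral_radial) measurable
  also have "... <= (nni lborel (%r. enn (C1^2 / dt ^ (b - 1)) * enn (indicator {0<..} r / om r)))"
  proof (rule nn_integral_mono)
  fix r :: real
  show "enn (indicator {0<..} r * r ^ (b - 1)) * (?g r)^2 <= enn (C1^2 / dt ^ (b - 1)) * enn (indicator {0<..} r / om r)"
  proof (cases "0 < r")
  case True
  have p: "0 < dt * r" using True dt by simp
  have "\<bar>ub (r * sin th)\<bar>\<^sup>2 <= (C1 * (1 + dt * r) powr (- be))^2"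
  using shell_ub[OF dt th True] by (rule power_mono) simp
  also have "... <= (C1 * (dt * r) powr (- be))^2"
  using p b2 C1 by (intro power_mono mult_left_mono powr_mono2') auto
  also have "... = C1^2 * (dt * r) powr (- (real b - 1))"
  using p by (simp only: power_mult_distrib powr_half_square)
  also have "(dt * r) powr (- (real b - 1)) = 1 / (dt * r) ^ (b - 1)"
  proof -
  have "(dt * r) ^ (b - 1) = (dt * r) powr (real b - 1)"
  using p b2 by (simp add: powr_realpow[symmetric] of_nat_diff)
  then show ?thesis by (simp only: powr_minus_divide)
  qed
  finally have "r ^ (b - 1) * \<bar>ub (r * sin th)\<bar>\<^sup>2 <= r ^ (b - 1) * (C1^2 * (1 / (dt * r) ^ (b - 1)))"
  using True by (intro mult_left_mono) auto
  also have "... = C1^2 / dt ^ (b - 1)"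
  using True dt by (simp add: power_mult_distrib)
  finally have "r ^ (b - 1) * \<bar>ub (r * sin th)\<bar>\<^sup>2 / om r <= C1^2 / dt ^ (b - 1) / om r"
  using om[OF True] by (intro divide_right_mono) auto
  then show ?thesis
  using True om[OF True] dt by (simp add: ennreal_power power_divide ennreal_mult'[symmetric] ennreal_leI)
  qed simp
  qed
  also have "... = enn (C1^2 / dt ^ (b - 1)) * (nni lborel (%r. enn (indicator {0<..} r / om r)))"
  by (rule nn_integral_cmult) measurable
  also have "... <= enn (C1^2 / dt ^ (b - 1)) * enn W" using W(1) by (rule mult_left_mono) simp
  also have "... = enn ?D" using W(2) dt by (intro ennreal_mult[symmetric]) auto
  finally show ?thesis .
  qed
  finally have "(enn (norm (T f th)))^2 <= ?Y th * enn ?D" by (simp add: mult_left_mono)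
  then show "enn ((norm (T f th))^2) <= enn ?D * ?Y th" by (simp add: ennreal_power mult.commute)
 qed
 also have "... = enn ?D * (nni lborel (%th. ?Y th * enn (shell dt th)))"
  unfolding mult.assoc[of "enn ?D"] by (rule nn_integral_cmult) measurable
 also have "... <= enn ?D * (enn ((2 * dt) ^ (b - 1) * (2 / dt)) * (enn K * (nni mu (%p. enn (om (snd p)) * enn ((norm (f p))^2)))))"
  by (intro mult_left_mono Fa_shell[OF dt f]) auto
 also have "(nni mu (%p. enn (om (snd p)) * enn ((norm (f p))^2))) = (nni mu (%p. enn (om (snd p) * (norm (f p))^2)))"
  by (rule nn_integral_cong_AE, rule eventually_mono[OF AE_quadrant_pos]) (use om in \<open>auto simp: ennreal_mult'[symmetric] less_imp_le\<close>)
 also have "enn ?D * (enn ((2 * dt) ^ (b - 1) * (2 / dt)) * (enn K * X)) = enn (C1^2 * W * (2 ^ b * K / dt)) * X" for X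
 proof -
  have e: "?D * ((2 * dt) ^ (b - 1) * (2 / dt)) * K = C1^2 * W * (2 ^ b * K / dt)"
  proof -
  have "2 ^ b = 2 ^ (b - 1) * (2::real)" using b2 by (intro power_minus_mult[symmetric]) simp
  then show ?thesis using dt by (simp add: power_mult_distrib field_simps)
  qed
  have "enn (?D * ((2 * dt) ^ (b - 1) * (2 / dt)) * K) = enn (?D * ((2 * dt) ^ (b - 1) * (2 / dt))) * enn K"
  using D0 dt K1 W by (intro ennreal_mult mult_nonneg_nonneg) auto
  also have "enn (?D * ((2 * dt) ^ (b - 1) * (2 / dt))) = enn ?D * enn ((2 * dt) ^ (b - 1) * (2 / dt))"
  using D0 dt W by (intro ennreal_mult mult_nonneg_nonneg) auto
  finally show ?thesis unfolding e by (simp only: mult.assoc)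
 qed
 finally show ?thesis .
qed

end

section \<open>Near and far from the diagonal\<close>

lemma nn_integral_near_diagonal:
 fixes g :: "real => ennreal"
 assumes [measurable]: "g: borel_measurable borel" and L: "0 < L"
 shows "(nni (radial n) (%r. (nni (radial n) (%r'. (if \<bar>r - r'\<bar> <= L then g r * g r' else 0)))))
  <= enn (2 * L) * (nni (radial n) (%r. enn (r ^ (n - 1)) * (g r)^2))"
proof -
 interpret R: sigma_finite_measure "radial n" by simp
 define j where "j r = enn (indicator {0<..} r * r ^ (n - 1))" for r :: real
 have [measurable]: "j: borel_measurable borel" unfolding j_def by measurable
 define G where "G r = j r * g r" for r
 have [measurable]: "G: borel_measurable borel" unfolding G_def by measurable
 let ?I = "\<integral>\<^sup>+r. (nni lborel (%r'. (if \<bar>r - r'\<bar> <= L then G r * G r' else 0))) \<partial>lborel"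
 have len: "(nni lborel (%r'. (if \<bar>r - r'\<bar> <= L then c else 0))) = c * enn (2 * L)" for r and c :: ennreal
 proof -
  have "(nni lborel (%r'. (if \<bar>r - r'\<bar> <= L then c else 0))) = (nni lborel (%r'. c * indicator {r - L..r + L} r'))"
  by (intro nn_integral_cong) (auto simp: indicator_def)
  also have "... = c * enn (2 * L)" using L by (subst nn_integral_cmult_indicator) auto
  finally show ?thesis .
 qed
 have "(nni (radial n) (%r. (nni (radial n) (%r'. (if \<bar>r - r'\<bar> <= L then g r * g r' else 0)))))
  = (nni lborel (%r. j r * (nni lborel (%r'. j r' * (if \<bar>r - r'\<bar> <= L then g r * g r' else 0)))))"
  unfolding j_def by (subst nn_integral_radial, measurable, intro nn_integral_cong, subst nn_integral_radial) measurable
 also have "... = ?I"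
 proof (rule nn_integral_cong)
  fix r
  have "j r * (nni lborel (%r'. j r' * (if \<bar>r - r'\<bar> <= L then g r * g r' else 0))) = (nni lborel (%r'. j r * (j r' * (if \<bar>r - r'\<bar> <= L then g r * g r' else 0))))"
  by (rule nn_integral_cmult[symmetric]) measurable
  also have "... = (nni lborel (%r'. (if \<bar>r - r'\<bar> <= L then G r * G r' else 0)))"
  by (intro nn_integral_cong) (auto simp: G_def mult_ac)
  finally show "j r * (nni lborel (%r'. j r' * (if \<bar>r - r'\<bar> <= L then g r * g r' else 0))) = ..." .
 qed
 finally have eq: "(nni (radial n) (%r. (nni (radial n) (%r'. (if \<bar>r - r'\<bar> <= L then g r * g r' else 0))))) = ?I" .
 have "2 * ?I = (nni lborel (%r. (nni lborel (%r'. 2 * (if \<bar>r - r'\<bar> <= L then G r * G r' else 0)))))"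
  by (subst nn_integral_cmult[symmetric], measurable, intro nn_integral_cong, subst nn_integral_cmult) auto
 also have "... <= (nni lborel (%r. (nni lborel (%r'. (if \<bar>r - r'\<bar> <= L then (G r)^2 else 0) + (if \<bar>r - r'\<bar> <= L then (G r')^2 else 0)))))"
  using sum_of_squares_ge_ennreal[of "G _" "G _"] by (intro nn_integral_mono) (auto simp: mult.assoc)
 also have "... = (nni lborel (%r. (nni lborel (%r'. (if \<bar>r - r'\<bar> <= L then (G r)^2 else 0))))) + (nni lborel (%r. (nni lborel (%r'. (if \<bar>r - r'\<bar> <= L then (G r')^2 else 0)))))"
  by (subst nn_integral_add[symmetric], measurable, intro nn_integral_cong, subst nn_integral_add) measurable
 also have "(nni lborel (%r. (nni lborel (%r'. (if \<bar>r - r'\<bar> <= L then (G r')^2 else 0))))) = (nni lborel (%r'. (nni lborel (%r. (if \<bar>r - r'\<bar> <= L then (G r')^2 else 0)))))"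
  by (rule lborel_pair.Fubini') measurable
 also have "... = (nni lborel (%r. (G r)^2 * enn (2 * L)))"
  by (subst abs_minus_commute) (simp only: len)
 also have "(nni lborel (%r. (nni lborel (%r'. (if \<bar>r - r'\<bar> <= L then (G r)^2 else 0))))) = (nni lborel (%r. (G r)^2 * enn (2 * L)))"
  by (simp only: len)
 also have "(nni lborel (%r. (G r)^2 * enn (2 * L))) + (nni lborel (%r. (G r)^2 * enn (2 * L))) = 2 * (nni lborel (%r. (G r)^2 * enn (2 * L)))"
  by (rule mult_2[symmetric])
 finally have "?I <= (nni lborel (%r. (G r)^2 * enn (2 * L)))"
  by (subst (asm) ennreal_mult_le_mult_iff) auto
 also have "... = (nni lborel (%r. j r * (enn (2 * L) * (enn (r ^ (n - 1)) * (g r)^2))))"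
  by (intro nn_integral_cong) (auto simp: G_def j_def indicator_def power_mult_distrib power2_eq_square mult_ac)
 also have "... = (nni (radial n) (%r. enn (2 * L) * (enn (r ^ (n - 1)) * (g r)^2)))"
  unfolding j_def by (rule nn_integral_radial[symmetric]) measurable
 also have "... = enn (2 * L) * (nni (radial n) (%r. enn (r ^ (n - 1)) * (g r)^2))"
  by (rule nn_integral_cmult) measurable
 finally show ?thesis unfolding eq .
qed

context kernel_pair begin

definition Ker :: "real => real * real => real * real => real" where
 "Ker dt p p' = (LINT th|lborel. u th p * u th p' * shell dt th)"

lemma integrable_shell:
 assumes dt: "0 < dt" "dt <= pi / 8"
 shows "integrable lborel (shell dt)"
proof (rule integrableI_nonneg)
 show "AE x in lborel. 0 <= shell dt x"
  using shell_nonneg[OF dt] shell_outside[of _ dt] by (intro AE_I2) (metis order_refl)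
 show "(nni lborel (%x. enn (shell dt x))) < \<infinity>"
  using nn_integral_shell_const[OF dt] by (rule order_le_less_trans) simp
qed measurable

lemma u_joint_measurable [measurable (raw)]:
 assumes [measurable]: "g: borel_measurable M" "h \<in> M \<rightarrow>\<^sub>M (borel :: (real * real) measure)"
 shows "(%x. u (g x) (h x)): borel_measurable M"
 unfolding u_def by measurable

lemma near_part_le:
 assumes dt: "0 < dt" "dt <= pi / 8" and f: "integrable mu f" and L: "0 < L" and th: "th \<in> {dt..2*dt}"
 shows "enn (norm (LINT p|mu. (f p * cpx (u th p)) * (LINT p'|mu. of_real (if \<bar>fst p - fst p'\<bar> <= L then 1 else 0) * cnj (f p' * cpx (u th p')))))
  <= enn (2 * L * C1^2) * (nni (radial a) (%r. enn ((norm (Fb f r (sin th)))^2)))"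
proof -
 have [measurable]: "f: borel_measurable borel" using f by auto
 interpret A: sigma_finite_measure "radial a" by simp
 interpret B: sigma_finite_measure "radial b" by simp
 interpret M: sigma_finite_measure mu by (rule sigma_finite_quadrant)
 define h where "h p = f p * cpx (u th p)" for p
 have hi: "integrable mu h" unfolding h_def by (rule integrable_u[OF f])
 have hc: "integrable mu (%p. cnj (h p))" using hi by simp
 have [measurable]: "h: borel_measurable borel" using hi by auto
 define G where "G r = Fb f r (sin th) * cpx (ua (r * cos th))" for r
 have [measurable]: "G: borel_measurable borel" unfolding G_def by measurable
 have hG: "(LINT s|radial b. h (r, s)) = G r" for r unfolding h_def G_def by (rule slice_b)
 have hGc: "(LINT s|radial b. cnj (h (r, s))) = cnj (G r)" for r
  unfolding hG[symmetric] by (rule Bochner_Integration.integral_cnj)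
 define q where "q r = (LINT p'|mu. of_real (if \<bar>r - fst p'\<bar> <= L then 1 else 0) * cnj (h p'))" for r
 have q_eq: "q r = (LINT r'|radial a. cnj (G r') * of_real (if \<bar>r - r'\<bar> <= L then 1 else 0))" for r
  unfolding q_def hGc[symmetric]
  using integral_quadrant_fst[OF hc, of "%r'. of_real (if \<bar>r - r'\<bar> <= L then 1 else 0)" 1] by (simp add: mult.commute)
 have qm [measurable]: "q: borel_measurable borel" unfolding q_def[abs_def] by measurable
 have q_bd: "norm (q r) <= (LINT p|mu. norm (h p))" for r
  unfolding q_def
 proof (rule Bochner_Integration.integral_norm_bound_integral)
  show "integrable mu (%p. norm (h p))" using hi by simp
  have "integrable mu (%p. cnj (h p) * of_real (if \<bar>r - fst p\<bar> <= L then 1 else 0))"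
  by (rule integrable_mult_bounded[OF hc, where B=1]) auto
  then show "integrable mu (%p'. of_real (if \<bar>r - fst p'\<bar> <= L then 1 else 0) * cnj (h p'))" by (simp add: mult.commute)
 qed auto
 have "(LINT p|mu. h p * q (fst p)) = (LINT r|radial a. G r * q r)"
  using integral_quadrant_fst[OF hi qm q_bd] by (simp add: hG)
 then have "enn (norm (LINT p|mu. h p * q (fst p))) <= (nni (radial a) (%r. enn (norm (G r * q r))))"
  using norm_integral_le_nn_integral[of "radial a" "%r. G r * q r"] by simp
 also have "... <= (nni (radial a) (%r. (nni (radial a) (%r'. (if \<bar>r - r'\<bar> <= L then enn (norm (G r)) * enn (norm (G r')) else 0)))))"
 proof (rule nn_integral_mono)
  fix r
  have "enn (norm (G r * q r)) = enn (norm (G r)) * enn (norm (q r))" by (simp add: norm_mult ennreal_mult)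
  also have "... <= enn (norm (G r)) * (nni (radial a) (%r'. enn (norm (cnj (G r') * of_real (if \<bar>r - r'\<bar> <= L then 1 else 0)))))"
  unfolding q_eq by (intro mult_left_mono norm_integral_le_nn_integral) simp
  also have "... = (nni (radial a) (%r'. enn (norm (G r)) * enn (norm (cnj (G r') * of_real (if \<bar>r - r'\<bar> <= L then 1 else 0)))))"
  by (rule nn_integral_cmult[symmetric]) measurable
  also have "... = (nni (radial a) (%r'. (if \<bar>r - r'\<bar> <= L then enn (norm (G r)) * enn (norm (G r')) else 0)))"
  by (intro nn_integral_cong) (simp add: norm_mult)
  finally show "enn (norm (G r * q r)) <= ..." .
 qed
 also have "... <= enn (2 * L) * (nni (radial a) (%r. enn (r ^ (a - 1)) * (enn (norm (G r)))^2))"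
  by (rule nn_integral_near_diagonal[OF _ L]) measurable
 also have "... <= enn (2 * L) * (nni (radial a) (%r. enn (C1^2) * enn ((norm (Fb f r (sin th)))^2)))"
 proof (intro mult_left_mono nn_integral_mono_AE, rule eventually_mono[OF AE_radial_pos])
  fix r :: real assume r: "0 < r"
  have "\<bar>ua (r * cos th)\<bar>\<^sup>2 <= (C1 * r powr (- al))^2"
  using shell_ua[OF dt th r] by (rule power_mono) simp
  also have "... = C1^2 * r powr (- (real a - 1))"
  using r by (simp only: power_mult_distrib powr_half_square)
  finally have "r ^ (a - 1) * \<bar>ua (r * cos th)\<bar>\<^sup>2 <= r ^ (a - 1) * (C1^2 * r powr (- (real a - 1)))"
  using r by (intro mult_left_mono) auto
  also have "... = C1^2 * (r ^ (a - 1) * r powr (- (real a - 1)))" by simp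
  also have "r ^ (a - 1) * r powr (- (real a - 1)) = 1"
  proof -
  have "r ^ (a - 1) = r powr (real a - 1)" using r a2 by (simp add: powr_realpow[symmetric] of_nat_diff)
  then have "r ^ (a - 1) * r powr (- (real a - 1)) = r powr ((real a - 1) + (- (real a - 1)))" by (simp only: powr_add)
  then show ?thesis using r by simp
  qed
  finally have le: "r ^ (a - 1) * \<bar>ua (r * cos th)\<bar>\<^sup>2 <= C1^2" by simp
  have "r ^ (a - 1) * (norm (G r))^2 = (norm (Fb f r (sin th)))^2 * (r ^ (a - 1) * \<bar>ua (r * cos th)\<bar>\<^sup>2)"
  unfolding G_def norm_mult norm_of_real power_mult_distrib by (simp only: mult_ac)
  also have "... <= (norm (Fb f r (sin th)))^2 * C1^2" using le by (intro mult_left_mono) auto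
  finally have "enn (r ^ (a - 1) * (norm (G r))^2) <= enn (C1^2 * (norm (Fb f r (sin th)))^2)"
  by (intro ennreal_leI) (simp add: mult.commute)
  then show "enn (r ^ (a - 1)) * (enn (norm (G r)))^2 <= enn (C1^2) * enn ((norm (Fb f r (sin th)))^2)"
  using r by (simp add: ennreal_power ennreal_mult)
 qed simp
 also have "... = enn (2 * L) * (enn (C1^2) * (nni (radial a) (%r. enn ((norm (Fb f r (sin th)))^2))))"
  by (subst nn_integral_cmult) measurable
 also have "... = enn (2 * L * C1^2) * (nni (radial a) (%r. enn ((norm (Fb f r (sin th)))^2)))"
  using L by (simp only: mult.assoc[symmetric] ennreal_mult[symmetric] less_imp_le mult_nonneg_nonneg zero_le_numeral zero_le_power2)
 finally show ?thesis unfolding q_def h_def .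
qed

text \<open>Expanding the square gives a double integral of \<open>f\<close> against a kernel. Close to the diagonal in the first variable the Hankel inequality in \<open>s\<close> and Schur's test give the first term; the rest is kept for the oscillation of the kernel.\<close>

lemma energy_near_far:
 assumes dt: "0 < dt" "dt <= pi / 8" and f: "integrable mu f" and L: "0 < L"
 shows "energy f dt <= enn (4 * L * C1^2 * K) * (nni mu (%p. enn ((norm (f p))^2)))
  + (nni mu (%p. (nni mu (%p'. (if L < \<bar>fst p - fst p'\<bar> then enn (norm (f p) * norm (f p') * \<bar>Ker dt p p'\<bar>) else 0)))))"
proof -
 have fm [measurable]: "f: borel_measurable borel" using f by auto
 interpret M: sigma_finite_measure mu by (rule sigma_finite_quadrant)
 interpret MM: pair_sigma_finite mu mu by (intro pair_sigma_finite.intro sigma_finite_quadrant)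
 interpret LM: pair_sigma_finite lborel "mu \<Otimes>\<^sub>M mu"
  by (intro pair_sigma_finite.intro sigma_finite_lborel) (unfold_locales)
 define nr where "nr p p' = (if \<bar>fst p - fst p'\<bar> <= L then 1 else 0 :: real)" for p p' :: "real * real"
 define fr where "fr p p' = (if L < \<bar>fst p - fst p'\<bar> then 1 else 0 :: real)" for p p' :: "real * real"
 have frnr: "nr p p' + fr p p' = 1" for p p' by (auto simp: nr_def fr_def)
 have [measurable]: "(%x. fr (fst x) (snd x)): borel_measurable (mu \<Otimes>\<^sub>M mu)" unfolding fr_def by measurable
 have [measurable]: "fr p: borel_measurable borel" "nr p: borel_measurable borel" for p unfolding fr_def[abs_def] nr_def[abs_def] by measurable
 define A where "A th p = f p * cpx (u th p)" for th p
 have Ai: "integrable mu (A th)" for th unfolding A_def by (rule integrable_u[OF f])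
 have Aci: "integrable mu (%p. cnj (A th p))" for th using Ai by simp
 have [measurable]: "A th: borel_measurable borel" for th using Ai[of th] by auto
 define N where "N th = (LINT p|mu. A th p * (LINT p'|mu. of_real (nr p p') * cnj (A th p')))" for th
 define R where "R th = (LINT p|mu. A th p * (LINT p'|mu. of_real (fr p p') * cnj (A th p')))" for th
 have T_A: "T f th = (LINT p|mu. A th p)" for th unfolding T_def A_def u_def ..
 define c where "c x = f (fst x) * cnj (f (snd x))" for x
 have fci: "integrable mu (%p. cnj (f p))" using f by simp
 have ci: "integrable (mu \<Otimes>\<^sub>M mu) c"
  using MM.integrable_product_bounded[OF f fci, of "%_. 1" 1] unfolding c_def by (simp add: split_beta')
 have uu: "\<bar>u th p * u th p'\<bar> <= K ^ 4" for th p p'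
 proof -
  have "\<bar>u th p\<bar> * \<bar>u th p'\<bar> <= K^2 * K^2" using u_bd K1 by (intro mult_mono) auto
  then show ?thesis by (simp add: abs_mult power_add[symmetric])
 qed
 have fr1: "\<bar>fr p p'\<bar> <= 1" "\<bar>nr p p'\<bar> <= 1" for p p' by (auto simp: fr_def nr_def)
 have uuf: "\<bar>u th p * u th p' * fr p p'\<bar> <= K ^ 4" for th p p'
  using mult_mono[OF uu[of th p p'] fr1(1)[of p p']] K1 by (simp add: abs_mult)
 define g where "g x = cpx (u (fst x) (fst (snd x)) * u (fst x) (snd (snd x)) * fr (fst (snd x)) (snd (snd x)))" for x
 have [measurable]: "g: borel_measurable (lborel \<Otimes>\<^sub>M (mu \<Otimes>\<^sub>M mu))"
 proof -
  have [measurable]: "(%x. fr (fst (snd x)) (snd (snd x))): borel_measurable ((lborel :: real measure) \<Otimes>\<^sub>M (mu \<Otimes>\<^sub>M mu))" unfolding fr_def by measurable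
  show ?thesis unfolding g_def by measurable
 qed
 have si: "integrable lborel (%th. cpx (shell dt th))" using integrable_shell[OF dt] by simp
 have gi: "integrable (lborel \<Otimes>\<^sub>M (mu \<Otimes>\<^sub>M mu)) (%(th, x). cpx (shell dt th) * c x * g (th, x))"
  using uuf by (intro LM.integrable_product_bounded[OF si ci, where B="K ^ 4"]) (auto simp: g_def simp del: of_real_mult)
 have R_eq: "R th * cpx (shell dt th) = (LINT x|(mu \<Otimes>\<^sub>M mu). cpx (shell dt th) * c x * g (th, x))" for th
 proof -
  have i: "integrable (mu \<Otimes>\<^sub>M mu) (%(p, p'). A th p * cnj (A th p') * (%x. cpx (fr (fst x) (snd x))) (p, p'))"
  using fr1 by (intro MM.integrable_product_bounded[OF Ai Aci, where B=1]) auto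
  have "R th = (LINT p|mu. (LINT p'|mu. A th p * cnj (A th p') * cpx (fr p p')))"
  unfolding R_def by (intro Bochner_Integration.integral_cong refl) (simp add: mult_ac flip: integral_mult_right_zero)
  also have "... = (LINT x|(mu \<Otimes>\<^sub>M mu). A th (fst x) * cnj (A th (snd x)) * cpx (fr (fst x) (snd x)))"
  using MM.integral_fst'[OF i] by (simp add: split_beta')
  finally have "R th * cpx (shell dt th) = (LINT x|(mu \<Otimes>\<^sub>M mu). (A th (fst x) * cnj (A th (snd x)) * cpx (fr (fst x) (snd x))) * cpx (shell dt th))"
  by (simp only: integral_mult_left_zero)
  also have "... = (LINT x|(mu \<Otimes>\<^sub>M mu). cpx (shell dt th) * c x * g (th, x))"
  by (intro Bochner_Integration.integral_cong refl) (simp add: A_def c_def g_def mult_ac)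
  finally show ?thesis .
 qed
 have Ri: "integrable lborel (%th. R th * cpx (shell dt th))"
  using LM.integrable_fst'[OF gi] unfolding R_eq by simp
 have R_int: "(LINT th|lborel. R th * cpx (shell dt th)) = (LINT x|(mu \<Otimes>\<^sub>M mu). c x * cpx (fr (fst x) (snd x) * Ker dt (fst x) (snd x)))"
 proof -
  have "(LINT th|lborel. R th * cpx (shell dt th)) = (LINT x|(mu \<Otimes>\<^sub>M mu). (LINT th|lborel. cpx (shell dt th) * c x * g (th, x)))"
  unfolding R_eq using LM.Fubini_integral[OF gi] by simp
  also have "... = (LINT x|(mu \<Otimes>\<^sub>M mu). c x * cpx (fr (fst x) (snd x) * Ker dt (fst x) (snd x)))"
  proof (rule Bochner_Integration.integral_cong[OF refl])
  fix x
  have "(LINT th|lborel. cpx (shell dt th) * c x * g (th, x))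
  = (LINT th|lborel. (c x * cpx (fr (fst x) (snd x))) * cpx (u th (fst x) * u th (snd x) * shell dt th))"
  by (intro Bochner_Integration.integral_cong refl) (simp add: g_def mult_ac)
  also have "... = (c x * cpx (fr (fst x) (snd x))) * (LINT th|lborel. cpx (u th (fst x) * u th (snd x) * shell dt th))"
  by (rule integral_mult_right_zero)
  also have "(LINT th|lborel. cpx (u th (fst x) * u th (snd x) * shell dt th)) = cpx (Ker dt (fst x) (snd x))"
  unfolding Ker_def by (rule integral_complex_of_real)
  finally show "(LINT th|lborel. cpx (shell dt th) * c x * g (th, x)) = c x * cpx (fr (fst x) (snd x) * Ker dt (fst x) (snd x))"
  by simp
  qed
  finally show ?thesis .
 qed
 define S where "S = (LINT p|mu. norm (f p))"
 have S0: "0 <= S" unfolding S_def by simp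
 have TS: "norm (T f th) <= K^2 * S" for th
 proof -
  have "norm (T f th) <= (LINT p|mu. K^2 * norm (f p))"
  unfolding T_A
  proof (rule Bochner_Integration.integral_norm_bound_integral[OF Ai])
  show "norm (A th p) <= K^2 * norm (f p)" for p
  using mult_left_mono[OF u_bd[of th p] norm_ge_zero[of "f p"]] by (simp add: A_def norm_mult mult.commute)
  qed (use f in simp)
  then show ?thesis by (simp add: S_def)
 qed
 have Ti: "integrable lborel (%th. cpx ((norm (T f th))^2 * shell dt th))"
 proof (rule Bochner_Integration.integrable_bound)
  show "integrable lborel (%th. (K^2 * S)^2 * shell dt th)" using integrable_shell[OF dt] by simp
  show "AE th in lborel. norm (cpx ((norm (T f th))^2 * shell dt th)) <= norm ((K^2 * S)^2 * shell dt th)"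
  proof (rule AE_I2)
  fix th
  have "(norm (T f th))^2 <= (K^2 * S)^2" using TS by (intro power_mono) auto
  then have "(norm (T f th))^2 * \<bar>shell dt th\<bar> <= (K^2 * S)^2 * \<bar>shell dt th\<bar>" by (rule mult_right_mono) simp
  then show "norm (cpx ((norm (T f th))^2 * shell dt th)) <= norm ((K^2 * S)^2 * shell dt th)"
  unfolding norm_of_real real_norm_def abs_mult by simp
  qed
 qed measurable
 have split: "cpx ((norm (T f th))^2) = N th + R th" for th
 proof -
  have in1: "integrable mu (%p'. of_real (nr p p') * cnj (A th p'))" for p
  using integrable_mult_bounded[OF Aci, of "%p'. of_real (nr p p')" 1 th] fr1 by (simp add: mult.commute)
  have in2: "integrable mu (%p'. of_real (fr p p') * cnj (A th p'))" for p
  using integrable_mult_bounded[OF Aci, of "%p'. of_real (fr p p')" 1 th] fr1 by (simp add: mult.commute)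
  have cT: "cnj (T f th) = (LINT p'|mu. of_real (nr p p') * cnj (A th p')) + (LINT p'|mu. of_real (fr p p') * cnj (A th p'))" for p
  proof -
  have "cnj (T f th) = (LINT p'|mu. cnj (A th p'))" unfolding T_A by (rule Bochner_Integration.integral_cnj[symmetric])
  also have "... = (LINT p'|mu. of_real (nr p p') * cnj (A th p') + of_real (fr p p') * cnj (A th p'))"
  by (simp only: distrib_right[symmetric] of_real_add[symmetric] frnr of_real_1 mult_1)
  finally show ?thesis by (simp only: Bochner_Integration.integral_add[OF in1 in2])
  qed
  have bd: "norm (LINT p'|mu. of_real (w p p') * cnj (A th p')) <= (LINT p|mu. norm (A th p))"
  if w1: "\<And>p p'. \<bar>w p p'\<bar> <= 1" and w2: "\<And>p. integrable mu (%p'. of_real (w p p') * cnj (A th p'))" for w :: "real * real => real * real => real" and p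
  using w1[of p] Ai[of th]
  by (intro Bochner_Integration.integral_norm_bound_integral w2) (auto simp: norm_mult intro!: mult_left_le_one_le)
  have m1: "(%p. \<integral>p'. of_real (nr p p') * cnj (A th p') \<partial>mu): borel_measurable borel"
  unfolding nr_def by measurable
  have m2: "(%p. \<integral>p'. of_real (fr p p') * cnj (A th p') \<partial>mu): borel_measurable borel"
  unfolding fr_def by measurable
  have "cpx ((norm (T f th))^2) = T f th * cnj (T f th)" by (rule complex_norm_square)
  also have "... = (LINT p|mu. A th p * cnj (T f th))" unfolding T_A by (rule integral_mult_left_zero[symmetric])
  also have "... = (LINT p|mu. A th p * (LINT p'|mu. of_real (nr p p') * cnj (A th p')) + A th p * (LINT p'|mu. of_real (fr p p') * cnj (A th p')))"
  proof (rule Bochner_Integration.integral_cong[OF refl])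
  fix p
  show "A th p * cnj (T f th) = A th p * (LINT p'|mu. of_real (nr p p') * cnj (A th p')) + A th p * (LINT p'|mu. of_real (fr p p') * cnj (A th p'))"
  unfolding distrib_left[symmetric] cT[of p] ..
  qed
  also have "... = N th + R th"
  unfolding N_def R_def
  proof (rule Bochner_Integration.integral_add)
  show "integrable mu (%p. A th p * (LINT p'|mu. of_real (nr p p') * cnj (A th p')))"
  by (rule integrable_mult_bounded[OF Ai m1, where B="\<integral>p. norm (A th p) \<partial>mu"]) (rule bd[OF fr1(2) in1])
  show "integrable mu (%p. A th p * (LINT p'|mu. of_real (fr p p') * cnj (A th p')))"
  by (rule integrable_mult_bounded[OF Ai m2, where B="\<integral>p. norm (A th p) \<partial>mu"]) (rule bd[OF fr1(1) in2])
  qed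
  finally show ?thesis .
 qed
 have N_eq: "N th * cpx (shell dt th) = cpx ((norm (T f th))^2 * shell dt th) - R th * cpx (shell dt th)" for th
  unfolding of_real_mult split by (simp add: distrib_right)
 have Ni: "integrable lborel (%th. N th * cpx (shell dt th))"
  unfolding N_eq using Ti Ri by (rule Bochner_Integration.integrable_diff)
 have N_bd: "(nni lborel (%th. enn (norm (N th * cpx (shell dt th))))) <= enn (4 * L * C1^2 * K) * (nni mu (%p. enn ((norm (f p))^2)))"
 proof -
  let ?Y = "%th. \<integral>\<^sup>+r. 1 * enn ((norm (Fb f r (sin th)))^2) \<partial>radial a"
  interpret RA: sigma_finite_measure "radial a" by simp
  have "(nni lborel (%th. enn (norm (N th * cpx (shell dt th))))) <= (nni lborel (%th. enn (2 * L * C1^2) * (?Y th * enn (shell dt th))))"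
  proof (rule nn_integral_mono)
  fix th
  show "enn (norm (N th * cpx (shell dt th))) <= enn (2 * L * C1^2) * (?Y th * enn (shell dt th))"
  proof (cases "th \<in> {dt..2*dt}")
  case True
  have "enn (norm (N th)) <= enn (2 * L * C1^2) * ?Y th"
  using near_part_le[OF dt f L True] unfolding N_def A_def nr_def by simp
  then have "enn (norm (N th)) * enn (shell dt th) <= enn (2 * L * C1^2) * ?Y th * enn (shell dt th)"
  by (rule mult_right_mono) simp
  then show ?thesis using shell_nonneg[OF dt True] by (simp add: norm_mult ennreal_mult mult.assoc)
  qed (simp add: shell_outside)
  qed
  also have "... = enn (2 * L * C1^2) * (nni lborel (%th. ?Y th * enn (shell dt th)))"
  by (rule nn_integral_cmult) measurable
  also have "... <= enn (2 * L * C1^2) * (2 * (enn K * (nni mu (%p. 1 * enn ((norm (f p))^2)))))"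
  by (intro mult_left_mono Fb_shell[OF dt f]) auto
  also have "... = enn (4 * L * C1^2 * K) * (nni mu (%p. enn ((norm (f p))^2)))"
  proof -
  have "enn (4 * L * C1^2 * K) = enn ((2 * L * C1^2) * (2 * K))" by (simp add: mult_ac)
  also have "... = enn (2 * L * C1^2) * enn (2 * K)"
  using L K1 by (intro ennreal_mult) auto
  also have "enn (2 * K) = 2 * enn K" using K1 by (subst ennreal_mult) auto
  finally show ?thesis by (simp add: mult.assoc)
  qed
  finally show ?thesis .
 qed
 have e0: "0 <= (norm (T f th))^2 * shell dt th" for th
  using shell_nonneg[OF dt, of th] shell_outside[of th dt] by (cases "th \<in> {dt..2*dt}") auto
 have "energy f dt = (nni lborel (%th. enn ((norm (T f th))^2 * shell dt th)))"
  unfolding energy_def by (intro nn_integral_cong) (simp add: ennreal_mult')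
 also have "... = enn (LINT th|lborel. (norm (T f th))^2 * shell dt th)"
  using Ti[unfolded complex_of_real_integrable_eq] e0 by (intro nn_integral_eq_integral) auto
 also have "... = enn (norm (cpx (LINT th|lborel. (norm (T f th))^2 * shell dt th)))"
  using e0 by (simp del: of_real_mult of_real_power)
 also have "cpx (LINT th|lborel. (norm (T f th))^2 * shell dt th) = (LINT th|lborel. N th * cpx (shell dt th) + R th * cpx (shell dt th))"
  unfolding integral_complex_of_real[symmetric]
  by (intro Bochner_Integration.integral_cong refl) (simp only: of_real_mult split distrib_right)
 also have "... = (LINT th|lborel. N th * cpx (shell dt th)) + (LINT th|lborel. R th * cpx (shell dt th))"
  by (rule Bochner_Integration.integral_add[OF Ni Ri])
 also have "enn (norm ...) <= enn (norm (LINT th|lborel. N th * cpx (shell dt th))) + enn (norm (LINT th|lborel. R th * cpx (shell dt th)))"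
  by (simp add: ennreal_plus[symmetric] ennreal_leI norm_triangle_ineq del: ennreal_plus)
 also have "... <= enn (4 * L * C1^2 * K) * (nni mu (%p. enn ((norm (f p))^2)))
  + (nni mu (%p. (nni mu (%p'. (if L < \<bar>fst p - fst p'\<bar> then enn (norm (f p) * norm (f p') * \<bar>Ker dt p p'\<bar>) else 0)))))"
 proof (rule add_mono)
  show "enn (norm (LINT th|lborel. N th * cpx (shell dt th))) <= enn (4 * L * C1^2 * K) * (nni mu (%p. enn ((norm (f p))^2)))"
  by (rule order_trans[OF norm_integral_le_nn_integral N_bd])
  have [measurable]: "(%x. Ker dt (fst x) (snd x)): borel_measurable (mu \<Otimes>\<^sub>M mu)"
  unfolding Ker_def by measurable
  have "enn (norm (LINT th|lborel. R th * cpx (shell dt th))) <= (nni (mu \<Otimes>\<^sub>M mu) (%x. enn (norm (c x * cpx (fr (fst x) (snd x) * Ker dt (fst x) (snd x))))))"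
  unfolding R_int by (rule norm_integral_le_nn_integral)
  also have "... = (nni mu (%p. (nni mu (%p'. enn (norm (c (p, p') * cpx (fr p p' * Ker dt p p')))))))"
  by (subst M.nn_integral_fst[symmetric]) (auto simp: c_def)
  also have "... = (nni mu (%p. (nni mu (%p'. (if L < \<bar>fst p - fst p'\<bar> then enn (norm (f p) * norm (f p') * \<bar>Ker dt p p'\<bar>) else 0)))))"
  by (intro nn_integral_cong) (simp add: c_def fr_def norm_mult)
  finally show "enn (norm (LINT th|lborel. R th * cpx (shell dt th)))
  <= (nni mu (%p. (nni mu (%p'. (if L < \<bar>fst p - fst p'\<bar> then enn (norm (f p) * norm (f p') * \<bar>Ker dt p p'\<bar>) else 0)))))" .
 qed
 finally show ?thesis .
qed

end

section \<open>Decay of the kernel far from the diagonal\<close>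

lemma abs_diff_prod_le:
 fixes x y x' y' :: real
 assumes "\<bar>y\<bar> <= B" "\<bar>x'\<bar> <= A" "\<bar>x - x'\<bar> <= d" "\<bar>y - y'\<bar> <= e" "0 <= A" "0 <= B"
 shows "\<bar>x * y - x' * y'\<bar> <= d * B + A * e"
proof -
 have "x * y - x' * y' = (x - x') * y + x' * (y - y')" by (simp add: algebra_simps)
 also have "\<bar>...\<bar> <= \<bar>x - x'\<bar> * \<bar>y\<bar> + \<bar>x'\<bar> * \<bar>y - y'\<bar>" by (metis abs_mult abs_triangle_ineq)
 also have "... <= d * B + A * e" using assms by (intro add_mono mult_mono) auto
 finally show ?thesis .
qed

lemma integrable_cis_indicator:
 fixes H :: "real => complex"
 assumes "continuous_on UNIV H"
 shows "integrable lborel (%th. H th * of_real (indicator {x..y} th))"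
 using borel_integrable_atLeastAtMost'[OF continuous_on_subset[OF assms subset_UNIV], of x y]
 unfolding set_integrable_def by (simp add: scaleR_conv_of_real mult.commute)

lemma oscillation_step:
 fixes H :: "real => complex" and ph :: "real => real"
 assumes H: "continuous_on UNIV H" and ph: "continuous_on UNIV ph" and AB: "\<bar>A\<bar> <= K" "\<bar>B\<bar> <= K"
  and V: "\<And>sg. sg \<in> {1, -1} ==> norm (LINT th|lborel. cis (sg * ph th) * H th * of_real (indicator {x..y} th)) <= V"
 shows "norm (LINT th|lborel. of_real (A * cos (ph th) + B * sin (ph th)) * H th * of_real (indicator {x..y} th)) <= 2 * K * V"
proof -
 define z where "z sg = Complex (A / 2) (- sg * B / 2)" for sg
 have z: "norm (z sg) <= K" if "sg \<in> {1, -1}" for sg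
  using cmod_le[of "z sg"] that AB by (auto simp: z_def abs_mult)
 let ?I = "%sg th. cis (sg * ph th) * H th * of_real (indicator {x..y} th)"
 have c: "continuous_on UNIV (%th. cis (sg * ph th) * H th)" for sg
  unfolding cis_conv_exp by (intro continuous_intros H ph)
 have i: "integrable lborel (?I sg)" for sg by (rule integrable_cis_indicator[OF c])
 define J1 where "J1 = (LINT th|lborel. ?I 1 th)"
 define J2 where "J2 = (LINT th|lborel. ?I (-1) th)"
 have "has_bochner_integral lborel (%th. z 1 * ?I 1 th + z (-1) * ?I (-1) th) (z 1 * J1 + z (-1) * J2)"
  unfolding J1_def J2_def
  by (intro has_bochner_integral_add has_bochner_integral_mult_right has_bochner_integral_integrable i)
 moreover have "(%th. z 1 * ?I 1 th + z (-1) * ?I (-1) th) = (%th. of_real (A * cos (ph th) + B * sin (ph th)) * H th * of_real (indicator {x..y} th))"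
 proof
  fix th
  have "cpx (A * cos (ph th) + B * sin (ph th)) = z 1 * cis (1 * ph th) + z (-1) * cis (-1 * ph th)"
  by (rule complex_eqI) (simp_all add: z_def)
  then show "z 1 * ?I 1 th + z (-1) * ?I (-1) th = of_real (A * cos (ph th) + B * sin (ph th)) * H th * of_real (indicator {x..y} th)"
  by (simp only: ring_distribs mult.assoc)
 qed
 ultimately have eq: "(LINT th|lborel. of_real (A * cos (ph th) + B * sin (ph th)) * H th * of_real (indicator {x..y} th)) = z 1 * J1 + z (-1) * J2"
  by (simp only: has_bochner_integral_integral_eq)
 have K0: "0 <= K" using AB(1) by linarith
 have J: "norm J1 <= V" "norm J2 <= V" unfolding J1_def J2_def by (rule V, simp)+
 have "norm (z 1 * J1 + z (-1) * J2) <= norm (z 1) * norm J1 + norm (z (-1)) * norm J2"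
  using norm_triangle_ineq[of "z 1 * J1" "z (-1) * J2"] by (simp add: norm_mult)
 also have "... <= K * V + K * V"
  by (intro add_mono mult_mono z J K0) simp_all
 finally show ?thesis unfolding eq by simp
qed

lemma ennreal_sum_squares_le: "(\<Sum>l. (x l :: ennreal)^2) <= (\<Sum>l. x l)^2"
proof -
 have "x l <= (\<Sum>l. x l)" for l
  using sum_le_suminf[of x "{l}"] by simp
 then have "(\<Sum>l. (x l)^2) <= (\<Sum>l. (\<Sum>l. x l) * x l)"
  by (intro suminf_le) (auto simp: power2_eq_square mult_right_mono)
 then show ?thesis by (simp add: power2_eq_square)
qed

lemma ennreal_suminf_Cauchy_Schwarz:
 "(\<Sum>l. (x l :: ennreal) * y l)^2 <= (\<Sum>l. (x l)^2) * (\<Sum>l. (y l)^2)"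
 using Cauchy_Schwarz_nn_integral[of x "count_space UNIV" y] by (simp add: nn_integral_count_space_nat)

context kernel_pair begin

definition "C2 = 960 * K ^ 4 * 2 ^ b"

text \<open>The four factors are replaced by their leading oscillations, at the cost of the last four summands. What remains is a sum of 16 exponentials with phase \<open>(r +- r') cos t + (s +- s') sin t\<close>, to each of which the estimate of van der Corput applies.\<close>

lemma kernel_far:
 assumes dt: "0 < dt" "dt <= pi / 8" and pos: "0 < r" "0 < s" "0 < r'" "0 < s'"
  and L: "0 < L" "L <= \<bar>r - r'\<bar>" "1 <= dt^2 * L" and s1: "1 <= dt * s" "1 <= dt * s'"
 shows "\<bar>Ker dt (r, s) (r', s')\<bar> <= C2 * dt ^ b * (m1 dt (r, s) * m1 dt (r', s')) * ((dt^2 * L) powr (- (1/3)) + 1 / r + 1 / r' + 1 / (dt * s) + 1 / (dt * s'))"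
proof -
 define X where "X = (dt^2 * L) powr (- (1/3))"
 define E where "E = 1 / r + 1 / r' + 1 / (dt * s) + 1 / (dt * s')"
 have E0: "0 <= E" using pos dt by (simp add: E_def)
 have X0: "0 <= X" by (simp add: X_def)
 define wa where "wa r = r powr al * ua r" for r
 define wb where "wb r = r powr be * ub r" for r
 define ma where "ma r = Aa * cos r + Ba * sin r" for r
 define mb where "mb r = Ab * cos r + Bb * sin r" for r
 define ind where "ind th = (indicator {dt..2*dt} th :: real)" for th
 define Pf where "Pf = (r powr (- al) * r' powr (- al)) * (s powr (- be) * s' powr (- be))"
 define W where "W th = (wa (r * cos th) * wa (r' * cos th)) * (wb (s * sin th) * wb (s' * sin th))" for th
 define M where "M th = (ma (r * cos th) * ma (r' * cos th)) * (mb (s * sin th) * mb (s' * sin th))" for th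
 have [measurable]: "W: borel_measurable borel" "M: borel_measurable borel" "ind: borel_measurable borel"
  unfolding W_def wa_def wb_def M_def ma_def mb_def ind_def by measurable
 have cancel: "c powr (- ((real n - 1) / 2)) * c powr (- ((real n - 1) / 2)) * c ^ (n - 1) = 1" if "0 < c" "2 <= n" for c :: real and n
 proof -
  have "c ^ (n - 1) = c powr (real n - 1)" using that by (simp add: powr_realpow[symmetric] of_nat_diff)
  then have "c powr (- ((real n - 1) / 2)) * c powr (- ((real n - 1) / 2)) * c ^ (n - 1) = c powr (- ((real n - 1) / 2) + - ((real n - 1) / 2) + (real n - 1))"
  by (simp only: powr_add)
  also have "- ((real n - 1) / 2) + - ((real n - 1) / 2) + (real n - 1) = 0" by simp
  finally show ?thesis using that by simp
 qed
 have ua_eq: "ua (x * c) = x powr (- al) * c powr (- al) * wa (x * c)" if "0 < x" "0 < c" for x c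
 proof -
  have "x powr (- al) * c powr (- al) = (x * c) powr (- al)" using that by (simp only: powr_mult less_imp_le)
  moreover have "(x * c) powr (- al) * (x * c) powr al = 1" using that by (simp add: powr_add[symmetric] del: powr_minus)
  ultimately show ?thesis unfolding wa_def by (simp only: mult.assoc[symmetric] mult_1)
 qed
 have ub_eq: "ub (x * c) = x powr (- be) * c powr (- be) * wb (x * c)" if "0 < x" "0 < c" for x c
 proof -
  have "x powr (- be) * c powr (- be) = (x * c) powr (- be)" using that by (simp only: powr_mult less_imp_le)
  moreover have "(x * c) powr (- be) * (x * c) powr be = 1" using that by (simp add: powr_add[symmetric] del: powr_minus)
  ultimately show ?thesis unfolding wb_def by (simp only: mult.assoc[symmetric] mult_1)
 qed
 have int_eq: "u th (r, s) * u th (r', s') * shell dt th = Pf * (W th * ind th)" for th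
 proof (cases "th \<in> {dt..2*dt}")
  case True
  have c: "0 < cos th" using shell_trig(1)[OF dt True] by simp
  have sn: "0 < sin th" using shell_trig(3)[OF dt True] dt by simp
  have "u th (r, s) * u th (r', s') * shell dt th
  = (ua (r * cos th) * ub (s * sin th)) * (ua (r' * cos th) * ub (s' * sin th)) * (cos th ^ (a - 1) * sin th ^ (b - 1))"
  using True by (simp add: u_def shell_def)
  also have "... = Pf * W th * (cos th powr (- al) * cos th powr (- al) * cos th ^ (a - 1)) * (sin th powr (- be) * sin th powr (- be) * sin th ^ (b - 1))"
  unfolding ua_eq[OF pos(1) c] ua_eq[OF pos(3) c] ub_eq[OF pos(2) sn] ub_eq[OF pos(4) sn] Pf_def W_def
  by (simp only: mult_ac)
  also have "... = Pf * W th" unfolding cancel[OF c a2] cancel[OF sn b2] by simp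
  finally show ?thesis using True by (simp add: ind_def)
 qed (simp add: shell_outside ind_def)
 have Ker_eq: "Ker dt (r, s) (r', s') = Pf * (LINT th|lborel. W th * ind th)"
  unfolding Ker_def int_eq by (rule integral_mult_right_zero)
 have wa_le: "\<bar>wa x\<bar> <= 2 * K" if "0 < x" for x using wa_bd[OF that] K1 by (simp add: wa_def)
 have wb_le: "\<bar>wb x\<bar> <= 2 * K" if "0 < x" for x using wb_bd[OF that] K1 by (simp add: wb_def)
 have lin: "\<bar>A * cos x + B * sin x\<bar> <= 2 * K" if "\<bar>A\<bar> <= K" "\<bar>B\<bar> <= K" for A B x
 proof -
  have "\<bar>A * cos x + B * sin x\<bar> <= \<bar>A\<bar> * \<bar>cos x\<bar> + \<bar>B\<bar> * \<bar>sin x\<bar>" by (metis abs_mult abs_triangle_ineq)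
  also have "... <= K * 1 + K * 1" using that K1 by (intro add_mono mult_mono) auto
  finally show ?thesis by simp
 qed
 have ma_le: "\<bar>ma x\<bar> <= 2 * K" for x unfolding ma_def by (rule lin[OF AB(1,2)])
 have mb_le: "\<bar>mb x\<bar> <= 2 * K" for x unfolding mb_def by (rule lin[OF AB(3,4)])
 have err: "\<bar>W th - M th\<bar> <= 16 * K ^ 4 * E" if th: "th \<in> {dt..2*dt}" for th
 proof -
  have c: "1 / 2 <= cos th" "dt / 2 <= sin th" using shell_trig[OF dt th] by auto
  have da: "\<bar>wa (x * cos th) - ma (x * cos th)\<bar> <= 2 * K / x" if x: "0 < x" for x
  proof -
  have p: "0 < x * cos th" using x c by (intro mult_pos_pos) auto
  have "\<bar>wa (x * cos th) - ma (x * cos th)\<bar> <= K / (x * cos th)" using wa_as[OF p] by (simp add: wa_def ma_def)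
  also have "... <= K / (x * (1 / 2))" using x c K1 p by (intro divide_left_mono mult_left_mono mult_pos_pos) auto
  also have "... = 2 * K / x" using x by (simp add: field_simps)
  finally show ?thesis .
  qed
  have db: "\<bar>wb (x * sin th) - mb (x * sin th)\<bar> <= 2 * K / (dt * x)" if x: "0 < x" for x
  proof -
  have p: "0 < x * sin th" using x c dt by (intro mult_pos_pos) auto
  have "\<bar>wb (x * sin th) - mb (x * sin th)\<bar> <= K / (x * sin th)" using wb_as[OF p] by (simp add: wb_def mb_def)
  also have "... <= K / (x * (dt / 2))" using x c K1 p dt by (intro divide_left_mono mult_left_mono mult_pos_pos) auto
  also have "... = 2 * K / (dt * x)" using x dt by (simp add: field_simps)
  finally show ?thesis .
  qed
  have pc: "0 < r * cos th" "0 < r' * cos th" "0 < s * sin th" "0 < s' * sin th" using pos c dt by (auto intro!: mult_pos_pos)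
  have K0: "0 <= 2 * K" using K1 by simp
  have 1: "\<bar>wa (r * cos th) * wa (r' * cos th) - ma (r * cos th) * ma (r' * cos th)\<bar> <= (2 * K / r) * (2 * K) + (2 * K) * (2 * K / r')"
  by (rule abs_diff_prod_le[OF wa_le[OF pc(2)] ma_le da[OF pos(1)] da[OF pos(3)] K0 K0])
  have 2: "\<bar>wb (s * sin th) * wb (s' * sin th) - mb (s * sin th) * mb (s' * sin th)\<bar> <= (2 * K / (dt * s)) * (2 * K) + (2 * K) * (2 * K / (dt * s'))"
  by (rule abs_diff_prod_le[OF wb_le[OF pc(4)] mb_le db[OF pos(2)] db[OF pos(4)] K0 K0])
  have 3: "\<bar>wb (s * sin th) * wb (s' * sin th)\<bar> <= (2 * K) * (2 * K)"
  unfolding abs_mult using K0 by (intro mult_mono wb_le pc) auto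
  have 4: "\<bar>ma (r * cos th) * ma (r' * cos th)\<bar> <= (2 * K) * (2 * K)"
  unfolding abs_mult using K0 by (intro mult_mono ma_le) auto
  have "\<bar>W th - M th\<bar> <= ((2 * K / r) * (2 * K) + (2 * K) * (2 * K / r')) * ((2 * K) * (2 * K)) + ((2 * K) * (2 * K)) * ((2 * K / (dt * s)) * (2 * K) + (2 * K) * (2 * K / (dt * s')))"
  unfolding W_def M_def by (rule abs_diff_prod_le[OF 3 4 1 2]) (use K0 in auto)
  also have "... = 16 * K ^ 4 * E" unfolding E_def by (simp add: algebra_simps power4_eq_xxxx)
  finally show ?thesis .
 qed
 have Mcont: "continuous_on UNIV M" unfolding M_def[abs_def] ma_def mb_def by (intro continuous_intros)
 have Mi: "integrable lborel (%th. M th * ind th)"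
  using borel_integrable_atLeastAtMost'[OF continuous_on_subset[OF Mcont subset_UNIV], of dt "2*dt"]
  unfolding set_integrable_def ind_def by (simp add: mult.commute)
 have indi: "integrable lborel ind"
  unfolding ind_def by (rule integrable_real_indicator) (use dt in auto)
 have Ei: "integrable lborel (%th. (W th - M th) * ind th)"
 proof (rule Bochner_Integration.integrable_bound)
  show "integrable lborel (%th. 16 * K ^ 4 * E * ind th)" using indi by simp
  show "AE th in lborel. norm ((W th - M th) * ind th) <= norm (16 * K ^ 4 * E * ind th)"
  proof (rule AE_I2)
  fix th
  show "norm ((W th - M th) * ind th) <= norm (16 * K ^ 4 * E * ind th)"
  using err[of th] by (cases "th \<in> {dt..2*dt}") (auto simp: ind_def)
  qed
 qed measurable
 have E_bd: "\<bar>\<integral>th. (W th - M th) * ind th \<partial>lborel\<bar> <= 16 * K ^ 4 * E * dt"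
 proof -
  have "norm (LINT th|lborel. (W th - M th) * ind th) <= (LINT th|lborel. 16 * K ^ 4 * E * ind th)"
  proof (rule Bochner_Integration.integral_norm_bound_integral[OF Ei])
  show "integrable lborel (%th. 16 * K ^ 4 * E * ind th)" using indi by simp
  fix th show "norm ((W th - M th) * ind th) <= 16 * K ^ 4 * E * ind th"
  using err[of th] by (cases "th \<in> {dt..2*dt}") (auto simp: ind_def)
  qed
  also have "... = 16 * K ^ 4 * E * dt" using dt by (simp add: ind_def)
  finally show ?thesis by simp
 qed
 let ?V = "60 * (dt * X)"
 have V0: "norm (LINT th|lborel. cis (sg1 * (r * cos th)) * (cis (sg2 * (r' * cos th)) * (cis (sg3 * (s * sin th)) * cis (sg4 * (s' * sin th)))) * of_real (indicator {dt..2*dt} th)) <= ?V"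
  if sg: "sg1 \<in> {1, -1}" "sg2 \<in> {1, -1}" for sg1 sg2 sg3 sg4 :: real
 proof -
  have PL: "L <= \<bar>sg1 * r + sg2 * r'\<bar>" using sg L(2) pos by auto
  have "norm (LINT th|lborel. cis ((sg1 * r + sg2 * r') * cos th + (sg3 * s + sg4 * s') * sin th) * of_real (indicator {dt..2*dt} th))
  <= 60 * ((2 * dt - dt) * ((2 * dt - dt)^2 * L) powr (- (1 / 3)))"
  using dt L PL by (intro van_der_corput_rotated) auto
  also have "... = ?V" by (simp add: X_def)
  finally show ?thesis by (simp add: cis_mult algebra_simps)
 qed
 have cc: "continuous_on UNIV (%th. cis (c * (d * cos th)))" "continuous_on UNIV (%th. cis (c * (d * sin th)))" for c d :: real
  unfolding cis_conv_exp by (intro continuous_intros)+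
 have cma: "continuous_on UNIV (%th. cpx (ma (d * cos th)))" "continuous_on UNIV (%th. cpx (mb (d * sin th)))" for d :: real
  unfolding ma_def mb_def by (intro continuous_intros)+
 have V1: "norm (LINT th|lborel. of_real (mb (s' * sin th)) * (cis (sg1 * (r * cos th)) * (cis (sg2 * (r' * cos th)) * cis (sg3 * (s * sin th)))) * of_real (indicator {dt..2*dt} th)) <= 2 * K * ?V"
  if "sg1 \<in> {1, -1}" "sg2 \<in> {1, -1}" for sg1 sg2 sg3
  unfolding mb_def
 proof (rule oscillation_step[OF _ _ AB(3,4)])
  fix sg4 :: real
  show "norm (LINT th|lborel. cis (sg4 * (s' * sin th)) * (cis (sg1 * (r * cos th)) * (cis (sg2 * (r' * cos th)) * cis (sg3 * (s * sin th)))) * of_real (indicator {dt..2*dt} th)) <= ?V"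
  using V0[OF that, of sg3 sg4] by (simp only: mult_ac)
 qed (intro continuous_intros cc)+
 have V2: "norm (LINT th|lborel. of_real (mb (s * sin th)) * (of_real (mb (s' * sin th)) * (cis (sg1 * (r * cos th)) * cis (sg2 * (r' * cos th)))) * of_real (indicator {dt..2*dt} th)) <= 2 * K * (2 * K * ?V)"
  if "sg1 \<in> {1, -1}" "sg2 \<in> {1, -1}" for sg1 sg2
  unfolding mb_def[of "s * _"]
 proof (rule oscillation_step[OF _ _ AB(3,4)])
  fix sg3 :: real
  show "norm (LINT th|lborel. cis (sg3 * (s * sin th)) * (of_real (mb (s' * sin th)) * (cis (sg1 * (r * cos th)) * cis (sg2 * (r' * cos th)))) * of_real (indicator {dt..2*dt} th)) <= 2 * K * ?V"
  using V1[OF that, of sg3] by (simp only: mult_ac)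
 qed (intro continuous_intros cc cma)+
 have V3: "norm (LINT th|lborel. of_real (ma (r' * cos th)) * (of_real (mb (s * sin th)) * (of_real (mb (s' * sin th)) * cis (sg1 * (r * cos th)))) * of_real (indicator {dt..2*dt} th)) <= 2 * K * (2 * K * (2 * K * ?V))"
  if "sg1 \<in> {1, -1}" for sg1
  unfolding ma_def[of "r' * _"]
 proof (rule oscillation_step[OF _ _ AB(1,2)])
  fix sg2 :: real assume sg2: "sg2 \<in> {1, -1}"
  show "norm (LINT th|lborel. cis (sg2 * (r' * cos th)) * (of_real (mb (s * sin th)) * (of_real (mb (s' * sin th)) * cis (sg1 * (r * cos th)))) * of_real (indicator {dt..2*dt} th)) <= 2 * K * (2 * K * ?V)"
  using V2[OF that sg2] by (simp only: mult_ac)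
 qed (intro continuous_intros cc cma)+
 have V4: "norm (LINT th|lborel. cpx (ma (r * cos th)) * (of_real (ma (r' * cos th)) * (of_real (mb (s * sin th)) * of_real (mb (s' * sin th)))) * of_real (indicator {dt..2*dt} th)) <= 2 * K * (2 * K * (2 * K * (2 * K * ?V)))"
  unfolding ma_def[of "r * _"]
 proof (rule oscillation_step[OF _ _ AB(1,2)])
  fix sg1 :: real assume sg1: "sg1 \<in> {1, -1}"
  show "norm (LINT th|lborel. cis (sg1 * (r * cos th)) * (of_real (ma (r' * cos th)) * (of_real (mb (s * sin th)) * of_real (mb (s' * sin th)))) * of_real (indicator {dt..2*dt} th)) <= 2 * K * (2 * K * (2 * K * ?V))"
  using V3[OF sg1] by (simp only: mult_ac)
 qed (intro continuous_intros cc cma)+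
 have M_bd: "\<bar>\<integral>th. M th * ind th \<partial>lborel\<bar> <= 960 * K ^ 4 * (dt * X)"
 proof -
  have e: "cpx (LINT th|lborel. M th * ind th) = (LINT th|lborel. of_real (ma (r * cos th)) * (of_real (ma (r' * cos th)) * (of_real (mb (s * sin th)) * of_real (mb (s' * sin th)))) * of_real (indicator {dt..2*dt} th))"
  unfolding integral_complex_of_real[symmetric] M_def ind_def of_real_mult by (simp only: mult.assoc)
  have "norm (cpx (LINT th|lborel. M th * ind th)) <= 2 * K * (2 * K * (2 * K * (2 * K * ?V)))"
  unfolding e by (rule V4)
  also have "... = 960 * K ^ 4 * (dt * X)" by (simp add: power4_eq_xxxx)
  finally show ?thesis unfolding norm_of_real by simp
 qed
 have "(LINT th|lborel. W th * ind th) = (LINT th|lborel. M th * ind th + (W th - M th) * ind th)"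
  by (intro Bochner_Integration.integral_cong refl) (simp add: algebra_simps)
 also have "... = (LINT th|lborel. M th * ind th) + (LINT th|lborel. (W th - M th) * ind th)"
  by (rule Bochner_Integration.integral_add[OF Mi Ei])
 finally have "\<bar>\<integral>th. W th * ind th \<partial>lborel\<bar> <= 960 * K ^ 4 * (dt * X) + 16 * K ^ 4 * E * dt"
  using M_bd E_bd by linarith
 moreover have "16 * (K ^ 4 * E * dt) <= 960 * (K ^ 4 * E * dt)" using E0 dt K1 by (intro mult_right_mono mult_nonneg_nonneg) auto
 moreover have "960 * K ^ 4 * dt * (X + E) = 960 * K ^ 4 * (dt * X) + 960 * (K ^ 4 * E * dt)" "16 * K ^ 4 * E * dt = 16 * (K ^ 4 * E * dt)" by (simp_all only: ring_distribs mult_ac)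
 ultimately have W_bd: "\<bar>\<integral>th. W th * ind th \<partial>lborel\<bar> <= 960 * K ^ 4 * dt * (X + E)"
  by linarith
 have Pf0: "0 <= Pf" by (simp add: Pf_def)
 have sb: "x powr (- be) <= (dt powr be * 2 powr be) * (1 + dt * x) powr (- be)" if x: "0 < x" "1 <= dt * x" for x
 proof -
  have p: "0 < 1 + dt * x" "1 + dt * x <= 2 * (dt * x)" using x by linarith+
  have "x powr (- be) = dt powr be * (dt * x) powr (- be)"
  using x dt by (simp add: powr_mult powr_minus field_simps)
  also have "... <= dt powr be * ((1 + dt * x) / 2) powr (- be)"
  proof (intro mult_left_mono powr_mono2')
  show "0 < (1 + dt * x) / 2" "(1 + dt * x) / 2 <= dt * x" using p by simp_all
  qed (use b2 in auto)
  also have "((1 + dt * x) / 2) powr (- be) = 2 powr be * (1 + dt * x) powr (- be)"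
  using x by (simp add: powr_divide powr_minus field_simps)
  finally show ?thesis by (simp add: mult.assoc)
 qed
 have "Pf <= (r powr (- al) * r' powr (- al)) * (((dt powr be * 2 powr be) * (1 + dt * s) powr (- be)) * ((dt powr be * 2 powr be) * (1 + dt * s') powr (- be)))"
  unfolding Pf_def by (intro mult_left_mono mult_mono sb pos s1) auto
 also have "... = ((dt powr be * dt powr be) * (2 powr be * 2 powr be)) * (m1 dt (r, s) * m1 dt (r', s'))"
  unfolding m1_def fst_conv snd_conv by (simp only: mult_ac)
 also have "(dt powr be * dt powr be) * (2 powr be * 2 powr be) = dt ^ (b - 1) * 2 ^ (b - 1)"
  using dt b2 by (simp add: powr_add[symmetric] powr_realpow[symmetric] of_nat_diff)
 finally have Pf_le: "Pf <= dt ^ (b - 1) * 2 ^ (b - 1) * (m1 dt (r, s) * m1 dt (r', s'))" .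
 have "\<bar>Ker dt (r, s) (r', s')\<bar> = Pf * \<bar>\<integral>th. W th * ind th \<partial>lborel\<bar>"
  unfolding Ker_eq using Pf0 by (simp add: abs_mult)
 also have "... <= (dt ^ (b - 1) * 2 ^ (b - 1) * (m1 dt (r, s) * m1 dt (r', s'))) * (960 * K ^ 4 * dt * (X + E))"
  using Pf_le W_bd Pf0 dt by (intro mult_mono) auto
 also have "... = 960 * K ^ 4 * 2 ^ (b - 1) * (dt ^ (b - 1) * dt) * (m1 dt (r, s) * m1 dt (r', s')) * (X + E)"
  by (simp only: mult_ac)
 also have "dt ^ (b - 1) * dt = dt ^ b" using b2 by (intro power_minus_mult) simp
 also have "960 * K ^ 4 * 2 ^ (b - 1) * dt ^ b * (m1 dt (r, s) * m1 dt (r', s')) * (X + E) <= C2 * dt ^ b * (m1 dt (r, s) * m1 dt (r', s')) * (X + E)"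
  unfolding C2_def using X0 E0 dt K1 by (intro mult_right_mono mult_left_mono power_increasing mult_nonneg_nonneg add_nonneg_nonneg) auto
 finally show ?thesis unfolding X_def E_def by (simp add: add.assoc)
qed

definition "C3 = 4 * C1^2 * K + 5 * C2"

lemma C2_nonneg: "0 <= C2" using K1 by (simp add: C2_def)

lemma C3_nonneg: "0 <= C3" using C2_nonneg C1_ge_1 K1 by (simp add: C3_def)

text \<open>The cut-off \<open>L\<close> is chosen so that \<open>\<delta>\<^sup>2 L\<close> is the square root of \<open>\<Lambda>\<close>; then every error term in the kernel bound is at most \<open>\<Lambda>\<close> to the power \<open>-1/6\<close>.\<close>

lemma energy_piece:
 assumes dt: "0 < dt" "dt <= pi / 8" and f: "integrable mu f" and Lm: "1 <= Lm"
  and supp: "\<And>p. f p ~= 0 ==> Lm <= dt * snd p & Lm powr (1/3) <= fst p"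
 shows "energy f dt <= enn (C3 * (Lm powr (1/2) / dt^2)) * (nni mu (%p. enn ((norm (f p))^2)))
  + enn (C3 * dt ^ b * Lm powr (- (1/6))) * (nni mu (%p. enn (norm (f p) * m1 dt p)))^2"
proof -
 have [measurable]: "f: borel_measurable borel" using f by auto
 interpret M: sigma_finite_measure mu by (rule sigma_finite_quadrant)
 define L where "L = Lm powr (1/2) / dt^2"
 have L0: "0 < L" using Lm dt by (simp add: L_def)
 have dtL: "dt^2 * L = Lm powr (1/2)" using dt by (simp add: L_def)
 have dtL1: "1 <= dt^2 * L" unfolding dtL using Lm by (simp add: ge_one_powr_ge_zero)
 define X where "X = Lm powr (- (1/6))"
 have X0: "0 <= X" by (simp add: X_def)
 have X1: "(dt^2 * L) powr (- (1/3)) = X" unfolding dtL X_def by (simp add: powr_powr)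
 have X2: "1 / r <= X" if "Lm powr (1/3) <= r" for r
 proof -
  have "1 / r <= 1 / Lm powr (1/3)" using that Lm by (intro divide_left_mono mult_pos_pos) (auto intro: less_le_trans[of _ "Lm powr (1/3)"])
  also have "... = Lm powr (- (1/3))" by (simp add: powr_minus_divide)
  also have "... <= X" unfolding X_def using Lm by (intro powr_mono) auto
  finally show ?thesis .
 qed
 have X3: "1 / r <= X" if "Lm <= r" for r
 proof (rule X2)
  have "Lm powr (1/3) <= Lm powr 1" using Lm by (intro powr_mono) auto
  then show "Lm powr (1/3) <= r" using that Lm by simp
 qed
 let ?c = "5 * C2 * dt ^ b * X"
 have c0: "0 <= ?c" using C2_nonneg dt X0 by simp
 let ?J = "\<integral>\<^sup>+p. enn (norm (f p) * m1 dt p) \<partial>mu"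
 have far: "(nni mu (%p. (nni mu (%p'. (if L < \<bar>fst p - fst p'\<bar> then enn (norm (f p) * norm (f p') * \<bar>Ker dt p p'\<bar>) else 0))))) <= enn ?c * ?J^2"
 proof -
  have "(nni mu (%p. (nni mu (%p'. (if L < \<bar>fst p - fst p'\<bar> then enn (norm (f p) * norm (f p') * \<bar>Ker dt p p'\<bar>) else 0)))))
  <= (nni mu (%p. (nni mu (%p'. enn ?c * (enn (norm (f p) * m1 dt p) * enn (norm (f p') * m1 dt p'))))))"
  proof (rule nn_integral_mono_AE, rule eventually_mono[OF AE_quadrant_pos], rule nn_integral_mono_AE, rule eventually_mono[OF AE_quadrant_pos])
  fix p p' :: "real * real" assume pp: "0 < fst p & 0 < snd p" "0 < fst p' & 0 < snd p'"
  show "(if L < \<bar>fst p - fst p'\<bar> then enn (norm (f p) * norm (f p') * \<bar>Ker dt p p'\<bar>) else 0) <= enn ?c * (enn (norm (f p) * m1 dt p) * enn (norm (f p') * m1 dt p'))"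
  proof (cases "L < \<bar>fst p - fst p'\<bar> & f p ~= 0 & f p' ~= 0")
  case True
  have sp: "Lm <= dt * snd p" "Lm powr (1/3) <= fst p" "Lm <= dt * snd p'" "Lm powr (1/3) <= fst p'"
  using supp[of p] supp[of p'] True by auto
  have "\<bar>Ker dt (fst p, snd p) (fst p', snd p')\<bar> <= C2 * dt ^ b * (m1 dt (fst p, snd p) * m1 dt (fst p', snd p')) * ((dt^2 * L) powr (- (1/3)) + 1 / fst p + 1 / fst p' + 1 / (dt * snd p) + 1 / (dt * snd p'))"
  using pp True sp Lm by (intro kernel_far[OF dt _ _ _ _ L0 _ dtL1]) auto
  also have "... <= C2 * dt ^ b * (m1 dt (fst p, snd p) * m1 dt (fst p', snd p')) * (X + X + X + X + X)"
  unfolding X1 using X2[OF sp(2)] X2[OF sp(4)] X3[OF sp(1)] X3[OF sp(3)] C2_nonneg dt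
  by (intro mult_left_mono add_mono mult_nonneg_nonneg) auto
  also have "... = ?c * (m1 dt p * m1 dt p')" by (simp add: algebra_simps)
  finally have "norm (f p) * norm (f p') * \<bar>Ker dt p p'\<bar> <= norm (f p) * norm (f p') * (?c * (m1 dt p * m1 dt p'))"
  by (intro mult_left_mono) auto
  also have "... = ?c * ((norm (f p) * m1 dt p) * (norm (f p') * m1 dt p'))" by (simp only: mult_ac)
  finally have "enn (norm (f p) * norm (f p') * \<bar>Ker dt p p'\<bar>) <= enn (?c * ((norm (f p) * m1 dt p) * (norm (f p') * m1 dt p')))"
  by (rule ennreal_leI)
  also have "... = enn ?c * (enn (norm (f p) * m1 dt p) * enn (norm (f p') * m1 dt p'))"
  using c0 by (subst ennreal_mult, simp, simp, subst ennreal_mult) auto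
  finally show ?thesis using True by simp
  qed auto
  qed
  also have "... = enn ?c * ?J^2"
  by (simp add: nn_integral_cmult nn_integral_multc power2_eq_square)
  finally show ?thesis .
 qed
 have "energy f dt <= enn (4 * L * C1^2 * K) * (nni mu (%p. enn ((norm (f p))^2))) + enn ?c * ?J^2"
  by (rule order_trans[OF energy_near_far[OF dt f L0] add_left_mono[OF far]])
 also have "... <= enn (C3 * (Lm powr (1/2) / dt^2)) * (nni mu (%p. enn ((norm (f p))^2))) + enn (C3 * dt ^ b * Lm powr (- (1/6))) * ?J^2"
 proof (intro add_mono mult_right_mono ennreal_leI)
  have "4 * C1^2 * K * L <= C3 * L" unfolding C3_def using C2_nonneg L0 by (intro mult_right_mono) auto
  then show "4 * L * C1^2 * K <= C3 * (Lm powr (1/2) / dt^2)" unfolding L_def[symmetric] by (simp add: mult_ac)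
  have "5 * C2 * (dt ^ b * X) <= C3 * (dt ^ b * X)" unfolding C3_def using dt X0 K1 by (intro mult_right_mono) auto
  then show "?c <= C3 * dt ^ b * Lm powr (- (1/6))" unfolding X_def[symmetric] by (simp add: mult_ac)
 qed auto
 finally show ?thesis .
qed

end

context kernel_pair begin

definition "geo = 1 / (1 - 2 powr (- (1/12) :: real))"
definition "C4 = 2 * geo * C3"

lemma geo_pos: "0 < geo"
proof -
 have "2 powr (- (1/12) :: real) < 2 powr 0" by (intro powr_less_mono) auto
 then show ?thesis by (simp add: geo_def)
qed

lemma geo_sum: "(\<Sum>l. enn (2 powr (- (real l / 12)))) = enn geo"
proof -
 have "2 powr (- (1/12) :: real) < 2 powr 0" by (intro powr_less_mono) auto
 then have "(%l. (2 powr (- (1/12) :: real)) ^ l) sums geo"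
  unfolding geo_def by (intro geometric_sums) simp
 moreover have "(2 powr (- (1/12) :: real)) ^ l = 2 powr (- (real l / 12))" for l
  by (simp add: powr_realpow[symmetric] powr_powr)
 ultimately have "(%l. 2 powr (- (real l / 12))) sums geo" by simp
 then show ?thesis by (intro suminf_ennreal_eq) auto
qed

lemma C4_nonneg: "0 <= C4" using geo_pos C3_nonneg by (simp add: C4_def)

text \<open>The function is cut into dyadic pieces according to the size of \<open>\<delta> s\<close>. Cauchy-Schwarz with the weights \<open>2 powr (l / 24)\<close> recombines the pieces; it consumes half of the gain \<open>\<Lambda> powr (-1/6)\<close> and leaves the factor \<open>(\<delta> s) powr (-1/24)\<close>.\<close>

lemma energy_mid:
 assumes dt: "0 < dt" "dt <= pi / 8" and f: "integrable mu f"
  and supp: "\<And>p. f p ~= 0 ==> 1 <= dt * snd p & (dt * snd p) powr (1/3) <= fst p"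
 shows "energy f dt <= enn (C4 / dt^2) * (nni mu (%p. enn ((dt * snd p) powr (7/12) * (norm (f p))^2)))
  + enn (C4 * dt ^ b) * (nni mu (%p. enn (norm (f p) * m1 dt p * (dt * snd p) powr (- (1/24)))))^2"
proof -
 have [measurable]: "f: borel_measurable borel" using f by auto
 define lev where "lev p = nat \<lfloor>log 2 (dt * snd p)\<rfloor>" for p :: "real * real"
 have [measurable]: "lev \<in> borel \<rightarrow>\<^sub>M count_space UNIV" unfolding lev_def[abs_def] by measurable
 define g where "g l p = (if l = lev p then f p else 0)" for l p
 have g_m [measurable]: "g l: borel_measurable borel" for l unfolding g_def[abs_def] by measurable
 have g_i: "integrable mu (g l)" for l
  by (rule Bochner_Integration.integrable_bound[OF f]) (auto simp: g_def)
 have lev: "2 powr real (lev p) <= dt * snd p" "dt * snd p <= 2 powr (real (lev p) + 1)" if "f p ~= 0" for p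
 proof -
  have s: "1 <= dt * snd p" using supp[OF that] by simp
  have l0: "0 <= log 2 (dt * snd p)" using s by simp
  have "real (lev p) = real_of_int \<lfloor>log 2 (dt * snd p)\<rfloor>" using l0 by (simp add: lev_def)
  then have l: "real (lev p) <= log 2 (dt * snd p)" "log 2 (dt * snd p) <= real (lev p) + 1" by linarith+
  have "dt * snd p = 2 powr (log 2 (dt * snd p))" using s by simp
  then show "2 powr real (lev p) <= dt * snd p" "dt * snd p <= 2 powr (real (lev p) + 1)"
  using l by (metis powr_mono one_le_numeral)+
 qed
 have single: "(\<Sum>l. if l = lev p then x l else 0) = (x (lev p) :: ennreal)" for p x
  using sums_unique[OF sums_single[of "lev p" x]] by simp
 have T_le: "enn (norm (T f th)) <= (\<Sum>l. enn (norm (T (g l) th)))" for th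
 proof -
  let ?v = "%p. cpx (ua (fst p * cos th) * ub (snd p * sin th))"
  have v: "norm (?v p) <= K * K" for p
  using ua_bd ub_bd K1 unfolding norm_of_real abs_mult by (intro mult_mono) auto
  have gs: "(\<Sum>l<n. g l p * ?v p) = (if lev p < n then f p * ?v p else 0)" for n p
  proof -
  have "(%l. g l p * ?v p) = (%l. if l = lev p then f p * ?v p else 0)" by (auto simp: g_def fun_eq_iff)
  then show ?thesis by (simp only: sum.delta[OF finite_lessThan] lessThan_iff)
  qed
  have gi: "integrable mu (%p. g l p * ?v p)" for l
  by (rule integrable_mult_bounded[OF g_i _ v]) measurable
  have "(%n. \<integral>p. (\<Sum>l<n. g l p * ?v p) \<partial>mu) \<longlonglongrightarrow> (LINT p|mu. f p * ?v p)"
  proof (rule integral_dominated_convergence[where w = "%p. norm (f p) * (K * K)"])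
  show "AE p in mu. (%n. \<Sum>l<n. g l p * ?v p) \<longlonglongrightarrow> f p * ?v p"
  proof (rule AE_I2, rule tendsto_eventually)
  fix p
  show "\<forall>\<^sub>F n in sequentially. (\<Sum>l<n. g l p * ?v p) = f p * ?v p"
  by (rule eventually_mono[OF eventually_gt_at_top[of "lev p"]]) (simp only: gs if_True)
  qed
  show "AE p in mu. norm (\<Sum>l<n. g l p * ?v p) <= norm (f p) * (K * K)" for n
  proof (rule AE_I2)
  fix p
  show "norm (\<Sum>l<n. g l p * ?v p) <= norm (f p) * (K * K)"
  unfolding gs using mult_left_mono[OF v[of p], of "norm (f p)"] K1 by (simp add: norm_mult)
  qed
  show "integrable mu (%p. norm (f p) * (K * K))" using f by simp
  qed measurable
  moreover have "(LINT p|mu. (\<Sum>l<n. g l p * ?v p)) = (\<Sum>l<n. T (g l) th)" for n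
  unfolding T_def by (rule Bochner_Integration.integral_sum[OF gi])
  ultimately have "(%n. \<Sum>l<n. T (g l) th) \<longlonglongrightarrow> T f th" by (simp only: T_def)
  then have "(%n. enn (norm (\<Sum>l<n. T (g l) th))) \<longlonglongrightarrow> enn (norm (T f th))"
  by (intro tendsto_ennrealI tendsto_norm)
  then show ?thesis
  proof (rule LIMSEQ_le_const2, intro exI allI impI)
  fix n
  have "enn (norm (\<Sum>l<n. T (g l) th)) <= enn (\<Sum>l<n. norm (T (g l) th))"
  by (intro ennreal_leI norm_sum)
  also have "... = (\<Sum>l<n. enn (norm (T (g l) th)))" by simp
  also have "... <= (\<Sum>l. enn (norm (T (g l) th)))" by (rule sum_le_suminf) auto
  finally show "enn (norm (\<Sum>l<n. T (g l) th)) <= (\<Sum>l. enn (norm (T (g l) th)))" .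
  qed
 qed
 have T_sq: "enn ((norm (T f th))^2) <= enn geo * (\<Sum>l. enn (2 powr (real l / 12)) * enn ((norm (T (g l) th))^2))" for th
 proof -
  have w: "enn (2 powr (- (real l / 24))) * (enn (2 powr (real l / 24)) * x) = x" for l x
  by (simp add: mult.assoc[symmetric] ennreal_mult[symmetric] powr_add[symmetric] del: powr_minus)
  have "enn ((norm (T f th))^2) = (enn (norm (T f th)))^2" by (simp add: ennreal_power)
  also have "... <= (\<Sum>l. enn (2 powr (- (real l / 24))) * (enn (2 powr (real l / 24)) * enn (norm (T (g l) th))))^2"
  unfolding w by (intro power_mono T_le) simp
  also have "... <= (\<Sum>l. (enn (2 powr (- (real l / 24))))^2) * (\<Sum>l. (enn (2 powr (real l / 24)) * enn (norm (T (g l) th)))^2)"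
  by (rule ennreal_suminf_Cauchy_Schwarz)
  also have "(%l. (enn (2 powr (- (real l / 24))))^2) = (%l. enn (2 powr (- (real l / 12))))"
  by (simp add: ennreal_power powr_power fun_eq_iff)
  also have "(%l. (enn (2 powr (real l / 24)) * enn (norm (T (g l) th)))^2) = (%l. enn (2 powr (real l / 12)) * enn ((norm (T (g l) th))^2))"
  by (simp add: power_mult_distrib ennreal_power powr_power fun_eq_iff)
  finally show ?thesis unfolding geo_sum .
 qed
 let ?A = "%l. \<integral>\<^sup>+p. enn ((norm (g l p))^2) \<partial>mu"
 let ?J = "%l. \<integral>\<^sup>+p. enn (norm (g l p) * m1 dt p) \<partial>mu"
 have piece: "enn (2 powr (real l / 12)) * energy (g l) dt <= enn (C3 / dt^2) * (enn (2 powr (real l * (7/12))) * ?A l)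
  + enn (C3 * dt ^ b) * (enn (2 powr (- (real l / 24))) * ?J l)^2" for l
 proof -
  let ?Lm = "2 powr real l"
  have "energy (g l) dt <= enn (C3 * (?Lm powr (1/2) / dt^2)) * ?A l + enn (C3 * dt ^ b * ?Lm powr (- (1/6))) * (?J l)^2"
  proof (rule energy_piece[OF dt g_i])
  show "1 <= ?Lm" by (simp add: ge_one_powr_ge_zero)
  fix p assume "g l p ~= 0"
  then have l: "l = lev p" and fp: "f p ~= 0" by (auto simp: g_def split: if_splits)
  show "?Lm <= dt * snd p & ?Lm powr (1/3) <= fst p"
  using lev(1)[OF fp] supp[OF fp] powr_mono2[of "1/3" ?Lm "dt * snd p"] l by auto
  qed
  then have "enn (2 powr (real l / 12)) * energy (g l) dt <= enn (2 powr (real l / 12)) * (enn (C3 * (?Lm powr (1/2) / dt^2)) * ?A l + enn (C3 * dt ^ b * ?Lm powr (- (1/6))) * (?J l)^2)"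
  by (rule mult_left_mono) simp
  also have "... = enn (2 powr (real l / 12) * (C3 * (?Lm powr (1/2) / dt^2))) * ?A l + enn (2 powr (real l / 12) * (C3 * dt ^ b * ?Lm powr (- (1/6)))) * (?J l)^2"
  using C3_nonneg dt by (simp add: distrib_left mult.assoc[symmetric] ennreal_mult[symmetric])
  also have "2 powr (real l / 12) * (C3 * (?Lm powr (1/2) / dt^2)) = C3 / dt^2 * 2 powr (real l * (7/12))"
  proof -
  have "2 powr (real l / 12) * ?Lm powr (1/2) = 2 powr (real l / 12 + real l * (1/2))" by (simp only: powr_powr powr_add)
  also have "real l / 12 + real l * (1/2) = real l * (7/12)" by simp
  finally show ?thesis by (simp add: field_simps)
  qed
  also have "2 powr (real l / 12) * (C3 * dt ^ b * ?Lm powr (- (1/6))) = (C3 * dt ^ b) * (2 powr (- (real l / 24)))^2"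
  proof -
  have "2 powr (real l / 12) * ?Lm powr (- (1/6)) = 2 powr (real l / 12 + real l * (- (1/6)))" by (simp only: powr_powr powr_add)
  also have "... = (2 powr (- (real l / 24)))^2" by (simp add: powr_power)
  finally show ?thesis by (simp only: mult_ac)
  qed
  also have "enn (C3 / dt^2 * 2 powr (real l * (7/12))) * ?A l = enn (C3 / dt^2) * (enn (2 powr (real l * (7/12))) * ?A l)"
  using C3_nonneg by (subst ennreal_mult) (auto simp: mult.assoc)
  also have "enn ((C3 * dt ^ b) * (2 powr (- (real l / 24)))^2) * (?J l)^2 = enn (C3 * dt ^ b) * (enn (2 powr (- (real l / 24))) * ?J l)^2"
  using C3_nonneg dt by (subst ennreal_mult) (auto simp: mult.assoc power_mult_distrib ennreal_power)
  finally show ?thesis .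
 qed
 have A_sum: "(\<Sum>l. enn (2 powr (real l * (7/12))) * ?A l) <= (nni mu (%p. enn ((dt * snd p) powr (7/12) * (norm (f p))^2)))"
 proof -
  have "(\<Sum>l. enn (2 powr (real l * (7/12))) * ?A l) = (nni mu (%p. (\<Sum>l. enn (2 powr (real l * (7/12))) * enn ((norm (g l p))^2))))"
  by (subst nn_integral_suminf) (auto simp: nn_integral_cmult)
  also have "... <= (nni mu (%p. enn ((dt * snd p) powr (7/12) * (norm (f p))^2)))"
  proof (rule nn_integral_mono)
  fix p
  have "(%l. enn (2 powr (real l * (7/12))) * enn ((norm (g l p))^2)) = (%l. if l = lev p then enn (2 powr (real l * (7/12)) * (norm (f p))^2) else 0)"
  by (auto simp: g_def fun_eq_iff ennreal_mult)
  then have "(\<Sum>l. enn (2 powr (real l * (7/12))) * enn ((norm (g l p))^2)) = enn (2 powr (real (lev p) * (7/12)) * (norm (f p))^2)"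
  by (simp only: single)
  also have "... <= enn ((dt * snd p) powr (7/12) * (norm (f p))^2)"
  proof (cases "f p = 0")
  case False
  have "2 powr (real (lev p) * (7/12)) <= (dt * snd p) powr (7/12)"
  using powr_mono2[OF _ _ lev(1)[OF False], of "7/12"] by (simp add: powr_powr)
  then show ?thesis by (intro ennreal_leI mult_right_mono) auto
  qed simp
  finally show "(\<Sum>l. enn (2 powr (real l * (7/12))) * enn ((norm (g l p))^2)) <= enn ((dt * snd p) powr (7/12) * (norm (f p))^2)" .
  qed
  finally show ?thesis .
 qed
 let ?R = "\<integral>\<^sup>+p. enn (norm (f p) * m1 dt p * (dt * snd p) powr (- (1/24))) \<partial>mu"
 have J_sum: "(\<Sum>l. enn (2 powr (- (real l / 24))) * ?J l) <= enn (2 powr (1/24)) * ?R"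
 proof -
  have "(\<Sum>l. enn (2 powr (- (real l / 24))) * ?J l) = (nni mu (%p. (\<Sum>l. enn (2 powr (- (real l / 24))) * enn (norm (g l p) * m1 dt p))))"
  by (subst nn_integral_suminf) (auto simp: nn_integral_cmult)
  also have "... <= (nni mu (%p. enn (2 powr (1/24)) * enn (norm (f p) * m1 dt p * (dt * snd p) powr (- (1/24)))))"
  proof (rule nn_integral_mono)
  fix p
  have "(%l. enn (2 powr (- (real l / 24))) * enn (norm (g l p) * m1 dt p)) = (%l. if l = lev p then enn (2 powr (- (real l / 24)) * (norm (f p) * m1 dt p)) else 0)"
  by (auto simp: g_def fun_eq_iff ennreal_mult)
  then have "(\<Sum>l. enn (2 powr (- (real l / 24))) * enn (norm (g l p) * m1 dt p)) = enn (2 powr (- (real (lev p) / 24)) * (norm (f p) * m1 dt p))"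
  by (simp only: single)
  also have "... <= enn (2 powr (1/24) * (norm (f p) * m1 dt p * (dt * snd p) powr (- (1/24))))"
  proof (cases "f p = 0")
  case False
  have s: "0 < dt * snd p" using supp[OF False] by linarith
  have "(2 powr (real (lev p) + 1)) powr (- (1/24)) <= (dt * snd p) powr (- (1/24))"
  using lev(2)[OF False] s by (intro powr_mono2') auto
  then have "2 powr (1/24) * (2 powr (real (lev p) + 1)) powr (- (1/24)) <= 2 powr (1/24) * (dt * snd p) powr (- (1/24))"
  by (intro mult_left_mono) auto
  moreover have "2 powr (1/24) * (2 powr (real (lev p) + 1)) powr (- (1/24)) = 2 powr (- (real (lev p) / 24))"
  proof -
  have "2 powr (1/24) * (2 powr (real (lev p) + 1)) powr (- (1/24)) = 2 powr (1/24 + (real (lev p) + 1) * (- (1/24)))" unfolding powr_powr by (rule powr_add[symmetric])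
  also have "1/24 + (real (lev p) + 1) * (- (1/24)) = - (real (lev p) / 24)" by (simp add: field_simps)
  finally show ?thesis .
  qed
  ultimately have "2 powr (- (real (lev p) / 24)) * (norm (f p) * m1 dt p) <= 2 powr (1/24) * (dt * snd p) powr (- (1/24)) * (norm (f p) * m1 dt p)"
  by (intro mult_right_mono) auto
  then show ?thesis by (intro ennreal_leI) (simp only: mult_ac)
  qed simp
  also have "... = enn (2 powr (1/24)) * enn (norm (f p) * m1 dt p * (dt * snd p) powr (- (1/24)))"
  by (simp add: ennreal_mult)
  finally show "(\<Sum>l. enn (2 powr (- (real l / 24))) * enn (norm (g l p) * m1 dt p)) <= enn (2 powr (1/24)) * enn (norm (f p) * m1 dt p * (dt * snd p) powr (- (1/24)))" .
  qed
  also have "... = enn (2 powr (1/24)) * ?R" by (rule nn_integral_cmult) measurable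
  finally show ?thesis .
 qed
 let ?Q = "\<integral>\<^sup>+p. enn ((dt * snd p) powr (7/12) * (norm (f p))^2) \<partial>mu"
 have J_sq: "(\<Sum>l. (enn (2 powr (- (real l / 24))) * ?J l)^2) <= 2 * ?R^2"
 proof -
  have "(\<Sum>l. (enn (2 powr (- (real l / 24))) * ?J l)^2) <= (enn (2 powr (1/24)) * ?R)^2"
  by (rule order_trans[OF ennreal_sum_squares_le power_mono[OF J_sum]]) simp
  also have "... = enn (2 powr (1/12)) * ?R^2" by (simp add: power_mult_distrib ennreal_power powr_power)
  also have "... <= enn (2 powr 1) * ?R^2" by (intro mult_right_mono ennreal_leI powr_mono) auto
  finally show ?thesis by simp
 qed
 have "energy f dt <= (nni lborel (%th. (enn geo * (\<Sum>l. enn (2 powr (real l / 12)) * enn ((norm (T (g l) th))^2))) * enn (shell dt th)))"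
  unfolding energy_def by (intro nn_integral_mono mult_right_mono T_sq) simp
 also have "... = (nni lborel (%th. enn geo * (\<Sum>l. enn (2 powr (real l / 12)) * (enn ((norm (T (g l) th))^2) * enn (shell dt th)))))"
  by (rule nn_integral_cong) (simp only: mult.assoc ennreal_suminf_multc[symmetric])
 also have "... = enn geo * (\<Sum>l. enn (2 powr (real l / 12)) * energy (g l) dt)"
 proof -
  define h where "h l th = enn ((norm (T (g l) th))^2) * enn (shell dt th)" for l th
  have [measurable]: "h l: borel_measurable borel" for l unfolding h_def[abs_def] by measurable
  have "(nni lborel (%th. enn geo * (\<Sum>l. enn (2 powr (real l / 12)) * h l th))) = enn geo * (nni lborel (%th. (\<Sum>l. enn (2 powr (real l / 12)) * h l th)))"
  by (rule nn_integral_cmult) measurable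
  also have "(nni lborel (%th. (\<Sum>l. enn (2 powr (real l / 12)) * h l th))) = (\<Sum>l. \<integral>\<^sup>+th. enn (2 powr (real l / 12)) * h l th \<partial>lborel)"
  by (rule nn_integral_suminf) measurable
  also have "(%l. \<integral>\<^sup>+th. enn (2 powr (real l / 12)) * h l th \<partial>lborel) = (%l. enn (2 powr (real l / 12)) * (nni lborel (%th. h l th)))"
  by (intro ext nn_integral_cmult) measurable
  finally show ?thesis unfolding energy_def h_def .
 qed
 also have "... <= enn geo * (\<Sum>l. enn (C3 / dt^2) * (enn (2 powr (real l * (7/12))) * ?A l) + enn (C3 * dt ^ b) * (enn (2 powr (- (real l / 24))) * ?J l)^2)"
  by (intro mult_left_mono suminf_le piece) auto
 also have "... = enn geo * (enn (C3 / dt^2) * (\<Sum>l. enn (2 powr (real l * (7/12))) * ?A l) + enn (C3 * dt ^ b) * (\<Sum>l. (enn (2 powr (- (real l / 24))) * ?J l)^2))"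
  by (simp only: ennreal_suminf_cmult suminf_add[symmetric, OF summableI summableI])
 also have "... <= enn geo * (enn (C3 / dt^2) * (2 * ?Q) + enn (C3 * dt ^ b) * (2 * ?R^2))"
 proof (intro mult_left_mono add_mono J_sq)
  have "?Q * 1 <= ?Q * 2" by (intro mult_left_mono) auto
  then show "(\<Sum>l. enn (2 powr (real l * (7/12))) * ?A l) <= 2 * ?Q" using A_sum by (simp add: mult.commute)
 qed auto
 also have "... = enn (C4 / dt^2) * ?Q + enn (C4 * dt ^ b) * ?R^2"
 proof -
  have e: "enn (C4 / dt^2) = enn geo * (enn (C3 / dt^2) * 2)" "enn (C4 * dt ^ b) = enn geo * (enn (C3 * dt ^ b) * 2)"
  using geo_pos C3_nonneg dt unfolding C4_def ennreal_numeral[symmetric]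
  by (auto simp: ennreal_mult[symmetric] intro!: arg_cong[of _ _ ennreal] simp del: ennreal_numeral)
  show ?thesis unfolding e by (simp only: distrib_left mult.assoc)
 qed
 finally show ?thesis .
qed

end

section \<open>Choosing the best of the four bounds\<close>

lemma exp_powr: "exp (x :: real) powr y = exp (y * x)"
 by (simp add: powr_def)

lemma nn_integral_positive_axis_FTC:
 fixes f F :: "real => real"
 assumes "\<And>x. 0 < x ==> (F has_real_derivative f x) (at x)" "\<And>x. 0 < x ==> isCont f x" "\<And>x. 0 < x ==> 0 <= f x"
  and "(F \<longlongrightarrow> A) (at_right 0)" "(F \<longlongrightarrow> B) at_top"
 shows "(nni lborel (%x. enn (indicator {0<..} x * f x))) = enn (B - A)"
proof -
 have e: "einterval (ereal 0) \<infinity> = {0<..}" by (auto simp: einterval_def)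
 have *: "0 < ereal x ==> 0 < x" for x by simp
 have i: "set_integrable lborel (einterval 0 \<infinity>) f"
  by (rule interval_integral_FTC_nonneg[of 0 \<infinity> F f A B])
  (use assms in \<open>auto simp: zero_ereal_def ereal_tendsto_simps[unfolded comp_def] comp_def\<close>)
 have v: "(LBINT x=0..\<infinity>. f x) = B - A"
  by (rule interval_integral_FTC_nonneg[of 0 \<infinity> F f A B])
  (use assms in \<open>auto simp: zero_ereal_def ereal_tendsto_simps[unfolded comp_def] comp_def\<close>)
 have "(nni lborel (%x. enn (indicator {0<..} x * f x))) = enn (LINT x|lborel. indicator {0<..} x * f x)"
  using i assms(3) unfolding zero_ereal_def e set_integrable_def
  by (intro nn_integral_eq_integral) (auto simp: indicator_def)
 also have "(LINT x|lborel. indicator {0<..} x * f x) = B - A"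
  using v unfolding zero_ereal_def interval_lebesgue_integral_def e set_lebesgue_integral_def by simp
 finally show ?thesis .
qed

lemma bump_sum:
 fixes q t :: real
 assumes q: "0 < q" "q < 1"
 shows "(\<Sum>j<n. q powr \<bar>real j - t\<bar>) <= 2 / (1 - q)"
proof -
 define m where "m = nat \<lfloor>t\<rfloor>"
 have tot: "(\<Sum>i\<in>A. q ^ i) <= 1 / (1 - q)" if "finite A" for A
  using sum_le_suminf[OF summable_geometric[of q] that] q suminf_geometric[of q] by simp
 have p: "q powr x <= q ^ i" if "real i <= x" for x i
  using powr_mono'[OF that, of q] q by (simp add: powr_realpow)
 let ?A = "{j. j < n & real j <= t}" and ?B = "{j. j < n & t < real j}"
 have "(\<Sum>j<n. q powr \<bar>real j - t\<bar>) = (\<Sum>j\<in>?A. q powr \<bar>real j - t\<bar>) + (\<Sum>j\<in>?B. q powr \<bar>real j - t\<bar>)"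
  by (subst sum.union_disjoint[symmetric]) (auto intro!: sum.cong)
 also have "... <= (\<Sum>j\<in>?A. q ^ (m - j)) + (\<Sum>j\<in>?B. q ^ (if t < 0 then j else j - Suc m))"
 proof (intro add_mono sum_mono p)
  fix j assume "j \<in> ?A" then show "real (m - j) <= \<bar>real j - t\<bar>" unfolding m_def by (auto simp: of_nat_diff) linarith
 next
  fix j assume "j \<in> ?B" then show "real (if t < 0 then j else j - Suc m) <= \<bar>real j - t\<bar>" unfolding m_def by (auto simp: of_nat_diff) linarith+
 qed
 also have "(\<Sum>j\<in>?A. q ^ (m - j)) = (\<Sum>i\<in>(%j. m - j) ` ?A. q ^ i)"
 proof (rule sum.reindex_cong[OF _ refl refl, symmetric])
  show "inj_on (%j. m - j) ?A" unfolding m_def by (intro inj_onI) (auto, linarith)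
 qed
 also have "(\<Sum>j\<in>?B. q ^ (if t < 0 then j else j - Suc m)) = (\<Sum>i\<in>(%j. if t < 0 then j else j - Suc m) ` ?B. q ^ i)"
 proof (rule sum.reindex_cong[OF _ refl refl, symmetric])
  show "inj_on (%j. if t < 0 then j else j - Suc m) ?B" unfolding m_def by (intro inj_onI) (auto split: if_splits, linarith)
 qed
 also have "(\<Sum>i\<in>(%j. m - j) ` ?A. q ^ i) + (\<Sum>i\<in>(%j. if t < 0 then j else j - Suc m) ` ?B. q ^ i) <= 1 / (1 - q) + 1 / (1 - q)"
  by (intro add_mono tot) auto
 finally show ?thesis by simp
qed

context kernel_pair begin

definition "ep = 1 / (64 * real a)"
definition "bump y Y = min ((y / Y) powr (2 * ep)) ((Y / y) powr (2 * ep))"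
definition "steep P Q \<longleftrightarrow> P < max 1 Q powr (- (1 / (16 * (real a - 1))))" for P Q :: real
definition "Yl P Q = (if steep P Q then max 1 Q powr (- 2) else max 1 Q powr (- (17/16)))"
definition "Yh P Q = (if steep P Q then P powr (- (real a - 1)) else max 1 Q powr (- (15/16)))"

lemma eps: "0 < ep" "ep <= 1 / 128" "64 * ep * real a = 1" using a2 by (auto simp: ep_def field_simps)

lemma bump_nonneg [simp]: "0 <= bump y Y" by (simp add: bump_def)

lemma bump_upper: "0 < Y ==> Y <= y ==> (Y / y) powr (2 * ep) <= bump y Y"
proof -
 assume "0 < Y" "Y <= y"
 then have "Y / y <= 1" "1 <= y / Y" "0 <= Y / y" by simp_all
 then show "(Y / y) powr (2 * ep) <= bump y Y"
  unfolding bump_def using eps by (intro min.boundedI powr_mono2) auto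
qed

lemma bump_lower: "0 < y ==> y <= Y ==> (y / Y) powr (2 * ep) <= bump y Y"
proof -
 assume "0 < y" "y <= Y"
 then have "y / Y <= 1" "1 <= Y / y" "0 <= y / Y" by simp_all
 then show "(y / Y) powr (2 * ep) <= bump y Y"
  unfolding bump_def using eps by (intro min.boundedI powr_mono2) auto
qed

context
 fixes y P Q :: real
 assumes y: "0 < y" and P: "0 < P" and Q: "0 < Q"
begin

lemma Y_pos: "0 < Yl P Q" "0 < Yh P Q" using P Q by (auto simp: Yl_def Yh_def)

lemma power_lower: fixes x :: real assumes "1 <= x" shows "x <= x ^ (b - 1)"
 using self_le_power[OF assms, of "b - 1"] b2 by simp

context
 fixes v u q :: real
 assumes yv: "y = exp v" and Pu: "P = exp u" and Qq: "max 1 Q = exp q" and q0: "0 <= q"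
begin

lemma steep_iff: "steep P Q \<longleftrightarrow> (real a - 1) * u < - (1/16) * q"
proof -
 have "steep P Q \<longleftrightarrow> u < - (1 / (16 * (real a - 1))) * q"
  by (simp add: steep_def Pu Qq exp_powr)
 also have "... \<longleftrightarrow> (real a - 1) * u < - (1/16) * q" using a2 by (simp add: field_simps)
 finally show ?thesis .
qed

lemma Yl_exp: "Yl P Q = exp (if steep P Q then - 2 * q else - (17/16) * q)"
 and Yh_exp: "Yh P Q = exp (if steep P Q then - (real a - 1) * u else - (15/16) * q)"
 by (simp_all add: Yl_def Yh_def Qq exp_powr Pu)

lemma Q_le: "Q <= exp q" using Qq by (metis max.cobounded2)

lemma P_pow: "P ^ (a - 1) = exp ((real a - 1) * u)"
 unfolding Pu using a2 by (simp add: exp_of_nat_mult[symmetric] of_nat_diff)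

text \<open>The absolute value bound is good for large \<open>y\<close>, that is, for large values of \<open>f\<close> or small angles. In the following lemmas all quantities are written as exponentials, which turns the claims into linear inequalities between exponents.\<close>

lemma rate_high_aux:
 assumes "Yh P Q <= y"
 shows "1 / (y * P ^ (a - 1) * (y + Q) ^ (b - 1)) <= (Yh P Q / y) powr (2 * ep)"
proof -
 have r: "0 < Yh P Q / y" "Yh P Q / y <= 1" using assms y Y_pos by auto
 have "1 / (y * P ^ (a - 1) * (y + Q) ^ (b - 1)) <= Yh P Q / y"
 proof (cases "steep P Q")
  case True
  then have h: "Yh P Q = exp (- (real a - 1) * u)" by (simp add: Yh_exp)
  have "0 <= - ((real a - 1) * u)" using True[unfolded steep_iff] q0 by linarith
  then have "1 <= Yh P Q" by (simp only: h mult_minus_left one_le_exp_iff)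
  then have "1 <= y + Q" using assms Q by linarith
  then have "1 <= (y + Q) ^ (b - 1)" by simp
  then have "1 / (y * P ^ (a - 1) * (y + Q) ^ (b - 1)) <= 1 / (y * P ^ (a - 1) * 1)"
  using y P by (intro divide_left_mono mult_left_mono) auto
  also have "... = Yh P Q / y"
  proof -
  have "1 / (y * exp z * 1) = exp (- z) / y" for z by (simp add: exp_minus field_simps)
  then show ?thesis unfolding h P_pow mult_minus_left .
  qed
  finally show ?thesis .
 next
  case False
  then have h: "Yh P Q = exp (- (15/16) * q)" by (simp add: Yh_exp)
  have Pl: "exp (- (1/16) * q) <= P ^ (a - 1)" unfolding P_pow using False unfolding steep_iff by simp
  have yQ1: "1 <= y + Q" "exp q <= y + Q"
  proof -
  have "exp q <= y + Q"
  proof (cases "1 <= Q")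
  case True
  then show ?thesis using Qq y by simp
  next
  case False
  then have "exp q = 1" using Qq by simp
  then have "Yh P Q = 1" unfolding h by simp
  then show ?thesis using assms Q \<open>exp q = 1\<close> by simp
  qed
  moreover have "1 <= exp q" using q0 by simp
  ultimately show "1 <= y + Q" "exp q <= y + Q" by linarith+
  qed
  have yQ: "exp q <= (y + Q) ^ (b - 1)"
  by (rule order_trans[OF yQ1(2) power_lower[OF yQ1(1)]])
  have "y * (exp (- (1/16) * q) * exp q) <= y * (P ^ (a - 1) * (y + Q) ^ (b - 1))"
  using y P by (intro mult_left_mono mult_mono Pl yQ) auto
  then have "1 / (y * P ^ (a - 1) * (y + Q) ^ (b - 1)) <= 1 / (y * (exp (- (1/16) * q) * exp q))"
  using y P Q by (intro divide_left_mono) (auto simp: mult.assoc)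
  also have "... = Yh P Q / y"
  proof -
  have "exp (- (1/16) * q) * exp q = exp ((15/16) * q)" by (simp add: exp_add[symmetric])
  then show ?thesis unfolding h by (simp add: exp_minus field_simps)
  qed
  finally show ?thesis .
 qed
 also have "... = (Yh P Q / y) powr 1" using r by (simp only: powr_one less_imp_le)
 also have "... <= (Yh P Q / y) powr (2 * ep)" using r eps by (intro powr_mono') auto
 finally show ?thesis .
qed

text \<open>For small \<open>y\<close> the Hankel transform in \<open>\<rho>\<close> is efficient.\<close>

lemma rate_low_aux:
 assumes "y < Yl P Q"
 shows "y^2 * (1 + Q / y) powr (1 + ep) <= 4 * (y / Yl P Q) powr (2 * ep)"
proof -
 define l where "l = (if steep P Q then - 2 * q else - (17/16) * q)"
 have Yl: "Yl P Q = exp l" by (simp add: Yl_exp l_def)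
 have l: "l <= 0" "l <= - (17/16) * q" using q0 by (auto simp: l_def)
 have vl: "v < l" using assms unfolding Yl yv by simp
 have "1 + Q / y <= 2 * exp (q - v)"
 proof -
  have "1 <= exp (q - v)" using q0 vl l by simp
  moreover have "Q / y <= exp (q - v)" using Q_le y unfolding yv by (simp add: exp_diff divide_right_mono)
  ultimately show ?thesis by linarith
 qed
 then have "(1 + Q / y) powr (1 + ep) <= (2 * exp (q - v)) powr (1 + ep)"
  using eps y Q by (intro powr_mono2) auto
 also have "... = 2 powr (1 + ep) * exp ((1 + ep) * (q - v))" by (simp add: powr_mult exp_powr)
 also have "... <= 4 * exp ((1 + ep) * (q - v))"
 proof (intro mult_right_mono)
  have "2 powr (1 + ep) <= 2 powr 2" using eps by (intro powr_mono) auto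
  then show "2 powr (1 + ep) <= 4" by simp
 qed simp
 finally have "y^2 * (1 + Q / y) powr (1 + ep) <= y^2 * (4 * exp ((1 + ep) * (q - v)))"
  by (rule mult_left_mono) simp
 also have "... = 4 * exp (2 * v + (1 + ep) * (q - v))" by (simp add: yv exp_add exp_double)
 also have "... <= 4 * exp (2 * ep * (v - l))"
 proof -
  have "(1 - ep) * (v - l) <= 2 * ep * (v - l)" using eps vl by (intro mult_right_mono_neg) auto
  moreover have "(1 - ep) * l + (1 + ep) * q <= 0"
  proof -
  have "(1 - ep) * l <= (1 - ep) * (- (17/16) * q)" using eps l by (intro mult_left_mono) auto
  moreover have "ep * q <= 1 / 128 * q" using eps q0 by (intro mult_right_mono) auto
  moreover have "(1 - ep) * (- (17/16) * q) = - (17/16) * q + 17/16 * (ep * q)" "(1 + ep) * q = q + ep * q" by (simp_all add: field_simps)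
  ultimately show ?thesis using q0 by argo
  qed
  moreover have "(1 - ep) * (v - l) = v - ep * v - (1 - ep) * l" "(1 + ep) * (q - v) = (1 + ep) * q - v - ep * v" by (simp_all add: algebra_simps)
  ultimately have "2 * v + (1 + ep) * (q - v) <= 2 * ep * (v - l)" by argo
  then show ?thesis by simp
 qed
 also have "... = 4 * (y / Yl P Q) powr (2 * ep)" by (simp add: yv Yl exp_diff[symmetric] exp_powr)
 finally show ?thesis .
qed

text \<open>If \<open>P\<close> is small compared with \<open>Q\<close>, the Hankel transform in \<open>s\<close> covers the whole intermediate range of \<open>y\<close>.\<close>

lemma rate_steep_aux:
 assumes st: "steep P Q"
 shows "P * ((P / y^2) powr ep + (y^2 / P) powr ep) <= (Yl P Q / y) powr (2 * ep) + (y / Yh P Q) powr (2 * ep)"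
proof -
 have a1: "1 <= real a - 1" using a2 by simp
 have au: "(real a - 1) * u < - (1/16) * q" using st by (simp add: steep_iff)
 have u0: "u <= 0"
 proof (rule ccontr)
  assume "\<not> u <= 0"
  then have "0 <= (real a - 1) * u" using a1 by simp
  then show False using au q0 by linarith
 qed
 have yy: "y^2 = exp (2 * v)" by (simp add: yv exp_double)
 have "P * (P / y^2) powr ep = exp (u + ep * (u - 2 * v))"
  by (simp add: yy Pu exp_diff[symmetric] exp_powr exp_add)
 also have "... <= exp (2 * ep * (- 2 * q - v))"
 proof -
  have "ep * (64 * real a * u) <= ep * (- 4 * q)"
  proof (intro mult_left_mono)
  have "64 * real a * u = 64 * ((real a - 1) * u) + 64 * u" by (simp add: algebra_simps)
  then show "64 * real a * u <= - 4 * q" using au u0 by linarith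
  qed (use eps in auto)
  moreover have "ep * (64 * real a * u) = (64 * ep * real a) * u" by (simp only: mult_ac)
  moreover have "ep * u <= 0" using eps u0 by (simp add: mult_nonneg_nonpos)
  moreover have "ep * (u - 2 * v) = ep * u - 2 * (ep * v)" "2 * ep * (- 2 * q - v) = - 4 * (ep * q) - 2 * (ep * v)" "ep * (- 4 * q) = - 4 * (ep * q)" by (simp_all add: algebra_simps)
  ultimately have "u + ep * (u - 2 * v) <= 2 * ep * (- 2 * q - v)" unfolding eps(3) by linarith
  then show ?thesis by simp
 qed
 also have "... = (Yl P Q / y) powr (2 * ep)" using st by (simp add: Yl_exp yv exp_diff[symmetric] exp_powr)
 finally have 1: "P * (P / y^2) powr ep <= (Yl P Q / y) powr (2 * ep)" .
 have "P * (y^2 / P) powr ep = exp (u + ep * (2 * v - u))"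
  by (simp add: yy Pu exp_diff[symmetric] exp_powr exp_add)
 also have "... <= exp (2 * ep * (v + (real a - 1) * u))"
 proof -
  have "u * (1 - 2 * (ep * real a) + ep) <= 0"
  proof (rule mult_nonpos_nonneg[OF u0])
  have "ep * real a = 1 / 64" using eps(3) by simp
  then show "0 <= 1 - 2 * (ep * real a) + ep" using eps by simp
  qed
  moreover have "u * (1 - 2 * (ep * real a) + ep) = u - 2 * (ep * real a * u) + ep * u" "ep * (2 * v - u) = 2 * (ep * v) - ep * u"
  "2 * ep * (v + (real a - 1) * u) = 2 * (ep * v) + 2 * (ep * real a * u) - 2 * (ep * u)" by (simp_all add: algebra_simps)
  ultimately have "u + ep * (2 * v - u) <= 2 * ep * (v + (real a - 1) * u)" by linarith
  then show ?thesis by simp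
 qed
 also have "... = (y / Yh P Q) powr (2 * ep)"
 proof -
  have "Yh P Q = exp (- ((real a - 1) * u))" using st by (simp add: Yh_exp algebra_simps)
  then show ?thesis by (simp only: yv exp_diff[symmetric] exp_powr diff_minus_eq_add)
 qed
 finally have "P * (y^2 / P) powr ep <= (y / Yh P Q) powr (2 * ep)" .
 with 1 show ?thesis by (simp add: distrib_left)
qed

lemma flat_exp:
 assumes st: "\<not> steep P Q" and mid: "Yl P Q <= y" "y < Yh P Q"
 shows "Q = exp q" "0 < q" "- (17/16) * q <= v" "v < - (15/16) * q"
proof -
 show v: "- (17/16) * q <= v" "v < - (15/16) * q" using mid st by (simp_all add: Yl_exp Yh_exp yv)
 show q: "0 < q" using v by linarith
 then show "Q = exp q" using Qq by (auto simp: max_def split: if_splits)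
qed

text \<open>If \<open>P\<close> is not small, none of the bounds without oscillation suffices when \<open>y\<close> is close to \<open>1 / Q\<close>. There \<open>\<delta> s\<close> and \<open>\<rho>\<close> are large enough for the oscillatory bound.\<close>

lemma rate_flat_aux:
 assumes st: "\<not> steep P Q" and mid: "Yl P Q <= y" "y < Yh P Q"
 shows "1 <= Q / y" "(Q / y) powr (1/3) <= P / y^2"
  "y^2 * (Q / y) powr (7/12) <= (y / Yh P Q) powr (2 * ep)"
  "1 / (y * P ^ (a - 1) * (y + Q) ^ (b - 1)) * (Q / y) powr (- (1/12)) <= (Yl P Q / y) powr (2 * ep)"
proof -
 note fl = flat_exp[OF assms]
 have Qy: "Q / y = exp (q - v)" by (simp add: fl(1) yv exp_diff)
 have yy: "y^2 = exp (2 * v)" by (simp add: yv exp_double)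
 have e: "2 * ep <= 1 / 64" "0 < 2 * ep" using eps by auto
 show "1 <= Q / y" unfolding Qy using fl by simp
 have au: "- (1/16) * q <= (real a - 1) * u" using st by (simp add: steep_iff)
 have u: "- (1/16) * q <= u"
 proof (cases "0 <= u")
  case False
  have "(real a - 1) * u <= 1 * u" using False a2 by (intro mult_right_mono_neg) auto
  then show ?thesis using au by linarith
 qed (use fl in auto)
 show "(Q / y) powr (1/3) <= P / y^2"
  unfolding Qy yy Pu exp_powr exp_diff[symmetric] using u fl by simp
 have "y^2 * (Q / y) powr (7/12) = exp (2 * v + 7/12 * (q - v))" by (simp add: Qy yy exp_powr exp_add)
 also have "... <= exp (2 * ep * (v + 15/16 * q))"
 proof -
  have m1: "1/64 * (v + 15/16 * q) <= 2 * ep * (v + 15/16 * q)" using e fl by (intro mult_right_mono_neg) auto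
  have m2: "2 * v + 7/12 * (q - v) <= 1/64 * (v + 15/16 * q)" using fl(2-4) by argo
  show ?thesis unfolding exp_le_cancel_iff by (rule order_trans[OF m2 m1])
 qed
 also have "... = (y / Yh P Q) powr (2 * ep)" using st by (simp add: Yh_exp yv exp_diff[symmetric] exp_powr)
 finally show "y^2 * (Q / y) powr (7/12) <= (y / Yh P Q) powr (2 * ep)" .
 have Q1: "1 <= Q" using fl by simp
 have "Q <= y + Q" using y by simp
 also have "... <= (y + Q) ^ (b - 1)" using power_lower[of "y + Q"] y Q1 by simp
 finally have "exp v * exp (- (1/16) * q) * exp q <= y * P ^ (a - 1) * (y + Q) ^ (b - 1)"
  using au unfolding P_pow yv fl(1) by (intro mult_mono) auto
 then have "1 / (y * P ^ (a - 1) * (y + Q) ^ (b - 1)) <= 1 / (exp v * exp (- (1/16) * q) * exp q)"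
  using y P Q by (intro divide_left_mono) auto
 then have "1 / (y * P ^ (a - 1) * (y + Q) ^ (b - 1)) * (Q / y) powr (- (1/12)) <= 1 / (exp v * exp (- (1/16) * q) * exp q) * (Q / y) powr (- (1/12))"
  by (rule mult_right_mono) simp
 also have "... = exp (- (v + - (1/16) * q + q)) * exp (- (1/12) * (q - v))"
  by (simp only: Qy exp_powr exp_minus exp_add inverse_eq_divide)
 also have "... = exp (- (v + - (1/16) * q + q) + - (1/12) * (q - v))" by (simp only: exp_add)
 also have "... <= exp (2 * ep * (- (17/16) * q - v))"
 proof -
  have m1: "1/64 * (- (17/16) * q - v) <= 2 * ep * (- (17/16) * q - v)" using e fl by (intro mult_right_mono_neg) auto
  have m2: "- (v + - (1/16) * q + q) + - (1/12) * (q - v) <= 1/64 * (- (17/16) * q - v)" using fl(2-4) by argo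
  show ?thesis unfolding exp_le_cancel_iff by (rule order_trans[OF m2 m1])
 qed
 also have "... = (Yl P Q / y) powr (2 * ep)" using st by (simp add: Yl_exp yv exp_diff[symmetric] exp_powr)
 finally show "1 / (y * P ^ (a - 1) * (y + Q) ^ (b - 1)) * (Q / y) powr (- (1/12)) <= (Yl P Q / y) powr (2 * ep)" .
qed

end

lemma logs: "y = exp (ln y)" "P = exp (ln P)" "max 1 Q = exp (ln (max 1 Q))" "0 <= ln (max 1 Q)"
 using y P Q by auto

lemma rate_high: "Yh P Q <= y ==> 1 / (y * P ^ (a - 1) * (y + Q) ^ (b - 1)) <= bump y (Yh P Q)"
 by (rule order_trans[OF rate_high_aux[OF logs] bump_upper]) (auto simp: Y_pos)

lemma rate_low: "y < Yl P Q ==> y^2 * (1 + Q / y) powr (1 + ep) <= 4 * bump y (Yl P Q)"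
 by (rule order_trans[OF rate_low_aux[OF logs] mult_left_mono[OF bump_lower]]) (auto simp: y)

lemma rate_steep:
 "steep P Q ==> Yl P Q <= y ==> y < Yh P Q ==> P * ((P / y^2) powr ep + (y^2 / P) powr ep) <= bump y (Yl P Q) + bump y (Yh P Q)"
 by (rule order_trans[OF rate_steep_aux[OF logs] add_mono[OF bump_upper bump_lower]]) (auto simp: y Y_pos)

lemma rate_flat:
 assumes "\<not> steep P Q" "Yl P Q <= y" "y < Yh P Q"
 shows "1 <= Q / y" "(Q / y) powr (1/3) <= P / y^2"
  "y^2 * (Q / y) powr (7/12) <= bump y (Yh P Q)"
  "1 / (y * P ^ (a - 1) * (y + Q) ^ (b - 1)) * (Q / y) powr (- (1/12)) <= bump y (Yl P Q)"
 using rate_flat_aux[OF logs assms] bump_upper[OF Y_pos(1) assms(2)] bump_lower[OF y less_imp_le[OF assms(3)]] by linarith+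

end

lemma weight_s:
 assumes "0 < dt"
 shows "(nni lborel (%s. enn (indicator {0<..} s / (1 + dt * s) powr (1 + ep)))) <= enn (1 / (ep * dt))"
proof -
 have "(nni lborel (%s. enn (indicator {0<..} s * (1 + dt * s) powr (- ep - 1)))) = enn (0 - (- (1 / (ep * dt))))"
 proof (rule nn_integral_positive_axis_FTC[where F = "%s. - ((1 + dt * s) powr (- ep) / (ep * dt))"])
  fix x :: real assume "0 < x"
  then have p: "0 < 1 + dt * x" using assms by (simp add: add_pos_pos)
  show "((%s. - ((1 + dt * s) powr (- ep) / (ep * dt))) has_real_derivative (1 + dt * x) powr (- ep - 1)) (at x)"
  proof -
  define w where "w = (1 + dt * x) powr (- ep - 1)"
  have "((%s. 1 + dt * s) has_real_derivative dt) (at x)" by (auto intro!: derivative_eq_intros)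
  from DERIV_chain2[OF has_real_derivative_powr[OF p] this]
  have "((%s. - ((1 + dt * s) powr (- ep) / (ep * dt))) has_real_derivative - (- ep * w * dt / (ep * dt))) (at x)"
  unfolding w_def by (intro DERIV_minus DERIV_cdivide)
  also have "- (- ep * w * dt / (ep * dt)) = w" using assms eps by (simp add: field_simps)
  finally show ?thesis unfolding w_def .
  qed
  show "isCont (%s. (1 + dt * s) powr (- ep - 1)) x"
  using p by (intro continuous_intros) auto
 next
  have "((%s. - ((1 + dt * s) powr (- ep) / (ep * dt))) \<longlongrightarrow> - ((1 + dt * 0) powr (- ep) / (ep * dt))) (at 0)"
  using assms eps by (intro tendsto_intros) auto
  then show "((%s. - ((1 + dt * s) powr (- ep) / (ep * dt))) \<longlongrightarrow> - (1 / (ep * dt))) (at_right 0)"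
  by (simp add: filterlim_at_split)
  have "filterlim (%s. 1 + dt * s) at_top at_top"
  using assms by (intro filterlim_tendsto_add_at_top[OF tendsto_const] filterlim_tendsto_pos_mult_at_top[OF tendsto_const] filterlim_ident)
  then have "((%s. (1 + dt * s) powr (- ep)) \<longlongrightarrow> 0) at_top" using eps by (intro tendsto_neg_powr) auto
  then have "((%s. - ((1 + dt * s) powr (- ep) / (ep * dt))) \<longlongrightarrow> - (0 / (ep * dt))) at_top"
  by (intro tendsto_intros) (use assms eps in auto)
  then show "((%s. - ((1 + dt * s) powr (- ep) / (ep * dt))) \<longlongrightarrow> 0) at_top" by simp
 qed simp
 moreover have "indicator {0<..} s / (1 + dt * s) powr (1 + ep) = indicator {0<..} s * (1 + dt * s) powr (- ep - 1)" for s :: real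
 proof -
  have e: "- ep - 1 = - (1 + ep)" by simp
  show ?thesis unfolding e powr_minus_divide by simp
 qed
 ultimately show ?thesis by simp
qed

lemma weight_rho:
 assumes "0 < dt"
 shows "(nni lborel (%r. enn (indicator {0<..} r / (r * ((dt^2 * r) powr ep + (1 / (dt^2 * r)) powr ep))))) <= enn (2 / ep)"
proof -
 let ?f = "%r. 1 / (r * ((dt^2 * r) powr ep + (1 / (dt^2 * r)) powr ep))"
 have "(nni lborel (%r. enn (indicator {0<..} r * ?f r))) = enn ((pi / 2) / ep - 0)"
 proof (rule nn_integral_positive_axis_FTC[where F = "%r. arctan ((dt^2 * r) powr ep) / ep"])
  fix x :: real assume x: "0 < x"
  have p: "0 < dt^2 * x" using assms x by simp
  have z: "(1 / (dt^2 * x)) powr ep = 1 / ((dt^2 * x) powr ep)" using p by (simp add: powr_divide)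
  define z where "z = (dt^2 * x) powr ep"
  have z0: "0 < z" using assms x by (simp add: z_def)
  have "((%r. arctan ((dt^2 * r) powr ep) / ep) has_real_derivative (inverse (1 + z^2) * (ep * (dt^2 * x) powr (ep - 1) * dt^2)) / ep) (at x)"
  unfolding z_def using p by (auto intro!: derivative_eq_intros simp: mult_ac)
  also have "(inverse (1 + z^2) * (ep * (dt^2 * x) powr (ep - 1) * dt^2)) / ep = ?f x"
  proof -
  have "(dt^2 * x) powr (ep - 1) * dt^2 = z / x" using p assms x by (simp add: powr_diff z_def field_simps)
  then have "(inverse (1 + z^2) * (ep * (dt^2 * x) powr (ep - 1) * dt^2)) / ep = inverse (1 + z^2) * (z / x)"
  using eps by simp
  also have "... = 1 / (x * (z + 1 / z))" using z0 x by (simp add: field_simps power2_eq_square add_pos_pos)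
  finally show ?thesis unfolding z z_def[symmetric] .
  qed
  finally show "((%r. arctan ((dt^2 * r) powr ep) / ep) has_real_derivative ?f x) (at x)" .
  have "0 < (dt^2 * x) powr ep + (1 / (dt^2 * x)) powr ep" using assms x by (intro add_pos_nonneg) auto
  then show "isCont ?f x" using x p by (intro continuous_intros) auto
  show "0 <= ?f x" using x by simp
 next
  have "((%r. dt^2 * r) \<longlongrightarrow> dt^2 * 0) (at_right 0)" by (intro tendsto_intros)
  then have "((%r. (dt^2 * r) powr ep) \<longlongrightarrow> (dt^2 * 0) powr ep) (at_right 0)"
  proof (rule tendsto_powr'[OF _ tendsto_const])
  have "\<forall>\<^sub>F r in at_right 0. 0 <= dt^2 * r"
  using assms by (intro eventually_mono[OF eventually_at_right_less[of 0]]) simp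
  then show "dt^2 * 0 ~= 0 \<or> 0 < ep & (\<forall>\<^sub>F x in at_right 0. 0 <= dt^2 * x)" using eps by simp
  qed
  then have "((%r. (dt^2 * r) powr ep) \<longlongrightarrow> 0 powr ep) (at_right 0)" by simp
  then have "((%r. arctan ((dt^2 * r) powr ep) / ep) \<longlongrightarrow> arctan (0 powr ep) / ep) (at_right 0)"
  by (intro tendsto_divide[OF tendsto_arctan tendsto_const]) (use eps in auto)
  then show "((%r. arctan ((dt^2 * r) powr ep) / ep) \<longlongrightarrow> 0) (at_right 0)" by simp
  have 1: "filterlim (%r. dt^2 * r) at_top at_top"
  using assms by (intro filterlim_tendsto_pos_mult_at_top[OF tendsto_const] filterlim_ident) auto
  have 2: "filterlim (%x::real. x powr ep) at_top at_top" using eps by (intro real_powr_at_top) 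
  have "filterlim (%r. (dt^2 * r) powr ep) at_top at_top" by (rule filterlim_compose[OF 2 1])
  then have "((%r. arctan ((dt^2 * r) powr ep)) \<longlongrightarrow> pi / 2) at_top" by (rule filterlim_compose[OF tendsto_arctan_at_top])
  then show "((%r. arctan ((dt^2 * r) powr ep) / ep) \<longlongrightarrow> (pi / 2) / ep) at_top" using eps by (intro tendsto_intros) auto
 qed
 also have "... <= enn (2 / ep)" using eps pi_less_4 divide_right_mono[of "pi / 2" 2 ep] by (intro ennreal_leI) simp
 finally show ?thesis by simp
qed

end

lemma powr_square: "((x::real) powr y)^2 = x powr (2 * y)"
 by (simp add: power2_eq_square powr_add[symmetric])

context kernel_pair begin

lemma steep_measurable [measurable (raw)]:
 assumes [measurable]: "P: borel_measurable M" "Q: borel_measurable M"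
 shows "Measurable.pred M (%x. steep (P x) (Q x))"
 unfolding steep_def by measurable

lemma Yl_measurable [measurable (raw)]:
 assumes [measurable]: "P: borel_measurable M" "Q: borel_measurable M"
 shows "(%x. Yl (P x) (Q x)): borel_measurable M"
 unfolding Yl_def by measurable

lemma Yh_measurable [measurable (raw)]:
 assumes [measurable]: "P: borel_measurable M" "Q: borel_measurable M"
 shows "(%x. Yh (P x) (Q x)): borel_measurable M"
 unfolding Yh_def by measurable

lemma bump_measurable [measurable (raw)]:
 assumes [measurable]: "y: borel_measurable M" "Y: borel_measurable M"
 shows "(%x. bump (y x) (Y x)): borel_measurable M"
 unfolding bump_def by measurable

definition "N = real a + 1 + real b / 2"
definition "pa = 2 * (2 * real a + real b) / (2 * real a + real b + 2)"
definition "D1 = C1 ^ 4 * 2 ^ b"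
definition "D2 = C1^2 * (2 / ep) * (2 * K)"
definition "D3 = C1^2 * (2 ^ b * K) / ep"
definition "D = D1 + D2 + 4 * D3 + 2 * C4"

lemma N_pos: "0 < N" by (simp add: N_def)

lemma N_eq: "N * (2 - pa) = 2" "N * (2 - 2 * pa) = - (2 * (real a - 1) + real b)"
 unfolding N_def pa_def by (auto simp: field_simps add_pos_pos)

lemma D_nonneg: "0 <= D1" "0 <= D2" "0 <= D3" "0 <= D"
 using C1_ge_1 K1 eps C4_nonneg by (auto simp: D1_def D2_def D3_def D_def)

text \<open>Jensen's inequality for the density \<open>norm f powr pa\<close> of total mass at most 1.\<close>

lemma square_integral_le:
 assumes [measurable]: "f: borel_measurable borel" "X: borel_measurable borel"
  and X: "\<And>p. 0 <= X p"
  and f1: "(nni mu (%p. enn (norm (f p) powr pa))) <= 1"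
 shows "(nni mu (%p. enn (norm (f p :: complex) * X p)))^2 <= (nni mu (%p. enn (norm (f p) powr pa * (norm (f p) powr (2 - 2 * pa) * (X p)^2))))"
proof -
 have 1: "enn (norm (f p) * X p) = enn (norm (f p) powr (pa / 2)) * enn (norm (f p) powr (1 - pa / 2) * X p)" for p
 proof (cases "f p = 0")
  case False
  have "norm (f p) powr (pa / 2) * norm (f p) powr (1 - pa / 2) = norm (f p)"
  using False by (simp add: powr_add[symmetric])
  then show ?thesis using X by (simp add: ennreal_mult[symmetric] mult.assoc[symmetric])
 qed simp
 have 2: "(enn (norm (f p) powr (pa / 2)))^2 = enn (norm (f p) powr pa)" for p
  by (simp add: ennreal_power powr_square)
 have 3: "(enn (norm (f p) powr (1 - pa / 2) * X p))^2 = enn (norm (f p) powr pa * (norm (f p) powr (2 - 2 * pa) * (X p)^2))" for p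
 proof -
  have "(norm (f p) powr (1 - pa / 2))^2 = norm (f p) powr pa * norm (f p) powr (2 - 2 * pa)"
  by (cases "f p = 0") (simp_all add: powr_square powr_add[symmetric])
  then show ?thesis using X by (simp add: ennreal_power power_mult_distrib mult.assoc)
 qed
 have "(nni mu (%p. enn (norm (f p) * X p)))^2 <= (nni mu (%p. enn (norm (f p) powr pa))) * (nni mu (%p. enn (norm (f p) powr pa * (norm (f p) powr (2 - 2 * pa) * (X p)^2))))"
  unfolding 1 2[symmetric] 3[symmetric] by (rule Cauchy_Schwarz_nn_integral) measurable
 also have "... <= 1 * (nni mu (%p. enn (norm (f p) powr pa * (norm (f p) powr (2 - 2 * pa) * (X p)^2))))"
  by (intro mult_right_mono f1) simp
 finally show ?thesis by simp
qed

context
 fixes f :: "real * real => complex" and dt :: real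
 assumes f: "integrable mu f" and f1: "(nni mu (%p. enn (norm (f p) powr pa))) <= 1"
  and dt: "0 < dt" "dt <= pi / 8"
begin

definition "height p = norm (f p) powr (1 / N)"
definition "yy p = height p / dt"
definition "PP p = (height p)^2 * fst p"
definition "QQ p = height p * snd p"
definition "rate p = bump (yy p) (Yl (PP p) (QQ p)) + bump (yy p) (Yh (PP p) (QQ p))"
definition "piece A p = (if A p then f p else 0)"
definition "hi p \<longleftrightarrow> Yh (PP p) (QQ p) <= yy p"
definition "lo p \<longleftrightarrow> \<not> hi p & yy p < Yl (PP p) (QQ p)"
definition "st p \<longleftrightarrow> \<not> hi p & \<not> lo p & steep (PP p) (QQ p)"
definition "fl p \<longleftrightarrow> \<not> hi p & \<not> lo p & \<not> steep (PP p) (QQ p) & 0 < fst p & 0 < snd p"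

lemma f_m [measurable]: "f: borel_measurable borel" using f by auto

lemma height_m [measurable]: "height: borel_measurable borel"
 unfolding height_def[abs_def] by measurable
lemma yy_m [measurable]: "yy: borel_measurable borel"
 unfolding yy_def[abs_def] by measurable
lemma PP_m [measurable]: "PP: borel_measurable borel"
 unfolding PP_def[abs_def] by measurable
lemma QQ_m [measurable]: "QQ: borel_measurable borel"
 unfolding QQ_def[abs_def] by measurable
lemma rate_m [measurable]: "rate: borel_measurable borel"
 unfolding rate_def[abs_def] by measurable
lemma hi_m [measurable]: "Measurable.pred borel hi"
 unfolding hi_def[abs_def] by measurable
lemma lo_m [measurable]: "Measurable.pred borel lo"
 unfolding lo_def[abs_def] by measurable
lemma st_m [measurable]: "Measurable.pred borel st"
 unfolding st_def[abs_def] by measurable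
lemma fl_m [measurable]: "Measurable.pred borel fl"
 unfolding fl_def[abs_def] by measurable

lemma piece_m [measurable]: "Measurable.pred borel A ==> piece A: borel_measurable borel"
 unfolding piece_def[abs_def] by measurable

lemma piece_i: "Measurable.pred borel A ==> integrable mu (piece A)"
 by (rule Bochner_Integration.integrable_bound[OF f]) (auto simp: piece_def)

lemma rate_nonneg: "0 <= rate p" by (simp add: rate_def)

lemma piece_f1: "(nni mu (%p. enn (norm (piece A p) powr pa))) <= 1"
 by (rule order_trans[OF nn_integral_mono f1]) (auto simp: piece_def)

abbreviation "mass \<equiv> \<integral>\<^sup>+p. enn (norm (f p) powr pa * rate p) \<partial>mu"

lemma facts:
 assumes "f p ~= 0" "0 < fst p" "0 < snd p"
 shows "0 < yy p" "0 < PP p" "0 < QQ p" "QQ p / yy p = dt * snd p" "PP p / (yy p)^2 = dt^2 * fst p"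
  "(norm (f p))^2 = norm (f p) powr pa * (height p)^2"
  "norm (f p) powr (2 - 2 * pa) * (dt ^ b * (m1 dt p)^2) = 1 / (yy p * PP p ^ (a - 1) * (yy p + QQ p) ^ (b - 1))"
proof -
 define h where "h = height p"
 have h: "0 < h" using assms by (simp add: h_def height_def)
 show "0 < yy p" "0 < PP p" "0 < QQ p" "QQ p / yy p = dt * snd p" "PP p / (yy p)^2 = dt^2 * fst p"
  using h assms dt by (auto simp: yy_def PP_def QQ_def h_def[symmetric] field_simps power2_eq_square)
 have np: "norm (f p) powr x = h powr (N * x)" for x
  using N_pos by (simp add: h_def height_def powr_powr)
 have "(norm (f p))^2 = norm (f p) powr (pa + (2 - pa))" using assms by simp
 also have "... = norm (f p) powr pa * h powr (N * (2 - pa))" unfolding powr_add np[of "2 - pa"] ..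
 also have "h powr (N * (2 - pa)) = h^2" using h by (simp add: N_eq powr_numeral)
 finally show "(norm (f p))^2 = norm (f p) powr pa * (height p)^2" by (simp add: h_def)
 have pw: "x powr real (n - 1) = x ^ (n - 1)" if "0 < x" for x :: real and n using that by (rule powr_realpow)
 have m1: "(m1 dt p)^2 = 1 / (fst p ^ (a - 1) * (1 + dt * snd p) ^ (b - 1))"
 proof -
  have p: "0 < 1 + dt * snd p" using assms dt by (simp add: add_pos_pos)
  have "(fst p powr (- al))^2 = 1 / fst p ^ (a - 1)"
  proof -
  have "2 * - al = - real (a - 1)" using a2 by (simp add: of_nat_diff field_simps)
  then show ?thesis unfolding powr_square by (simp only: powr_minus_divide pw[OF assms(2)])
  qed
  moreover have "((1 + dt * snd p) powr (- be))^2 = 1 / (1 + dt * snd p) ^ (b - 1)"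
  proof -
  have "2 * - be = - real (b - 1)" using b2 by (simp add: of_nat_diff field_simps)
  then show ?thesis unfolding powr_square by (simp only: powr_minus_divide pw[OF p])
  qed
  ultimately show ?thesis by (simp add: m1_def power_mult_distrib)
 qed
 have "norm (f p) powr (2 - 2 * pa) = h powr (- real (2 * (a - 1) + b))"
  unfolding np N_eq using a2 by (intro arg_cong[of _ _ "(powr) h"]) (simp add: of_nat_diff)
 also have "... = 1 / h ^ (2 * (a - 1) + b)" by (simp only: powr_minus_divide powr_realpow[OF h])
 finally have n: "norm (f p) powr (2 - 2 * pa) = 1 / h ^ (2 * (a - 1) + b)" .
 have hb: "h ^ b = h * h ^ (b - 1)" "dt ^ b = dt * dt ^ (b - 1)" using b2 by (simp_all add: power_eq_if)
 have s: "yy p + QQ p = h * (1 + dt * snd p) / dt" using dt by (simp add: yy_def QQ_def h_def field_simps)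
 have r: "PP p ^ (a - 1) = h ^ (2 * (a - 1)) * fst p ^ (a - 1)"
  by (simp add: PP_def h_def power_mult_distrib power_mult)
 show "norm (f p) powr (2 - 2 * pa) * (dt ^ b * (m1 dt p)^2) = 1 / (yy p * PP p ^ (a - 1) * (yy p + QQ p) ^ (b - 1))"
 proof -
  have "1 / (A * (h * B)) * (dt * E * (1 / (R * S))) = 1 / (h / dt * (A * R) * (B * S / E))"
  if "A ~= 0" "B ~= 0" "E ~= 0" "R ~= 0" "S ~= 0" for A B E R S :: real
  using that h dt by (simp add: field_simps)
  from this[of "h ^ (2 * (a - 1))" "h ^ (b - 1)" "dt ^ (b - 1)" "fst p ^ (a - 1)" "(1 + dt * snd p) ^ (b - 1)"]
  show ?thesis unfolding n m1 s r power_add hb power_divide power_mult_distrib unfolding yy_def h_def[symmetric]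
  using h dt assms mult_pos_pos[of dt "snd p"] by simp
 qed
qed

lemma mass_le:
 assumes [measurable]: "w: borel_measurable borel" and c: "0 <= c"
  and le: "\<And>p. 0 < fst p ==> 0 < snd p ==> w p <= c * (norm (f p) powr pa * rate p)"
 shows "(nni mu (%p. enn (w p))) <= enn c * mass"
proof -
 have "(nni mu (%p. enn (w p))) <= (nni mu (%p. enn c * enn (norm (f p) powr pa * rate p)))"
  by (rule nn_integral_mono_AE, rule eventually_mono[OF AE_quadrant_pos])
  (use le c rate_nonneg in \<open>auto simp: ennreal_mult[symmetric] intro!: ennreal_leI\<close>)
 also have "... = enn c * mass" by (rule nn_integral_cmult) measurable
 finally show ?thesis .
qed

lemma energy_hi: "energy (piece hi) dt <= enn D1 * mass"
proof -
 let ?X = "%p. dt powr (real b / 2) * m1 dt p"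
 have dX: "(?X p)^2 = dt ^ b * (m1 dt p)^2" for p
  using dt by (simp add: power_mult_distrib powr_square powr_realpow)
 let ?J = "\<integral>\<^sup>+p. enn (norm (piece hi p) * m1 dt p) \<partial>mu"
 have "enn (dt ^ b) * ?J^2 = (nni mu (%p. enn (norm (piece hi p) * ?X p)))^2"
 proof -
  have "(nni mu (%p. enn (norm (piece hi p) * ?X p))) = (nni mu (%p. enn (dt powr (real b / 2)) * enn (norm (piece hi p) * m1 dt p)))"
  by (intro nn_integral_cong) (simp add: ennreal_mult[symmetric] mult_ac)
  also have "... = enn (dt powr (real b / 2)) * ?J" by (rule nn_integral_cmult) measurable
  finally show ?thesis using dt by (simp add: power_mult_distrib ennreal_power powr_square powr_realpow)
 qed
 also have "... <= (nni mu (%p. enn (norm (piece hi p) powr pa * (norm (piece hi p) powr (2 - 2 * pa) * (?X p)^2))))"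
  by (rule square_integral_le) (auto intro: piece_f1)
 also have "... <= ennreal 1 * mass"
 proof (rule mass_le)
  fix p :: "real * real" assume p: "0 < fst p" "0 < snd p"
  show "norm (piece hi p) powr pa * (norm (piece hi p) powr (2 - 2 * pa) * (?X p)^2) <= 1 * (norm (f p) powr pa * rate p)"
  proof (cases "hi p & f p ~= 0")
  case True
  then have fp: "f p ~= 0" and l: "Yh (PP p) (QQ p) <= yy p" and e: "piece hi p = f p" by (auto simp: hi_def piece_def)
  have "1 / (yy p * PP p ^ (a - 1) * (yy p + QQ p) ^ (b - 1)) <= rate p"
  using rate_high[OF facts(1-3)[OF fp p] l] bump_nonneg[of "yy p" "Yl (PP p) (QQ p)"] unfolding rate_def by linarith
  then have "norm (f p) powr pa * (norm (f p) powr (2 - 2 * pa) * (?X p)^2) <= norm (f p) powr pa * rate p"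
  unfolding dX facts(7)[OF fp p, symmetric] by (rule mult_left_mono) simp
  then show ?thesis unfolding e by (simp only: mult_1)
  qed (auto simp: piece_def rate_nonneg)
 qed (simp_all, measurable)
 finally have "enn (dt ^ b) * ?J^2 <= mass" by simp
 then have "enn D1 * (enn (dt ^ b) * ?J^2) <= enn D1 * mass" by (rule mult_left_mono) simp
 moreover have "energy (piece hi) dt <= enn D1 * (enn (dt ^ b) * ?J^2)"
  using energy_L1[OF dt piece_m[OF hi_m]] D_nonneg dt by (simp add: D1_def[symmetric] ennreal_mult mult.assoc)
 ultimately show ?thesis by (rule order_trans[rotated])
qed

lemma energy_lo: "energy (piece lo) dt <= enn (4 * D3) * mass"
proof -
 have "energy (piece lo) dt <= enn (C1^2 * (1 / (ep * dt)) * (2 ^ b * K / dt)) * (nni mu (%p. enn ((1 + dt * snd p) powr (1 + ep) * (norm (piece lo p))^2)))"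
 proof (rule energy_L2_s[OF dt piece_i[OF lo_m]])
  fix r :: real assume "0 < r"
  then have "0 < 1 + dt * r" using dt by (simp add: add_pos_pos)
  then show "0 < (1 + dt * r) powr (1 + ep)" by simp
 qed (use weight_s[OF dt(1)] dt eps in simp_all)
 also have "... <= enn (C1^2 * (1 / (ep * dt)) * (2 ^ b * K / dt)) * (enn (4 * dt^2) * mass)"
 proof (rule mult_left_mono[OF mass_le])
  fix p :: "real * real" assume p: "0 < fst p" "0 < snd p"
  show "(1 + dt * snd p) powr (1 + ep) * (norm (piece lo p))^2 <= 4 * dt^2 * (norm (f p) powr pa * rate p)"
  proof (cases "lo p & f p ~= 0")
  case True
  then have fp: "f p ~= 0" and l: "yy p < Yl (PP p) (QQ p)" by (auto simp: lo_def)
  note F = facts[OF fp p]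
  have "(yy p)^2 * (1 + QQ p / yy p) powr (1 + ep) <= 4 * rate p"
  by (rule order_trans[OF rate_low[OF F(1-3) l]]) (simp add: rate_def)
  then have "norm (f p) powr pa * dt^2 * ((yy p)^2 * (1 + QQ p / yy p) powr (1 + ep)) <= norm (f p) powr pa * dt^2 * (4 * rate p)"
  by (rule mult_left_mono) simp
  moreover have "(height p)^2 = dt^2 * (yy p)^2" using dt by (simp add: yy_def power_divide)
  then have "(1 + dt * snd p) powr (1 + ep) * (norm (f p))^2 = norm (f p) powr pa * dt^2 * ((yy p)^2 * (1 + QQ p / yy p) powr (1 + ep))"
  unfolding F(4,6) by (simp only: mult_ac)
  moreover have "norm (f p) powr pa * dt^2 * (4 * rate p) = 4 * dt^2 * (norm (f p) powr pa * rate p)" by (simp only: mult_ac)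
  ultimately show ?thesis using True by (simp only: piece_def if_True)
  qed (auto simp: piece_def rate_nonneg)
 qed (use dt in \<open>simp_all, measurable\<close>)
 also have "... = enn (4 * D3) * mass"
 proof -
  have "C1^2 * (1 / (ep * dt)) * (2 ^ b * K / dt) * (4 * dt^2) = 4 * D3" using dt eps by (simp add: D3_def field_simps power2_eq_square)
  then show ?thesis using dt eps K1 by (simp add: mult.assoc[symmetric] ennreal_mult[symmetric])
 qed
 finally show ?thesis .
qed

lemma energy_st: "energy (piece st) dt <= enn D2 * mass"
proof -
 let ?om = "%r. r * ((dt^2 * r) powr ep + (1 / (dt^2 * r)) powr ep)"
 have "energy (piece st) dt <= enn D2 * (nni mu (%p. enn (?om (fst p) * (norm (piece st p))^2)))"
  unfolding D2_def
  by (rule energy_L2_rho[OF dt piece_i[OF st_m]]) (use weight_rho[OF dt(1)] dt eps in \<open>auto intro!: mult_pos_pos add_pos_nonneg\<close>)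
 also have "... <= enn D2 * (ennreal 1 * mass)"
 proof (rule mult_left_mono[OF mass_le])
  fix p :: "real * real" assume p: "0 < fst p" "0 < snd p"
  show "?om (fst p) * (norm (piece st p))^2 <= 1 * (norm (f p) powr pa * rate p)"
  proof (cases "st p & f p ~= 0")
  case True
  then have fp: "f p ~= 0" and l: "steep (PP p) (QQ p)" "Yl (PP p) (QQ p) <= yy p" "yy p < Yh (PP p) (QQ p)" by (auto simp: st_def lo_def hi_def)
  note F = facts[OF fp p]
  have "1 / (dt^2 * fst p) = (yy p)^2 / PP p" unfolding F(5)[symmetric] by simp
  then have "?om (fst p) * (height p)^2 = PP p * ((PP p / (yy p)^2) powr ep + ((yy p)^2 / PP p) powr ep)"
  unfolding F(5)[symmetric] PP_def by (simp add: mult_ac)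
  also have "... <= rate p" using rate_steep[OF F(1-3) l] unfolding rate_def by simp
  finally have "norm (f p) powr pa * (?om (fst p) * (height p)^2) <= norm (f p) powr pa * rate p"
  by (rule mult_left_mono) simp
  then show ?thesis using True unfolding piece_def by (simp add: F(6) mult_ac)
  qed (auto simp: piece_def rate_nonneg)
 qed (simp_all, measurable)
 finally show ?thesis by simp
qed

lemma energy_fl: "energy (piece fl) dt <= enn (2 * C4) * mass"
proof -
 let ?X = "%p. dt powr (real b / 2) * (m1 dt p * (dt * snd p) powr (- (1/24)))"
 have dX: "(?X p)^2 = dt ^ b * (m1 dt p)^2 * (dt * snd p) powr (- (1/12))" for p
  using dt by (simp add: power_mult_distrib powr_square powr_realpow mult.assoc)
 let ?J = "\<integral>\<^sup>+p. enn (norm (piece fl p) * m1 dt p * (dt * snd p) powr (- (1/24))) \<partial>mu"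
 have flat: "1 <= dt * snd p & (dt * snd p) powr (1/3) <= fst p"
  "(yy p)^2 * (dt * snd p) powr (7/12) <= rate p"
  "1 / (yy p * PP p ^ (a - 1) * (yy p + QQ p) ^ (b - 1)) * (dt * snd p) powr (- (1/12)) <= rate p"
  if "piece fl p ~= 0" for p
 proof -
  have l: "\<not> steep (PP p) (QQ p)" "Yl (PP p) (QQ p) <= yy p" "yy p < Yh (PP p) (QQ p)" "f p ~= 0" "0 < fst p" "0 < snd p"
  using that by (auto simp: fl_def lo_def hi_def piece_def split: if_splits)
  note F = facts[OF l(4-6)]
  note R = rate_flat[OF F(1-3) l(1-3), unfolded F(4,5)]
  have "dt^2 * fst p <= 1 * fst p" using dt l pi_less_4 by (intro mult_right_mono power_le_one) auto
  then show "1 <= dt * snd p & (dt * snd p) powr (1/3) <= fst p" using R by simp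
  show "(yy p)^2 * (dt * snd p) powr (7/12) <= rate p"
  using R(3) bump_nonneg[of "yy p" "Yl (PP p) (QQ p)"] unfolding rate_def by linarith
  show "1 / (yy p * PP p ^ (a - 1) * (yy p + QQ p) ^ (b - 1)) * (dt * snd p) powr (- (1/12)) <= rate p"
  using R(4) bump_nonneg[of "yy p" "Yh (PP p) (QQ p)"] unfolding rate_def by linarith
 qed
 have J: "enn (dt ^ b) * ?J^2 <= ennreal 1 * mass"
 proof -
  have "(nni mu (%p. enn (norm (piece fl p) * ?X p))) = (nni mu (%p. enn (dt powr (real b / 2)) * enn (norm (piece fl p) * m1 dt p * (dt * snd p) powr (- (1/24)))))"
  by (intro nn_integral_cong) (simp add: ennreal_mult[symmetric] mult_ac del: powr_minus)
  also have "... = enn (dt powr (real b / 2)) * ?J" by (rule nn_integral_cmult) measurable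
  finally have "enn (dt ^ b) * ?J^2 = (nni mu (%p. enn (norm (piece fl p) * ?X p)))^2"
  using dt by (simp add: power_mult_distrib ennreal_power powr_square powr_realpow)
  also have "... <= (nni mu (%p. enn (norm (piece fl p) powr pa * (norm (piece fl p) powr (2 - 2 * pa) * (?X p)^2))))"
  by (rule square_integral_le) (auto intro: piece_f1)
  also have "... <= ennreal 1 * mass"
  proof (rule mass_le)
  fix p :: "real * real" assume p: "0 < fst p" "0 < snd p"
  show "norm (piece fl p) powr pa * (norm (piece fl p) powr (2 - 2 * pa) * (?X p)^2) <= 1 * (norm (f p) powr pa * rate p)"
  proof (cases "piece fl p = 0")
  case False
  then have e: "piece fl p = f p" "f p ~= 0" by (auto simp: piece_def split: if_splits)
  have "norm (f p) powr (2 - 2 * pa) * (?X p)^2 <= rate p"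
  using flat(3)[OF False] unfolding dX facts(7)[OF e(2) p, symmetric] by (simp only: mult.assoc)
  then have "norm (f p) powr pa * (norm (f p) powr (2 - 2 * pa) * (?X p)^2) <= norm (f p) powr pa * rate p"
  by (rule mult_left_mono) simp
  then show ?thesis unfolding e by (simp only: mult_1)
  qed (simp add: rate_nonneg)
  qed (simp_all, measurable)
  finally show ?thesis .
 qed
 have Q: "(nni mu (%p. enn ((dt * snd p) powr (7/12) * (norm (piece fl p))^2))) <= enn (dt^2) * mass"
 proof (rule mass_le)
  fix p :: "real * real" assume p: "0 < fst p" "0 < snd p"
  show "(dt * snd p) powr (7/12) * (norm (piece fl p))^2 <= dt^2 * (norm (f p) powr pa * rate p)"
  proof (cases "piece fl p = 0")
  case False
  then have e: "piece fl p = f p" "f p ~= 0" by (auto simp: piece_def split: if_splits)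
  have "norm (f p) powr pa * dt^2 * ((yy p)^2 * (dt * snd p) powr (7/12)) <= norm (f p) powr pa * dt^2 * rate p"
  using flat(2)[OF False] by (rule mult_left_mono) simp
  moreover have "(height p)^2 = dt^2 * (yy p)^2" using dt by (simp add: yy_def power_divide)
  then have "(dt * snd p) powr (7/12) * (norm (f p))^2 = norm (f p) powr pa * dt^2 * ((yy p)^2 * (dt * snd p) powr (7/12))"
  unfolding facts(6)[OF e(2) p] by (simp only: mult_ac)
  moreover have "norm (f p) powr pa * dt^2 * rate p = dt^2 * (norm (f p) powr pa * rate p)" by (simp only: mult_ac)
  ultimately show ?thesis unfolding e(1) by (simp only:)
  qed (simp add: rate_nonneg)
 qed (simp_all, measurable)
 have "energy (piece fl) dt <= enn (C4 / dt^2) * (nni mu (%p. enn ((dt * snd p) powr (7/12) * (norm (piece fl p))^2))) + enn (C4 * dt ^ b) * ?J^2"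
  by (rule energy_mid[OF dt piece_i[OF fl_m] flat(1)])
 also have "... = enn (C4 / dt^2) * (nni mu (%p. enn ((dt * snd p) powr (7/12) * (norm (piece fl p))^2))) + enn C4 * (enn (dt ^ b) * ?J^2)"
  using C4_nonneg dt by (simp add: ennreal_mult mult.assoc)
 also have "... <= enn (C4 / dt^2) * (enn (dt^2) * mass) + enn C4 * (ennreal 1 * mass)"
  by (intro add_mono mult_left_mono Q J) auto
 also have "... = enn (2 * C4) * mass"
 proof -
  have "enn (C4 / dt^2) * enn (dt^2) = enn C4" using C4_nonneg dt by (simp add: ennreal_mult[symmetric])
  then have 1: "enn (C4 / dt^2) * (enn (dt^2) * mass) = enn C4 * mass" by (simp only: mult.assoc[symmetric])
  have 2: "enn (2 * C4) = enn C4 + enn C4" using C4_nonneg by (simp add: ennreal_plus[symmetric] del: ennreal_plus)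
  show ?thesis unfolding 1 2 by (simp add: distrib_right)
 qed
 finally show ?thesis .
qed

text \<open>Every point of the quadrant is assigned to the bound that is favourable there, and \<open>f\<close> is split accordingly into four pieces. The splitting depends on \<open>f\<close> itself and on \<open>\<delta>\<close>.\<close>

lemma energy_rate: "energy f dt <= enn (4 * D) * mass"
proof -
 let ?g = "%A th. enn ((norm (T (piece A) th))^2)"
 have Tf: "T f th = T (piece hi) th + T (piece lo) th + T (piece st) th + T (piece (%p. \<not> hi p & \<not> lo p & \<not> st p)) th" for th
 proof -
  have i: "has_bochner_integral mu (%p. piece A p * cpx (u th p)) (T (piece A) th)" if "Measurable.pred borel A" for A
  unfolding T_def u_def[symmetric] by (rule has_bochner_integral_integrable[OF integrable_u[OF piece_i[OF that]]])
  have "has_bochner_integral mu (%p. piece hi p * cpx (u th p) + piece lo p * cpx (u th p) + piece st p * cpx (u th p) + piece (%p. \<not> hi p & \<not> lo p & \<not> st p) p * cpx (u th p))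
  (T (piece hi) th + T (piece lo) th + T (piece st) th + T (piece (%p. \<not> hi p & \<not> lo p & \<not> st p)) th)"
  by (intro has_bochner_integral_add i) measurable
  moreover have "(%p. piece hi p * cpx (u th p) + piece lo p * cpx (u th p) + piece st p * cpx (u th p) + piece (%p. \<not> hi p & \<not> lo p & \<not> st p) p * cpx (u th p)) = (%p. f p * cpx (u th p))"
  by (auto simp: piece_def lo_def st_def fun_eq_iff)
  ultimately show ?thesis unfolding T_def[of f] u_def[symmetric] by (simp only: has_bochner_integral_integral_eq)
 qed
 have "T (piece (%p. \<not> hi p & \<not> lo p & \<not> st p)) th = T (piece fl) th" for th
  unfolding T_def
 proof (rule integral_cong_AE)
  show "AE p in mu. piece (%p. \<not> hi p & \<not> lo p & \<not> st p) p * cpx (ua (fst p * cos th) * ub (snd p * sin th)) = piece fl p * cpx (ua (fst p * cos th) * ub (snd p * sin th))"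
  by (rule eventually_mono[OF AE_quadrant_pos]) (auto simp: piece_def fl_def st_def)
 qed measurable
 note Tf = Tf[unfolded this]
 have sq: "(norm (x + y + z + w))^2 <= 4 * ((norm x)^2 + (norm y)^2 + (norm z)^2 + (norm w)^2)" for x y z w :: complex
 proof -
  have "norm (x + y + z + w) <= norm x + norm y + norm z + norm w"
  by (meson add_mono norm_triangle_ineq order_refl order_trans)
  then have "(norm (x + y + z + w))^2 <= (norm x + norm y + norm z + norm w)^2" by (rule power_mono) simp
  also have "... <= 4 * ((norm x)^2 + (norm y)^2 + (norm z)^2 + (norm w)^2)"
  proof -
  have "0 <= (norm x - norm y)^2 + (norm x - norm z)^2 + (norm x - norm w)^2 + (norm y - norm z)^2 + (norm y - norm w)^2 + (norm z - norm w)^2" by simp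
  then show ?thesis by (simp add: power2_eq_square algebra_simps)
  qed
  finally show ?thesis .
 qed
 have "energy f dt <= (nni lborel (%th. (ennreal 4 * (?g hi th + ?g lo th + ?g st th + ?g fl th)) * enn (shell dt th)))"
 proof (rule energy_le_pointwise)
  fix th
  have "enn ((norm (T f th))^2) <= enn (4 * ((norm (T (piece hi) th))^2 + (norm (T (piece lo) th))^2 + (norm (T (piece st) th))^2 + (norm (T (piece fl) th))^2))"
  unfolding Tf by (intro ennreal_leI sq)
  also have "... = ennreal 4 * (?g hi th + ?g lo th + ?g st th + ?g fl th)"
  by (subst ennreal_mult) (simp_all add: ennreal_plus[symmetric] del: ennreal_plus)
  finally show "enn ((norm (T f th))^2) <= ennreal 4 * (?g hi th + ?g lo th + ?g st th + ?g fl th)" .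
 qed
 also have "... = ennreal 4 * (energy (piece hi) dt + energy (piece lo) dt + energy (piece st) dt + energy (piece fl) dt)"
  unfolding energy_def mult.assoc by (simp add: nn_integral_add nn_integral_cmult distrib_right)
 also have "... <= ennreal 4 * (enn D1 * mass + enn (4 * D3) * mass + enn D2 * mass + enn (2 * C4) * mass)"
  by (intro mult_left_mono add_mono energy_hi energy_lo energy_st energy_fl) simp
 also have "... = ennreal 4 * (enn D * mass)"
  unfolding D_def using D_nonneg C4_nonneg by (simp add: distrib_right add_ac)
 also have "... = enn (4 * D) * mass"
  using D_nonneg by (simp add: ennreal_mult mult.assoc)
 finally show ?thesis .
qed

end

end

section \<open>Summation over the shells\<close>

context kernel_pair begin

definition "geo2 = 2 / (1 - 2 powr (- (2 * ep)))"
definition "shell_const = 4 * D * (2 * geo2)"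
definition "half_energy f = (nni lborel (%th. enn ((norm (T f th))^2) * enn (cos th ^ (a - 1) * sin th ^ (b - 1) * indicator {0<..pi / 4} th)))"
definition "final_const = 2 * shell_const + 2 * K ^ 4"

lemma geo2_pos: "0 < geo2"
proof -
 have "2 powr (- (2 * ep)) < 2 powr 0" using eps by (intro powr_less_mono) auto
 then show ?thesis by (simp add: geo2_def)
qed

lemma const_nonneg: "0 <= shell_const" "0 <= final_const"
 using geo2_pos D_nonneg K1 by (auto simp: shell_const_def final_const_def)

lemma bump_geometric:
 assumes "0 < y" "0 < Y"
 shows "(\<Sum>j. enn (bump (y * 2 ^ j) Y)) <= enn geo2"
proof -
 define q where "q = 2 powr (- (2 * ep))"
 have q: "0 < q" "q < 1"
  using eps powr_less_mono[of "- (2 * ep)" 0 2] by (auto simp: q_def)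
 define t where "t = log 2 (Y / y)"
 have Y: "Y = y * 2 powr t" using assms by (simp add: t_def)
 have b: "bump (y * 2 ^ j) Y <= q powr \<bar>real j - t\<bar>" for j
 proof -
  have "y * 2 ^ j / Y = 2 powr (real j - t)" "Y / (y * 2 ^ j) = 2 powr (t - real j)"
  using assms by (simp_all add: Y powr_diff powr_realpow)
  then have "bump (y * 2 ^ j) Y = min (2 powr ((real j - t) * (2 * ep))) (2 powr ((t - real j) * (2 * ep)))"
  by (simp add: bump_def powr_powr)
  also have "... <= 2 powr (- (2 * ep) * \<bar>real j - t\<bar>)"
  by (cases "t <= real j") (auto simp: min_le_iff_disj algebra_simps)
  also have "... = q powr \<bar>real j - t\<bar>" unfolding q_def powr_powr ..
  finally show ?thesis .
 qed
 show ?thesis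
 proof (rule suminf_le_const[OF summableI])
  fix n
  have "(\<Sum>j<n. enn (bump (y * 2 ^ j) Y)) = enn (\<Sum>j<n. bump (y * 2 ^ j) Y)" by simp
  also have "... <= enn (\<Sum>j<n. q powr \<bar>real j - t\<bar>)" by (intro ennreal_leI sum_mono b)
  also have "... <= enn geo2"
  unfolding geo2_def q_def[symmetric] by (intro ennreal_leI bump_sum q)
  finally show "(\<Sum>j<n. enn (bump (y * 2 ^ j) Y)) <= enn geo2" .
 qed
qed

definition dl :: "nat => real" where "dl j = pi / 8 * (1 / 2) ^ j"

lemma shell_scale: "0 < dl j" "dl j <= pi / 8"
 using mult_left_mono[of "(1/2) ^ j" 1 "pi / 8"] by (auto simp: power_le_one dl_def)

text \<open>At a fixed point \<open>P\<close> and \<open>Q\<close> are independent of the shell while \<open>y\<close> doubles from one shell to the next, so that the rates form two geometric bumps.\<close>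

lemma shells_sum:
 assumes f: "integrable mu f" and f1: "(nni mu (%p. enn (norm (f p) powr pa))) <= 1"
 shows "(\<Sum>j. energy f (dl j)) <= enn shell_const"
proof -
 note dt = shell_scale
 have [measurable]: "f: borel_measurable borel" using f by auto
 note [measurable] = rate_m[OF f f1 dt]
 let ?r = "%j. rate f (dl j)"
 have "(\<Sum>j. energy f (dl j)) <= (\<Sum>j. enn (4 * D) * (nni mu (%p. enn (norm (f p) powr pa * ?r j p))))"
  by (intro suminf_le energy_rate[OF f f1 dt] summableI)
 also have "... = enn (4 * D) * (nni mu (%p. (\<Sum>j. enn (norm (f p) powr pa * ?r j p))))"
 proof -
  have m: "(%p. enn (norm (f p) powr pa * ?r j p)): borel_measurable mu" for j by measurable
  show ?thesis unfolding nn_integral_suminf[OF m] by (rule ennreal_suminf_cmult)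
 qed
 also have "... <= enn (4 * D) * (nni mu (%p. enn (2 * geo2) * enn (norm (f p) powr pa)))"
 proof (rule mult_left_mono[OF nn_integral_mono_AE])
  show "AE p in mu. (\<Sum>j. enn (norm (f p) powr pa * ?r j p)) <= enn (2 * geo2) * enn (norm (f p) powr pa)"
  proof (rule eventually_mono[OF AE_quadrant_pos])
  fix p :: "real * real" assume p: "0 < fst p & 0 < snd p"
  show "(\<Sum>j. enn (norm (f p) powr pa * ?r j p)) <= enn (2 * geo2) * enn (norm (f p) powr pa)"
  proof (cases "f p = 0")
  case False
  define Y0 where "Y0 = yy f (dl 0) p"
  have pos: "0 < Y0" "0 < PP f p" "0 < QQ f p"
  unfolding Y0_def using facts(1-3)[OF f f1 dt(1)[of 0] dt(2)[of 0] False] p by auto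
  have y: "yy f (dl j) p = Y0 * 2 ^ j" for j
  unfolding Y0_def yy_def[OF f f1 dt] by (simp add: dl_def power_one_over)
  let ?b = "%Y. \<Sum>j. enn (bump (Y0 * 2 ^ j) Y)"
  have 1: "(\<Sum>j. enn (norm (f p) powr pa * ?r j p)) = enn (norm (f p) powr pa) * (\<Sum>j. enn (?r j p))"
  proof -
  have "enn (norm (f p) powr pa * ?r j p) = enn (norm (f p) powr pa) * enn (?r j p)" for j
  using rate_nonneg[OF f f1 dt] by (intro ennreal_mult) auto
  then show ?thesis by (simp only: ennreal_suminf_cmult)
  qed
  have "(\<Sum>j. enn (?r j p)) = ?b (Yl (PP f p) (QQ f p)) + ?b (Yh (PP f p) (QQ f p))"
  unfolding rate_def[OF f f1 dt] y suminf_add[OF summableI summableI] by (intro suminf_cong ennreal_plus) simp_all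
  also have "... <= enn geo2 + enn geo2"
  by (intro add_mono bump_geometric pos Y_pos[OF pos])
  also have "... = enn (2 * geo2)" using geo2_pos by (simp add: ennreal_plus[symmetric] del: ennreal_plus)
  finally have "(\<Sum>j. enn (norm (f p) powr pa * ?r j p)) <= enn (norm (f p) powr pa) * enn (2 * geo2)"
  unfolding 1 by (rule mult_left_mono) simp
  then show ?thesis by (simp only: mult.commute)
  qed simp
  qed
 qed simp
 also have "... = enn (4 * D) * (enn (2 * geo2) * (nni mu (%p. enn (norm (f p) powr pa))))"
 proof -
  have "(%p. enn (norm (f p) powr pa)): borel_measurable mu" by measurable
  then show ?thesis by (simp only: nn_integral_cmult)
 qed
 also have "... <= enn (4 * D) * (enn (2 * geo2) * 1)" by (intro mult_left_mono f1) auto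
 also have "... = enn shell_const" using D_nonneg geo2_pos unfolding shell_const_def mult_1_right by (intro ennreal_mult[symmetric]) auto
 finally show ?thesis .
qed

lemma half_energy_le_shells:
 assumes [measurable]: "f: borel_measurable borel"
 shows "half_energy f <= (\<Sum>j. energy f (dl j))"
proof -
 have "half_energy f <= (nni lborel (%th. (\<Sum>j. enn ((norm (T f th))^2) * enn (shell (dl j) th))))"
  unfolding half_energy_def
 proof (rule nn_integral_mono)
  fix th
  show "enn ((norm (T f th))^2) * enn (cos th ^ (a - 1) * sin th ^ (b - 1) * indicator {0<..pi / 4} th) <= (\<Sum>j. enn ((norm (T f th))^2) * enn (shell (dl j) th))"
  proof (cases "th \<in> {0<..pi / 4}")
  case True
  have "\<exists>j. dl j <= th"
  proof -
  have "(%j. dl j) \<longlonglongrightarrow> pi / 8 * 0" unfolding dl_def by (intro tendsto_intros LIMSEQ_power_zero) auto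
  then have "\<forall>\<^sub>F j in sequentially. dl j < th" using True by (intro order_tendstoD) auto
  then show ?thesis by (metis (no_types, lifting) eventually_sequentially less_imp_le order_refl)
  qed
  define j where "j = (LEAST j. dl j <= th)"
  have j1: "dl j <= th" unfolding j_def by (rule LeastI_ex) fact
  have j2: "th <= 2 * (dl j)"
  proof (cases j)
  case 0 then show ?thesis using True by (simp add: dl_def)
  next
  case (Suc i)
  then have "\<not> dl i <= th" unfolding j_def by (intro not_less_Least) simp
  then show ?thesis by (simp add: Suc dl_def)
  qed
  have e: "shell (dl j) th = cos th ^ (a - 1) * sin th ^ (b - 1) * indicator {0<..pi / 4} th"
  unfolding shell_def using True j1 j2 by simp
  show ?thesis unfolding e[symmetric]
  using sum_le_suminf[of "%j. enn ((norm (T f th))^2) * enn (shell (dl j) th)" "{j}"] by (simp add: summableI)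
  qed simp
 qed
 also have "... = (\<Sum>j. energy f (dl j))"
  unfolding energy_def by (rule nn_integral_suminf) measurable
 finally show ?thesis .
qed

text \<open>On \<open>|f| <= 1\<close> the critical power of \<open>f\<close> is dominated by the power \<open>p\<close>, and on \<open>|f| > 1\<close> the first power is.\<close>

lemma half_energy_Lp:
 assumes p: "1 <= p" "p <= pa" and f: "integrable mu f" and f1: "(nni mu (%x. enn (norm (f x) powr p))) <= 1"
 shows "half_energy f <= enn final_const"
proof -
 have [measurable]: "f: borel_measurable borel" using f by auto
 define g where "g x = (if norm (f x) <= 1 then f x else 0)" for x
 define h where "h x = (if norm (f x) <= 1 then 0 else f x)" for x
 have [measurable]: "g: borel_measurable borel" "h: borel_measurable borel" unfolding g_def[abs_def] h_def[abs_def] by measurable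
 have g: "integrable mu g" by (rule Bochner_Integration.integrable_bound[OF f]) (auto simp: g_def)
 have h: "integrable mu h" by (rule Bochner_Integration.integrable_bound[OF f]) (auto simp: h_def)
 have g1: "(nni mu (%x. enn (norm (g x) powr pa))) <= 1"
 proof (rule order_trans[OF nn_integral_mono f1], rule ennreal_leI)
  fix x show "norm (g x) powr pa <= norm (f x) powr p"
  using p by (auto simp: g_def intro: powr_mono')
 qed
 have h1: "(nni mu (%x. enn (norm (h x)))) <= 1"
 proof (rule order_trans[OF nn_integral_mono f1], rule ennreal_leI)
  fix x show "norm (h x) <= norm (f x) powr p"
  using p powr_mono[of 1 p "norm (f x)"] by (auto simp: h_def)
 qed
 have Th: "(norm (T h th))^2 <= K ^ 4" for th
 proof -
  have "enn (norm (T h th)) <= (nni mu (%x. enn (norm (h x * cpx (u th x)))))"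
  unfolding T_def u_def[symmetric] by (rule norm_integral_le_nn_integral)
  also have "... <= (nni mu (%x. enn (K^2) * enn (norm (h x))))"
  proof (intro nn_integral_mono)
  fix x
  have "norm (h x) * \<bar>u th x\<bar> <= norm (h x) * K^2" using u_bd by (intro mult_left_mono) auto
  then show "enn (norm (h x * cpx (u th x))) <= enn (K^2) * enn (norm (h x))"
  by (simp add: ennreal_mult[symmetric] norm_mult mult.commute)
  qed
  also have "... = enn (K^2) * (nni mu (%x. enn (norm (h x))))" by (rule nn_integral_cmult) measurable
  also have "... <= enn (K^2) * 1" by (intro mult_left_mono h1) simp
  finally have "norm (T h th) <= K^2" by (simp add: ennreal_le_iff)
  then have "(norm (T h th))^2 <= (K^2)^2" by (rule power_mono) simp
  then show ?thesis by simp
 qed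
 have Tf: "T f th = T g th + T h th" for th
 proof -
  have "T g th + T h th = (LINT x|mu. g x * cpx (u th x) + h x * cpx (u th x))"
  unfolding T_def u_def[symmetric] by (rule Bochner_Integration.integral_add[symmetric, OF integrable_u[OF g] integrable_u[OF h]])
  also have "... = T f th" unfolding T_def u_def[symmetric]
  by (intro Bochner_Integration.integral_cong refl) (simp add: g_def h_def)
  finally show ?thesis ..
 qed
 let ?w = "%th. cos th ^ (a - 1) * sin th ^ (b - 1) * indicator {0<..pi / 4} th :: real"
 have w: "enn (?w th) <= indicator {0..1} th" for th
 proof (cases "th \<in> {0<..pi / 4}")
  case True
  then have c: "0 <= cos th" "0 <= sin th" using pi_gt_zero by (auto intro: cos_ge_zero sin_ge_zero)
  have "cos th ^ (a - 1) * sin th ^ (b - 1) <= 1 * 1" using c by (intro mult_mono power_le_one) auto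
  then show ?thesis using True pi_less_4 by simp
 qed simp
 have "half_energy f <= (nni lborel (%th. 2 * (enn ((norm (T g th))^2) * enn (?w th)) + enn (2 * K ^ 4) * indicator {0..1} th))"
  unfolding half_energy_def
 proof (rule nn_integral_mono)
  fix th
  have "(norm (T f th))^2 <= (norm (T g th) + norm (T h th))^2" unfolding Tf by (intro power_mono norm_triangle_ineq) simp
  also have "... <= 2 * (norm (T g th))^2 + 2 * (norm (T h th))^2"
  using sum_squares_bound[of "norm (T g th)" "norm (T h th)"] by (simp add: power2_sum)
  also have "... <= 2 * (norm (T g th))^2 + 2 * K ^ 4" using Th[of th] by simp
  finally have "enn ((norm (T f th))^2) <= 2 * enn ((norm (T g th))^2) + enn (2 * K ^ 4)"
  using K1 by (subst ennreal_numeral[symmetric], subst ennreal_mult[symmetric]) (auto simp: ennreal_plus[symmetric] simp del: ennreal_plus ennreal_numeral)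
  then have "enn ((norm (T f th))^2) * enn (?w th) <= (2 * enn ((norm (T g th))^2) + enn (2 * K ^ 4)) * enn (?w th)"
  by (rule mult_right_mono) simp
  also have "... <= 2 * (enn ((norm (T g th))^2) * enn (?w th)) + enn (2 * K ^ 4) * indicator {0..1} th"
  unfolding distrib_right mult.assoc using w[of th] unfolding mult.assoc by (intro add_mono order_refl mult_left_mono) simp_all
  finally show "enn ((norm (T f th))^2) * enn (?w th) <= 2 * (enn ((norm (T g th))^2) * enn (?w th)) + enn (2 * K ^ 4) * indicator {0..1} th" .
 qed
 also have "... = 2 * half_energy g + enn (2 * K ^ 4)"
  unfolding half_energy_def by (simp add: nn_integral_add nn_integral_cmult)
 also have "... <= 2 * enn shell_const + enn (2 * K ^ 4)"
  by (intro add_mono mult_left_mono order_refl order_trans[OF half_energy_le_shells shells_sum[OF g g1]]) auto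
 also have "... = enn final_const"
  using const_nonneg K1 unfolding final_const_def by (subst ennreal_plus) (auto simp: ennreal_mult)
 finally show ?thesis .
qed

end

section \<open>From the quadrant to the sphere\<close>

lemma nn_integral_surface_measure:
 fixes H :: "'v::euclidean_space => ennreal"
 assumes [measurable]: "H: borel_measurable borel"
 shows "(nni surf (%om. H om)) = of_nat DIM('v) * (nni lborel (%x. H (sgn x) * indicator (cball 0 1 - {0}) x))"
proof -
 have [measurable]: "sgn: borel_measurable (borel :: 'v measure)" unfolding sgn_div_norm by measurable
 have H: "H: borel_measurable (restrict_space borel (sphere 0 1))" by (rule measurable_restrict_space1) simp
 have H': "(%x. H (sgn x)): borel_measurable (restrict_space (lborel :: 'v measure) (cball 0 1 - {0}))"
  by (rule measurable_restrict_space1) measurable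
 have "(nni surf (%om. H om)) = (nni (scale_measure (of_nat DIM('v)) (restrict_space lborel (cball 0 1 - {0}))) (%x. H (sgn x)))"
 proof -
  have "sgn \<in> scale_measure (of_nat DIM('v)) (restrict_space (lborel :: 'v measure) (cball 0 1 - {0})) \<rightarrow>\<^sub>M restrict_space borel (sphere 0 1)"
  unfolding measurable_cong_sets[OF sets_scale_measure refl] by (rule sgn_measurable_sphere)
  from nn_integral_distr[OF this, of H] show ?thesis unfolding surface_measure_def using H by simp
 qed
 also have "... = of_nat DIM('v) * (nni (restrict_space lborel (cball 0 1 - {0})) (%x. H (sgn x)))"
  by (rule nn_integral_scale_measure[OF H'])
 also have "(nni (restrict_space lborel (cball 0 1 - {0})) (%x. H (sgn x))) = (nni lborel (%x. H (sgn x) * indicator (cball 0 1 - {0}) x))"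
  by (rule nn_integral_restrict_space) simp
 finally show ?thesis .
qed

lemma nn_integral_quadrant_swap:
 assumes [measurable]: "f: borel_measurable (borel :: (real * real) measure)"
 shows "(nni (quadrant a b) (%p. f p)) = (nni (quadrant b a) (%p. f (prod.swap p)))"
proof -
 interpret pair_sigma_finite "radial a" "radial b" by (rule pair_sigma_finite_radial)
 have m: "(%p. f (prod.swap p)): borel_measurable borel" unfolding prod.swap_def by measurable
 have f: "(%(r, s). f (r, s)): borel_measurable (radial a \<Otimes>\<^sub>M radial b)"
  using assms sets_quadrant[of a b] unfolding quadrant_def by (simp cong: measurable_cong_sets)
 show ?thesis unfolding nn_integral_quadrant[OF assms] nn_integral_quadrant[OF m] using Fubini'[OF f] by simp
qed

lemma integral_quadrant_swap:
 fixes f :: "real * real => complex"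
 shows "(LINT p|quadrant a b. f p) = (LINT p|quadrant b a. f (prod.swap p))"
  and "integrable (quadrant a b) f ==> integrable (quadrant b a) (%p. f (prod.swap p))"
proof -
 interpret pair_sigma_finite "radial b" "radial a" by (rule pair_sigma_finite_radial)
 have q: "quadrant a b = distr (quadrant b a) (radial a \<Otimes>\<^sub>M radial b) prod.swap"
 proof -
  have "(%(x, y). (y, x)) = (prod.swap :: real * real => _)" by (auto simp: fun_eq_iff)
  then show ?thesis unfolding quadrant_def using pair_sigma_finite.distr_pair_swap[OF pair_sigma_finite_radial, of a b] by simp
 qed
 have sw: "prod.swap \<in> quadrant b a \<rightarrow>\<^sub>M radial a \<Otimes>\<^sub>M radial b"
  unfolding quadrant_def prod.swap_def by measurable
 have m: "f: borel_measurable (radial a \<Otimes>\<^sub>M radial b) \<longleftrightarrow> f: borel_measurable (quadrant a b)"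
  unfolding quadrant_def ..
 show "integrable (quadrant b a) (%p. f (prod.swap p))" if "integrable (quadrant a b) f"
  using that integrable_distr[OF sw, of f] unfolding q by simp
 show "(LINT p|quadrant a b. f p) = (LINT p|quadrant b a. f (prod.swap p))"
 proof (cases "f: borel_measurable borel")
  case True
  then have "f: borel_measurable (radial a \<Otimes>\<^sub>M radial b)" unfolding m by simp
  then show ?thesis unfolding q by (rule integral_distr[OF sw])
 next
  case False
  have "\<not> integrable (quadrant a b) f" using False by auto
  moreover have "\<not> integrable (quadrant b a) (%p. f (prod.swap p))"
  proof
  assume "integrable (quadrant b a) (%p. f (prod.swap p))"
  then have g: "(%p. f (prod.swap p)): borel_measurable borel" by auto
  have "prod.swap \<in> borel \<rightarrow>\<^sub>M (borel :: (real * real) measure)" unfolding prod.swap_def by measurable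
  from measurable_comp[OF this g] have "f: borel_measurable borel" by (simp add: comp_def)
  then show False using False by blast
  qed
  ultimately show ?thesis by (simp add: not_integrable_integral_eq)
 qed
qed

definition cone_angle :: "nat => nat => (real * real => ennreal) => ennreal" where
 "cone_angle a b G = (nni lborel (%th. G (cos th, sin th) * enn (cos th ^ (a - 1) * sin th ^ (b - 1)) * indicator {0..pi/4} th))"

text \<open>The cone over the sphere is the unit ball; its profile in the quadrant is divided along the diagonal.\<close>

lemma nn_integral_sphere_block_le:
 fixes G :: "real * real => ennreal"
 assumes [measurable]: "G: borel_measurable borel"
 shows "(nni (surf :: ('v::euclidean_space \<times> 'w::euclidean_space) measure) (%om. G (norm (fst om), norm (snd om))))
  <= enn (measure (surf :: 'v measure) (sphere 0 1) * measure (surf :: 'w measure) (sphere 0 1))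
  * (cone_angle DIM('v) DIM('w) G + cone_angle DIM('w) DIM('v) (%p. G (prod.swap p)))"
proof -
 let ?a = "DIM('v)" and ?b = "DIM('w)"
 let ?c = "enn (measure (surf :: 'v measure) (sphere 0 1) * measure (surf :: 'w measure) (sphere 0 1))"
 have ab: "?a \<ge> 1" "?b \<ge> 1" by (simp_all add: Suc_leI)
 define S where "S p = sqrt ((fst p)^2 + (snd p)^2)" for p :: "real * real"
 have [measurable]: "S: borel_measurable borel" unfolding S_def[abs_def] by measurable
 define H where "H p = G (fst p / S p, snd p / S p) * (if S p <= 1 then 1 else 0)" for p
 have [measurable]: "H: borel_measurable borel" unfolding H_def[abs_def] by measurable
 define H1 where "H1 p = indicator {(r, s). s <= r & sqrt (r^2 + s^2) <= 1} p * G (fst p / S p, snd p / S p)" for p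
 define H2 where "H2 p = indicator {(r, s). s <= r & sqrt (r^2 + s^2) <= 1} p * G (snd p / S p, fst p / S p)" for p
 have set: "Measurable.pred borel (%p::real * real. p \<in> {(r, s). s <= r & sqrt (r^2 + s^2) <= 1})"
  unfolding mem_Collect_eq split_beta' by measurable
 have [measurable]: "{(r, s). s <= r & sqrt (r^2 + s^2) <= 1} \<in> sets (borel :: (real * real) measure)"
  using set by (simp add: pred_def)
 have [measurable]: "H1: borel_measurable borel" "H2: borel_measurable borel" unfolding H1_def[abs_def] H2_def[abs_def] by measurable
 have "(nni (surf :: ('v \<times> 'w) measure) (%om. G (norm (fst om), norm (snd om))))
  = of_nat DIM('v \<times> 'w) * (nni (lborel :: ('v \<times> 'w) measure) (%x. G (norm (fst (sgn x)), norm (snd (sgn x))) * indicator (cball 0 1 - {0}) x))"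
  by (rule nn_integral_surface_measure) measurable
 also have "(nni (lborel :: ('v \<times> 'w) measure) (%x. G (norm (fst (sgn x)), norm (snd (sgn x))) * indicator (cball 0 1 - {0}) x))
  <= (nni (lborel :: ('v \<times> 'w) measure) (%x. H (norm (fst x), norm (snd x))))"
 proof (rule nn_integral_mono)
  fix x :: "'v \<times> 'w"
  have "norm x = S (norm (fst x), norm (snd x))" "\<And>q. \<bar>S q\<bar> = S q" by (simp_all add: S_def norm_prod_def)
  then show "G (norm (fst (sgn x)), norm (snd (sgn x))) * indicator (cball 0 1 - {0}) x <= H (norm (fst x), norm (snd x))"
  by (auto simp: H_def sgn_div_norm divide_inverse mult.commute split: split_indicator)
 qed
 also have "... = ?c * (nni (quadrant ?a ?b) (%p. H p))"
  by (rule nn_integral_block_radial) measurable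
 also have "(nni (quadrant ?a ?b) (%p. H p)) <= (nni (quadrant ?a ?b) (%p. H1 p + H2 (prod.swap p)))"
  by (intro nn_integral_mono) (auto simp: H_def H1_def H2_def S_def add.commute split: split_indicator)
 also have "... = (nni (quadrant ?a ?b) (%p. H1 p)) + (nni (quadrant ?a ?b) (%p. H2 (prod.swap p)))"
  by (rule nn_integral_add) (simp_all add: prod.swap_def)
 also have "(nni (quadrant ?a ?b) (%p. H2 (prod.swap p))) = (nni (quadrant ?b ?a) (%p. H2 p))"
  by (rule nn_integral_quadrant_swap[symmetric]) measurable
 also have "(nni (quadrant ?a ?b) (%p. H1 p)) = enn (1 / (real ?a + real ?b)) * cone_angle ?a ?b G"
  unfolding cone_angle_def quadrant_cone[OF assms ab, symmetric] by (subst nn_integral_quadrant) (simp_all add: H1_def S_def)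
 also have "(nni (quadrant ?b ?a) (%p. H2 p)) = enn (1 / (real ?b + real ?a)) * cone_angle ?b ?a (%p. G (prod.swap p))"
 proof -
  have sw: "(%p. G (prod.swap p)): borel_measurable borel" unfolding prod.swap_def by measurable
  show ?thesis unfolding cone_angle_def quadrant_cone[OF sw ab(2,1), symmetric] by (subst nn_integral_quadrant) (simp_all add: H2_def S_def)
 qed
 also have "of_nat DIM('v \<times> 'w) * (?c * (enn (1 / (real ?a + real ?b)) * cone_angle ?a ?b G + enn (1 / (real ?b + real ?a)) * cone_angle ?b ?a (%p. G (prod.swap p))))
  = ?c * (of_nat DIM('v \<times> 'w) * enn (1 / (real ?a + real ?b))) * (cone_angle ?a ?b G + cone_angle ?b ?a (%p. G (prod.swap p)))"
 proof -
  have "n * (c * (x * A + x * B)) = c * (n * x) * (A + B)" for n c x A B :: ennreal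
  unfolding distrib_left[symmetric] by (simp only: mult_ac)
  then show ?thesis unfolding add.commute[of "real ?b" "real ?a"] .
 qed
 also have "of_nat DIM('v \<times> 'w) * enn (1 / (real ?a + real ?b)) = 1"
 proof -
  have "of_nat DIM('v \<times> 'w) = enn (real ?a + real ?b)" by (simp add: ennreal_of_nat_eq_real_of_nat)
  moreover have "0 < real ?a + real ?b" using ab by linarith
  ultimately show ?thesis by (simp only:, subst ennreal_mult[symmetric]) simp_all
 qed
 finally show ?thesis by (simp add: mult_left_mono)
qed

lemma bessel_bounds:
 assumes n: "CARD('n::finite) \<ge> 2"
 shows "\<exists>K A B. \<forall>L\<ge>K. 1 <= L & \<bar>A\<bar> <= L & \<bar>B\<bar> <= L & (2 * pi) ^ CARD('n) <= L & (\<forall>r. \<bar>bessel TYPE('n) r\<bar> <= L) &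
  (\<forall>r>0. \<bar>r powr ((real CARD('n) - 1) / 2) * bessel TYPE('n) r\<bar> <= L &
  \<bar>r powr ((real CARD('n) - 1) / 2) * bessel TYPE('n) r - (A * cos r + B * sin r)\<bar> <= L / r)"
proof -
 obtain C A B where C: "C \<ge> 0" "\<And>r. 0 < r ==> \<bar>r powr ((real CARD('n) - 1) / 2) * bessel TYPE('n) r\<bar> <= C"
  "\<And>r. 0 < r ==> \<bar>r powr ((real CARD('n) - 1) / 2) * bessel TYPE('n) r - (A * cos r + B * sin r)\<bar> <= C / r"
  using bessel_asymptotics[OF n] by blast
 let ?m = "measure (surf :: (real^'n) measure) (sphere 0 1)"
 let ?K = "1 + \<bar>A\<bar> + \<bar>B\<bar> + (2 * pi) ^ CARD('n) + ?m + C"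
 have p: "0 <= ?m" "0 <= (2 * pi) ^ CARD('n)" by simp_all
 show ?thesis
 proof (rule exI[of _ ?K], rule exI[of _ A], rule exI[of _ B], intro allI impI conjI)
  fix L assume L: "?K <= L"
  show "1 <= L" "\<bar>A\<bar> <= L" "\<bar>B\<bar> <= L" "(2 * pi) ^ CARD('n) <= L" using L C(1) p by linarith+
  have CL: "C <= L" using L p by linarith
  show "\<bar>bessel TYPE('n) r\<bar> <= L" for r using bessel_bounded[where 'n='n, of r] L C(1) p by linarith
  fix r :: real assume r: "0 < r"
  show "\<bar>r powr ((real CARD('n) - 1) / 2) * bessel TYPE('n) r\<bar> <= L" using C(2)[OF r] CL by linarith
  have "C / r <= L / r" using CL r by (intro divide_right_mono) auto
  then show "\<bar>r powr ((real CARD('n) - 1) / 2) * bessel TYPE('n) r - (A * cos r + B * sin r)\<bar> <= L / r" using C(3)[OF r] by linarith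
 qed
qed

lemma kernel_pair_sphere:
 assumes "CARD('a::finite) \<ge> 2" "CARD('b::finite) \<ge> 2"
 shows "\<exists>K Aa Ba Ab Bb. kernel_pair CARD('a) CARD('b) (bessel TYPE('a)) (bessel TYPE('b)) K Aa Ba Ab Bb"
proof -
 from bessel_bounds[OF assms(1)] obtain Ka Aa Ba where a: "\<And>L. L \<ge> Ka ==> 1 <= L & \<bar>Aa\<bar> <= L & \<bar>Ba\<bar> <= L & (2 * pi) ^ CARD('a) <= L & (\<forall>r. \<bar>bessel TYPE('a) r\<bar> <= L) &
  (\<forall>r>0. \<bar>r powr ((real CARD('a) - 1) / 2) * bessel TYPE('a) r\<bar> <= L &
  \<bar>r powr ((real CARD('a) - 1) / 2) * bessel TYPE('a) r - (Aa * cos r + Ba * sin r)\<bar> <= L / r)" by blast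
 from bessel_bounds[OF assms(2)] obtain Kb Ab Bb where b: "\<And>L. L \<ge> Kb ==> 1 <= L & \<bar>Ab\<bar> <= L & \<bar>Bb\<bar> <= L & (2 * pi) ^ CARD('b) <= L & (\<forall>r. \<bar>bessel TYPE('b) r\<bar> <= L) &
  (\<forall>r>0. \<bar>r powr ((real CARD('b) - 1) / 2) * bessel TYPE('b) r\<bar> <= L &
  \<bar>r powr ((real CARD('b) - 1) / 2) * bessel TYPE('b) r - (Ab * cos r + Bb * sin r)\<bar> <= L / r)" by blast
 let ?K = "max Ka Kb"
 have "kernel_pair CARD('a) CARD('b) (bessel TYPE('a)) (bessel TYPE('b)) ?K Aa Ba Ab Bb"
 proof
  fix f :: "real => complex" assume f: "f: borel_measurable borel" "integrable (radial CARD('a)) f"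
  show "(nni (radial CARD('a)) (%t. enn ((norm (LINT r|radial CARD('a). f r * cpx (bessel TYPE('a) (r * t))))^2)))
  <= enn ?K * (nni (radial CARD('a)) (%r. enn ((norm (f r))^2)))"
  by (rule order_trans[OF hankel_plancherel_le[OF f] mult_right_mono[OF ennreal_leI]]) (use a[of ?K] in auto)
 next
  fix f :: "real => complex" assume f: "f: borel_measurable borel" "integrable (radial CARD('b)) f"
  show "(nni (radial CARD('b)) (%t. enn ((norm (LINT r|radial CARD('b). f r * cpx (bessel TYPE('b) (r * t))))^2)))
  <= enn ?K * (nni (radial CARD('b)) (%r. enn ((norm (f r))^2)))"
  by (rule order_trans[OF hankel_plancherel_le[OF f] mult_right_mono[OF ennreal_leI]]) (use b[of ?K] in auto)
 next
  show "bessel TYPE('a): borel_measurable borel" "bessel TYPE('b): borel_measurable borel"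
  by (rule borel_measurable_continuous_onI[OF continuous_bessel])+
 qed (use assms a[of ?K] b[of ?K] in auto)
 then show ?thesis by blast
qed

lemma sphere_energy_radial:
 assumes a2: "CARD('a::finite) \<ge> 2" and b2: "CARD('b::finite) \<ge> 2" and p: "1 <= p"
  "p <= 2 * (2 * real CARD('a) + real CARD('b)) / (2 * real CARD('a) + real CARD('b) + 2)"
  "p <= 2 * (2 * real CARD('b) + real CARD('a)) / (2 * real CARD('b) + real CARD('a) + 2)"
 shows "\<exists>C\<ge>0. \<forall>f :: real * real => complex. integrable (quadrant CARD('a) CARD('b)) f \<longrightarrow>
  (nni (quadrant CARD('a) CARD('b)) (%x. enn (norm (f x) powr p))) <= 1 \<longrightarrow>
  (nni surf (%om. enn ((norm (fourierB (%x :: (real^'a) * (real^'b). f (norm (fst x), norm (snd x))) om))^2))) <= enn C"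
proof -
 let ?a = "CARD('a)" and ?b = "CARD('b)" and ?ua = "bessel TYPE('a)" and ?ub = "bessel TYPE('b)"
 obtain K1 Aa Ba Ab Bb where "kernel_pair ?a ?b ?ua ?ub K1 Aa Ba Ab Bb" using kernel_pair_sphere[OF a2 b2] by blast
 then interpret A: kernel_pair ?a ?b ?ua ?ub K1 Aa Ba Ab Bb .
 obtain K2 Ac Bc Ad Bd where "kernel_pair ?b ?a ?ub ?ua K2 Ac Bc Ad Bd" using kernel_pair_sphere[OF b2 a2] by blast
 then interpret B: kernel_pair ?b ?a ?ub ?ua K2 Ac Bc Ad Bd .
 let ?c = "measure (surf :: (real^'a) measure) (sphere 0 1) * measure (surf :: (real^'b) measure) (sphere 0 1)"
 have c0: "0 <= ?c" by simp
 have null: "AE th in lborel. th ~= (0::real)" by (rule AE_lborel_singleton)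
 show ?thesis
 proof (intro exI[of _ "?c * (A.final_const + B.final_const)"] conjI allI impI)
  show "0 <= ?c * (A.final_const + B.final_const)" using A.const_nonneg B.const_nonneg c0 by simp
  fix f :: "real * real => complex" assume f: "integrable (quadrant ?a ?b) f" and f1: "(nni (quadrant ?a ?b) (%x. enn (norm (f x) powr p))) <= 1"
  have [measurable]: "f: borel_measurable borel" using f by auto
  define g where "g q = f (prod.swap q)" for q
  have g: "integrable (quadrant ?b ?a) g" unfolding g_def by (rule integral_quadrant_swap(2)[OF f])
  have g1: "(nni (quadrant ?b ?a) (%x. enn (norm (g x) powr p))) <= 1"
  using f1 nn_integral_quadrant_swap[of "%x. enn (norm (f x) powr p)" ?a ?b] by (simp add: g_def)
  define G where "G q = enn ((norm (LINT x|quadrant ?a ?b. f x * cpx (?ua (fst x * fst q) * ?ub (snd x * snd q))))^2)" for q :: "real * real"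
  have [measurable]: "G: borel_measurable borel"
  proof -
  interpret sigma_finite_measure "quadrant ?a ?b" by (rule sigma_finite_quadrant)
  have [measurable]: "(%x::(real * real) \<times> (real * real). fst (snd x)) \<in> borel \<Otimes>\<^sub>M quadrant ?a ?b \<rightarrow>\<^sub>M borel"
  "(%x::(real * real) \<times> (real * real). snd (snd x)) \<in> borel \<Otimes>\<^sub>M quadrant ?a ?b \<rightarrow>\<^sub>M borel" by measurable
  show ?thesis unfolding G_def[abs_def] by measurable
  qed
  have GA: "G (cos th, sin th) = enn ((norm (A.T f th))^2)" for th by (simp add: G_def A.T_def)
  have GB: "G (prod.swap (cos th, sin th)) = enn ((norm (B.T g th))^2)" for th
  proof -
  have "B.T g th = (LINT x|quadrant ?a ?b. f x * cpx (?ua (fst x * sin th) * ?ub (snd x * cos th)))"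
  unfolding B.T_def g_def by (subst integral_quadrant_swap(1)[of ?a ?b]) (simp add: mult.commute)
  then show ?thesis by (simp add: G_def)
  qed
  have "(nni surf (%om. enn ((norm (fourierB (%x :: (real^'a) * (real^'b). f (norm (fst x), norm (snd x))) om))^2)))
  = (nni (surf :: ((real^'a) * (real^'b)) measure) (%om. G (norm (fst om), norm (snd om))))"
  proof (rule nn_integral_cong)
  fix om :: "(real^'a) * (real^'b)"
  show "enn ((norm (fourierB (%x :: (real^'a) * (real^'b). f (norm (fst x), norm (snd x))) om))^2) = G (norm (fst om), norm (snd om))"
  using fourier_block_radial[OF _ f, of "fst om" "snd om"] by (simp add: G_def)
  qed
  also have "... <= enn ?c * (cone_angle ?a ?b G + cone_angle ?b ?a (%q. G (prod.swap q)))"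
  using nn_integral_sphere_block_le[of G, where 'v="real^'a" and 'w="real^'b"] by simp
  also have "... <= enn ?c * (enn A.final_const + enn B.final_const)"
  proof (intro mult_left_mono add_mono)
  have "cone_angle ?a ?b G = A.half_energy f"
  unfolding cone_angle_def A.half_energy_def GA
  by (rule nn_integral_cong_AE, rule eventually_mono[OF null]) (auto split: split_indicator)
  then show "cone_angle ?a ?b G <= enn A.final_const"
  using A.half_energy_Lp[OF p(1) _ f f1] p(2) by (simp add: A.pa_def)
  have "cone_angle ?b ?a (%q. G (prod.swap q)) = B.half_energy g"
  unfolding cone_angle_def B.half_energy_def GB
  by (rule nn_integral_cong_AE, rule eventually_mono[OF null]) (auto split: split_indicator)
  then show "cone_angle ?b ?a (%q. G (prod.swap q)) <= enn B.final_const"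
  using B.half_energy_Lp[OF p(1) _ g g1] p(3) by (simp add: B.pa_def)
  qed simp
  also have "... = enn (?c * (A.final_const + B.final_const))"
  using A.const_nonneg B.const_nonneg c0 by (simp add: ennreal_mult ennreal_plus)
  finally show "(nni surf (%om. enn ((norm (fourierB (%x :: (real^'a) * (real^'b). f (norm (fst x), norm (snd x))) om))^2))) <= enn (?c * (A.final_const + B.final_const))" .
 qed
qed

section \<open>The estimate for integrable symmetric functions\<close>

lemma schwartz_differentiable: "schwartz f ==> f differentiable (at x)"
 unfolding schwartz_def by (metis iter_deriv.simps(1) list.set(1) empty_subsetI)

lemma schwartz_continuous: "schwartz f ==> continuous_on UNIV f"
 using schwartz_differentiable by (auto intro!: continuous_at_imp_continuous_on differentiable_imp_continuous_within)

lemma schwartz_decay: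
 assumes "schwartz f"
 shows "\<exists>B\<ge>0. \<forall>x. norm x ^ n * norm (f x) <= B"
proof -
 have "bounded (range (%x. norm x ^ n *\<^sub>R f x))"
  using assms unfolding schwartz_def by (metis iter_deriv.simps(1) list.set(1) empty_subsetI)
 then obtain B where "\<And>x. norm (norm x ^ n *\<^sub>R f x) <= B" unfolding bounded_iff by auto
 then have "\<And>x. norm x ^ n * norm (f x) <= max 0 B" by (simp add: max.coboundedI2)
 then show ?thesis by (intro exI[of _ "max 0 B"]) auto
qed

lemma integrable_decaying:
 fixes f :: "'v::euclidean_space => complex"
 assumes [measurable]: "f: borel_measurable borel"
  and B: "\<And>x. norm (f x) <= B" "\<And>x. norm x ^ (DIM('v) + 1) * norm (f x) <= B"
 shows "integrable lborel f"
proof (rule integrableI_bounded)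
 let ?n = "DIM('v)"
 have n1: "1 <= ?n" by (simp add: Suc_leI)
 have B0: "0 <= B" using B(1) norm_ge_zero order_trans by blast
 have fb: "norm (f x) <= 2 * B / (1 + norm x ^ (?n + 1))" for x
 proof -
  have "(1 + norm x ^ (?n + 1)) * norm (f x) <= 2 * B" using B[of x] by (simp add: distrib_right)
  moreover have "0 < 1 + norm x ^ (?n + 1)" by (simp add: add_pos_nonneg)
  ultimately show ?thesis by (simp add: pos_le_divide_eq mult.commute)
 qed
 have pw: "r ^ (?n - 1) * (1 / (1 + r ^ (?n + 1))) <= 2 * inverse (1 + r^2)" if r: "0 < r" for r :: real
 proof (cases "r <= 1")
  case True
  have "r ^ (?n - 1) * (1 / (1 + r ^ (?n + 1))) <= 1 * 1"
  proof (intro mult_mono power_le_one)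
  have "0 <= r ^ (?n + 1)" using r by simp
  then show "1 / (1 + r ^ (?n + 1)) <= 1" "0 <= 1 / (1 + r ^ (?n + 1))" by (simp_all add: divide_le_eq_1)
  qed (use r True in auto)
  also have "1 * 1 <= 2 * inverse (1 + r^2)"
  proof -
  have "r^2 <= 1" using r True by (intro power_le_one) auto
  then show ?thesis by (simp add: field_simps add_pos_nonneg)
  qed
  finally show ?thesis .
 next
  case False
  have e: "r ^ (?n + 1) = r ^ (?n - 1) * r^2" using n1 by (simp add: power_add[symmetric])
  have p: "0 < r ^ (?n - 1)" using r by simp
  have "r ^ (?n - 1) * (1 / (1 + r ^ (?n + 1))) <= r ^ (?n - 1) * (1 / (r ^ (?n - 1) * r^2))"
  unfolding e using r p by (intro mult_left_mono divide_left_mono) (auto intro!: mult_pos_pos add_pos_pos)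
  also have "... = 1 / r^2" using p r by simp
  also have "... <= 2 * inverse (1 + r^2)"
  proof -
  have "1 <= r^2" using False by simp
  then show ?thesis using r by (simp add: field_simps add_pos_pos)
  qed
  finally show ?thesis .
 qed
 have tail: "(nni lborel (%r. enn (indicator {0<..} r * (2 * inverse (1 + r^2))))) = enn (2 * (pi / 2) - 0)"
 proof (rule nn_integral_positive_axis_FTC[where F = "%r. 2 * arctan r"])
  fix x :: real
  show "((%r. 2 * arctan r) has_real_derivative 2 * inverse (1 + x^2)) (at x)" by (auto intro!: derivative_eq_intros)
  have "1 + x^2 ~= 0" using zero_le_power2[of x] by linarith
  then show "isCont (%x. 2 * inverse (1 + x^2)) x" by (intro continuous_intros)
  show "0 <= 2 * inverse (1 + x^2)" by simp
 next
  have "((%r. 2 * arctan r) \<longlongrightarrow> 2 * arctan 0) (at 0)" by (intro tendsto_intros)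
  then show "((%r. 2 * arctan r) \<longlongrightarrow> 0) (at_right 0)" by (simp add: filterlim_at_split)
  show "((%r. 2 * arctan r) \<longlongrightarrow> 2 * (pi / 2)) at_top" by (intro tendsto_intros tendsto_arctan_at_top)
 qed
 have "(nni lborel (%x. enn (norm (f x)))) <= (nni (lborel :: 'v measure) (%x. enn (2 * B) * enn (1 / (1 + norm x ^ (?n + 1)))))"
  using fb B0 by (intro nn_integral_mono) (auto simp: ennreal_mult[symmetric] intro!: ennreal_leI)
 also have "... = enn (2 * B) * (nni (lborel :: 'v measure) (%x. enn (1 / (1 + norm x ^ (?n + 1)))))"
  by (rule nn_integral_cmult) measurable
 also have "(nni (lborel :: 'v measure) (%x. enn (1 / (1 + norm x ^ (?n + 1)))))
  = enn (measure (surf :: 'v measure) (sphere 0 1)) * (nni (radial ?n) (%r. enn (1 / (1 + r ^ (?n + 1)))))"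
  by (rule nn_integral_radial_function) measurable
 also have "(nni (radial ?n) (%r. enn (1 / (1 + r ^ (?n + 1))))) <= (nni lborel (%r. enn (indicator {0<..} r * (2 * inverse (1 + r^2)))))"
 proof (subst nn_integral_radial, measurable, rule nn_integral_mono)
  fix r :: real
  show "enn (indicator {0<..} r * r ^ (?n - 1)) * enn (1 / (1 + r ^ (?n + 1))) <= enn (indicator {0<..} r * (2 * inverse (1 + r^2)))"
  proof (cases "0 < r")
  case True
  then have "enn (indicator {0<..} r * r ^ (?n - 1)) * enn (1 / (1 + r ^ (?n + 1))) = enn (r ^ (?n - 1) * (1 / (1 + r ^ (?n + 1))))"
  by (subst ennreal_mult[symmetric]) auto
  then show ?thesis using pw[OF True] True by (simp add: ennreal_leI)
  qed simp
 qed
 finally have le: "(nni lborel (%x. enn (norm (f x)))) <= enn (2 * B) * (enn (measure (surf :: 'v measure) (sphere 0 1)) * enn (2 * (pi / 2) - 0))"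
  unfolding tail by (simp add: mult_left_mono)
 show "(nni lborel (%x. enn (norm (f x)))) < \<infinity>"
  by (rule le_less_trans[OF le]) (simp add: ennreal_mult_less_top)
qed simp

lemma integrable_powr_bounded:
 fixes f :: "'x => complex"
 assumes f: "integrable M f" and B: "\<And>x. norm (f x) <= B" and q: "1 <= q"
 shows "integrable M (%x. norm (f x) powr q)"
proof (rule Bochner_Integration.integrable_bound)
 show "integrable M (%x. B powr (q - 1) * norm (f x))" using f by simp
 show "AE x in M. norm (norm (f x) powr q) <= norm (B powr (q - 1) * norm (f x))"
 proof (rule AE_I2)
  fix x
  have "norm (f x) powr q = norm (f x) powr (q - 1) * norm (f x) powr 1" by (simp only: powr_add[symmetric]) simp
  also have "... <= B powr (q - 1) * norm (f x) powr 1" using B[of x] q by (intro mult_right_mono powr_mono2) auto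
  finally show "norm (norm (f x) powr q) <= norm (B powr (q - 1) * norm (f x))" by simp
 qed
qed (use f in measurable)

lemma schwartz_integrable:
 fixes f :: "'v::euclidean_space => complex"
 assumes f: "schwartz f"
 shows "integrable lborel f" "1 <= q ==> integrable lborel (%x. norm (f x) powr q)" "f: borel_measurable borel"
proof -
 show m: "f: borel_measurable borel" by (rule borel_measurable_continuous_onI[OF schwartz_continuous[OF f]])
 obtain B1 where B1: "0 <= B1" "\<And>x. norm x ^ 0 * norm (f x) <= B1" using schwartz_decay[OF f] by blast
 obtain B2 where B2: "0 <= B2" "\<And>x. norm x ^ (DIM('v) + 1) * norm (f x) <= B2" using schwartz_decay[OF f] by blast
 show i: "integrable lborel f"
  by (rule integrable_decaying[OF m, of "B1 + B2"]) (use B1 B2 in \<open>force intro: add_increasing add_increasing2\<close>)+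
 show "1 <= q ==> integrable lborel (%x. norm (f x) powr q)"
  by (rule integrable_powr_bounded[OF i]) (use B1 in auto)
qed

text \<open>Two vectors of equal norm are exchanged by an orthogonal map, so a symmetric function is determined by its values along one ray in each block.\<close>

lemma block_symmetric_profile:
 fixes f :: "(real^'a::finite) \<times> (real^'b::finite) => complex"
 assumes f: "block_symmetric f"
 shows "\<exists>e :: real * real => (real^'a) * (real^'b). continuous_on UNIV e & (\<forall>x. f x = f (e (norm (fst x), norm (snd x))))
  & (\<forall>p. norm (fst (e p)) = \<bar>fst p\<bar> & norm (snd (e p)) = \<bar>snd p\<bar>)"
proof -
 define ea where "ea = (axis (SOME i. True) 1 :: real^'a)"
 define eb where "eb = (axis (SOME i. True) 1 :: real^'b)"
 have n: "norm ea = 1" "norm eb = 1" by (simp_all add: ea_def eb_def norm_axis_1)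
 let ?e = "%p :: real * real. (fst p *\<^sub>R ea, snd p *\<^sub>R eb)"
 have "f x = f (?e (norm (fst x), norm (snd x)))" for x
 proof -
  obtain A where A: "orthogonal_transformation A" "A (fst x) = norm (fst x) *\<^sub>R ea"
  using orthogonal_transformation_exists[of "fst x" "norm (fst x) *\<^sub>R ea"] n by auto
  obtain B where B: "orthogonal_transformation B" "B (snd x) = norm (snd x) *\<^sub>R eb"
  using orthogonal_transformation_exists[of "snd x" "norm (snd x) *\<^sub>R eb"] n by auto
  have "map_prod A B \<in> block_group" using A B by (auto simp: block_group_def)
  then have "f \<circ> map_prod A B = f" using f by (auto simp: block_symmetric_def)
  then have "f x = f (map_prod A B x)" by (metis comp_apply)
  also have "map_prod A B x = ?e (norm (fst x), norm (snd x))" using A B by (cases x) simp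
  finally show ?thesis .
 qed
 then show ?thesis using n by (intro exI[of _ ?e]) (auto intro!: continuous_intros)
qed

lemma fourier_eq_fourierB:
 assumes [measurable]: "f: borel_measurable borel"
 shows "fourier f = fourierB f"
 unfolding fourier_def fourierB_def fun_eq_iff by (intro allI integral_completion) measurable

lemma Lp_norm_lebesgue_borel:
 fixes f :: "'v::euclidean_space => complex"
 assumes [measurable]: "f: borel_measurable borel"
 shows "Lp_norm lebesgue p f = Lp_norm lborel p f"
 unfolding Lp_norm_def by (subst integral_completion) auto

text \<open>Rescaling reduces to profiles of norm at most 1. The scale is taken slightly larger than the norm, so that functions vanishing almost everywhere need no separate argument.\<close>

lemma restriction_estimate_integrable:
 assumes a2: "CARD('a::finite) \<ge> 2" and b2: "CARD('b::finite) \<ge> 2" and p: "1 <= p"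
  "p <= 2 * (2 * real CARD('a) + real CARD('b)) / (2 * real CARD('a) + real CARD('b) + 2)"
  "p <= 2 * (2 * real CARD('b) + real CARD('a)) / (2 * real CARD('b) + real CARD('a) + 2)"
 shows "\<exists>C\<ge>0. \<forall>f :: (real^'a) * (real^'b) => complex.
  integrable lborel f \<longrightarrow> integrable lborel (%x. norm (f x) powr p) \<longrightarrow> block_symmetric f \<longrightarrow>
  Lp_norm surf 2 (fourierB f) <= C * Lp_norm lborel p f"
proof -
 let ?q = "quadrant CARD('a) CARD('b)"
 obtain C where C: "0 <= C" "\<And>f :: real * real => complex. integrable ?q f ==> (nni ?q (%x. enn (norm (f x) powr p))) <= 1 ==>
  (nni surf (%om. enn ((norm (fourierB (%x :: (real^'a) * (real^'b). f (norm (fst x), norm (snd x))) om))^2))) <= enn C"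
  using sphere_energy_radial[OF assms] by blast
 define c where "c = measure (surf :: (real^'a) measure) (sphere 0 1) * measure (surf :: (real^'b) measure) (sphere 0 1)"
 have c: "0 < c" unfolding c_def by (intro mult_pos_pos emeasure_sphere_pos)
 define k where "k = c powr (- 1 / p)"
 have k: "0 < k" using c by (simp add: k_def)
 define D where "D = sqrt C * k + 1"
 have D: "0 < D" "sqrt C * k <= D" using C(1) k by (auto simp: D_def add_nonneg_pos)
 show ?thesis
 proof (intro exI[of _ D] conjI allI impI)
  show "0 <= D" using D by simp
  fix f :: "(real^'a) * (real^'b) => complex"
  assume f: "integrable lborel f" and fp: "integrable lborel (%x. norm (f x) powr p)" and sym: "block_symmetric f"
  have [measurable]: "f: borel_measurable borel" using f by auto
  obtain e where e: "continuous_on UNIV e" "\<And>x. f x = f (e (norm (fst x), norm (snd x)))"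
  using block_symmetric_profile[OF sym] by blast
  have [measurable]: "e: borel_measurable borel" by (rule borel_measurable_continuous_onI[OF e(1)])
  define f0 where "f0 q = f (e q)" for q
  have [measurable]: "f0: borel_measurable borel" unfolding f0_def[abs_def] by measurable
  have fe: "f = (%x. f0 (norm (fst x), norm (snd x)))" using e(2) by (auto simp: f0_def)
  have block: "(nni lborel (%x. G (f x))) = enn c * (nni ?q (%q. G (f0 q)))" if [measurable]: "G: borel_measurable borel" for G
  using nn_integral_block_radial[of "%q. G (f0 q)", where 'v="real^'a" and 'w="real^'b"] by (simp add: c_def fun_cong[OF fe, symmetric])
  have f0: "integrable ?q f0"
  proof (rule integrableI_bounded)
  have "enn c * (nni ?q (%q. enn (norm (f0 q)))) < \<infinity>"
  using f block[of "%z. enn (norm z)"] unfolding integrable_iff_bounded by simp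
  then show "(nni ?q (%q. enn (norm (f0 q)))) < \<infinity>" using c by (auto simp: ennreal_mult_less_top)
  qed simp
  define L where "L = Lp_norm lborel p f"
  have L0: "0 <= L" by (simp add: L_def Lp_norm_def)
  have Lp: "(LINT x|lborel. norm (f x) powr p) = L powr p"
  using p(1) by (simp add: L_def Lp_norm_def powr_powr)
  have main: "Lp_norm surf 2 (fourierB f) <= D * t" if t: "L < t" for t
  proof -
  define s where "s = t * k"
  have s: "0 < s" using t L0 k by (simp add: s_def)
  define g where "g q = f0 q / of_real s" for q
  have g: "integrable ?q g" unfolding g_def using f0 by simp
  have g1: "(nni ?q (%q. enn (norm (g q) powr p))) <= 1"
  proof -
  have "enn c * (nni ?q (%q. enn (norm (f0 q) powr p))) = (nni lborel (%x. enn (norm (f x) powr p)))"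
  by (rule block[symmetric]) measurable
  also have "... = enn (L powr p)" unfolding Lp[symmetric] using fp by (intro nn_integral_eq_integral) auto
  also have "... <= enn (t powr p)" using t L0 p by (intro ennreal_leI powr_mono2) auto
  also have "t powr p = c * s powr p"
  proof -
  have "- 1 / p * p = - 1" using p(1) by simp
  then have "k powr p = c powr (- 1)" by (simp only: k_def powr_powr)
  then have "k powr p = 1 / c" using c by (simp add: powr_minus_divide)
  then show ?thesis using c k t L0 by (simp add: s_def powr_mult)
  qed
  also have "enn (c * s powr p) = enn c * enn (s powr p)" using c by (simp add: ennreal_mult)
  finally have le: "(nni ?q (%q. enn (norm (f0 q) powr p))) <= enn (s powr p)"
  using c by (subst (asm) ennreal_mult_le_mult_iff) auto
  have "(nni ?q (%q. enn (norm (g q) powr p))) = (nni ?q (%q. enn (1 / s powr p) * enn (norm (f0 q) powr p)))"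
  using s by (intro nn_integral_cong) (simp add: g_def norm_divide powr_divide ennreal_mult[symmetric])
  also have "... = enn (1 / s powr p) * (nni ?q (%q. enn (norm (f0 q) powr p)))" by (rule nn_integral_cmult) measurable
  also have "... <= enn (1 / s powr p) * enn (s powr p)" by (intro mult_left_mono le) simp
  also have "... = 1" using s by (simp add: ennreal_mult[symmetric])
  finally show ?thesis .
  qed
  define F where "F = fourierB (%x :: (real^'a) * (real^'b). g (norm (fst x), norm (snd x)))"
  have Ff: "fourierB f om = of_real s * F om" for om :: "(real^'a) * (real^'b)"
  proof -
  have "of_real s * F om = (LINT x|lborel. of_real s * (g (norm (fst x), norm (snd x)) * exp (- \<i> * of_real (om \<bullet> x))))"
  unfolding F_def fourierB_def by (rule integral_mult_right_zero[symmetric])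
  also have "... = fourierB f om"
  unfolding fourierB_def using s by (intro Bochner_Integration.integral_cong refl) (simp add: g_def fun_cong[OF fe])
  finally show ?thesis ..
  qed
  have "(LINT om|surf. norm (fourierB f om) powr 2) <= C * s^2"
  proof (rule integral_real_bounded)
  have [measurable]: "(%om. F om): borel_measurable (surf :: ((real^'a) * (real^'b)) measure)"
  unfolding F_def g_def by (rule borel_measurable_surface_measure) measurable
  have "(nni surf (%om. enn (norm (fourierB f om) powr 2)))
  = (nni surf (%om. enn (s^2) * enn ((norm (F om))^2)))"
  using s by (intro nn_integral_cong) (simp add: Ff norm_mult power_mult_distrib ennreal_mult[symmetric])
  also have "... = enn (s^2) * (nni surf (%om. enn ((norm (F om))^2)))"
  by (rule nn_integral_cmult) measurable
  also have "... <= enn (s^2) * enn C" unfolding F_def by (intro mult_left_mono C(2) g g1) simp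
  also have "... = enn (C * s^2)" using C(1) by (simp add: ennreal_mult mult.commute)
  finally show "(nni surf (%om. enn (norm (fourierB f om) powr 2))) <= enn (C * s^2)" .
  qed (use C(1) in simp)
  then have "Lp_norm surf 2 (fourierB f) <= (C * s^2) powr (1 / 2)"
  unfolding Lp_norm_def by (intro powr_mono2) auto
  also have "... = sqrt C * s" using C(1) s by (simp add: powr_half_sqrt real_sqrt_mult)
  also have "... = sqrt C * k * t" by (simp add: s_def)
  also have "... <= D * t" using D t L0 by (intro mult_right_mono) auto
  finally show ?thesis .
  qed
  show "Lp_norm surf 2 (fourierB f) <= D * Lp_norm lborel p f"
  proof (rule field_le_epsilon)
  fix ep :: real assume ep: "0 < ep"
  have "Lp_norm surf 2 (fourierB f) <= D * (L + ep / D)" using ep D by (intro main) simp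
  then show "Lp_norm surf 2 (fourierB f) <= D * Lp_norm lborel p f + ep" using D by (simp add: L_def distrib_left)
  qed
 qed
qed

section \<open>Symmetric Schwartz functions from Gaussians\<close>

definition gauss1 :: "'a::euclidean_space \<times> 'b::euclidean_space => complex" where
 "gauss1 x = of_real (exp (- (fst x \<bullet> fst x)))"
definition gauss2 :: "'a::euclidean_space \<times> 'b::euclidean_space => complex" where
 "gauss2 x = of_real (exp (- (snd x \<bullet> snd x)))"

inductive_set gauss_poly :: "('a::euclidean_space \<times> 'b::euclidean_space => complex) set" where
 const: "(%x. c) \<in> gauss_poly"
| lin: "(%x. of_real (v \<bullet> x)) \<in> gauss_poly"
| g1: "gauss1 \<in> gauss_poly"
| g2: "gauss2 \<in> gauss_poly"
| add: "f \<in> gauss_poly ==> g \<in> gauss_poly ==> (%x. f x + g x) \<in> gauss_poly"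
| mult: "f \<in> gauss_poly ==> g \<in> gauss_poly ==> (%x. f x * g x) \<in> gauss_poly"

lemma gauss1_deriv: "(gauss1 has_derivative (%w. gauss1 x * (- 2 * of_real ((fst w, 0) \<bullet> x)))) (at x)"
 unfolding gauss1_def[abs_def] by (auto intro!: derivative_eq_intros simp: inner_commute inner_prod_def)

lemma gauss2_deriv: "(gauss2 has_derivative (%w. gauss2 x * (- 2 * of_real ((0, snd w) \<bullet> x)))) (at x)"
 unfolding gauss2_def[abs_def] by (auto intro!: derivative_eq_intros simp: inner_commute inner_prod_def)

lemma gauss_poly_derivative:
 assumes "h \<in> gauss_poly"
 shows "\<exists>D. (\<forall>x. (h has_derivative D x) (at x)) & (\<forall>v. (%x. D x v) \<in> gauss_poly)"
 using assms
proof induction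
 case (const c)
 show ?case by (rule exI[of _ "%x v. 0"]) (auto intro: gauss_poly.intros)
next
 case (lin v)
 show ?case by (rule exI[of _ "%x w. of_real (v \<bullet> w)"]) (auto intro: gauss_poly.intros intro!: derivative_eq_intros)
next
 case g1
 show ?case
  by (rule exI[of _ "%x w. gauss1 x * (- 2 * of_real ((fst w, 0) \<bullet> x))"])
  (intro conjI allI gauss1_deriv gauss_poly.intros)
next
 case g2
 show ?case
  by (rule exI[of _ "%x w. gauss2 x * (- 2 * of_real ((0, snd w) \<bullet> x))"])
  (intro conjI allI gauss2_deriv gauss_poly.intros)
next
 case (add f g)
 then obtain Df Dg where D: "\<And>x. (f has_derivative Df x) (at x)" "\<And>x. (g has_derivative Dg x) (at x)"
  and p: "\<And>v. (%x. Df x v) \<in> gauss_poly" "\<And>v. (%x. Dg x v) \<in> gauss_poly" by blast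
 show ?case
  by (rule exI[of _ "%x v. Df x v + Dg x v"]) (intro conjI allI has_derivative_add D gauss_poly.add p)
next
 case (mult f g)
 then obtain Df Dg where D: "\<And>x. (f has_derivative Df x) (at x)" "\<And>x. (g has_derivative Dg x) (at x)"
  and p: "\<And>v. (%x. Df x v) \<in> gauss_poly" "\<And>v. (%x. Dg x v) \<in> gauss_poly" by blast
 show ?case
  by (rule exI[of _ "%x v. f x * Dg x v + Df x v * g x"])
  (intro conjI allI has_derivative_mult D gauss_poly.add gauss_poly.mult p mult.hyps)
qed

lemma gauss_poly_growth:
 assumes "h \<in> gauss_poly"
 shows "\<exists>C n. 0 <= C & (\<forall>x. norm (h x) <= C * (1 + norm x) ^ n)"
 using assms
proof induction
 case (const c)
 show ?case by (rule exI[of _ "norm c"], rule exI[of _ 0]) simp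
next
 case (lin v)
 have "\<bar>v \<bullet> x\<bar> <= norm v * (1 + norm x) ^ 1" for x
  using order_trans[OF Cauchy_Schwarz_ineq2[of v x]] by (simp add: mult_left_mono)
 then show ?case by (intro exI[of _ "norm v"] exI[of _ 1]) simp
next
 case g1
 show ?case by (rule exI[of _ 1], rule exI[of _ 0]) (simp add: gauss1_def)
next
 case g2
 show ?case by (rule exI[of _ 1], rule exI[of _ 0]) (simp add: gauss2_def)
next
 case (add f g)
 then obtain C n C' n' where *: "0 <= C" "\<And>x. norm (f x) <= C * (1 + norm x) ^ n" "0 <= C'" "\<And>x. norm (g x) <= C' * (1 + norm x) ^ n'" by blast
 have "norm (f x + g x) <= (C + C') * (1 + norm x) ^ (n + n')" for x
 proof -
  have "norm (f x + g x) <= C * (1 + norm x) ^ n + C' * (1 + norm x) ^ n'"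
  using *(2)[of x] *(4)[of x] norm_triangle_ineq[of "f x" "g x"] by linarith
  also have "... <= C * (1 + norm x) ^ (n + n') + C' * (1 + norm x) ^ (n + n')"
  using * by (intro add_mono mult_left_mono power_increasing) auto
  finally show ?thesis by (simp add: distrib_right)
 qed
 then show ?case using * by (intro exI[of _ "C + C'"] exI[of _ "n + n'"]) auto
next
 case (mult f g)
 then obtain C n C' n' where *: "0 <= C" "\<And>x. norm (f x) <= C * (1 + norm x) ^ n" "0 <= C'" "\<And>x. norm (g x) <= C' * (1 + norm x) ^ n'" by blast
 have "norm (f x * g x) <= (C * C') * (1 + norm x) ^ (n + n')" for x
 proof -
  have "norm (f x * g x) <= (C * (1 + norm x) ^ n) * (C' * (1 + norm x) ^ n')"
  unfolding norm_mult using * by (intro mult_mono) auto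
  then show ?thesis by (simp add: power_add mult_ac)
 qed
 then show ?case using * by (intro exI[of _ "C * C'"] exI[of _ "n + n'"]) auto
qed

lemma gauss_times_derivative:
 assumes h: "h \<in> gauss_poly"
 shows "\<exists>D. (\<forall>x. ((%x. gauss1 x * gauss2 x * h x) has_derivative (%v. gauss1 x * gauss2 x * D v x)) (at x)) & (\<forall>v. D v \<in> gauss_poly)"
proof -
 obtain D where D: "\<And>x. (h has_derivative D x) (at x)" "\<And>v. (%x. D x v) \<in> gauss_poly"
  using gauss_poly_derivative[OF h] by blast
 let ?D = "%v x. - 2 * of_real ((fst v, 0) \<bullet> x) * h x + - 2 * of_real ((0, snd v) \<bullet> x) * h x + D x v"
 have "((%x. gauss1 x * gauss2 x * h x) has_derivative (%v. gauss1 x * gauss2 x * ?D v x)) (at x)" for x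
  by (rule has_derivative_eq_rhs[OF has_derivative_mult[OF has_derivative_mult[OF gauss1_deriv gauss2_deriv] D(1)]])
  (auto simp: algebra_simps)
 moreover have "?D v \<in> gauss_poly" for v
  by (intro gauss_poly.add gauss_poly.mult gauss_poly.const gauss_poly.lin h D(2))
 ultimately show ?thesis by (intro exI[of _ ?D]) blast
qed

text \<open>Derivatives stay in the class, which is what makes these functions Schwartz.\<close>

lemma iter_deriv_gauss:
 assumes "h \<in> gauss_poly"
 shows "\<exists>h'\<in>gauss_poly. iter_deriv vs (%x. gauss1 x * gauss2 x * h x) = (%x. gauss1 x * gauss2 x * h' x)"
proof (induction vs)
 case Nil
 show ?case using assms by auto
next
 case (Cons v vs)
 then obtain h' where h': "h' \<in> gauss_poly" "iter_deriv vs (%x. gauss1 x * gauss2 x * h x) = (%x. gauss1 x * gauss2 x * h' x)" by blast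
 obtain D where D: "\<And>x. ((%x. gauss1 x * gauss2 x * h' x) has_derivative (%v. gauss1 x * gauss2 x * D v x)) (at x)" "\<And>v. D v \<in> gauss_poly"
  using gauss_times_derivative[OF h'(1)] by blast
 show ?case using D(2)[of v] frechet_derivative_at[OF D(1), symmetric] by (auto simp: h'(2))
qed

lemma power_times_gaussian_bounded: "\<exists>B. \<forall>r\<ge>0. (1 + r) ^ m * exp (- (r^2)) <= (B :: real)"
proof -
 let ?m = "Suc m"
 have "(1 + r) ^ m * exp (- (r^2)) <= real ?m ^ ?m * exp 2" if r: "0 <= r" for r :: real
 proof -
  have "(1 + r) ^ m <= (1 + r) ^ ?m" using r by (intro power_increasing) auto
  also have "... <= (real ?m * (1 + (1 + r) / real ?m)) ^ ?m"
  using r by (intro power_mono) (auto simp: field_simps)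
  also have "... = real ?m ^ ?m * (1 + (1 + r) / real ?m) ^ ?m" by (rule power_mult_distrib)
  also have "... <= real ?m ^ ?m * exp (1 + r)"
  using r by (intro mult_left_mono exp_ge_one_plus_x_over_n_power_n) auto
  finally have "(1 + r) ^ m * exp (- (r^2)) <= (real ?m ^ ?m * exp (1 + r)) * exp (1 - 2 * r)"
  proof (rule mult_mono)
  have "0 <= (r - 1)^2" by simp
  then show "exp (- (r^2)) <= exp (1 - 2 * r)" by (simp add: power2_eq_square algebra_simps)
  qed auto
  also have "... = real ?m ^ ?m * (exp (1 + r) * exp (1 - 2 * r))" by (rule mult.assoc)
  also have "... <= real ?m ^ ?m * exp 2" using r by (intro mult_left_mono) (auto simp: exp_add[symmetric])
  finally show ?thesis .
 qed
 then show ?thesis by blast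
qed

lemma gauss_product: "gauss1 x * gauss2 x = of_real (exp (- (norm x)\<^sup>2))"
 unfolding gauss1_def gauss2_def of_real_mult[symmetric] exp_add[symmetric] power2_norm_eq_inner by (simp add: inner_prod_def)

lemma schwartz_gauss_poly:
 assumes h: "h \<in> gauss_poly"
 shows "schwartz (%x. gauss1 x * gauss2 x * h x)"
 unfolding schwartz_def
proof (intro allI impI conjI)
 fix vs :: "('a * 'b) list"
 obtain h' where h': "h' \<in> gauss_poly" and eq: "iter_deriv vs (%x. gauss1 x * gauss2 x * h x) = (%x. gauss1 x * gauss2 x * h' x)"
  using iter_deriv_gauss[OF h] by blast
 show "iter_deriv vs (%x. gauss1 x * gauss2 x * h x) differentiable (at x)" for x
  unfolding eq differentiable_def using gauss_times_derivative[OF h'] by blast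
 fix N :: nat
 obtain C n where C: "0 <= C" "\<And>x. norm (h' x) <= C * (1 + norm x) ^ n" using gauss_poly_growth[OF h'] by blast
 obtain B :: real where B: "\<forall>r\<ge>0. (1 + r) ^ (N + n) * exp (- (r^2)) <= B" using power_times_gaussian_bounded[of "N + n"] ..
 have "norm (norm x ^ N *\<^sub>R (gauss1 x * gauss2 x * h' x)) <= C * B" for x
 proof -
  have "norm (norm x ^ N *\<^sub>R (gauss1 x * gauss2 x * h' x)) = norm x ^ N * (exp (- (norm x)\<^sup>2) * norm (h' x))"
  unfolding gauss_product norm_scaleR norm_mult norm_of_real by simp
  also have "... <= (1 + norm x) ^ N * (exp (- (norm x)\<^sup>2) * (C * (1 + norm x) ^ n))"
  proof (rule mult_mono)
  show "norm x ^ N <= (1 + norm x) ^ N" by (intro power_mono) auto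
  show "exp (- (norm x)\<^sup>2) * norm (h' x) <= exp (- (norm x)\<^sup>2) * (C * (1 + norm x) ^ n)"
  by (rule mult_left_mono[OF C(2)]) simp
  qed simp_all
  also have "... = C * ((1 + norm x) ^ (N + n) * exp (- (norm x)\<^sup>2))" by (simp only: power_add mult_ac)
  also have "... <= C * B" by (rule mult_left_mono[OF B[rule_format, OF norm_ge_zero] C(1)])
  finally show ?thesis .
 qed
 then show "bounded (range (%x. norm x ^ N *\<^sub>R iter_deriv vs (%x. gauss1 x * gauss2 x * h x) x))"
  unfolding eq bounded_iff by blast
qed

lemma gauss_poly_real_polynomial:
 assumes "real_polynomial_function P"
 shows "(%x. of_real (P (exp (- (fst x \<bullet> fst x)), exp (- (snd x \<bullet> snd x))))) \<in> gauss_poly"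
 using assms
proof induction
 case (linear f)
 then interpret bounded_linear f .
 have lin: "f (s, t) = f (1, 0) * s + f (0, 1) * t" for s t
  using add[of "(s, 0)" "(0, t)"] scaleR[of s "(1, 0)"] scaleR[of t "(0, 1)"] by simp
 have eq: "f (exp (- (fst x \<bullet> fst x)), exp (- (snd x \<bullet> snd x))) = f (1, 0) * exp (- (fst x \<bullet> fst x)) + f (0, 1) * exp (- (snd x \<bullet> snd x))" for x :: "'a * 'b"
  by (rule lin)
 have "(%x. of_real (f (exp (- (fst x \<bullet> fst x)), exp (- (snd x \<bullet> snd x))))) = (%x :: 'a * 'b. of_real (f (1, 0)) * gauss1 x + of_real (f (0, 1)) * gauss2 x)"
  by (simp only: eq gauss1_def gauss2_def of_real_add of_real_mult)
 then show ?case by (auto intro!: gauss_poly.intros)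
qed (auto intro: gauss_poly.intros)

text \<open>The points \<open>(exp (- |y|\<^sup>2), exp (- |z|\<^sup>2))\<close> fill a square. Below the level \<open>exp (- S\<^sup>2)\<close>, where the given function vanishes, the coordinates are clipped, so that dividing by the Gaussian leaves a continuous function on the closed square to which the Stone-Weierstrass theorem applies.\<close>

lemma gauss_poly_dense:
 fixes ph :: "real * real => complex"
 assumes ph: "continuous_on UNIV ph" and R: "\<And>p. R < norm p ==> ph p = 0" and ep: "0 < ep"
 shows "\<exists>F :: 'a::euclidean_space \<times> 'b::euclidean_space => complex. schwartz F & block_symmetric F &
  (\<forall>x. norm (F x - ph (norm (fst x), norm (snd x))) <= ep * exp (- (norm x)\<^sup>2))"
proof -
 define S where "S = \<bar>R\<bar> + 1"
 define dt where "dt = exp (- (S^2))"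
 have dt: "0 < dt" by (simp add: dt_def)
 define ch where "ch t = sqrt (- ln (max dt t))" for t
 define ps where "ps p = ph (ch (fst p), ch (snd p)) / of_real (max dt (fst p) * max dt (snd p))" for p
 have mx: "max dt t ~= 0" for t using dt by (simp add: max_def)
 have ch: "continuous_on UNIV (%p. ch (f p))" if "continuous_on UNIV f" for f :: "real * real => real"
  unfolding ch_def using mx that by (intro continuous_intros) auto
 have "continuous_on UNIV (%p. ph (ch (fst p), ch (snd p)))"
  by (rule continuous_on_compose2[OF ph]) (auto intro!: continuous_intros ch)
 then have psc: "continuous_on UNIV ps"
  unfolding ps_def using mx by (intro continuous_intros) auto
 obtain g where g: "polynomial_function g" "\<And>p. p \<in> cbox (0, 0) (1, 1) ==> norm (ps p - g p) < ep"
  using Stone_Weierstrass_polynomial_function[OF compact_cbox continuous_on_subset[OF psc subset_UNIV] ep, of "(0, 0)" "(1, 1)"] by auto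
 define e where "e x = (exp (- (fst x \<bullet> fst x)), exp (- (snd x \<bullet> snd x)))" for x :: "'a * 'b"
 define h where "h x = of_real ((Re \<circ> g) (e x)) + \<i> * of_real ((Im \<circ> g) (e x))" for x
 have h_eq: "h x = g (e x)" for x by (simp add: h_def complex_eq[symmetric])
 have "h \<in> gauss_poly"
 proof -
  have "real_polynomial_function (Re \<circ> g)" "real_polynomial_function (Im \<circ> g)"
  using g(1) bounded_linear_Re bounded_linear_Im unfolding polynomial_function_def by auto
  then show ?thesis unfolding h_def[abs_def] e_def
  by (intro gauss_poly.add gauss_poly.mult gauss_poly.const gauss_poly_real_polynomial)
 qed
 then have sch: "schwartz (%x. gauss1 x * gauss2 x * h x)" by (rule schwartz_gauss_poly)
 have sym: "block_symmetric (%x. gauss1 x * gauss2 x * h x)"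
  unfolding block_symmetric_def block_group_def
  by (auto simp: fun_eq_iff h_eq e_def gauss1_def gauss2_def orthogonal_transformation_def)
 have close: "norm (gauss1 x * gauss2 x * h x - ph (norm (fst x), norm (snd x))) <= ep * exp (- (norm x)\<^sup>2)" for x
 proof -
  let ?E = "exp (- (norm x)\<^sup>2)"
  have e: "e x = (exp (- (norm (fst x))\<^sup>2), exp (- (norm (snd x))\<^sup>2))" by (simp add: e_def power2_norm_eq_inner)
  have E: "?E = fst (e x) * snd (e x)" unfolding e_def by (simp add: exp_add[symmetric] power2_norm_eq_inner inner_prod_def)
  have box: "e x \<in> cbox (0, 0) (1, 1)" by (simp add: e cbox_Pair_eq)
  have S0: "0 < S" by (simp add: S_def)
  have small: "S < norm y" if "exp (- (norm y)\<^sup>2) < dt" for y :: "'c::real_normed_vector"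
  proof -
  have "S^2 < (norm y)^2" using that by (simp add: dt_def)
  then show ?thesis by (rule power2_less_imp_less) simp
  qed
  have ph0: "ph (r, s) = 0" if "S <= \<bar>r\<bar> \<or> S <= \<bar>s\<bar>" for r s
  proof (rule R)
  have "\<bar>r\<bar> <= norm (r, s)" "\<bar>s\<bar> <= norm (r, s)" using norm_fst_le[of r s] norm_snd_le[of s r] by auto
  then show "R < norm (r, s)" using that by (auto simp: S_def)
  qed
  have "ph (norm (fst x), norm (snd x)) = of_real ?E * ps (e x)"
  proof (cases "dt <= fst (e x) & dt <= snd (e x)")
  case True
  then have m: "max dt (fst (e x)) = fst (e x)" "max dt (snd (e x)) = snd (e x)" by auto
  have "ch (fst (e x)) = norm (fst x)" "ch (snd (e x)) = norm (snd x)" unfolding ch_def m by (simp_all add: e)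
  then show ?thesis unfolding ps_def m E by (simp add: e)
  next
  case False
  have Sd: "sqrt (- ln dt) = S" using S0 by (simp add: dt_def)
  have "S < norm (fst x) \<or> S < norm (snd x)" using False small[of "fst x"] small[of "snd x"] by (auto simp: e)
  then have 1: "ph (norm (fst x), norm (snd x)) = 0" by (intro ph0) auto
  have "ch (fst (e x)) = S \<or> ch (snd (e x)) = S" using False Sd by (auto simp: ch_def max_def)
  then have "ph (ch (fst (e x)), ch (snd (e x))) = 0" using S0 by (intro ph0) auto
  then show ?thesis unfolding ps_def 1 by simp
  qed
  then have "gauss1 x * gauss2 x * h x - ph (norm (fst x), norm (snd x)) = of_real ?E * (g (e x) - ps (e x))"
  unfolding gauss_product h_eq by (simp add: algebra_simps)
  also have "norm ... <= ?E * ep" unfolding norm_mult using g(2)[OF box] by (intro mult_mono) (auto simp: norm_minus_commute)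
  finally show ?thesis by (simp add: mult.commute)
 qed
 show ?thesis using sch sym close by (intro exI[of _ "%x. gauss1 x * gauss2 x * h x"]) blast
qed

section \<open>Density of symmetric Schwartz functions\<close>

definition Dp :: "real => ('v::euclidean_space => complex) => ennreal" where
 "Dp p f = (nni lebesgue (%x. enn (norm (f x) powr p)))"

lemma powr_add_le: "0 <= x ==> 0 <= y ==> 0 <= p ==> (x + y) powr p <= 2 powr p * (x powr p + y powr p :: real)"
proof -
 assume *: "0 <= x" "0 <= y" "0 <= p"
 have "(x + y) powr p <= (2 * max x y) powr p" using * by (intro powr_mono2) auto
 also have "... = 2 powr p * max x y powr p" using * by (simp add: powr_mult)
 also have "... <= 2 powr p * (x powr p + y powr p)" by (intro mult_left_mono) (auto simp: max_def)
 finally show ?thesis .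
qed

lemma Dp_add:
 fixes f g :: "'v::euclidean_space => complex"
 assumes [measurable]: "f: borel_measurable lebesgue" "g: borel_measurable lebesgue" and p: "1 <= p"
 shows "Dp p (%x. f x + g x) <= enn (2 powr p) * (Dp p f + Dp p g)"
proof -
 have "Dp p (%x. f x + g x) <= (nni lebesgue (%x. enn (2 powr p) * (enn (norm (f x) powr p) + enn (norm (g x) powr p))))"
  unfolding Dp_def
 proof (rule nn_integral_mono)
  fix x
  have "norm (f x + g x) powr p <= (norm (f x) + norm (g x)) powr p" using p by (intro powr_mono2 norm_triangle_ineq) auto
  also have "... <= 2 powr p * (norm (f x) powr p + norm (g x) powr p)" using p by (intro powr_add_le) auto
  finally show "enn (norm (f x + g x) powr p) <= enn (2 powr p) * (enn (norm (f x) powr p) + enn (norm (g x) powr p))"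
  by (simp add: ennreal_mult[symmetric] ennreal_plus[symmetric] ennreal_leI del: ennreal_plus)
 qed
 also have "... = enn (2 powr p) * (Dp p f + Dp p g)"
  unfolding Dp_def by (simp add: nn_integral_cmult nn_integral_add)
 finally show ?thesis .
qed

definition block_approx :: "real => ('a::euclidean_space \<times> 'b::euclidean_space => complex) => bool" where
 "block_approx p f \<longleftrightarrow> f: borel_measurable lebesgue & (\<forall>ep>0. \<exists>ph R. continuous_on UNIV ph & (\<forall>q. R < norm q \<longrightarrow> ph q = 0) &
  Dp p (%x. ph (norm (fst x), norm (snd x)) - f x) < enn ep)"

lemma radial_lebesgue_measurable:
 fixes ph :: "real * real => complex"
 assumes "continuous_on UNIV ph"
 shows "(%x :: 'a::euclidean_space \<times> 'b::euclidean_space. ph (norm (fst x), norm (snd x))): borel_measurable lebesgue"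
  "(%x :: 'a::euclidean_space \<times> 'b::euclidean_space. ph (norm (fst x), norm (snd x))): borel_measurable borel"
proof -
 show "(%x :: 'a * 'b. ph (norm (fst x), norm (snd x))): borel_measurable borel"
  by (intro borel_measurable_continuous_onI continuous_on_compose2[OF assms]) (auto intro!: continuous_intros)
 then show "(%x :: 'a * 'b. ph (norm (fst x), norm (snd x))): borel_measurable lebesgue"
  by (intro measurable_completion) simp
qed

lemma block_approx_limit:
 fixes f :: "'a::euclidean_space \<times> 'b::euclidean_space => complex"
 assumes p: "1 <= p" and f: "f: borel_measurable lebesgue"
  and g: "\<And>ep. 0 < ep ==> \<exists>g. block_approx p g & Dp p (%x. g x - f x) < enn ep"
 shows "block_approx p f"
 unfolding block_approx_def
proof (intro conjI allI impI f)
 fix ep :: real assume ep: "0 < ep"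
 define e where "e = ep / (2 powr p * 2)"
 have e: "0 < e" using ep by (simp add: e_def)
 obtain g where g1: "block_approx p g" and g2: "Dp p (%x. g x - f x) < enn e" using g[OF e] by blast
 obtain ph R where ph: "continuous_on UNIV ph" "\<forall>q. R < norm q \<longrightarrow> ph q = 0" "Dp p (%x. ph (norm (fst x), norm (snd x)) - g x) < enn e"
  using g1 e unfolding block_approx_def by blast
 have gm: "g: borel_measurable lebesgue" using g1 by (simp add: block_approx_def)
 note m = borel_measurable_diff[OF radial_lebesgue_measurable(1)[OF ph(1)] gm] borel_measurable_diff[OF gm f]
 have "Dp p (%x. ph (norm (fst x), norm (snd x)) - f x) = Dp p (%x. (ph (norm (fst x), norm (snd x)) - g x) + (g x - f x))" by simp
 also have "... <= enn (2 powr p) * (Dp p (%x. ph (norm (fst x), norm (snd x)) - g x) + Dp p (%x. g x - f x))"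
  by (rule Dp_add[OF m p])
 also have "... < enn (2 powr p) * (enn e + enn e)"
  using ph(3) g2 by (intro ennreal_mult_strict_left_mono add_strict_mono) (auto simp: less_top[symmetric])
 also have "... = enn ep" using e by (simp add: ennreal_plus[symmetric] ennreal_mult[symmetric] del: ennreal_plus) (simp add: e_def)
 finally show "\<exists>ph R. continuous_on UNIV ph & (\<forall>q. R < norm q \<longrightarrow> ph q = 0) & Dp p (%x. ph (norm (fst x), norm (snd x)) - f x) < enn ep"
  using ph by blast
qed

lemma block_approx_zero: "block_approx p (%x. 0)"
 unfolding block_approx_def by (auto simp: Dp_def intro!: exI[of _ "%q. 0"])

lemma block_approx_add:
 fixes f g :: "'a::euclidean_space \<times> 'b::euclidean_space => complex"
 assumes p: "1 <= p" and f: "block_approx p f" and g: "block_approx p g"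
 shows "block_approx p (%x. f x + g x)"
 unfolding block_approx_def
proof (intro conjI allI impI)
 have fm: "f: borel_measurable lebesgue" and gm: "g: borel_measurable lebesgue" using f g by (auto simp: block_approx_def)
 show "(%x. f x + g x): borel_measurable lebesgue" using fm gm by simp
 fix ep :: real assume ep: "0 < ep"
 define e where "e = ep / (2 powr p * 2)"
 have e: "0 < e" using ep by (simp add: e_def)
 obtain ph R where ph: "continuous_on UNIV ph" "\<forall>q. R < norm q \<longrightarrow> ph q = 0" "Dp p (%x. ph (norm (fst x), norm (snd x)) - f x) < enn e"
  using f e unfolding block_approx_def by blast
 obtain ps S where ps: "continuous_on UNIV ps" "\<forall>q. S < norm q \<longrightarrow> ps q = 0" "Dp p (%x. ps (norm (fst x), norm (snd x)) - g x) < enn e"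
  using g e unfolding block_approx_def by blast
 note m = borel_measurable_diff[OF radial_lebesgue_measurable(1)[OF ph(1)] fm] borel_measurable_diff[OF radial_lebesgue_measurable(1)[OF ps(1)] gm]
 have "Dp p (%x. (ph (norm (fst x), norm (snd x)) + ps (norm (fst x), norm (snd x))) - (f x + g x))
  = Dp p (%x. (ph (norm (fst x), norm (snd x)) - f x) + (ps (norm (fst x), norm (snd x)) - g x))" by (simp add: algebra_simps)
 also have "... <= enn (2 powr p) * (Dp p (%x. ph (norm (fst x), norm (snd x)) - f x) + Dp p (%x. ps (norm (fst x), norm (snd x)) - g x))"
  by (rule Dp_add[OF m p])
 also have "... < enn (2 powr p) * (enn e + enn e)"
  using ph(3) ps(3) by (intro ennreal_mult_strict_left_mono add_strict_mono) (auto simp: less_top[symmetric])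
 also have "... = enn ep" using e by (simp add: ennreal_plus[symmetric] ennreal_mult[symmetric] del: ennreal_plus) (simp add: e_def)
 finally show "\<exists>ph R. continuous_on UNIV ph & (\<forall>q. R < norm q \<longrightarrow> ph q = 0) & Dp p (%x. ph (norm (fst x), norm (snd x)) - (f x + g x)) < enn ep"
  using ph ps by (intro exI[of _ "%q. ph q + ps q"] exI[of _ "max R S"]) (auto intro!: continuous_intros)
qed

lemma block_approx_scale:
 fixes f :: "'a::euclidean_space \<times> 'b::euclidean_space => complex"
 assumes p: "1 <= p" and f: "block_approx p f"
 shows "block_approx p (%x. c * f x)"
proof (cases "c = 0")
 case True then show ?thesis by (simp add: block_approx_zero)
next
 case False
 have fm: "f: borel_measurable lebesgue" using f by (auto simp: block_approx_def)
 show ?thesis unfolding block_approx_def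
 proof (intro conjI allI impI)
  show "(%x. c * f x): borel_measurable lebesgue" using fm by simp
  fix ep :: real assume ep: "0 < ep"
  define e where "e = ep / norm c powr p"
  have e: "0 < e" using ep False by (simp add: e_def)
  obtain ph R where ph: "continuous_on UNIV ph" "\<forall>q. R < norm q \<longrightarrow> ph q = 0" "Dp p (%x. ph (norm (fst x), norm (snd x)) - f x) < enn e"
  using f e unfolding block_approx_def by blast
  note m [measurable] = borel_measurable_diff[OF radial_lebesgue_measurable(1)[OF ph(1)] fm]
  have "Dp p (%x. c * ph (norm (fst x), norm (snd x)) - c * f x) = (nni lebesgue (%x. enn (norm c powr p) * enn (norm (ph (norm (fst x), norm (snd x)) - f x) powr p)))"
  unfolding Dp_def by (simp add: right_diff_distrib[symmetric] norm_mult powr_mult ennreal_mult)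
  also have "... = enn (norm c powr p) * Dp p (%x. ph (norm (fst x), norm (snd x)) - f x)"
  unfolding Dp_def by (rule nn_integral_cmult) measurable
  also have "... < enn (norm c powr p) * enn e" using ph(3) False by (intro ennreal_mult_strict_left_mono) (auto simp: less_top[symmetric])
  also have "... = enn ep" using e False by (simp add: ennreal_mult[symmetric]) (simp add: e_def)
  finally show "\<exists>ph R. continuous_on UNIV ph & (\<forall>q. R < norm q \<longrightarrow> ph q = 0) & Dp p (%x. ph (norm (fst x), norm (snd x)) - c * f x) < enn ep"
  using ph by (intro exI[of _ "%q. c * ph q"] exI[of _ R]) (auto intro!: continuous_intros)
 qed
qed

lemma block_approx_compact:
 fixes Q :: "(real * real) set"
 assumes p: "1 <= p" and Q: "compact Q"
 shows "block_approx p (%x :: 'a::euclidean_space \<times> 'b::euclidean_space. indicator Q (norm (fst x), norm (snd x)))"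
proof (cases "Q = {}")
 case True then show ?thesis by (simp add: block_approx_zero)
next
 case False
 let ?N = "%x :: 'a * 'b. (norm (fst x), norm (snd x))"
 obtain R where R: "\<And>q. q \<in> Q ==> norm q <= R" using compact_imp_bounded[OF Q] unfolding bounded_iff by blast
 define ph where "ph k q = cpx (max 0 (1 - real k * infdist q Q))" for k q
 have phc: "continuous_on UNIV (ph k)" for k unfolding ph_def by (intro continuous_intros)
 have infd: "norm q <= R + infdist q Q" for q
 proof -
  obtain z where z: "z \<in> Q" "infdist q Q = dist q z" using infdist_attains_inf[OF compact_imp_closed[OF Q] False] by blast
  have "norm q <= norm z + norm (q - z)" by norm
  then show ?thesis using R[OF z(1)] z(2) by (simp add: dist_norm)
 qed
 have phR: "ph (Suc k) q = 0" if "R + 1 < norm q" for k q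
 proof -
  have "1 * 1 <= real (Suc k) * infdist q Q" using infd[of q] that by (intro mult_mono) auto
  then show ?thesis by (simp add: ph_def)
 qed
 have ph1: "ph k q = 1" if "q \<in> Q" for k q using that by (simp add: ph_def)
 have nN: "norm (?N x) = norm x" for x by (simp add: norm_prod_def)
 have im: "(%x. indicator Q (?N x) :: complex): borel_measurable lebesgue"
 proof -
  have "Q \<in> sets borel" using Q by (simp add: compact_imp_closed borel_closed)
  then have "(%x. indicator Q (?N x) :: complex): borel_measurable borel" by measurable
  then show ?thesis by (intro measurable_completion) simp
 qed
 have lim: "(%k. Dp p (%x. ph (Suc k) (?N x) - indicator Q (?N x))) \<longlonglongrightarrow> (nni (lebesgue :: ('a * 'b) measure) (%x. 0))"
  unfolding Dp_def
 proof (rule nn_integral_dominated_convergence[where w = "%x. indicator (cball 0 (R + 1)) x"])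
  show "(%x. enn (norm (ph (Suc k) (?N x) - indicator Q (?N x)) powr p)): borel_measurable lebesgue" for k
  using borel_measurable_diff[OF radial_lebesgue_measurable(1)[OF phc] im] by measurable
  show "AE x in lebesgue. enn (norm (ph (Suc k) (?N x) - indicator Q (?N x)) powr p) <= indicator (cball 0 (R + 1)) x" for k
  proof (rule AE_I2)
  fix x :: "'a * 'b"
  show "enn (norm (ph (Suc k) (?N x) - indicator Q (?N x)) powr p) <= indicator (cball 0 (R + 1)) x"
  proof (cases "norm x <= R + 1")
  case True
  have "norm (ph (Suc k) (?N x) - indicator Q (?N x)) <= 1"
  proof (cases "?N x \<in> Q")
  case True
  then show ?thesis using ph1[OF True, of "Suc k"] by simp
  next
  case False
  have "0 <= real (Suc k) * infdist (?N x) Q" by (intro mult_nonneg_nonneg infdist_nonneg) simp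
  then show ?thesis using False unfolding ph_def by (simp del: of_nat_Suc)
  qed
  then have "norm (ph (Suc k) (?N x) - indicator Q (?N x)) powr p <= 1 powr p" using p by (intro powr_mono2) auto
  then show ?thesis using True by simp
  next
  case False
  then have "R + 1 < norm (?N x)" unfolding nN by simp
  then have "ph (Suc k) (?N x) = 0" "?N x \<notin> Q" using phR[of "?N x" k] R[of "?N x"] by auto
  then show ?thesis by simp
  qed
  qed
  show "(nni lebesgue (%x. indicator (cball 0 (R + 1)) (x :: 'a * 'b))) < \<infinity>"
  unfolding nn_integral_completion using emeasure_bounded_finite[OF bounded_cball, of "0 :: 'a * 'b" "R + 1"] by simp
  show "AE x in lebesgue. (%k. enn (norm (ph (Suc k) (?N x) - indicator Q (?N x)) powr p)) \<longlonglongrightarrow> 0"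
  proof (rule AE_I2, rule tendsto_eventually)
  fix x :: "'a * 'b"
  show "\<forall>\<^sub>F k in sequentially. enn (norm (ph (Suc k) (?N x) - indicator Q (?N x)) powr p) = 0"
  proof (cases "?N x \<in> Q")
  case True
  then show ?thesis using ph1[OF True] by simp
  next
  case False
  then have d: "0 < infdist (?N x) Q" using in_closed_iff_infdist_zero[OF compact_imp_closed[OF Q] \<open>Q ~= {}\<close>, of "?N x"] infdist_nonneg[of "?N x" Q] by (simp add: less_le)
  obtain n :: nat where n: "1 / infdist (?N x) Q < real n" using reals_Archimedean2 by blast
  have z: "ph (Suc k) (?N x) = 0" if "n <= k" for k
  proof -
  have "1 < real n * infdist (?N x) Q" using n d by (simp add: field_simps)
  also have "... <= real (Suc k) * infdist (?N x) Q" using that d by (intro mult_right_mono) auto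
  finally show ?thesis by (simp add: ph_def)
  qed
  have i0: "indicator Q (?N x) = (0 :: complex)" using False by simp
  show ?thesis by (rule eventually_mono[OF eventually_ge_at_top[of n]]) (simp add: z i0)
  qed
  qed
 qed (auto intro!: borel_measurable_indicator fmeasurableD lmeasurable_cball)
 show ?thesis unfolding block_approx_def
 proof (intro conjI allI impI im)
  fix ep :: real assume ep: "0 < ep"
  have "\<forall>\<^sub>F k in sequentially. Dp p (%x. ph (Suc k) (?N x) - indicator Q (?N x)) < enn ep"
  using lim ep by (intro order_tendstoD) auto
  then obtain k where "Dp p (%x. ph (Suc k) (?N x) - indicator Q (?N x)) < enn ep" unfolding eventually_sequentially by blast
  then show "\<exists>ph R. continuous_on UNIV ph & (\<forall>q. R < norm q \<longrightarrow> ph q = 0) & Dp p (%x. ph (?N x) - indicator Q (?N x)) < enn ep"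
  using phc phR by (intro exI[of _ "ph (Suc k)"] exI[of _ "R + 1"]) auto
 qed
qed

text \<open>Inner regularity gives a compact subset; the set of all points with the same norms as one of its points is still contained in the symmetric set.\<close>

lemma block_approx_indicator:
 fixes E :: "((real^'a::finite) \<times> (real^'b::finite)) set"
 assumes p: "1 <= p" and E: "E \<in> sets lebesgue" and fin: "emeasure lebesgue E < \<infinity>"
  and sym: "\<And>x y. x \<in> E ==> norm (fst x) = norm (fst y) ==> norm (snd x) = norm (snd y) ==> y \<in> E"
 shows "block_approx p (indicator E)"
proof (rule block_approx_limit[OF p])
 let ?N = "%x :: (real^'a) * (real^'b). (norm (fst x), norm (snd x))"
 show "indicator E: borel_measurable lebesgue" using E by simp
 fix ep :: real assume ep: "0 < ep"
 obtain T where T: "closed T" "T \<subseteq> E" "E - T \<in> lmeasurable" "emeasure lebesgue (E - T) < enn (ep / 2)"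
  using sets_lebesgue_inner_closed[OF E, of "ep / 2"] ep by auto
 have lim: "(%n. emeasure lebesgue (E - cball 0 (real n))) \<longlonglongrightarrow> emeasure lebesgue (\<Inter>n. E - cball 0 (real n))"
 proof (rule Lim_emeasure_decseq)
  show "range (%n. E - cball 0 (real n)) \<subseteq> sets lebesgue" using E by auto
  show "decseq (%n. E - cball 0 (real n))" by (auto simp: decseq_def)
  show "emeasure lebesgue (E - cball 0 (real n)) ~= \<infinity>" for n
  using emeasure_mono[of "E - cball 0 (real n)" E lebesgue] E fin by (auto simp: top_unique)
 qed
 have "x \<notin> (\<Inter>n. E - cball 0 (real n))" for x using real_arch_simple[of "norm x"] by auto
 then have e: "(\<Inter>n. E - cball 0 (real n)) = {}" by blast
 have "\<forall>\<^sub>F n in sequentially. emeasure lebesgue (E - cball 0 (real n)) < enn (ep / 2)"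
  using order_tendstoD(2)[OF lim[unfolded e emeasure_empty], of "enn (ep / 2)"] ep by simp
 then obtain n where n: "emeasure lebesgue (E - cball 0 (real n)) < enn (ep / 2)"
  unfolding eventually_sequentially by blast
 define K where "K = T \<inter> cball 0 (real n)"
 have K: "compact K" "K \<subseteq> E" using T by (auto simp: K_def compact_Int_closed Int_commute[of T])
 have cQ: "compact (?N ` K)" by (intro compact_continuous_image K continuous_intros)
 have sub: "x \<in> E" if "?N x \<in> ?N ` K" for x
 proof -
  from that obtain y where "?N x = ?N y" "y \<in> K" by (rule imageE)
  then show ?thesis using sym[of y x] K(2) by auto
 qed
 have "Dp p (%x. indicator (?N ` K) (?N x) - indicator E x) <= (nni lebesgue (%x. indicator (E - T) x + indicator (E - cball 0 (real n)) x))"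
  unfolding Dp_def
 proof (rule nn_integral_mono)
  fix x :: "(real^'a) * (real^'b)"
  show "enn (norm (indicator (?N ` K) (?N x) - indicator E x :: complex) powr p) <= indicator (E - T) x + indicator (E - cball 0 (real n)) x"
  proof (cases "x \<in> E & ?N x \<notin> ?N ` K")
  case True
  then have "x \<notin> K" by blast
  then show ?thesis using True by (auto simp: K_def indicator_def)
  next
  case False
  then have "indicator (?N ` K) (?N x) - indicator E x = (0 :: complex)" using sub[of x] by (auto simp: indicator_def)
  then show ?thesis by simp
  qed
 qed
 also have "... = emeasure lebesgue (E - T) + emeasure lebesgue (E - cball 0 (real n))"
 proof -
  have m: "E - T \<in> sets lebesgue" "E - cball 0 (real n) \<in> sets lebesgue" using E fmeasurableD[OF T(3)] by auto
  show ?thesis using m by (simp add: nn_integral_add borel_measurable_indicator)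
 qed
 also have "... < enn (ep / 2) + enn (ep / 2)" by (intro add_strict_mono T n)
 also have "... = enn ep" using ep by (simp add: ennreal_plus[symmetric] del: ennreal_plus)
 finally show "\<exists>g. block_approx p g & Dp p (%x. g x - indicator E x) < enn ep"
  using block_approx_compact[OF p cQ] by blast
qed

lemma block_symmetric_norms:
 fixes f :: "(real^'a::finite) \<times> (real^'b::finite) => complex"
 assumes "block_symmetric f" "norm (fst x) = norm (fst y)" "norm (snd x) = norm (snd y)"
 shows "f x = f y"
proof -
 obtain e where e: "\<And>x. f x = f (e (norm (fst x), norm (snd x)))"
  using block_symmetric_profile[OF assms(1)] by blast
 have "f x = f (e (norm (fst x), norm (snd x)))" by (rule e)
 also have "... = f y" unfolding assms(2,3) by (rule e[symmetric])
 finally show ?thesis .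
qed

lemma block_approx_symmetric:
 fixes f :: "(real^'a::finite) \<times> (real^'b::finite) => complex"
 assumes p: "1 <= p" and f: "in_Lp lebesgue p f" and sym: "block_symmetric f"
 shows "block_approx p f"
proof (rule block_approx_limit[OF p])
 show fm [measurable]: "f: borel_measurable lebesgue" using f by (simp add: in_Lp_def)
 have fi: "Dp p f < \<infinity>" using f by (simp add: in_Lp_def Dp_def integrable_iff_bounded)
 obtain s :: "nat => complex => complex" where s: "\<And>i. simple_function borel (s i)" "\<And>z. (%i. s i z) \<longlonglongrightarrow> z" "\<And>i z. norm (s i z) <= 2 * norm z"
  using borel_measurable_implies_sequence_metric[of "%z::complex. z" borel 0] by auto
 have sm [measurable]: "s i: borel_measurable borel" for i using s(1) by (rule borel_measurable_simple_function)
 have sfm: "(%x. s i (f x)): borel_measurable lebesgue" for i by measurable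
 have dom: "(nni lebesgue (%x. enn (3 powr p) * enn (norm (f x) powr p))) < \<infinity>"
  using fi by (subst nn_integral_cmult) (auto simp: Dp_def ennreal_mult_less_top)
 have approx: "block_approx p (%x. s i (f x))" for i
 proof -
  let ?R = "range (s i) - {0}"
  have fin: "finite ?R" using s(1)[of i] by (simp add: simple_function_def)
  have ind: "block_approx p (%x. c * indicator {x. s i (f x) = c} x)" if c: "c ~= 0" for c
  proof (rule block_approx_scale[OF p block_approx_indicator[OF p]])
  show m: "{x. s i (f x) = c} \<in> sets lebesgue" using measurable_sets[OF sfm, of "{c}" i] by (simp add: vimage_def)
  have "enn (norm c powr p) * emeasure lebesgue {x. s i (f x) = c} = (nni lebesgue (%x. enn (norm c powr p) * indicator {x. s i (f x) = c} x))"
  using m by (simp add: nn_integral_cmult_indicator)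
  also have "... <= (nni lebesgue (%x. enn (3 powr p) * enn (norm (f x) powr p)))"
  proof (rule nn_integral_mono)
  fix x
  have "norm (s i (f x)) <= 3 * norm (f x)" using s(3)[of i "f x"] norm_ge_zero[of "f x"] by linarith
  then have "norm (s i (f x)) powr p <= (3 * norm (f x)) powr p" using p by (intro powr_mono2) auto
  then show "enn (norm c powr p) * indicator {x. s i (f x) = c} x <= enn (3 powr p) * enn (norm (f x) powr p)"
  by (auto simp: indicator_def powr_mult ennreal_mult[symmetric] intro!: ennreal_leI)
  qed
  also note dom
  finally show "emeasure lebesgue {x. s i (f x) = c} < \<infinity>" using c by (auto simp: ennreal_mult_less_top)
  show "y \<in> {x. s i (f x) = c}" if "x \<in> {x. s i (f x) = c}" "norm (fst x) = norm (fst y)" "norm (snd x) = norm (snd y)" for x y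
  using block_symmetric_norms[OF sym that(2,3)] that(1) by simp
  qed
  have "block_approx p (%x. \<Sum>c\<in>A. c * indicator {x. s i (f x) = c} x)" if "finite A" "0 \<notin> A" for A
  using that
  proof (induction A)
  case empty
  show ?case unfolding sum.empty by (rule block_approx_zero)
  next
  case (insert c A)
  have "block_approx p (%x. c * indicator {x. s i (f x) = c} x + (\<Sum>c\<in>A. c * indicator {x. s i (f x) = c} x))"
  by (rule block_approx_add[OF p ind insert.IH]) (use insert.prems in auto)
  then show ?case unfolding sum.insert[OF insert.hyps] .
  qed
  from this[OF fin] have "block_approx p (%x. \<Sum>c\<in>?R. c * indicator {x. s i (f x) = c} x)" by simp
  moreover have "(\<Sum>c\<in>?R. c * indicator {x. s i (f x) = c} x) = s i (f x)" for x
  proof -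
  have "(\<Sum>c\<in>?R. c * indicator {x. s i (f x) = c} x) = (\<Sum>c\<in>?R. if c = s i (f x) then c else 0)"
  by (intro sum.cong refl) (auto simp: indicator_def)
  also have "... = s i (f x)" using fin by (auto simp: sum.delta)
  finally show ?thesis .
  qed
  ultimately show ?thesis by simp
 qed
 fix ep :: real assume ep: "0 < ep"
 have "(%i. Dp p (%x. s i (f x) - f x)) \<longlonglongrightarrow> (nni (lebesgue :: ((real^'a) * (real^'b)) measure) (%x. 0))"
  unfolding Dp_def
 proof (rule nn_integral_dominated_convergence[OF _ _ _ _ dom])
  show "AE x in lebesgue. enn (norm (s i (f x) - f x) powr p) <= enn (3 powr p) * enn (norm (f x) powr p)" for i
  proof (rule AE_I2)
  fix x
  have "norm (s i (f x) - f x) powr p <= (3 * norm (f x)) powr p"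
  proof (rule powr_mono2)
  show "norm (s i (f x) - f x) <= 3 * norm (f x)"
  using s(3)[of i "f x"] norm_triangle_ineq4[of "s i (f x)" "f x"] by linarith
  qed (use p in auto)
  then show "enn (norm (s i (f x) - f x) powr p) <= enn (3 powr p) * enn (norm (f x) powr p)"
  by (simp add: powr_mult ennreal_mult[symmetric] ennreal_leI)
  qed
  show "AE x in lebesgue. (%i. enn (norm (s i (f x) - f x) powr p)) \<longlonglongrightarrow> 0"
  proof (rule AE_I2)
  fix x
  have "(%i. norm (s i (f x) - f x)) \<longlonglongrightarrow> 0" using s(2)[of "f x"] by (simp add: tendsto_norm_zero LIM_zero)
  then have "(%i. norm (s i (f x) - f x) powr p) \<longlonglongrightarrow> 0 powr p" using p by (intro tendsto_powr'[OF _ tendsto_const]) auto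
  then show "(%i. enn (norm (s i (f x) - f x) powr p)) \<longlonglongrightarrow> 0" using tendsto_ennrealI by fastforce
  qed
 qed (use sfm in measurable)
 then have "\<forall>\<^sub>F i in sequentially. Dp p (%x. s i (f x) - f x) < enn ep" using ep by (intro order_tendstoD) auto
 then show "\<exists>g. block_approx p g & Dp p (%x. g x - f x) < enn ep"
  using approx unfolding eventually_sequentially by blast
qed

lemma schwartz_dense:
 fixes f :: "(real^'a::finite) \<times> (real^'b::finite) => complex"
 assumes p: "1 <= p" and f: "in_Lp lebesgue p f" and sym: "block_symmetric f" and ep: "0 < ep"
 shows "\<exists>F. schwartz F & block_symmetric F & Dp p (%x. F x - f x) < enn ep"
proof -
 let ?N = "%x :: (real^'a) * (real^'b). (norm (fst x), norm (snd x))"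
 have fm: "f: borel_measurable lebesgue" using f by (simp add: in_Lp_def)
 let ?G = "%x :: (real^'a) * (real^'b). cpx (exp (- (norm x)\<^sup>2))"
 have G: "Dp p ?G < \<infinity>"
 proof -
  have "?G = (%x. gauss1 x * gauss2 x * 1)" by (simp add: gauss_product)
  then have "schwartz ?G" using schwartz_gauss_poly[OF gauss_poly.const[of 1]] by simp
  from schwartz_integrable(2)[OF this p] show ?thesis by (simp add: Dp_def nn_integral_completion integrable_iff_bounded)
 qed
 define I where "I = enn2real (Dp p ?G)"
 have I: "Dp p ?G = enn I" "0 <= I" using G by (auto simp: I_def less_top)
 define e where "e = ep / (2 powr p * 2)"
 have e: "0 < e" using ep by (simp add: e_def)
 define et where "et = (e / (I + 1)) powr (1 / p)"
 have et: "0 < et" "et powr p = e / (I + 1)" using e I p by (auto simp: et_def powr_powr)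
 obtain ph R where ph: "continuous_on UNIV ph" "\<forall>q. R < norm q \<longrightarrow> ph q = 0" "Dp p (%x. ph (?N x) - f x) < enn e"
  using block_approx_symmetric[OF p f sym] e unfolding block_approx_def by blast
 obtain F :: "(real^'a) * (real^'b) => complex" where F: "schwartz F" "block_symmetric F" "\<And>x. norm (F x - ph (?N x)) <= et * exp (- (norm x)\<^sup>2)"
  using gauss_poly_dense[OF ph(1) _ et(1), of R] ph(2) by blast
 have Fm: "F: borel_measurable lebesgue" using schwartz_integrable(3)[OF F(1)] by (intro measurable_completion) simp
 have d: "Dp p (%x. F x - ph (?N x)) < enn e"
 proof -
  have "Dp p (%x. F x - ph (?N x)) <= (nni lebesgue (%x. enn (et powr p) * enn (norm (?G x) powr p)))"
  unfolding Dp_def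
  proof (rule nn_integral_mono)
  fix x :: "(real^'a) * (real^'b)"
  have "norm (F x - ph (?N x)) powr p <= (et * exp (- (norm x)\<^sup>2)) powr p" using F(3) p by (intro powr_mono2) auto
  then show "enn (norm (F x - ph (?N x)) powr p) <= enn (et powr p) * enn (norm (?G x) powr p)"
  using et(1) by (simp add: powr_mult ennreal_mult[symmetric] ennreal_leI)
  qed
  also have "... = enn (et powr p) * Dp p ?G"
  unfolding Dp_def nn_integral_completion by (rule nn_integral_cmult) measurable
  also have "... = enn (e / (I + 1) * I)" using e I by (simp add: et(2) ennreal_mult[symmetric])
  also have "... < enn e" using e I by (intro ennreal_lessI) (auto simp: field_simps)
  finally show ?thesis .
 qed
 have "Dp p (%x. F x - f x) = Dp p (%x. (F x - ph (?N x)) + (ph (?N x) - f x))" by simp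
 also have "... <= enn (2 powr p) * (Dp p (%x. F x - ph (?N x)) + Dp p (%x. ph (?N x) - f x))"
  by (rule Dp_add[OF borel_measurable_diff[OF Fm radial_lebesgue_measurable(1)[OF ph(1)]] borel_measurable_diff[OF radial_lebesgue_measurable(1)[OF ph(1)] fm] p])
 also have "... < enn (2 powr p) * (enn e + enn e)"
  using ph(3) d by (intro ennreal_mult_strict_left_mono add_strict_mono) (auto simp: less_top[symmetric])
 also have "... = enn ep" using e by (simp add: ennreal_plus[symmetric] ennreal_mult[symmetric] del: ennreal_plus) (simp add: e_def)
 finally show ?thesis using F by blast
qed

section \<open>Completeness and the extension by density\<close>

lemma Lp_norm_nonneg: "0 <= Lp_norm M q f" by (simp add: Lp_norm_def)

lemma Lp_norm_powr:
 assumes "1 <= q"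
 shows "Lp_norm M q f powr q = (LINT x|M. norm (f x) powr q)"
 using assms by (simp add: Lp_norm_def powr_powr)

lemma Lp_norm_minus_commute: "Lp_norm M q (%x. f x - g x) = Lp_norm M q (%x. g x - f x)"
 by (simp add: Lp_norm_def norm_minus_commute)

text \<open>A triangle inequality up to a constant, which suffices because the constant of the theorem is not specified.\<close>

lemma Lp_norm_add:
 assumes q: "1 <= q" and f: "in_Lp M q f" and g: "in_Lp M q g"
 shows "in_Lp M q (%x. f x + g x)" "Lp_norm M q (%x. f x + g x) <= 4 * (Lp_norm M q f + Lp_norm M q g)"
proof -
 have [measurable]: "f: borel_measurable M" "g: borel_measurable M" using f g by (auto simp: in_Lp_def)
 have i: "integrable M (%x. norm (f x) powr q)" "integrable M (%x. norm (g x) powr q)" using f g by (auto simp: in_Lp_def)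
 have le: "norm (f x + g x) powr q <= 2 powr q * (norm (f x) powr q + norm (g x) powr q)" for x
 proof -
  have "norm (f x + g x) powr q <= (norm (f x) + norm (g x)) powr q" using q by (intro powr_mono2 norm_triangle_ineq) auto
  also have "... <= 2 powr q * (norm (f x) powr q + norm (g x) powr q)" using q by (intro powr_add_le) auto
  finally show ?thesis .
 qed
 have i2: "integrable M (%x. 2 powr q * (norm (f x) powr q + norm (g x) powr q))" using i by simp
 have i3: "integrable M (%x. norm (f x + g x) powr q)"
  by (rule Bochner_Integration.integrable_bound[OF i2]) (use le in auto)
 then show "in_Lp M q (%x. f x + g x)" by (simp add: in_Lp_def)
 let ?m = "max (Lp_norm M q f) (Lp_norm M q g)"
 have "(LINT x|M. norm (f x + g x) powr q) <= (LINT x|M. 2 powr q * (norm (f x) powr q + norm (g x) powr q))"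
  by (rule Bochner_Integration.integral_mono[OF i3 i2 le])
 also have "... = 2 powr q * (Lp_norm M q f powr q + Lp_norm M q g powr q)"
  using i q by (simp add: Lp_norm_powr)
 also have "... <= 2 powr q * (2 * ?m powr q)"
  using q powr_mono2[of q "Lp_norm M q f" ?m] powr_mono2[of q "Lp_norm M q g" ?m] by (simp add: Lp_norm_nonneg)
 also have "... <= 2 powr q * (2 powr q * ?m powr q)"
  using powr_mono[of 1 q 2] q by (intro mult_left_mono mult_right_mono) auto
 also have "... = (4 * ?m) powr q"
 proof -
  have "2 powr q * (2 powr q * x powr q) = (4 * x) powr q" if "0 <= x" for x
  using that powr_mult[of 2 "2 * x" q] powr_mult[of 2 x q] by simp
  moreover have "0 <= ?m" using Lp_norm_nonneg[of M q f] by (rule max.coboundedI1)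
  ultimately show ?thesis by blast
 qed
 finally have "Lp_norm M q (%x. f x + g x) <= ((4 * ?m) powr q) powr (1 / q)"
  unfolding Lp_norm_def by (intro powr_mono2) (use q in auto)
 also have "... = 4 * ?m" using q Lp_norm_nonneg[of M q f] by (simp add: powr_powr max_def Lp_norm_nonneg)
 also have "... <= 4 * (Lp_norm M q f + Lp_norm M q g)" using Lp_norm_nonneg[of M q f] Lp_norm_nonneg[of M q g] by auto
 finally show "Lp_norm M q (%x. f x + g x) <= 4 * (Lp_norm M q f + Lp_norm M q g)" .
qed

lemma in_Lp_minus: "in_Lp M q f ==> in_Lp M q (%x. - f x)" by (simp add: in_Lp_def)

lemma Lp_norm_diff:
 assumes q: "1 <= q" and f: "in_Lp M q f" and g: "in_Lp M q g"
 shows "in_Lp M q (%x. f x - g x)" "Lp_norm M q (%x. f x - g x) <= 4 * (Lp_norm M q f + Lp_norm M q g)"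
 using Lp_norm_add[OF q f in_Lp_minus[OF g]] by (simp_all add: Lp_norm_def)

lemma Lp_norm_triangle:
 assumes q: "1 <= q" and f: "in_Lp M q f" and g: "in_Lp M q g" and h: "in_Lp M q h"
 shows "Lp_norm M q (%x. f x - h x) <= 4 * (Lp_norm M q (%x. f x - g x) + Lp_norm M q (%x. g x - h x))"
 using Lp_norm_add(2)[OF q Lp_norm_diff(1)[OF q f g] Lp_norm_diff(1)[OF q g h]] by simp

text \<open>A rapidly convergent Cauchy sequence converges pointwise almost everywhere, and Fatou's lemma turns the pointwise limit into a limit in the mean.\<close>

lemma L2_complete:
 assumes M: "finite_measure M" and A: "\<And>n. in_Lp M 2 (A n)" and C: "0 <= C"
  and cauchy: "\<And>n m. n <= m ==> Lp_norm M 2 (%x. A n x - A m x) <= C * (1 / 4) ^ n"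
 shows "\<exists>g. in_Lp M 2 g & (\<forall>n. Lp_norm M 2 (%x. A n x - g x) <= C * (1 / 4) ^ n)"
proof -
 interpret finite_measure M by (rule M)
 have [measurable]: "A n: borel_measurable M" for n using A by (auto simp: in_Lp_def)
 have d2: "(nni M (%x. enn ((norm (A n x - A m x))^2))) <= enn ((C * (1 / 4) ^ n)^2)" if "n <= m" for n m
 proof -
  have "integrable M (%x. norm (A n x - A m x) powr 2)" using Lp_norm_diff(1)[OF _ A[of n] A[of m]] by (simp add: in_Lp_def)
  then have "(nni M (%x. enn (norm (A n x - A m x) powr 2))) = enn (Lp_norm M 2 (%x. A n x - A m x) powr 2)"
  by (subst Lp_norm_powr) (auto intro!: nn_integral_eq_integral)
  also have "... <= enn ((C * (1 / 4) ^ n)^2)"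
  using cauchy[OF that] by (simp add: Lp_norm_nonneg ennreal_leI power_mono)
  finally show ?thesis by simp
 qed
 define u where "u n x = norm (A n x - A (Suc n) x)" for n x
 have [measurable]: "u n: borel_measurable M" for n unfolding u_def[abs_def] by measurable
 let ?sg = "measure M (space M)"
 have u: "(nni M (%x. enn (u n x))) <= enn ((?sg + C^2) * (1 / 2) ^ n)" for n
 proof -
  have "(nni M (%x. enn (u n x))) <= (nni M (%x. enn ((1 / 2) ^ n) + enn (2 ^ n) * enn ((u n x)^2)))"
  proof (rule nn_integral_mono)
  fix x
  \<comment> \<open>Trading a square for a first power keeps the series summable because the squares decay like \<open>16 powr - n\<close>.\<close>
  have "u n x <= (1 / 2) ^ n + 2 ^ n * (u n x)^2"
  proof (cases "u n x <= (1 / 2) ^ n")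
  case False
  have "1 * u n x <= (2 ^ n * u n x) * u n x"
  using False by (intro mult_right_mono) (auto simp: u_def power_one_over field_simps)
  then show ?thesis by (simp add: power2_eq_square mult.assoc add_increasing)
  qed (simp add: add_increasing2)
  then show "enn (u n x) <= enn ((1 / 2) ^ n) + enn (2 ^ n) * enn ((u n x)^2)"
  by (simp add: ennreal_mult[symmetric] ennreal_plus[symmetric] ennreal_leI del: ennreal_plus)
  qed
  also have "... = enn ((1 / 2) ^ n) * emeasure M (space M) + enn (2 ^ n) * (nni M (%x. enn ((u n x)^2)))"
  by (simp add: nn_integral_add nn_integral_cmult)
  also have "... <= enn ((1 / 2) ^ n) * enn ?sg + enn (2 ^ n) * enn ((C * (1 / 4) ^ n)^2)"
  unfolding u_def by (intro add_mono mult_left_mono d2) (auto simp: emeasure_eq_measure)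
  also have "... = enn ((1 / 2) ^ n * ?sg + 2 ^ n * (C * (1 / 4) ^ n)^2)"
  by (simp add: ennreal_mult[symmetric] ennreal_plus[symmetric] del: ennreal_plus)
  also have "... <= enn ((?sg + C^2) * (1 / 2) ^ n)"
  proof (rule ennreal_leI)
  have "2 ^ n * ((1 / 4) ^ n)^2 = ((1 / 8) ^ n :: real)"
  unfolding power_mult_distrib[symmetric] power2_eq_square by simp
  also have "... <= (1 / 2) ^ n" by (intro power_mono) auto
  finally have "C^2 * (2 ^ n * ((1 / 4) ^ n)^2) <= C^2 * (1 / 2) ^ n" by (rule mult_left_mono) simp
  then show "(1 / 2) ^ n * ?sg + 2 ^ n * (C * (1 / 4) ^ n)^2 <= (?sg + C^2) * (1 / 2) ^ n"
  unfolding power_mult_distrib[of C] distrib_right by (simp only: mult_ac add_le_cancel_left)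
  qed
  finally show ?thesis .
 qed
 have "(nni M (%x. (\<Sum>n. enn (u n x)))) = (\<Sum>n. \<integral>\<^sup>+x. enn (u n x) \<partial>M)" by (rule nn_integral_suminf) measurable
 also have "... <= (\<Sum>n. enn ((?sg + C^2) * (1 / 2) ^ n))" by (intro suminf_le u summableI)
 also have "... = enn ((?sg + C^2) * 2)"
 proof (rule suminf_ennreal_eq)
  show "(%n. (?sg + C^2) * (1 / 2) ^ n) sums ((?sg + C^2) * 2)"
  using sums_mult[OF geometric_sums[of "1/2 :: real"], of "?sg + C^2"] by simp
 qed simp
 finally have "(nni M (%x. (\<Sum>n. enn (u n x)))) ~= \<infinity>" by (auto simp: top_unique)
 then have "AE x in M. (\<Sum>n. enn (u n x)) ~= \<infinity>" by (intro nn_integral_PInf_AE) measurable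
 then have conv: "AE x in M. convergent (%n. A n x)"
 proof (rule eventually_mono)
  fix x assume "(\<Sum>n. enn (u n x)) ~= \<infinity>"
  then have "summable (%n. u n x)" by (intro summable_suminf_not_top) (auto simp: u_def)
  moreover have "u n x = norm (A (Suc n) x - A n x)" for n unfolding u_def by (rule norm_minus_commute)
  ultimately have "summable (%n. norm (A (Suc n) x - A n x))" by (simp only:)
  then have "summable (%n. A (Suc n) x - A n x)" by (rule summable_norm_cancel)
  then have "(%n. A 0 x + (\<Sum>i<n. A (Suc i) x - A i x)) \<longlonglongrightarrow> A 0 x + (\<Sum>i. A (Suc i) x - A i x)"
  by (rule tendsto_add[OF tendsto_const summable_LIMSEQ])
  moreover have "A 0 x + (\<Sum>i<n. A (Suc i) x - A i x) = A n x" for n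
  unfolding sum_lessThan_telescope[of "%n. A n x"] by simp
  ultimately have "(%n. A n x) \<longlonglongrightarrow> A 0 x + (\<Sum>i. A (Suc i) x - A i x)" by (simp only:)
  then show "convergent (%n. A n x)" by (rule convergentI)
 qed
 define g where "g x = lim (%n. A n x)" for x
 have [measurable]: "g: borel_measurable M" unfolding g_def by measurable
 have lim: "AE x in M. (%n. A n x) \<longlonglongrightarrow> g x"
  using conv by (auto simp: convergent_LIMSEQ_iff g_def)
 have fatou: "(nni M (%x. enn ((norm (A n x - g x))^2))) <= enn ((C * (1 / 4) ^ n)^2)" for n
 proof -
  have "(nni M (%x. enn ((norm (A n x - g x))^2))) = (nni M (%x. liminf (%m. enn ((norm (A n x - A m x))^2))))"
  proof (rule nn_integral_cong_AE, rule eventually_mono[OF lim])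
  fix x assume "(%m. A m x) \<longlonglongrightarrow> g x"
  then have "(%m. enn ((norm (A n x - A m x))^2)) \<longlonglongrightarrow> enn ((norm (A n x - g x))^2)"
  by (intro tendsto_ennrealI tendsto_power tendsto_norm tendsto_diff tendsto_const)
  then show "enn ((norm (A n x - g x))^2) = liminf (%m. enn ((norm (A n x - A m x))^2))"
  by (intro lim_imp_Liminf[symmetric]) auto
  qed
  also have "... <= liminf (%m. \<integral>\<^sup>+x. enn ((norm (A n x - A m x))^2) \<partial>M)" by (rule nn_integral_liminf) measurable
  also have "... <= liminf (%m. enn ((C * (1 / 4) ^ n)^2))"
  by (rule Liminf_mono, rule eventually_mono[OF eventually_ge_at_top[of n]]) (rule d2)
  also have "... = enn ((C * (1 / 4) ^ n)^2)" by (simp add: Liminf_const)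
  finally show ?thesis .
 qed
 have Ag: "in_Lp M 2 (%x. A n x - g x)" for n
  unfolding in_Lp_def integrable_iff_bounded using le_less_trans[OF fatou[of n], of \<infinity>] by simp
 show ?thesis
 proof (intro exI[of _ g] conjI allI)
  show "in_Lp M 2 g" using Lp_norm_diff(1)[OF _ A[of 0] Ag[of 0]] by simp
  show "Lp_norm M 2 (%x. A n x - g x) <= C * (1 / 4) ^ n" for n
  proof -
  have "(LINT x|M. norm (A n x - g x) powr 2) <= (C * (1 / 4) ^ n)^2"
  using fatou[of n] by (intro integral_real_bounded) simp_all
  then have "Lp_norm M 2 (%x. A n x - g x) <= ((C * (1 / 4) ^ n)^2) powr (1 / 2)"
  unfolding Lp_norm_def by (intro powr_mono2) auto
  then show ?thesis using C by (simp add: powr_half_sqrt)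
  qed
 qed
qed

lemma Lp_norm_zero_AE:
 assumes "in_Lp M q f" "1 <= q" "Lp_norm M q f = 0"
 shows "AE x in M. f x = 0"
proof -
 have "(LINT x|M. norm (f x) powr q) = 0" using Lp_norm_powr[OF assms(2), of M f] assms(3) by simp
 then have "AE x in M. norm (f x) powr q = 0"
  using assms(1) integral_nonneg_eq_0_iff_AE[of M "%x. norm (f x) powr q"] by (simp add: in_Lp_def)
 then show ?thesis by simp
qed

lemma in_Lp_fourier_surface:
 assumes f: "integrable lborel f"
 shows "in_Lp surf 2 (fourierB f)"
proof -
 have [measurable]: "f: borel_measurable borel" using f by auto
 have m: "fourierB f: borel_measurable borel" by measurable
 have bd: "norm (fourierB f xi) <= (LINT x|lborel. norm (f x))" for xi
  unfolding fourierB_def using integral_norm_bound[of lborel "%x. f x * exp (- \<i> * of_real (xi \<bullet> x))"] by (simp add: norm_mult)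
 have "integrable surf (%om. norm (fourierB f om) powr 2)"
  by (rule integrable_surface_bounded[where B="(LINT x|lborel. norm (f x))^2"]) (use m bd in \<open>auto intro: power_mono\<close>)
 then show ?thesis using borel_measurable_surface_measure[OF m] by (simp add: in_Lp_def)
qed

lemma schwartz_in_Lp:
 assumes "schwartz f" "1 <= p"
 shows "in_Lp lebesgue p f"
 using schwartz_integrable[OF assms(1)] assms(2)
 by (auto simp: in_Lp_def intro!: measurable_completion integrable_completion[THEN iffD2])

lemma block_symmetric_diff: "block_symmetric f ==> block_symmetric g ==> block_symmetric (%x. f x - g x)"
 by (simp add: block_symmetric_def fun_eq_iff)

theorem theorem1p1:
  fixes d k m :: nat and p :: real
  assumes "d \<ge> 4" and "2 \<le> k" and "k \<le> d - 2"
    and "m = min (d - k) k"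
    and "CARD('a::finite) = d - k" and "CARD('b::finite) = k"
    and "1 \<le> p" and "p \<le> 2 * (real d + real m) / (real d + real m + 2)"
  shows "\<exists>C\<ge>0.
    (\<forall>f :: (real^'a) \<times> (real^'b) \<Rightarrow> complex.
       schwartz f \<and> block_symmetric f \<longrightarrow>
         Lp_norm surface_measure 2 (fourier f) \<le> C * Lp_norm lebesgue p f) \<and>
    (\<forall>f :: (real^'a) \<times> (real^'b) \<Rightarrow> complex.
       in_Lp lebesgue p f \<and> block_symmetric f \<longrightarrow>
         (\<exists>g. fourier_restriction p f g \<and>
              (\<forall>h. fourier_restriction p f h \<longrightarrow> (AE \<omega> in surface_measure. h \<omega> = g \<omega>)) \<and>
              Lp_norm surface_measure 2 g \<le> C * Lp_norm lebesgue p f))"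
proof -
 have p1: "1 <= p" by fact
 have a2: "CARD('a) \<ge> 2" "CARD('b) \<ge> 2" using assms(1-6) by auto
 have dab: "real d = real CARD('a) + real CARD('b)" using assms(1-6) by (simp add: of_nat_diff)
 have m: "real m <= real CARD('a)" "real m <= real CARD('b)" using assms(4-6) by auto
 have mono: "2 * x / (x + 2) <= 2 * y / (y + 2)" if "0 <= x" "x <= y" for x y :: real
  using that by (simp add: field_simps)
 have pa: "p <= 2 * (2 * real CARD('a) + real CARD('b)) / (2 * real CARD('a) + real CARD('b) + 2)"
  using order_trans[OF assms(8) mono[of "real d + real m" "2 * real CARD('a) + real CARD('b)"]] dab m by simp
 have pb: "p <= 2 * (2 * real CARD('b) + real CARD('a)) / (2 * real CARD('b) + real CARD('a) + 2)"
  using order_trans[OF assms(8) mono[of "real d + real m" "2 * real CARD('b) + real CARD('a)"]] dab m by simp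
 obtain C where C: "0 <= C" and est: "\<And>f :: (real^'a) * (real^'b) => complex. integrable lborel f ==> integrable lborel (%x. norm (f x) powr p) ==>
  block_symmetric f ==> Lp_norm surf 2 (fourierB f) <= C * Lp_norm lborel p f"
  using restriction_estimate_integrable[OF a2 p1 pa pb] by blast
 let ?S = "%F :: (real^'a) * (real^'b) => complex. schwartz F & block_symmetric F"
 let ?L = "%f :: (real^'a) * (real^'b) => complex. Lp_norm lebesgue p f"
 let ?L2 = "%h :: (real^'a) * (real^'b) => complex. Lp_norm surf 2 h"
 have FS: "fourier F = fourierB F" "in_Lp surf 2 (fourier F)" "in_Lp lebesgue p F" if "?S F" for F
 proof -
  have F: "schwartz F" using that ..
  show e: "fourier F = fourierB F" by (rule fourier_eq_fourierB[OF schwartz_integrable(3)[OF F]])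
  show "in_Lp surf 2 (fourier F)" unfolding e by (rule in_Lp_fourier_surface[OF schwartz_integrable(1)[OF F]])
  show "in_Lp lebesgue p F" by (rule schwartz_in_Lp[OF F p1])
 qed
 have est1: "?L2 (fourier F) <= C * ?L F" if "?S F" for F
  using est[of F] that schwartz_integrable[of F] p1 by (simp add: FS(1) Lp_norm_lebesgue_borel)
 have est2: "?L2 (%om. fourier F om - fourier G om) <= C * ?L (%x. F x - G x)" if F: "?S F" and G: "?S G" for F G
 proof -
  note iF = schwartz_integrable[of F] and iG = schwartz_integrable[of G]
  have i: "integrable lborel (%x. F x - G x)" using iF(1) iG(1) F G by simp
  have m: "(%x. F x - G x): borel_measurable borel" using i by auto
  have "integrable lborel (%x. norm (F x - G x) powr p)"
  using Lp_norm_diff(1)[OF p1, of lborel F G] iF iG F G p1 by (simp add: in_Lp_def)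
  from est[OF i this block_symmetric_diff] F G have "?L2 (fourierB (%x. F x - G x)) <= C * Lp_norm lborel p (%x. F x - G x)" by blast
  moreover have "fourierB (%x. F x - G x) = (%om. fourier F om - fourier G om)"
  proof
  fix om
  show "fourierB (%x. F x - G x) om = fourier F om - fourier G om"
  unfolding FS(1)[OF F] FS(1)[OF G] fourierB_def left_diff_distrib
  by (rule Bochner_Integration.integral_diff) (use iF(1) iG(1) F G integrable_mult_exp in auto)
  qed
  ultimately show ?thesis by (simp add: Lp_norm_lebesgue_borel[OF m])
 qed
 show ?thesis
 proof (intro exI[of _ "16 * C"] conjI allI impI)
  show "0 <= 16 * C" using C by simp
 next
  fix f :: "(real^'a) * (real^'b) => complex" assume f: "schwartz f & block_symmetric f"
  have "C * ?L f <= 16 * C * ?L f" using C Lp_norm_nonneg[of lebesgue p f] by (simp add: mult_right_mono)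
  then show "?L2 (fourier f) <= 16 * C * ?L f" using est1[OF f] by linarith
 next
  fix f :: "(real^'a) * (real^'b) => complex" assume f: "in_Lp lebesgue p f & block_symmetric f"
  have fL: "in_Lp lebesgue p f" using f by simp
  have est3: "?L2 (%om. fourier F om - fourier G om) <= 4 * C * (?L (%x. F x - f x) + ?L (%x. G x - f x))" if F: "?S F" and G: "?S G" for F G
  proof -
  have "C * ?L (%x. F x - G x) <= C * (4 * (?L (%x. F x - f x) + ?L (%x. f x - G x)))"
  using C Lp_norm_triangle[OF p1 FS(3)[OF F] fL FS(3)[OF G]] by (rule mult_left_mono[rotated])
  also have "... = 4 * C * (?L (%x. F x - f x) + ?L (%x. G x - f x))"
  unfolding Lp_norm_minus_commute[of lebesgue p f G] by (simp only: mult_ac)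
  finally show ?thesis using est2[OF F G] by linarith
  qed
  have "\<forall>n. \<exists>F. ?S F & ?L (%x. F x - f x) <= (1 / 4) ^ n"
  proof
  fix n
  obtain F where F: "schwartz F" "block_symmetric F" "Dp p (%x. F x - f x) < enn (((1 / 4) ^ n) powr p)"
  using schwartz_dense[OF p1, of f "((1 / 4) ^ n) powr p"] f by auto
  have "(LINT x|lebesgue. norm (F x - f x) powr p) <= ((1 / 4) ^ n) powr p"
  using F(3) unfolding Dp_def by (intro integral_real_bounded) auto
  then have "?L (%x. F x - f x) <= (((1 / 4) ^ n) powr p) powr (1 / p)"
  unfolding Lp_norm_def using p1 by (intro powr_mono2) auto
  also have "... = (1 / 4) ^ n" using p1 by (simp add: powr_powr)
  finally show "\<exists>F. ?S F & ?L (%x. F x - f x) <= (1 / 4) ^ n" using F by blast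
  qed
  from choice[OF this] obtain F where FF: "\<forall>n. ?S (F n) & ?L (%x. F n x - f x) <= (1 / 4) ^ n" ..
  then have F: "?S (F n)" "?L (%x. F n x - f x) <= (1 / 4) ^ n" for n by blast+
  have "?L2 (%om. fourier (F n) om - fourier (F l) om) <= 8 * C * (1 / 4) ^ n" if "n <= l" for n l
  proof -
  have "(1 / 4 :: real) ^ l <= (1 / 4) ^ n" using that by (intro power_decreasing) auto
  then have "?L (%x. F n x - f x) + ?L (%x. F l x - f x) <= 2 * (1 / 4) ^ n" using F(2)[of n] F(2)[of l] by linarith
  then have "4 * C * (?L (%x. F n x - f x) + ?L (%x. F l x - f x)) <= 4 * C * (2 * (1 / 4) ^ n)" using C by (intro mult_left_mono) auto
  then show ?thesis using est3[OF F(1) F(1), of n l] by simp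
  qed
  from L2_complete[OF surface_measure_finite FS(2)[OF F(1)] _ this] C
  obtain g where g: "in_Lp surf 2 g" "\<And>n. ?L2 (%om. fourier (F n) om - g om) <= 8 * C * (1 / 4) ^ n" by auto
  have z: "(%n. c * (1 / 4 :: real) ^ n) \<longlonglongrightarrow> 0" for c using tendsto_mult_right_zero[OF LIMSEQ_power_zero[of "1/4 :: real"], of c] by simp
  have Flim: "(%n. ?L (%x. F n x - f x)) \<longlonglongrightarrow> 0"
  by (rule tendsto_sandwich[OF _ _ tendsto_const z[of 1]]) (use F(2) in \<open>auto simp: Lp_norm_nonneg\<close>)
  have glim: "(%n. ?L2 (%om. fourier (F n) om - g om)) \<longlonglongrightarrow> 0"
  by (rule tendsto_sandwich[OF _ _ tendsto_const z[of "8 * C"]]) (use g(2) in \<open>auto simp: Lp_norm_nonneg\<close>)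
  have res: "fourier_restriction p f g" unfolding fourier_restriction_def using g(1) F(1) Flim glim by blast
  have uniq: "AE om in surf. h om = g om" if h: "fourier_restriction p f h" for h
  proof -
  obtain H where hL: "in_Lp surf 2 h" and H: "\<And>n. ?S (H n)" and Hlim: "(%n. ?L (%x. H n x - f x)) \<longlonglongrightarrow> 0"
  and hlim: "(%n. ?L2 (%om. fourier (H n) om - h om)) \<longlonglongrightarrow> 0"
  using h unfolding fourier_restriction_def by blast
  let ?b = "%n. 4 * (?L2 (%om. fourier (H n) om - h om) + 4 * (4 * C * (?L (%x. H n x - f x) + ?L (%x. F n x - f x)) + ?L2 (%om. fourier (F n) om - g om)))"
  have "?b \<longlonglongrightarrow> 4 * (0 + 4 * (4 * C * (0 + 0) + 0))" by (intro tendsto_intros Hlim hlim Flim glim)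
  moreover have "?L2 (%om. h om - g om) <= ?b n" for n
  using Lp_norm_triangle[OF _ hL FS(2)[OF H[of n]] g(1)] Lp_norm_triangle[OF _ FS(2)[OF H[of n]] FS(2)[OF F(1)[of n]] g(1)] est3[OF H[of n] F(1)[of n]]
  Lp_norm_minus_commute[of surf 2 h "fourier (H n)"] by simp
  ultimately have "?L2 (%om. h om - g om) <= 0" by (intro LIMSEQ_le_const[of ?b]) auto
  then have "?L2 (%om. h om - g om) = 0" using Lp_norm_nonneg[of surf 2] by (meson antisym)
  from Lp_norm_zero_AE[OF Lp_norm_diff(1)[OF _ hL g(1)] _ this] show ?thesis by simp
  qed
  have bound: "?L2 g <= 16 * C * ?L f"
  proof -
  let ?b = "%n. 4 * (?L2 (%om. fourier (F n) om - g om) + C * (4 * (?L (%x. F n x - f x) + ?L f)))"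
  have "?b \<longlonglongrightarrow> 4 * (0 + C * (4 * (0 + ?L f)))" by (intro tendsto_intros Flim glim)
  moreover have "?L2 g <= ?b n" for n
  proof -
  have 1: "?L2 g <= 4 * (?L2 (fourier (F n)) + ?L2 (%om. fourier (F n) om - g om))"
  using Lp_norm_diff(2)[OF _ FS(2)[OF F(1)[of n]] Lp_norm_diff(1)[OF _ FS(2)[OF F(1)[of n]] g(1)]] by simp
  have "?L (F n) <= 4 * (?L (%x. F n x - f x) + ?L f)"
  using Lp_norm_add(2)[OF p1 Lp_norm_diff(1)[OF p1 FS(3)[OF F(1)[of n]] fL] fL] by simp
  then have "C * ?L (F n) <= C * (4 * (?L (%x. F n x - f x) + ?L f))" using C by (rule mult_left_mono)
  then have "?L2 (fourier (F n)) <= C * (4 * (?L (%x. F n x - f x) + ?L f))" using est1[OF F(1)[of n]] by (rule order_trans[rotated])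
  then show ?thesis using 1 by simp
  qed
  ultimately have "?L2 g <= 4 * (0 + C * (4 * (0 + ?L f)))" by (intro LIMSEQ_le_const[of ?b]) auto
  then show ?thesis by simp
  qed
  show "\<exists>g. fourier_restriction p f g & (\<forall>h. fourier_restriction p f h \<longrightarrow> (AE om in surf. h om = g om)) & ?L2 g <= 16 * C * ?L f"
  using res uniq bound by blast
 qed
qed

end
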